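(* Let $k$ be a field and let $\mathcal{C}$ be an essentially small $k$-linear Hom-finite triangulated category with split idempotents and suspension functor $\Sigma$. Let $w \geqslant 2$ be an integer and let $\mathcal{S} = \{ s_1, \ldots, s_e \}$ be a $w$-simple minded system in $\mathcal{C}$. Then $\langle \mathcal{S} \rangle \simeq \operatorname{mod} A$ for a finite dimensional $k$-algebra $A$. If $k$ is algebraically closed, then the Gabriel quiver of $A$ has vertices the elements of $\mathcal{S} = \{ s_1, \ldots, s_e \}$ and $\dim_k \mathcal{C}( s_j,\Sigma s_i )$ arrows from $s_i$ to $s_j$.
   Context: $\mathcal{C}(x,y)$ denotes the Hom space in $\mathcal{C}$. $\operatorname{mod} A$ is the category of finitely generated $A$-modules. Convention: modules are right modules, and the Gabriel quiver of $A$ has one vertex for each isomorphism class of simple modules, with primitive idempotents $e_i$ corresponding to the simple modules $s_i$, and $\dim_k e_j(\operatorname{rad}A/\operatorname{rad}^2A)e_i$ arrows from vertex $i$ to vertex $j$. A diagram $c' \to c \to c''$ in $\mathcal{C}$ is a short triangle if it can be completed to a (distinguished) triangle $c' \to c \to c'' \to \Sigma c'$. For full subcategories $\mathcal{A},\mathcal{B} \subseteq \mathcal{C}$, $\mathcal{A} * \mathcal{B}$ is the full subcategory of objects $e$ for which there is a short triangle $a \to e \to b$ with $a \in \mathcal{A}$, $b \in \mathcal{B}$; this operation is associative. The extension closure of $\mathcal{S}$ is $\langle \mathcal{S} \rangle = \bigcup_{n \geqslant 0} (\mathcal{S})_n$, where $(\mathcal{S})_0 = \{0\}$ and $(\mathcal{S})_n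 = (\mathcal{S})_{n-1} * (\mathcal{S} \cup \{0\})$ for $n \geqslant 1$; it is viewed as a full subcategory of $\mathcal{C}$. A $w$-orthogonal collection in $\mathcal{C}$ is a finite set $\mathcal{S} = \{ s_1, \ldots, s_e \}$ of objects such that: (i) $\mathcal{C}(s_i,s_j)$ is a skew field if $i=j$ and is $0$ if $i \neq j$; (ii) $\mathcal{C}(s_i,\Sigma^{\ell}s_j) = 0$ for all $i,j$ and all $\ell \in \{ -w+1, \ldots, -1 \}$. A $w$-simple minded system is a $w$-orthogonal collection $\mathcal{S}$ such that moreover $\mathcal{C} = \langle \mathcal{S} \rangle * \Sigma^{-1}\langle \mathcal{S} \rangle * \cdots * \Sigma^{-w+1}\langle \mathcal{S} \rangle$. *)

theory Defs
  imports
    "Jordan_Normal_Form.Missing_VectorSpace"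
    "HOL-Algebra.Ideal_Product"
    "HOL-Algebra.Algebraic_Closure"
begin

section \<open>Linear categories\<close>

text \<open>
  The objects form a set in a type, so every category below is small; this covers the essentially
  small ones up to equivalence. Each Hom space is a module record over the ground field, in which
  the ring fields \<open>mult\<close> and \<open>one\<close> carry no meaning. Hom sets need not be disjoint, hence composition
  is indexed by the objects: \<open>Cmp C x y z g f\<close> is the composite of \<open>f\<close> from \<open>x\<close> to \<open>y\<close> followed by
  \<open>g\<close> from \<open>y\<close> to \<open>z\<close>.
\<close>

record ('k, 'o, 'm) lin_cat =
  Obj :: "'o set"
  Hom :: "'o \<Rightarrow> 'o \<Rightarrow> ('k, 'm) module"
  Idt :: "'o \<Rightarrow> 'm"
  Cmp :: "'o \<Rightarrow> 'o \<Rightarrow> 'o \<Rightarrow> 'm \<Rightarrow> 'm \<Rightarrow> 'm"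

locale linear_category =
  fixes K :: "('k, 'r) ring_scheme"
    and C :: "('k, 'o, 'm, 's) lin_cat_scheme"
  assumes field_K: "field K"
    and Hom_vectorspace:
      "\<lbrakk>x \<in> Obj C; y \<in> Obj C\<rbrakk> \<Longrightarrow> vectorspace K (Hom C x y)"
    and Idt_closed:
      "x \<in> Obj C \<Longrightarrow> Idt C x \<in> carrier (Hom C x x)"
    and Cmp_closed:
      "\<lbrakk>x \<in> Obj C; y \<in> Obj C; z \<in> Obj C; g \<in> carrier (Hom C y z); f \<in> carrier (Hom C x y)\<rbrakk>
        \<Longrightarrow> Cmp C x y z g f \<in> carrier (Hom C x z)"
    and Idt_left:
      "\<lbrakk>x \<in> Obj C; y \<in> Obj C; f \<in> carrier (Hom C x y)\<rbrakk> \<Longrightarrow> Cmp C x y y (Idt C y) f = f"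
    and Idt_right:
      "\<lbrakk>x \<in> Obj C; y \<in> Obj C; f \<in> carrier (Hom C x y)\<rbrakk> \<Longrightarrow> Cmp C x x y f (Idt C x) = f"
    and Cmp_assoc:
      "\<lbrakk>w \<in> Obj C; x \<in> Obj C; y \<in> Obj C; z \<in> Obj C;
        h \<in> carrier (Hom C y z); g \<in> carrier (Hom C x y); f \<in> carrier (Hom C w x)\<rbrakk>
        \<Longrightarrow> Cmp C w x z (Cmp C x y z h g) f = Cmp C w y z h (Cmp C w x y g f)"
    and Cmp_add_left:
      "\<lbrakk>x \<in> Obj C; y \<in> Obj C; z \<in> Obj C;
        g \<in> carrier (Hom C y z); g' \<in> carrier (Hom C y z); f \<in> carrier (Hom C x y)\<rbrakk>
        \<Longrightarrow> Cmp C x y z (g \<oplus>\<^bsub>Hom C y z\<^esub> g') f = Cmp C x y z g f \<oplus>\<^bsub>Hom C x z\<^esub> Cmp C x y z g' f"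
    and Cmp_add_right:
      "\<lbrakk>x \<in> Obj C; y \<in> Obj C; z \<in> Obj C;
        g \<in> carrier (Hom C y z); f \<in> carrier (Hom C x y); f' \<in> carrier (Hom C x y)\<rbrakk>
        \<Longrightarrow> Cmp C x y z g (f \<oplus>\<^bsub>Hom C x y\<^esub> f') = Cmp C x y z g f \<oplus>\<^bsub>Hom C x z\<^esub> Cmp C x y z g f'"
    and Cmp_smult_left:
      "\<lbrakk>x \<in> Obj C; y \<in> Obj C; z \<in> Obj C;
        c \<in> carrier K; g \<in> carrier (Hom C y z); f \<in> carrier (Hom C x y)\<rbrakk>
        \<Longrightarrow> Cmp C x y z (c \<odot>\<^bsub>Hom C y z\<^esub> g) f = c \<odot>\<^bsub>Hom C x z\<^esub> Cmp C x y z g f"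
    and Cmp_smult_right:
      "\<lbrakk>x \<in> Obj C; y \<in> Obj C; z \<in> Obj C;
        c \<in> carrier K; g \<in> carrier (Hom C y z); f \<in> carrier (Hom C x y)\<rbrakk>
        \<Longrightarrow> Cmp C x y z g (c \<odot>\<^bsub>Hom C x y\<^esub> f) = c \<odot>\<^bsub>Hom C x z\<^esub> Cmp C x y z g f"

definition is_iso :: "('k, 'o, 'm, 's) lin_cat_scheme \<Rightarrow> 'o \<Rightarrow> 'o \<Rightarrow> 'm \<Rightarrow> bool" where
  "is_iso C x y f \<longleftrightarrow> f \<in> carrier (Hom C x y) \<and>
     (\<exists>g \<in> carrier (Hom C y x). Cmp C x y x g f = Idt C x \<and> Cmp C y x y f g = Idt C y)"

definition isomorphic :: "('k, 'o, 'm, 's) lin_cat_scheme \<Rightarrow> 'o \<Rightarrow> 'o \<Rightarrow> bool" where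
  "isomorphic C x y \<longleftrightarrow> (\<exists>f. is_iso C x y f)"

definition zero_object :: "('k, 'o, 'm, 's) lin_cat_scheme \<Rightarrow> 'o \<Rightarrow> bool" where
  "zero_object C z \<longleftrightarrow> z \<in> Obj C \<and>
     (\<forall>x \<in> Obj C. carrier (Hom C z x) = {\<zero>\<^bsub>Hom C z x\<^esub>} \<and> carrier (Hom C x z) = {\<zero>\<^bsub>Hom C x z\<^esub>})"

definition is_biproduct ::
  "('k, 'o, 'm, 's) lin_cat_scheme \<Rightarrow> 'o \<Rightarrow> 'o \<Rightarrow> 'o \<Rightarrow> 'm \<Rightarrow> 'm \<Rightarrow> 'm \<Rightarrow> 'm \<Rightarrow> bool" where
  "is_biproduct C x y b i j p q \<longleftrightarrow> b \<in> Obj C \<and>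
     i \<in> carrier (Hom C x b) \<and> j \<in> carrier (Hom C y b) \<and>
     p \<in> carrier (Hom C b x) \<and> q \<in> carrier (Hom C b y) \<and>
     Cmp C x b x p i = Idt C x \<and> Cmp C y b y q j = Idt C y \<and>
     Cmp C y b x p j = \<zero>\<^bsub>Hom C y x\<^esub> \<and> Cmp C x b y q i = \<zero>\<^bsub>Hom C x y\<^esub> \<and>
     Cmp C b x b i p \<oplus>\<^bsub>Hom C b b\<^esub> Cmp C b y b j q = Idt C b"

locale additive_linear_category = linear_category +
  assumes zero_object_exists: "\<exists>z. zero_object C z"
    and biproducts_exist:
      "\<lbrakk>x \<in> Obj C; y \<in> Obj C\<rbrakk> \<Longrightarrow> \<exists>b i j p q. is_biproduct C x y b i j p q"

definition hom_finite ::
  "('k, 'r) ring_scheme \<Rightarrow> ('k, 'o, 'm, 's) lin_cat_scheme \<Rightarrow> bool" where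
  "hom_finite K C \<longleftrightarrow> (\<forall>x \<in> Obj C. \<forall>y \<in> Obj C. vectorspace.fin_dim K (Hom C x y))"

definition split_idempotents :: "('k, 'o, 'm, 's) lin_cat_scheme \<Rightarrow> bool" where
  "split_idempotents C \<longleftrightarrow>
     (\<forall>x \<in> Obj C. \<forall>e \<in> carrier (Hom C x x). Cmp C x x x e e = e \<longrightarrow>
       (\<exists>y \<in> Obj C. \<exists>r \<in> carrier (Hom C x y). \<exists>i \<in> carrier (Hom C y x).
          Cmp C x y x i r = e \<and> Cmp C y x y r i = Idt C y))"

definition full_subcat ::
  "('k, 'o, 'm, 's) lin_cat_scheme \<Rightarrow> 'o set \<Rightarrow> ('k, 'o, 'm) lin_cat" where
  "full_subcat C U = \<lparr>Obj = U, Hom = Hom C, Idt = Idt C, Cmp = Cmp C\<rparr>"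

definition End_ring :: "('k, 'o, 'm, 's) lin_cat_scheme \<Rightarrow> 'o \<Rightarrow> ('k, 'm) module" where
  "End_ring C x = (Hom C x x)\<lparr>mult := Cmp C x x x, one := Idt C x\<rparr>"

definition skew_field :: "('a, 'b) ring_scheme \<Rightarrow> bool" where
  "skew_field R \<longleftrightarrow> ring R \<and> Units R = carrier R - {\<zero>\<^bsub>R\<^esub>}"


section \<open>Linear functors and equivalences\<close>

record ('o, 'm, 'p, 'n) fun_data =
  on_obj :: "'o \<Rightarrow> 'p"
  on_hom :: "'o \<Rightarrow> 'o \<Rightarrow> 'm \<Rightarrow> 'n"

definition linear_functor ::
  "('k, 'r) ring_scheme \<Rightarrow> ('k, 'o, 'm, 's) lin_cat_scheme \<Rightarrow> ('k, 'p, 'n, 't) lin_cat_scheme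
    \<Rightarrow> ('o, 'm, 'p, 'n) fun_data \<Rightarrow> bool" where
  "linear_functor K C D F \<longleftrightarrow>
     (\<forall>x \<in> Obj C. on_obj F x \<in> Obj D) \<and>
     (\<forall>x \<in> Obj C. \<forall>y \<in> Obj C.
        on_hom F x y \<in> LinearCombinations.module_hom K (Hom C x y) (Hom D (on_obj F x) (on_obj F y))) \<and>
     (\<forall>x \<in> Obj C. on_hom F x x (Idt C x) = Idt D (on_obj F x)) \<and>
     (\<forall>x \<in> Obj C. \<forall>y \<in> Obj C. \<forall>z \<in> Obj C.
        \<forall>g \<in> carrier (Hom C y z). \<forall>f \<in> carrier (Hom C x y).
          on_hom F x z (Cmp C x y z g f)
            = Cmp D (on_obj F x) (on_obj F y) (on_obj F z) (on_hom F y z g) (on_hom F x y f))"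

definition fun_id :: "('o, 'm, 'o, 'm) fun_data" where
  "fun_id = \<lparr>on_obj = (\<lambda>x. x), on_hom = (\<lambda>x y f. f)\<rparr>"

definition fun_comp ::
  "('p, 'n, 'q, 'l) fun_data \<Rightarrow> ('o, 'm, 'p, 'n) fun_data \<Rightarrow> ('o, 'm, 'q, 'l) fun_data" where
  "fun_comp G F = \<lparr>on_obj = (\<lambda>x. on_obj G (on_obj F x)),
     on_hom = (\<lambda>x y f. on_hom G (on_obj F x) (on_obj F y) (on_hom F x y f))\<rparr>"

definition naturally_isomorphic ::
  "('k, 'o, 'm, 's) lin_cat_scheme \<Rightarrow> ('k, 'p, 'n, 't) lin_cat_scheme
    \<Rightarrow> ('o, 'm, 'p, 'n) fun_data \<Rightarrow> ('o, 'm, 'p, 'n) fun_data \<Rightarrow> bool" where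
  "naturally_isomorphic C D F G \<longleftrightarrow>
     (\<exists>\<eta>. (\<forall>x \<in> Obj C. is_iso D (on_obj F x) (on_obj G x) (\<eta> x)) \<and>
          (\<forall>x \<in> Obj C. \<forall>y \<in> Obj C. \<forall>f \<in> carrier (Hom C x y).
             Cmp D (on_obj F x) (on_obj F y) (on_obj G y) (\<eta> y) (on_hom F x y f)
               = Cmp D (on_obj F x) (on_obj G x) (on_obj G y) (on_hom G x y f) (\<eta> x)))"

definition linear_equivalence ::
  "('k, 'r) ring_scheme \<Rightarrow> ('k, 'o, 'm, 's) lin_cat_scheme \<Rightarrow> ('k, 'p, 'n, 't) lin_cat_scheme
    \<Rightarrow> ('o, 'm, 'p, 'n) fun_data \<Rightarrow> bool" where
  "linear_equivalence K C D F \<longleftrightarrow> linear_functor K C D F \<and>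
     (\<exists>G. linear_functor K D C G \<and>
        naturally_isomorphic C C (fun_comp G F) fun_id \<and>
        naturally_isomorphic D D (fun_comp F G) fun_id)"


section \<open>Triangulated categories\<close>

text \<open>
  \<open>dist C x y z f g h\<close> says that \<open>x \<rightarrow> y \<rightarrow> z \<rightarrow> \<Sigma>x\<close>, with maps \<open>f\<close>, \<open>g\<close>, \<open>h\<close>, is a
  distinguished triangle.
\<close>

record ('k, 'o, 'm) tri_cat = "('k, 'o, 'm) lin_cat" +
  Susp :: "('o, 'm, 'o, 'm) fun_data"
  dist :: "'o \<Rightarrow> 'o \<Rightarrow> 'o \<Rightarrow> 'm \<Rightarrow> 'm \<Rightarrow> 'm \<Rightarrow> bool"

abbreviation susp :: "('k, 'o, 'm, 's) tri_cat_scheme \<Rightarrow> 'o \<Rightarrow> 'o" where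
  "susp C \<equiv> on_obj (Susp C)"

abbreviation susp_hom :: "('k, 'o, 'm, 's) tri_cat_scheme \<Rightarrow> 'o \<Rightarrow> 'o \<Rightarrow> 'm \<Rightarrow> 'm" where
  "susp_hom C \<equiv> on_hom (Susp C)"

text \<open>
  The suspension is a linear autoequivalence; automorphisms are a special case. The axiom
  \<open>octahedral\<close> is Verdier's axiom for the composite of \<open>f\<close> from \<open>x\<close> to \<open>y\<close> and \<open>g\<close> from \<open>y\<close> to
  \<open>z\<close>; the cones of \<open>f\<close>, \<open>g\<close> and the composite are \<open>z'\<close>, \<open>x'\<close> and \<open>y'\<close>.
\<close>

locale triangulated_category = additive_linear_category K C
  for K :: "('k, 'r) ring_scheme" and C :: "('k, 'o, 'm, 's) tri_cat_scheme" +
  assumes susp_equivalence: "linear_equivalence K C C (Susp C)"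
    and dist_typed:
      "dist C x y z f g h \<Longrightarrow>
        x \<in> Obj C \<and> y \<in> Obj C \<and> z \<in> Obj C \<and> f \<in> carrier (Hom C x y) \<and>
        g \<in> carrier (Hom C y z) \<and> h \<in> carrier (Hom C z (susp C x))"
    and dist_iso_closed:
      "\<lbrakk>dist C x y z f g h;
        x' \<in> Obj C; y' \<in> Obj C; z' \<in> Obj C; f' \<in> carrier (Hom C x' y');
        g' \<in> carrier (Hom C y' z'); h' \<in> carrier (Hom C z' (susp C x'));
        is_iso C x x' a; is_iso C y y' b; is_iso C z z' c;
        Cmp C x y y' b f = Cmp C x x' y' f' a;
        Cmp C y z z' c g = Cmp C y y' z' g' b;
        Cmp C z (susp C x) (susp C x') (susp_hom C x x' a) h = Cmp C z z' (susp C x') h' c\<rbrakk>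
        \<Longrightarrow> dist C x' y' z' f' g' h'"
    and dist_identity:
      "\<lbrakk>x \<in> Obj C; zero_object C z\<rbrakk>
        \<Longrightarrow> dist C x x z (Idt C x) \<zero>\<^bsub>Hom C x z\<^esub> \<zero>\<^bsub>Hom C z (susp C x)\<^esub>"
    and dist_complete:
      "\<lbrakk>x \<in> Obj C; y \<in> Obj C; f \<in> carrier (Hom C x y)\<rbrakk> \<Longrightarrow> \<exists>z g h. dist C x y z f g h"
    and dist_rotate:
      "\<lbrakk>x \<in> Obj C; y \<in> Obj C; z \<in> Obj C; f \<in> carrier (Hom C x y);
        g \<in> carrier (Hom C y z); h \<in> carrier (Hom C z (susp C x))\<rbrakk>
        \<Longrightarrow> dist C x y z f g h \<longleftrightarrow>
            dist C y z (susp C x) g h (\<ominus>\<^bsub>Hom C (susp C x) (susp C y)\<^esub> susp_hom C x y f)"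
    and dist_morphism:
      "\<lbrakk>dist C x y z f g h; dist C x' y' z' f' g' h';
        a \<in> carrier (Hom C x x'); b \<in> carrier (Hom C y y');
        Cmp C x y y' b f = Cmp C x x' y' f' a\<rbrakk>
        \<Longrightarrow> \<exists>c \<in> carrier (Hom C z z').
              Cmp C y z z' c g = Cmp C y y' z' g' b \<and>
              Cmp C z (susp C x) (susp C x') (susp_hom C x x' a) h = Cmp C z z' (susp C x') h' c"
    and octahedral:
      "\<lbrakk>dist C x y z' f u u'; dist C y z x' g v v'; dist C x z y' (Cmp C x y z g f) w w'\<rbrakk>
        \<Longrightarrow> \<exists>r s.
              dist C z' y' x' r s
                (Cmp C x' (susp C y) (susp C z') (susp_hom C y z' u) v') \<and>
              Cmp C y z' y' r u = Cmp C y z y' w g \<and>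
              Cmp C z' y' (susp C x) w' r = u' \<and>
              Cmp C z y' x' s w = v \<and>
              Cmp C y' x' (susp C y) v' s
                = Cmp C y' (susp C x) (susp C y) (susp_hom C x y f) w'"

text \<open>
  As the suspension is only an autoequivalence, negative shifts of objects are chosen up to
  isomorphism.
\<close>

definition desusp :: "('k, 'o, 'm, 's) tri_cat_scheme \<Rightarrow> 'o \<Rightarrow> 'o" where
  "desusp C y = (SOME x. x \<in> Obj C \<and> isomorphic C (susp C x) y)"

definition shift :: "('k, 'o, 'm, 's) tri_cat_scheme \<Rightarrow> int \<Rightarrow> 'o \<Rightarrow> 'o" where
  "shift C l x = (if 0 \<le> l then (susp C ^^ nat l) x else (desusp C ^^ nat (- l)) x)"

definition short_triangle :: "('k, 'o, 'm, 's) tri_cat_scheme \<Rightarrow> 'o \<Rightarrow> 'o \<Rightarrow> 'o \<Rightarrow> bool" where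
  "short_triangle C x y z \<longleftrightarrow> (\<exists>f g h. dist C x y z f g h)"

definition ext_prod :: "('k, 'o, 'm, 's) tri_cat_scheme \<Rightarrow> 'o set \<Rightarrow> 'o set \<Rightarrow> 'o set" where
  "ext_prod C U Y = {e \<in> Obj C. \<exists>x \<in> U. \<exists>y \<in> Y. short_triangle C x e y}"

text \<open>Zero objects are unique up to isomorphism only, so \<open>{0}\<close> is read as the class of all of them.\<close>

primrec ext_pow :: "('k, 'o, 'm, 's) tri_cat_scheme \<Rightarrow> 'o set \<Rightarrow> nat \<Rightarrow> 'o set" where
  "ext_pow C S 0 = {z. zero_object C z}"
| "ext_pow C S (Suc n) = ext_prod C (ext_pow C S n) (S \<union> {z. zero_object C z})"

definition ext_closure :: "('k, 'o, 'm, 's) tri_cat_scheme \<Rightarrow> 'o set \<Rightarrow> 'o set" where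
  "ext_closure C S = (\<Union>n. ext_pow C S n)"


section \<open>Simple minded systems\<close>

definition orthogonal_collection ::
  "('k, 'o, 'm, 's) tri_cat_scheme \<Rightarrow> nat \<Rightarrow> 'o set \<Rightarrow> bool" where
  "orthogonal_collection C w S \<longleftrightarrow> finite S \<and> S \<subseteq> Obj C \<and>
     (\<forall>s \<in> S. skew_field (End_ring C s)) \<and>
     (\<forall>s \<in> S. \<forall>t \<in> S. s \<noteq> t \<longrightarrow> carrier (Hom C s t) = {\<zero>\<^bsub>Hom C s t\<^esub>}) \<and>
     (\<forall>s \<in> S. \<forall>t \<in> S. \<forall>l \<in> {- int w + 1 .. -1}.
        carrier (Hom C s (shift C l t)) = {\<zero>\<^bsub>Hom C s (shift C l t)\<^esub>})"

text \<open>
  \<open>neg_shift_prod C U n\<close> is \<open>U * \<Sigma>\<^sup>-\<^sup>1U * \<dots> * \<Sigma>\<^sup>-\<^sup>nU\<close>, bracketed to the left.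
\<close>

primrec neg_shift_prod :: "('k, 'o, 'm, 's) tri_cat_scheme \<Rightarrow> 'o set \<Rightarrow> nat \<Rightarrow> 'o set" where
  "neg_shift_prod C U 0 = U"
| "neg_shift_prod C U (Suc n) =
     ext_prod C (neg_shift_prod C U n) (shift C (- int (Suc n)) ` U)"

definition simple_minded_system ::
  "('k, 'o, 'm, 's) tri_cat_scheme \<Rightarrow> nat \<Rightarrow> 'o set \<Rightarrow> bool" where
  "simple_minded_system C w S \<longleftrightarrow> orthogonal_collection C w S \<and>
     Obj C = neg_shift_prod C (ext_closure C S) (w - 1)"


section \<open>Finite dimensional algebras and their right modules\<close>

definition fd_algebra :: "('k, 'r) ring_scheme \<Rightarrow> ('k, 'a) module \<Rightarrow> bool" where
  "fd_algebra K A \<longleftrightarrow> vectorspace K A \<and> ring A \<and> vectorspace.fin_dim K A \<and>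
     (\<forall>c \<in> carrier K. \<forall>a \<in> carrier A. \<forall>b \<in> carrier A.
        (c \<odot>\<^bsub>A\<^esub> a) \<otimes>\<^bsub>A\<^esub> b = c \<odot>\<^bsub>A\<^esub> (a \<otimes>\<^bsub>A\<^esub> b) \<and>
        a \<otimes>\<^bsub>A\<^esub> (c \<odot>\<^bsub>A\<^esub> b) = c \<odot>\<^bsub>A\<^esub> (a \<otimes>\<^bsub>A\<^esub> b))"

text \<open>
  The library's \<open>module\<close> locale is confined to commutative rings. For a right module \<open>M\<close> the term
  \<open>a \<odot>\<^bsub>M\<^esub> v\<close> denotes the product of \<open>v\<close> with \<open>a\<close> acting from the right.
\<close>

definition right_module :: "('k, 'a) module \<Rightarrow> ('a, 'v) module \<Rightarrow> bool" where
  "right_module A M \<longleftrightarrow> ring A \<and> abelian_group M \<and>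
     (\<forall>a \<in> carrier A. \<forall>v \<in> carrier M. a \<odot>\<^bsub>M\<^esub> v \<in> carrier M) \<and>
     (\<forall>a \<in> carrier A. \<forall>b \<in> carrier A. \<forall>v \<in> carrier M.
        (a \<oplus>\<^bsub>A\<^esub> b) \<odot>\<^bsub>M\<^esub> v = a \<odot>\<^bsub>M\<^esub> v \<oplus>\<^bsub>M\<^esub> b \<odot>\<^bsub>M\<^esub> v) \<and>
     (\<forall>a \<in> carrier A. \<forall>v \<in> carrier M. \<forall>u \<in> carrier M.
        a \<odot>\<^bsub>M\<^esub> (v \<oplus>\<^bsub>M\<^esub> u) = a \<odot>\<^bsub>M\<^esub> v \<oplus>\<^bsub>M\<^esub> a \<odot>\<^bsub>M\<^esub> u) \<and>
     (\<forall>a \<in> carrier A. \<forall>b \<in> carrier A. \<forall>v \<in> carrier M.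
        (a \<otimes>\<^bsub>A\<^esub> b) \<odot>\<^bsub>M\<^esub> v = b \<odot>\<^bsub>M\<^esub> (a \<odot>\<^bsub>M\<^esub> v)) \<and>
     (\<forall>v \<in> carrier M. \<one>\<^bsub>A\<^esub> \<odot>\<^bsub>M\<^esub> v = v)"

definition finitely_generated :: "('k, 'a) module \<Rightarrow> ('a, 'v) module \<Rightarrow> bool" where
  "finitely_generated A M \<longleftrightarrow>
     (\<exists>U. finite U \<and> U \<subseteq> carrier M \<and>
        (\<forall>v \<in> carrier M. \<exists>c \<in> U \<rightarrow> carrier A. v = (\<Oplus>\<^bsub>M\<^esub>x\<in>U. c x \<odot>\<^bsub>M\<^esub> x)))"

definition right_hom :: "('k, 'a) module \<Rightarrow> ('a, 'v) module \<Rightarrow> ('a, 'u) module \<Rightarrow> ('v \<Rightarrow> 'u) set"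
  where
  "right_hom A M N = {f \<in> carrier M \<rightarrow>\<^sub>E carrier N.
     (\<forall>v \<in> carrier M. \<forall>u \<in> carrier M. f (v \<oplus>\<^bsub>M\<^esub> u) = f v \<oplus>\<^bsub>N\<^esub> f u) \<and>
     (\<forall>a \<in> carrier A. \<forall>v \<in> carrier M. f (a \<odot>\<^bsub>M\<^esub> v) = a \<odot>\<^bsub>N\<^esub> f v)}"

definition right_iso :: "('k, 'a) module \<Rightarrow> ('a, 'v) module \<Rightarrow> ('a, 'u) module \<Rightarrow> bool" where
  "right_iso A M N \<longleftrightarrow> (\<exists>f \<in> right_hom A M N. bij_betw f (carrier M) (carrier N))"

text \<open>
  The category of finitely generated right \<open>A\<close>-modules with underlying set in the type \<open>'v\<close>. A
  scalar \<open>c\<close> of the ground field acts on a module through the element \<open>c \<odot>\<^bsub>A\<^esub> \<one>\<^bsub>A\<^esub>\<close> of \<open>A\<close>.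
\<close>

definition mod_cat :: "('k, 'a) module \<Rightarrow> ('k, ('a, 'v) module, 'v \<Rightarrow> 'v) lin_cat" where
  "mod_cat A = \<lparr>
     Obj = {M. right_module A M \<and> finitely_generated A M},
     Hom = (\<lambda>M N. \<lparr>
       carrier = right_hom A M N,
       monoid.mult = (\<lambda>f g. undefined),
       one = undefined,
       zero = (\<lambda>v\<in>carrier M. \<zero>\<^bsub>N\<^esub>),
       add = (\<lambda>f g. \<lambda>v\<in>carrier M. f v \<oplus>\<^bsub>N\<^esub> g v),
       smult = (\<lambda>c f. \<lambda>v\<in>carrier M. (c \<odot>\<^bsub>A\<^esub> \<one>\<^bsub>A\<^esub>) \<odot>\<^bsub>N\<^esub> f v)\<rparr>),
     Idt = (\<lambda>M. \<lambda>v\<in>carrier M. v),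
     Cmp = (\<lambda>L M N g f. compose (carrier L) g f)\<rparr>"

definition right_submodule :: "('k, 'a) module \<Rightarrow> ('a, 'v) module \<Rightarrow> 'v set \<Rightarrow> bool" where
  "right_submodule A M N \<longleftrightarrow> additive_subgroup N M \<and>
     (\<forall>a \<in> carrier A. \<forall>v \<in> N. a \<odot>\<^bsub>M\<^esub> v \<in> N)"

definition simple_right_module :: "('k, 'a) module \<Rightarrow> ('a, 'v) module \<Rightarrow> bool" where
  "simple_right_module A M \<longleftrightarrow> right_module A M \<and> carrier M \<noteq> {\<zero>\<^bsub>M\<^esub>} \<and>
     (\<forall>N. right_submodule A M N \<longrightarrow> N = {\<zero>\<^bsub>M\<^esub>} \<or> N = carrier M)"

text \<open>
  The quotient of \<open>M\<close> by \<open>N\<close>, with the cosets of \<open>N\<close> as elements. It is used both for vector spaces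
  over the ground field and for right modules.
\<close>

definition quot_module :: "('a, 'v) module \<Rightarrow> 'v set \<Rightarrow> ('a, 'v set) module" where
  "quot_module M N = \<lparr>
     carrier = a_rcosets\<^bsub>M\<^esub> N,
     monoid.mult = (\<lambda>U Y. undefined),
     one = undefined,
     zero = N,
     add = (\<lambda>U Y. U <+>\<^bsub>M\<^esub> Y),
     smult = (\<lambda>a U. \<Union>v\<in>U. N +>\<^bsub>M\<^esub> (a \<odot>\<^bsub>M\<^esub> v))\<rparr>"


section \<open>The Gabriel quiver\<close>

text \<open>The right module \<open>eA\<close>; for \<open>e = \<one>\<close> it is the regular right module.\<close>

definition idem_module :: "('k, 'a) module \<Rightarrow> 'a \<Rightarrow> ('a, 'a) module" where
  "idem_module A e = \<lparr>
     carrier = (\<lambda>a. e \<otimes>\<^bsub>A\<^esub> a) ` carrier A,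
     monoid.mult = (\<lambda>a b. undefined),
     one = undefined,
     zero = \<zero>\<^bsub>A\<^esub>,
     add = add A,
     smult = (\<lambda>a x. x \<otimes>\<^bsub>A\<^esub> a)\<rparr>"

definition maximal_right_ideal :: "('k, 'a) module \<Rightarrow> 'a set \<Rightarrow> bool" where
  "maximal_right_ideal A I \<longleftrightarrow>
     right_submodule A (idem_module A \<one>\<^bsub>A\<^esub>) I \<and> I \<noteq> carrier A \<and>
     (\<forall>J. right_submodule A (idem_module A \<one>\<^bsub>A\<^esub>) J \<and> I \<subseteq> J \<longrightarrow> J = I \<or> J = carrier A)"

definition rad :: "('k, 'a) module \<Rightarrow> 'a set" where
  "rad A = {x \<in> carrier A. \<forall>I. maximal_right_ideal A I \<longrightarrow> x \<in> I}"

definition rad2 :: "('k, 'a) module \<Rightarrow> 'a set" where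
  "rad2 A = ideal_prod A (rad A) (rad A)"

definition primitive_idempotent :: "('k, 'a) module \<Rightarrow> 'a \<Rightarrow> bool" where
  "primitive_idempotent A e \<longleftrightarrow> e \<in> carrier A \<and> e \<noteq> \<zero>\<^bsub>A\<^esub> \<and> e \<otimes>\<^bsub>A\<^esub> e = e \<and>
     (\<forall>f \<in> carrier A. \<forall>g \<in> carrier A.
        f \<otimes>\<^bsub>A\<^esub> f = f \<and> g \<otimes>\<^bsub>A\<^esub> g = g \<and> f \<otimes>\<^bsub>A\<^esub> g = \<zero>\<^bsub>A\<^esub> \<and> g \<otimes>\<^bsub>A\<^esub> f = \<zero>\<^bsub>A\<^esub> \<and>
        e = f \<oplus>\<^bsub>A\<^esub> g \<longrightarrow> f = \<zero>\<^bsub>A\<^esub> \<or> g = \<zero>\<^bsub>A\<^esub>)"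

text \<open>
  A primitive idempotent \<open>e\<close> corresponds to the simple module which is the top of \<open>eA\<close>, that is,
  the quotient of \<open>eA\<close> by its radical \<open>e rad A\<close>.
\<close>

definition idempotent_of :: "('k, 'a) module \<Rightarrow> ('a, 'v) module \<Rightarrow> 'a \<Rightarrow> bool" where
  "idempotent_of A M e \<longleftrightarrow> primitive_idempotent A e \<and>
     right_iso A (quot_module (idem_module A e) ((\<lambda>r. e \<otimes>\<^bsub>A\<^esub> r) ` rad A)) M"

text \<open>The subspace \<open>e(rad A / rad\<^sup>2 A)f\<close> of \<open>A / rad\<^sup>2 A\<close>.\<close>

definition arrow_space :: "('k, 'a) module \<Rightarrow> 'a \<Rightarrow> 'a \<Rightarrow> ('k, 'a set) module" where
  "arrow_space A e f = (quot_module A (rad2 A))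
     \<lparr>carrier := (\<lambda>r. rad2 A +>\<^bsub>A\<^esub> (e \<otimes>\<^bsub>A\<^esub> r \<otimes>\<^bsub>A\<^esub> f)) ` rad A\<rparr>"

text \<open>A quiver is given by its vertices and the number of arrows from one vertex to another.\<close>

record 'x quiver =
  verts :: "'x set"
  arrows :: "'x \<Rightarrow> 'x \<Rightarrow> nat"

definition quiver_iso :: "('x \<Rightarrow> 'y) \<Rightarrow> 'x quiver \<Rightarrow> 'y quiver \<Rightarrow> bool" where
  "quiver_iso \<phi> Q Q' \<longleftrightarrow> bij_betw \<phi> (verts Q) (verts Q') \<and>
     (\<forall>x \<in> verts Q. \<forall>y \<in> verts Q. arrows Q' (\<phi> x) (\<phi> y) = arrows Q x y)"

definition iso_class :: "('k, 'a) module \<Rightarrow> ('a, 'v) module \<Rightarrow> ('a, 'v) module set" where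
  "iso_class A M = {N \<in> Obj (mod_cat A). right_iso A M N}"

definition vertex_idempotent :: "('k, 'a) module \<Rightarrow> ('a, 'v) module set \<Rightarrow> 'a" where
  "vertex_idempotent A U = (SOME e. \<exists>M \<in> U. idempotent_of A M e)"

definition gabriel_quiver ::
  "('k, 'r) ring_scheme \<Rightarrow> ('k, 'a) module \<Rightarrow> ('a, 'v) module set quiver" where
  "gabriel_quiver K A = \<lparr>
     verts = iso_class A ` {M \<in> Obj (mod_cat A). simple_right_module A M},
     arrows = (\<lambda>U Y. vectorspace.dim K
       (arrow_space A (vertex_idempotent A Y) (vertex_idempotent A U)))\<rparr>"

definition ext_quiver ::
  "('k, 'r) ring_scheme \<Rightarrow> ('k, 'o, 'm, 's) tri_cat_scheme \<Rightarrow> 'o set \<Rightarrow> 'o quiver" where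
  "ext_quiver K C S = \<lparr>
     verts = S,
     arrows = (\<lambda>s t. vectorspace.dim K (Hom C t (susp C s)))\<rparr>"

text \<open>
  Every finite dimensional vector space over a field with elements in \<open>'k\<close> has a copy with underlying
  set in the following type (use coordinates). Consequently every finite dimensional algebra \<open>A\<close> and
  every finitely generated \<open>A\<close>-module has an isomorphic copy there, so that \<open>mod_cat A\<close> at this type
  is equivalent to the category of all finitely generated right \<open>A\<close>-modules.
\<close>

type_synonym 'k coords = "nat \<Rightarrow> 'k"

end

theory Submission
  imports Defs
begin

text \<open>
  Let \<open>E\<close> be the extension closure of \<open>S\<close>. Its objects have a filtration with subquotients in \<open>S\<close>,
  and \<open>Hom(\<Sigma>E, E) = 0\<close>, so \<open>E\<close> behaves like a category of modules of finite length whose simple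
  objects are the elements of \<open>S\<close>: a nonzero map from an object of \<open>E\<close> to a simple object has its
  fibre in \<open>E\<close> (\<open>simple_quotient\<close>), and statements about \<open>E\<close> are proved by induction on the length.
  To identify \<open>E\<close> with \<open>mod A\<close> it suffices to find a projective generator \<open>P\<close> and to put
  \<open>A = End(P)\<close>.

  The generator comes from the generation property of simple minded systems. It gives for
  \<open>\<Sigma>\<^sup>-\<^sup>w s\<close> a triangle \<open>d' \<rightarrow> \<Sigma>\<^sup>-\<^sup>w s \<rightarrow> \<Sigma>\<^sup>-\<^sup>w\<^sup>+\<^sup>1 e\<close> with \<open>e\<close> in \<open>E\<close> and \<open>d'\<close> in
  \<open>E * \<dots> * \<Sigma>\<^sup>-\<^sup>w\<^sup>+\<^sup>2 E\<close>. Shifted by \<open>w\<close> and rotated it becomes \<open>e \<rightarrow> d \<rightarrow> s\<close>, so \<open>d\<close> lies in \<open>E\<close>, and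
  orthogonality yields \<open>Hom(d, \<Sigma>E) = 0\<close>, which says that \<open>d\<close> is projective in \<open>E\<close>
  (\<open>projective_presentation\<close>). The sum of these \<open>d\<close> is \<open>P\<close>.

  The functor \<open>Hom(P, -)\<close> from \<open>E\<close> to right \<open>A\<close>-modules is fully faithful by induction on the
  length (\<open>represented_faithful\<close>, \<open>represented_full\<close>). Every submodule of \<open>Hom(P, x)\<close> is the kernel
  of a surjection to some \<open>Hom(P, y)\<close> (\<open>represented_quotient\<close>); applied to a sum of copies of \<open>P\<close>
  this makes the functor essentially surjective (\<open>rep_essentially_surjective\<close>).

  For the quiver let \<open>K\<close> be algebraically closed, so that \<open>End(s) = K\<close> for \<open>s\<close> in \<open>S\<close>. The simple
  modules are the \<open>Hom(P, s)\<close> and the radical of \<open>A\<close> is their common annihilator. An idempotent \<open>e\<close>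
  belonging to \<open>t\<close> comes with a map \<open>v\<close> from \<open>P\<close> to \<open>t\<close> such that \<open>ve = v\<close> and \<open>ea\<close> is in
  the radical whenever \<open>va = 0\<close>; let \<open>f\<close> be such an idempotent for \<open>s\<close>. If \<open>k \<rightarrow> P \<rightarrow> t\<close> is a
  triangle with second map \<open>v\<close>, then every map from \<open>t\<close> to \<open>\<Sigma>s\<close> comes from a map \<open>c\<close> from \<open>k\<close> to
  \<open>s\<close>, and since every radical element \<open>j\<close> factors through \<open>k\<close>, composition of this factor with
  \<open>c\<close> pairs \<open>Hom(t, \<Sigma>s)\<close> with \<open>e rad A f\<close>, with values in \<open>Hom(P, s)f\<close>, a space of dimension one. The
  pairing kills \<open>rad\<^sup>2 A\<close>, and it is perfect on the quotient: on one side because \<open>c\<close> is determined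
  up to maps that extend to \<open>P\<close>, on the other because \<open>e rad A / e rad\<^sup>2 A\<close> is semisimple and
  \<open>Hom(P, -)\<close> is full (\<open>pair_left_nondegenerate\<close>, \<open>pair_right_nondegenerate\<close>). Hence both spaces have the
  same dimension.
\<close>


section \<open>Calculus in a linear category\<close>

context linear_category
begin

abbreviation mor :: "'o \<Rightarrow> 'o \<Rightarrow> 'm set" where
  "mor x y \<equiv> carrier (Hom C x y)"

abbreviation nul :: "'o \<Rightarrow> 'o \<Rightarrow> 'm" where
  "nul x y \<equiv> \<zero>\<^bsub>Hom C x y\<^esub>"

lemma mor_abelian: "x \<in> Obj C \<Longrightarrow> y \<in> Obj C \<Longrightarrow> abelian_group (Hom C x y)"
  using Hom_vectorspace[of x y] unfolding vectorspace_def Module.module_def by blast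

lemma mor_module: "x \<in> Obj C \<Longrightarrow> y \<in> Obj C \<Longrightarrow> Module.module K (Hom C x y)"
  using Hom_vectorspace[of x y] unfolding vectorspace_def by blast

declare Cmp_closed [simp] Idt_closed [simp] Idt_left [simp] Idt_right [simp]

lemma nul_closed [simp]: "x \<in> Obj C \<Longrightarrow> y \<in> Obj C \<Longrightarrow> nul x y \<in> mor x y"
  by (rule abelian_monoid.zero_closed[OF abelian_group.axioms(1)[OF mor_abelian]])

lemma mor_add_closed [simp]:
  "\<lbrakk>x \<in> Obj C; y \<in> Obj C; f \<in> mor x y; g \<in> mor x y\<rbrakk> \<Longrightarrow> f \<oplus>\<^bsub>Hom C x y\<^esub> g \<in> mor x y"
  by (rule abelian_monoid.a_closed[OF abelian_group.axioms(1)[OF mor_abelian]])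

lemma mor_neg_closed [simp]:
  "\<lbrakk>x \<in> Obj C; y \<in> Obj C; f \<in> mor x y\<rbrakk> \<Longrightarrow> \<ominus>\<^bsub>Hom C x y\<^esub> f \<in> mor x y"
  by (rule abelian_group.a_inv_closed[OF mor_abelian])

lemma mor_diff_closed [simp]:
  "\<lbrakk>x \<in> Obj C; y \<in> Obj C; f \<in> mor x y; g \<in> mor x y\<rbrakk> \<Longrightarrow> f \<ominus>\<^bsub>Hom C x y\<^esub> g \<in> mor x y"
  by (simp add: a_minus_def)

lemma mor_smult_closed [simp]:
  "\<lbrakk>x \<in> Obj C; y \<in> Obj C; c \<in> carrier K; f \<in> mor x y\<rbrakk> \<Longrightarrow> c \<odot>\<^bsub>Hom C x y\<^esub> f \<in> mor x y"
  by (rule Module.module.smult_closed[OF mor_module])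

lemma mor_add_nul [simp]:
  assumes "x \<in> Obj C" "y \<in> Obj C" "f \<in> mor x y"
  shows "f \<oplus>\<^bsub>Hom C x y\<^esub> nul x y = f" "nul x y \<oplus>\<^bsub>Hom C x y\<^esub> f = f"
  using abelian_monoid.r_zero[OF abelian_group.axioms(1)[OF mor_abelian[OF assms(1,2)]] assms(3)]
    abelian_monoid.l_zero[OF abelian_group.axioms(1)[OF mor_abelian[OF assms(1,2)]] assms(3)] by auto

lemma mor_diff_eq_nul [simp]:
  "\<lbrakk>x \<in> Obj C; y \<in> Obj C; f \<in> mor x y; g \<in> mor x y\<rbrakk> \<Longrightarrow> f \<ominus>\<^bsub>Hom C x y\<^esub> g = nul x y \<longleftrightarrow> f = g"
  by (rule abelian_group.minus_other_side[OF mor_abelian])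

lemma mor_neg_nul [simp]: "\<lbrakk>x \<in> Obj C; y \<in> Obj C\<rbrakk> \<Longrightarrow> \<ominus>\<^bsub>Hom C x y\<^esub> nul x y = nul x y"
  using abelian_group.minus_equality[OF mor_abelian, of x y "nul x y" "nul x y"] by simp

lemma mor_diff_nul [simp]: "\<lbrakk>x \<in> Obj C; y \<in> Obj C; f \<in> mor x y\<rbrakk> \<Longrightarrow> f \<ominus>\<^bsub>Hom C x y\<^esub> nul x y = f"
  by (simp add: a_minus_def)

lemma mor_neg_neg [simp]:
  "\<lbrakk>x \<in> Obj C; y \<in> Obj C; f \<in> mor x y\<rbrakk> \<Longrightarrow> \<ominus>\<^bsub>Hom C x y\<^esub> (\<ominus>\<^bsub>Hom C x y\<^esub> f) = f"
  by (rule abelian_group.minus_minus[OF mor_abelian])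

lemma mor_neg_eq_nul [simp]:
  "\<lbrakk>x \<in> Obj C; y \<in> Obj C; f \<in> mor x y\<rbrakk> \<Longrightarrow> \<ominus>\<^bsub>Hom C x y\<^esub> f = nul x y \<longleftrightarrow> f = nul x y"
  by (metis mor_neg_neg mor_neg_nul)

lemma mor_diff_add:
  assumes "x \<in> Obj C" "y \<in> Obj C" "f \<in> mor x y" "g \<in> mor x y"
  shows "(f \<ominus>\<^bsub>Hom C x y\<^esub> g) \<oplus>\<^bsub>Hom C x y\<^esub> g = f" "g \<oplus>\<^bsub>Hom C x y\<^esub> (f \<ominus>\<^bsub>Hom C x y\<^esub> g) = f"
proof -
  interpret abelian_group "Hom C x y" using mor_abelian assms by blast
  show "(f \<ominus>\<^bsub>Hom C x y\<^esub> g) \<oplus>\<^bsub>Hom C x y\<^esub> g = f" using assms by (simp add: a_minus_def a_assoc l_neg)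
  then show "g \<oplus>\<^bsub>Hom C x y\<^esub> (f \<ominus>\<^bsub>Hom C x y\<^esub> g) = f" using assms by (simp add: a_comm)
qed

lemma mor_diff_diff:
  assumes "x \<in> Obj C" "y \<in> Obj C" "f \<in> mor x y" "g \<in> mor x y"
  shows "f \<ominus>\<^bsub>Hom C x y\<^esub> (f \<ominus>\<^bsub>Hom C x y\<^esub> g) = g"
proof -
  interpret ab: abelian_group "Hom C x y" by (rule mor_abelian[OF assms(1,2)])
  have m: "f \<ominus>\<^bsub>Hom C x y\<^esub> g \<in> mor x y" "f \<ominus>\<^bsub>Hom C x y\<^esub> (f \<ominus>\<^bsub>Hom C x y\<^esub> g) \<in> mor x y"
    using assms by simp_all
  have "(f \<ominus>\<^bsub>Hom C x y\<^esub> (f \<ominus>\<^bsub>Hom C x y\<^esub> g)) \<oplus>\<^bsub>Hom C x y\<^esub> (f \<ominus>\<^bsub>Hom C x y\<^esub> g) = g \<oplus>\<^bsub>Hom C x y\<^esub> (f \<ominus>\<^bsub>Hom C x y\<^esub> g)"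
    using mor_diff_add(1)[OF assms(1,2) assms(3) m(1)] mor_diff_add(2)[OF assms] by simp
  then show ?thesis using m assms ab.add.right_cancel by blast
qed

lemma Cmp_nul_left [simp]:
  assumes "x \<in> Obj C" "y \<in> Obj C" "z \<in> Obj C" "f \<in> mor x y"
  shows "Cmp C x y z (nul y z) f = nul x z"
proof -
  interpret abelian_group "Hom C x z" using mor_abelian assms by blast
  have "Cmp C x y z (nul y z) f = Cmp C x y z (nul y z) f \<oplus>\<^bsub>Hom C x z\<^esub> Cmp C x y z (nul y z) f"
    using Cmp_add_left[of x y z "nul y z" "nul y z" f] assms by simp
  then show ?thesis using assms by (metis Cmp_closed nul_closed add.r_cancel_one')
qed

lemma Cmp_nul_right [simp]:
  assumes "x \<in> Obj C" "y \<in> Obj C" "z \<in> Obj C" "g \<in> mor y z"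
  shows "Cmp C x y z g (nul x y) = nul x z"
proof -
  interpret abelian_group "Hom C x z" using mor_abelian assms by blast
  have "Cmp C x y z g (nul x y) = Cmp C x y z g (nul x y) \<oplus>\<^bsub>Hom C x z\<^esub> Cmp C x y z g (nul x y)"
    using Cmp_add_right[of x y z g "nul x y" "nul x y"] assms by simp
  then show ?thesis using assms by (metis Cmp_closed nul_closed add.r_cancel_one')
qed

lemma Cmp_neg_left:
  assumes "x \<in> Obj C" "y \<in> Obj C" "z \<in> Obj C" "g \<in> mor y z" "f \<in> mor x y"
  shows "Cmp C x y z (\<ominus>\<^bsub>Hom C y z\<^esub> g) f = \<ominus>\<^bsub>Hom C x z\<^esub> Cmp C x y z g f"
proof -
  interpret abelian_group "Hom C x z" using mor_abelian assms by blast
  have "Cmp C x y z (\<ominus>\<^bsub>Hom C y z\<^esub> g) f \<oplus>\<^bsub>Hom C x z\<^esub> Cmp C x y z g f = nul x z"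
    using Cmp_add_left[of x y z "\<ominus>\<^bsub>Hom C y z\<^esub> g" g f] assms
      abelian_group.l_neg[OF mor_abelian, of y z g] by simp
  then show ?thesis using assms by (metis Cmp_closed mor_neg_closed minus_equality)
qed

lemma Cmp_neg_right:
  assumes "x \<in> Obj C" "y \<in> Obj C" "z \<in> Obj C" "g \<in> mor y z" "f \<in> mor x y"
  shows "Cmp C x y z g (\<ominus>\<^bsub>Hom C x y\<^esub> f) = \<ominus>\<^bsub>Hom C x z\<^esub> Cmp C x y z g f"
proof -
  interpret abelian_group "Hom C x z" using mor_abelian assms by blast
  have "Cmp C x y z g (\<ominus>\<^bsub>Hom C x y\<^esub> f) \<oplus>\<^bsub>Hom C x z\<^esub> Cmp C x y z g f = nul x z"
    using Cmp_add_right[of x y z g "\<ominus>\<^bsub>Hom C x y\<^esub> f" f] assms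
      abelian_group.l_neg[OF mor_abelian, of x y f] by simp
  then show ?thesis using assms by (metis Cmp_closed mor_neg_closed minus_equality)
qed

lemma Cmp_diff_left:
  "\<lbrakk>x \<in> Obj C; y \<in> Obj C; z \<in> Obj C; g \<in> mor y z; g' \<in> mor y z; f \<in> mor x y\<rbrakk> \<Longrightarrow>
    Cmp C x y z (g \<ominus>\<^bsub>Hom C y z\<^esub> g') f = Cmp C x y z g f \<ominus>\<^bsub>Hom C x z\<^esub> Cmp C x y z g' f"
  by (simp add: a_minus_def Cmp_add_left Cmp_neg_left)

lemma Cmp_diff_right:
  "\<lbrakk>x \<in> Obj C; y \<in> Obj C; z \<in> Obj C; g \<in> mor y z; f \<in> mor x y; f' \<in> mor x y\<rbrakk> \<Longrightarrow>
    Cmp C x y z g (f \<ominus>\<^bsub>Hom C x y\<^esub> f') = Cmp C x y z g f \<ominus>\<^bsub>Hom C x z\<^esub> Cmp C x y z g f'"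
  by (simp add: a_minus_def Cmp_add_right Cmp_neg_right)

lemma is_iso_inverse:
  assumes "is_iso C x y f"
  obtains g where "is_iso C y x g" "g \<in> mor y x" "f \<in> mor x y"
    "Cmp C x y x g f = Idt C x" "Cmp C y x y f g = Idt C y"
  using assms unfolding is_iso_def by blast

lemma is_iso_Idt [simp]: "x \<in> Obj C \<Longrightarrow> is_iso C x x (Idt C x)"
  unfolding is_iso_def by (auto intro!: bexI[of _ "Idt C x"])

lemma Cmp_reassoc:
  assumes "Cmp C x y z g f = h" "w \<in> Obj C" "x \<in> Obj C" "y \<in> Obj C" "z \<in> Obj C"
    "g \<in> mor y z" "f \<in> mor x y" "u \<in> mor w x"
  shows "Cmp C w y z g (Cmp C w x y f u) = Cmp C w x z h u"
  using assms Cmp_assoc[of w x y z g f u] by simp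

lemma is_iso_Cmp:
  assumes "x \<in> Obj C" "y \<in> Obj C" "z \<in> Obj C" "is_iso C x y f" "is_iso C y z g"
  shows "is_iso C x z (Cmp C x y z g f)"
proof -
  obtain f' where f: "f' \<in> mor y x" "f \<in> mor x y" "Cmp C x y x f' f = Idt C x" "Cmp C y x y f f' = Idt C y"
    using assms(4) is_iso_inverse by blast
  obtain g' where g: "g' \<in> mor z y" "g \<in> mor y z" "Cmp C y z y g' g = Idt C y" "Cmp C z y z g g' = Idt C z"
    using assms(5) is_iso_inverse by blast
  have "Cmp C x z x (Cmp C z y x f' g') (Cmp C x y z g f) = Idt C x"
    using assms f g Cmp_reassoc[OF g(3), of x f] by (simp add: Cmp_assoc)
  moreover have "Cmp C z x z (Cmp C x y z g f) (Cmp C z y x f' g') = Idt C z"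
    using assms f g Cmp_reassoc[OF f(4), of z g'] by (simp add: Cmp_assoc)
  ultimately show ?thesis unfolding is_iso_def using assms f g by (auto intro!: bexI[of _ "Cmp C z y x f' g'"])
qed

lemma isomorphic_refl: "x \<in> Obj C \<Longrightarrow> isomorphic C x x"
  unfolding isomorphic_def using is_iso_Idt by blast

lemma isomorphic_sym: "isomorphic C x y \<Longrightarrow> isomorphic C y x"
  unfolding isomorphic_def by (meson is_iso_inverse)

lemma isomorphic_trans:
  "\<lbrakk>x \<in> Obj C; y \<in> Obj C; z \<in> Obj C; isomorphic C x y; isomorphic C y z\<rbrakk> \<Longrightarrow> isomorphic C x z"
  unfolding isomorphic_def by (meson is_iso_Cmp)

lemma zero_objectD:
  assumes "zero_object C z" "x \<in> Obj C"
  shows "z \<in> Obj C" "f \<in> mor z x \<Longrightarrow> f = nul z x" "f \<in> mor x z \<Longrightarrow> f = nul x z"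
  using assms unfolding zero_object_def by auto

lemma zero_objectI:
  assumes "z \<in> Obj C" "Idt C z = nul z z"
  shows "zero_object C z"
proof -
  have "f = nul z x" if "x \<in> Obj C" "f \<in> mor z x" for x f
    using that assms Idt_right[of z x f] by simp
  moreover have "f = nul x z" if "x \<in> Obj C" "f \<in> mor x z" for x f
    using that assms Idt_left[of x z f] by simp
  ultimately show ?thesis unfolding zero_object_def using assms(1) by auto
qed

lemma zero_object_iso:
  assumes "zero_object C z" "y \<in> Obj C" "isomorphic C z y"
  shows "zero_object C y"
proof (rule zero_objectI)
  obtain f g where fg: "f \<in> mor z y" "g \<in> mor y z" "Cmp C y z y f g = Idt C y"
    using assms(3) unfolding isomorphic_def is_iso_def by blast
  moreover have "f = nul z y" using fg assms zero_objectD by blast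
  ultimately show "Idt C y = nul y y" using assms zero_objectD(1)[OF assms(1,2)] by (metis Cmp_nul_left)
qed (fact assms)

end

lemma linear_functorD:
  assumes "linear_functor K C D F"
  shows linear_functor_obj: "x \<in> Obj C \<Longrightarrow> on_obj F x \<in> Obj D"
    and linear_functor_mor: "\<lbrakk>x \<in> Obj C; y \<in> Obj C; f \<in> carrier (Hom C x y)\<rbrakk> \<Longrightarrow>
      on_hom F x y f \<in> carrier (Hom D (on_obj F x) (on_obj F y))"
    and linear_functor_add: "\<lbrakk>x \<in> Obj C; y \<in> Obj C; f \<in> carrier (Hom C x y); g \<in> carrier (Hom C x y)\<rbrakk> \<Longrightarrow>
      on_hom F x y (f \<oplus>\<^bsub>Hom C x y\<^esub> g)
        = on_hom F x y f \<oplus>\<^bsub>Hom D (on_obj F x) (on_obj F y)\<^esub> on_hom F x y g"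
    and linear_functor_smult: "\<lbrakk>x \<in> Obj C; y \<in> Obj C; c \<in> carrier K; f \<in> carrier (Hom C x y)\<rbrakk> \<Longrightarrow>
      on_hom F x y (c \<odot>\<^bsub>Hom C x y\<^esub> f) = c \<odot>\<^bsub>Hom D (on_obj F x) (on_obj F y)\<^esub> on_hom F x y f"
    and linear_functor_Idt: "x \<in> Obj C \<Longrightarrow> on_hom F x x (Idt C x) = Idt D (on_obj F x)"
    and linear_functor_Cmp: "\<lbrakk>x \<in> Obj C; y \<in> Obj C; z \<in> Obj C; g \<in> carrier (Hom C y z); f \<in> carrier (Hom C x y)\<rbrakk> \<Longrightarrow>
      on_hom F x z (Cmp C x y z g f)
        = Cmp D (on_obj F x) (on_obj F y) (on_obj F z) (on_hom F y z g) (on_hom F x y f)"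
proof -
  have h: "x \<in> Obj C \<Longrightarrow> y \<in> Obj C \<Longrightarrow>
    on_hom F x y \<in> LinearCombinations.module_hom K (Hom C x y) (Hom D (on_obj F x) (on_obj F y))" for x y
    using assms unfolding linear_functor_def by simp
  show "x \<in> Obj C \<Longrightarrow> on_obj F x \<in> Obj D"
    using assms unfolding linear_functor_def by simp
  show "\<lbrakk>x \<in> Obj C; y \<in> Obj C; f \<in> carrier (Hom C x y)\<rbrakk> \<Longrightarrow>
      on_hom F x y f \<in> carrier (Hom D (on_obj F x) (on_obj F y))"
    using LinearCombinations.module_hom_closed[OF h, of x y] by auto
  show "\<lbrakk>x \<in> Obj C; y \<in> Obj C; f \<in> carrier (Hom C x y); g \<in> carrier (Hom C x y)\<rbrakk> \<Longrightarrow>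
      on_hom F x y (f \<oplus>\<^bsub>Hom C x y\<^esub> g)
        = on_hom F x y f \<oplus>\<^bsub>Hom D (on_obj F x) (on_obj F y)\<^esub> on_hom F x y g"
    using LinearCombinations.module_hom_add[OF h] by simp
  show "\<lbrakk>x \<in> Obj C; y \<in> Obj C; c \<in> carrier K; f \<in> carrier (Hom C x y)\<rbrakk> \<Longrightarrow>
      on_hom F x y (c \<odot>\<^bsub>Hom C x y\<^esub> f) = c \<odot>\<^bsub>Hom D (on_obj F x) (on_obj F y)\<^esub> on_hom F x y f"
    using LinearCombinations.module_hom_smult[OF h] by simp
  show "x \<in> Obj C \<Longrightarrow> on_hom F x x (Idt C x) = Idt D (on_obj F x)"
    using assms unfolding linear_functor_def by simp
  show "\<lbrakk>x \<in> Obj C; y \<in> Obj C; z \<in> Obj C; g \<in> carrier (Hom C y z); f \<in> carrier (Hom C x y)\<rbrakk> \<Longrightarrow>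
      on_hom F x z (Cmp C x y z g f)
        = Cmp D (on_obj F x) (on_obj F y) (on_obj F z) (on_hom F y z g) (on_hom F x y f)"
    using assms unfolding linear_functor_def by simp
qed

lemma natural_retractionE:
  assumes "naturally_isomorphic C C (fun_comp G F) fun_id"
  obtains \<eta> where "\<And>x. x \<in> Obj C \<Longrightarrow> is_iso C (on_obj G (on_obj F x)) x (\<eta> x)"
    and "\<And>x y f. \<lbrakk>x \<in> Obj C; y \<in> Obj C; f \<in> carrier (Hom C x y)\<rbrakk> \<Longrightarrow>
      Cmp C (on_obj G (on_obj F x)) (on_obj G (on_obj F y)) y (\<eta> y)
         (on_hom G (on_obj F x) (on_obj F y) (on_hom F x y f))
      = Cmp C (on_obj G (on_obj F x)) x y f (\<eta> x)"
proof -
  obtain \<eta> where 1: "\<forall>x\<in>Obj C. is_iso C (on_obj G (on_obj F x)) x (\<eta> x)"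
    and 2: "\<forall>x\<in>Obj C. \<forall>y\<in>Obj C. \<forall>f\<in>carrier (Hom C x y).
      Cmp C (on_obj G (on_obj F x)) (on_obj G (on_obj F y)) y (\<eta> y)
         (on_hom G (on_obj F x) (on_obj F y) (on_hom F x y f))
      = Cmp C (on_obj G (on_obj F x)) x y f (\<eta> x)"
    using assms unfolding naturally_isomorphic_def fun_comp_def fun_id_def by auto
  show thesis by (rule that[of \<eta>]) (use 1 2 in simp_all)
qed

text \<open>An equivalence is fully faithful: a natural isomorphism from \<open>G \<circ> F\<close> to the identity makes
  \<open>F\<close> faithful, and then fullness of \<open>F\<close> follows from faithfulness of \<open>G\<close>.\<close>

lemma retract_functor_faithful:
  assumes C: "linear_category K C" and D: "linear_category K D"
    and F: "linear_functor K C D F" and G: "linear_functor K D C G"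
    and n: "naturally_isomorphic C C (fun_comp G F) fun_id"
    and x: "x \<in> Obj C" and y: "y \<in> Obj C"
    and f: "f \<in> carrier (Hom C x y)" and g: "g \<in> carrier (Hom C x y)"
    and eq: "on_hom F x y f = on_hom F x y g"
  shows "f = g"
proof -
  interpret linear_category K C by (fact C)
  obtain \<eta> where iso: "\<And>x. x \<in> Obj C \<Longrightarrow> is_iso C (on_obj G (on_obj F x)) x (\<eta> x)"
    and nat: "\<And>x y f. \<lbrakk>x \<in> Obj C; y \<in> Obj C; f \<in> mor x y\<rbrakk> \<Longrightarrow>
      Cmp C (on_obj G (on_obj F x)) (on_obj G (on_obj F y)) y (\<eta> y)
         (on_hom G (on_obj F x) (on_obj F y) (on_hom F x y f))
      = Cmp C (on_obj G (on_obj F x)) x y f (\<eta> x)"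
    using natural_retractionE[OF n] by blast
  let ?x = "on_obj G (on_obj F x)"
  have X: "?x \<in> Obj C" using linear_functor_obj[OF G linear_functor_obj[OF F x]] .
  obtain e where e: "e \<in> mor x ?x" "\<eta> x \<in> mor ?x x" "Cmp C x ?x x (\<eta> x) e = Idt C x"
    by (rule is_iso_inverse[OF iso[OF x]])
  have "Cmp C ?x x y f (\<eta> x) = Cmp C ?x x y g (\<eta> x)"
    using nat[OF x y f] nat[OF x y g] eq by simp
  then have "Cmp C x ?x y (Cmp C ?x x y f (\<eta> x)) e = Cmp C x ?x y (Cmp C ?x x y g (\<eta> x)) e"
    by simp
  then show ?thesis using x y f g e X by (simp add: Cmp_assoc)
qed

lemma linear_equivalence_fully_faithful:
  assumes C: "linear_category K C" and D: "linear_category K D"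
    and E: "linear_equivalence K C D F" and x: "x \<in> Obj C" and y: "y \<in> Obj C"
  shows "bij_betw (on_hom F x y) (carrier (Hom C x y)) (carrier (Hom D (on_obj F x) (on_obj F y)))"
proof -
  interpret linear_category K C by (fact C)
  obtain G where F: "linear_functor K C D F" and G: "linear_functor K D C G"
    and n: "naturally_isomorphic C C (fun_comp G F) fun_id"
    and n': "naturally_isomorphic D D (fun_comp F G) fun_id"
    using E unfolding linear_equivalence_def by blast
  have Fx: "on_obj F x \<in> Obj D" and Fy: "on_obj F y \<in> Obj D"
    using linear_functor_obj[OF F x] linear_functor_obj[OF F y] .
  have Fm: "on_hom F x y f \<in> carrier (Hom D (on_obj F x) (on_obj F y))" if "f \<in> mor x y" for f
    using linear_functor_mor[OF F x y that] .
  have "inj_on (on_hom F x y) (mor x y)"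
    by (rule inj_onI) (rule retract_functor_faithful[OF C D F G n x y])
  moreover have "\<exists>f \<in> mor x y. on_hom F x y f = h" if h: "h \<in> carrier (Hom D (on_obj F x) (on_obj F y))" for h
  proof -
    obtain \<eta> where iso: "\<And>x. x \<in> Obj C \<Longrightarrow> is_iso C (on_obj G (on_obj F x)) x (\<eta> x)"
      and nat: "\<And>x y f. \<lbrakk>x \<in> Obj C; y \<in> Obj C; f \<in> mor x y\<rbrakk> \<Longrightarrow>
        Cmp C (on_obj G (on_obj F x)) (on_obj G (on_obj F y)) y (\<eta> y)
           (on_hom G (on_obj F x) (on_obj F y) (on_hom F x y f))
        = Cmp C (on_obj G (on_obj F x)) x y f (\<eta> x)"
      using natural_retractionE[OF n] by blast
    let ?x = "on_obj G (on_obj F x)" and ?y = "on_obj G (on_obj F y)"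
    have X: "?x \<in> Obj C" "?y \<in> Obj C" using linear_functor_obj[OF G linear_functor_obj[OF F x]] linear_functor_obj[OF G linear_functor_obj[OF F y]] .
    obtain e where e: "e \<in> mor x ?x" "\<eta> x \<in> mor ?x x" "Cmp C ?x x ?x e (\<eta> x) = Idt C ?x"
      by (rule is_iso_inverse[OF iso[OF x]])
    obtain e' where e': "e' \<in> mor y ?y" "\<eta> y \<in> mor ?y y" "Cmp C ?y y ?y e' (\<eta> y) = Idt C ?y"
      by (rule is_iso_inverse[OF iso[OF y]])
    have Gm: "on_hom G (on_obj F x) (on_obj F y) k \<in> mor ?x ?y"
      if "k \<in> carrier (Hom D (on_obj F x) (on_obj F y))" for k
      using linear_functor_mor[OF G Fx Fy that] .
    define f where "f = Cmp C x ?y y (\<eta> y) (Cmp C x ?x ?y (on_hom G (on_obj F x) (on_obj F y) h) e)"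
    have f: "f \<in> mor x y" unfolding f_def using e e' X x y Gm[OF h] by simp
    let ?k = "on_hom G (on_obj F x) (on_obj F y) (on_hom F x y f)"
    let ?g = "on_hom G (on_obj F x) (on_obj F y) h"
    have "Cmp C ?x ?y y (\<eta> y) ?k = Cmp C ?x x y f (\<eta> x)" using nat[OF x y f] .
    also have "\<dots> = Cmp C ?x ?y y (\<eta> y) ?g"
      unfolding f_def using e e' X x y Gm[OF h] by (simp add: Cmp_assoc)
    finally have "Cmp C ?x y ?y e' (Cmp C ?x ?y y (\<eta> y) ?k) = Cmp C ?x y ?y e' (Cmp C ?x ?y y (\<eta> y) ?g)"
      by simp
    then have "?k = ?g"
      using e' X x y Gm[OF h] Gm[OF Fm[OF f]] Cmp_assoc[of ?x ?y y ?y e' "\<eta> y" ?k] Cmp_assoc[of ?x ?y y ?y e' "\<eta> y" ?g]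
      by simp
    then have "on_hom F x y f = h"
      using retract_functor_faithful[OF D C G F n' Fx Fy Fm[OF f] h] by simp
    then show ?thesis using f by blast
  qed
  ultimately show ?thesis unfolding bij_betw_def using Fm by blast
qed


section \<open>Triangles\<close>

context triangulated_category
begin

abbreviation T :: "'o \<Rightarrow> 'o" where "T \<equiv> susp C"

abbreviation Tm :: "'o \<Rightarrow> 'o \<Rightarrow> 'm \<Rightarrow> 'm" where "Tm \<equiv> susp_hom C"

lemma susp_functor: "linear_functor K C C (Susp C)"
  using susp_equivalence unfolding linear_equivalence_def by blast

lemma T_obj [simp]: "x \<in> Obj C \<Longrightarrow> T x \<in> Obj C"
  by (rule linear_functor_obj[OF susp_functor])

lemma Tm_closed [simp]: "\<lbrakk>x \<in> Obj C; y \<in> Obj C; f \<in> mor x y\<rbrakk> \<Longrightarrow> Tm x y f \<in> mor (T x) (T y)"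
  by (rule linear_functor_mor[OF susp_functor])

lemma Tm_add: "\<lbrakk>x \<in> Obj C; y \<in> Obj C; f \<in> mor x y; g \<in> mor x y\<rbrakk> \<Longrightarrow>
  Tm x y (f \<oplus>\<^bsub>Hom C x y\<^esub> g) = Tm x y f \<oplus>\<^bsub>Hom C (T x) (T y)\<^esub> Tm x y g"
  by (rule linear_functor_add[OF susp_functor])

lemma Tm_smult: "\<lbrakk>x \<in> Obj C; y \<in> Obj C; c \<in> carrier K; f \<in> mor x y\<rbrakk> \<Longrightarrow>
  Tm x y (c \<odot>\<^bsub>Hom C x y\<^esub> f) = c \<odot>\<^bsub>Hom C (T x) (T y)\<^esub> Tm x y f"
  by (rule linear_functor_smult[OF susp_functor])

lemma Tm_Idt [simp]: "x \<in> Obj C \<Longrightarrow> Tm x x (Idt C x) = Idt C (T x)"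
  by (rule linear_functor_Idt[OF susp_functor])

lemma Tm_Cmp: "\<lbrakk>x \<in> Obj C; y \<in> Obj C; z \<in> Obj C; g \<in> mor y z; f \<in> mor x y\<rbrakk> \<Longrightarrow>
  Tm x z (Cmp C x y z g f) = Cmp C (T x) (T y) (T z) (Tm y z g) (Tm x y f)"
  by (rule linear_functor_Cmp[OF susp_functor])

lemma Tm_bij: "\<lbrakk>x \<in> Obj C; y \<in> Obj C\<rbrakk> \<Longrightarrow> bij_betw (Tm x y) (mor x y) (mor (T x) (T y))"
  by (rule linear_equivalence_fully_faithful[OF linear_category_axioms linear_category_axioms susp_equivalence])

lemma Tm_inj: "\<lbrakk>x \<in> Obj C; y \<in> Obj C; f \<in> mor x y; g \<in> mor x y; Tm x y f = Tm x y g\<rbrakk> \<Longrightarrow> f = g"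
  using Tm_bij[of x y] unfolding bij_betw_def inj_on_def by blast

lemma Tm_surj:
  assumes "x \<in> Obj C" "y \<in> Obj C" "h \<in> mor (T x) (T y)"
  shows "\<exists>f \<in> mor x y. Tm x y f = h"
proof -
  have "h \<in> Tm x y ` mor x y" using bij_betw_imp_surj_on[OF Tm_bij[OF assms(1,2)]] assms(3) by simp
  then show ?thesis by blast
qed

lemma Tm_nul [simp]:
  assumes "x \<in> Obj C" "y \<in> Obj C"
  shows "Tm x y (nul x y) = nul (T x) (T y)"
proof -
  interpret abelian_group "Hom C (T x) (T y)" using mor_abelian assms by simp
  have "Tm x y (nul x y) = Tm x y (nul x y) \<oplus>\<^bsub>Hom C (T x) (T y)\<^esub> Tm x y (nul x y)"
    using Tm_add[of x y "nul x y" "nul x y"] assms by simp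
  then show ?thesis using assms by (metis Tm_closed nul_closed add.r_cancel_one')
qed

lemma Tm_neg:
  assumes "x \<in> Obj C" "y \<in> Obj C" "f \<in> mor x y"
  shows "Tm x y (\<ominus>\<^bsub>Hom C x y\<^esub> f) = \<ominus>\<^bsub>Hom C (T x) (T y)\<^esub> Tm x y f"
proof -
  interpret abelian_group "Hom C (T x) (T y)" using mor_abelian assms by simp
  have "Tm x y (\<ominus>\<^bsub>Hom C x y\<^esub> f) \<oplus>\<^bsub>Hom C (T x) (T y)\<^esub> Tm x y f = nul (T x) (T y)"
    using Tm_add[of x y "\<ominus>\<^bsub>Hom C x y\<^esub> f" f] assms abelian_group.l_neg[OF mor_abelian, of x y f] by simp
  then show ?thesis using assms by (metis Tm_closed mor_neg_closed minus_equality)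
qed

lemma Tm_eq_nul: "\<lbrakk>x \<in> Obj C; y \<in> Obj C; f \<in> mor x y\<rbrakk> \<Longrightarrow> Tm x y f = nul (T x) (T y) \<longleftrightarrow> f = nul x y"
  using Tm_inj[of x y f "nul x y"] by auto

lemma Tm_iso:
  assumes "x \<in> Obj C" "y \<in> Obj C" "is_iso C x y f"
  shows "is_iso C (T x) (T y) (Tm x y f)"
proof -
  obtain g where g: "g \<in> mor y x" "f \<in> mor x y" "Cmp C x y x g f = Idt C x" "Cmp C y x y f g = Idt C y"
    using is_iso_inverse[OF assms(3)] by metis
  show ?thesis unfolding is_iso_def
    using g assms Tm_Cmp[of x y x g f] Tm_Cmp[of y x y f g] by (auto intro!: bexI[of _ "Tm y x g"])
qed

lemma Tm_reflects_zero_mor: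
  "\<lbrakk>x \<in> Obj C; y \<in> Obj C; mor (T x) (T y) = {nul (T x) (T y)}\<rbrakk> \<Longrightarrow> mor x y = {nul x y}"
  using Tm_closed[of x y] Tm_eq_nul[of x y] nul_closed[of x y] by blast

lemma T_zero_object:
  assumes "zero_object C z"
  shows "zero_object C (T z)"
proof (rule zero_objectI)
  have z: "z \<in> Obj C" using assms unfolding zero_object_def by blast
  then have "Idt C z = nul z z" using zero_objectD(2)[OF assms, of z] by simp
  then show "Idt C (T z) = nul (T z) (T z)" using z Tm_Idt[of z] by simp
  show "T z \<in> Obj C" using z by simp
qed

lemma desusp_exists: "y \<in> Obj C \<Longrightarrow> \<exists>x \<in> Obj C. isomorphic C (T x) y"
proof -
  assume y: "y \<in> Obj C"
  obtain G where G: "linear_functor K C C G"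
    and n: "naturally_isomorphic C C (fun_comp (Susp C) G) fun_id"
    using susp_equivalence unfolding linear_equivalence_def by blast
  obtain \<eta> where "is_iso C (on_obj (Susp C) (on_obj G y)) y (\<eta> y)"
    using natural_retractionE[OF n] y by metis
  then show ?thesis using linear_functor_obj[OF G y] unfolding isomorphic_def by blast
qed

lemma desusp: "y \<in> Obj C \<Longrightarrow> desusp C y \<in> Obj C \<and> isomorphic C (T (desusp C y)) y"
  unfolding desusp_def by (rule someI_ex) (use desusp_exists in blast)

lemma distD:
  assumes "dist C x y z f g h"
  shows "x \<in> Obj C" "y \<in> Obj C" "z \<in> Obj C" "f \<in> mor x y" "g \<in> mor y z" "h \<in> mor z (T x)"
  using dist_typed[OF assms] by auto

lemma dist_rot:
  "dist C x y z f g h \<Longrightarrow> dist C y z (T x) g h (\<ominus>\<^bsub>Hom C (T x) (T y)\<^esub> Tm x y f)"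
  using dist_rotate[of x y z f g h] distD[of x y z f g h] by simp

lemma dist_unrot:
  assumes "dist C y z (T x) g h k" "x \<in> Obj C"
  shows "\<exists>f. dist C x y z f g h \<and> k = \<ominus>\<^bsub>Hom C (T x) (T y)\<^esub> Tm x y f"
proof -
  note d = distD[OF assms(1)]
  obtain f where f: "f \<in> mor x y" "Tm x y f = k" using Tm_surj[of x y k] d assms by auto
  let ?f = "\<ominus>\<^bsub>Hom C x y\<^esub> f"
  have "k = \<ominus>\<^bsub>Hom C (T x) (T y)\<^esub> Tm x y ?f" using f d assms by (simp add: Tm_neg)
  then show ?thesis using dist_rotate[of x y z ?f g h] f d assms by (auto intro!: exI[of _ ?f])
qed

text \<open>The functors \<open>Hom(w, -)\<close> and \<open>Hom(-, w)\<close> are exact on triangles: the given triangle is compared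
  with a trivial one that consists of \<open>w\<close>, \<open>w\<close> and a zero object. The following lemmas are the
  consequences at the various places of a triangle, with shifts removed.\<close>

lemma dist_zero_first:
  assumes w: "w \<in> Obj C" and o1: "zero_object C o1"
  shows "dist C o1 w w (nul o1 w) (Idt C w) (nul w (T o1))"
proof -
  have "o1 \<in> Obj C" using o1 unfolding zero_object_def by blast
  then show ?thesis
    using dist_rotate[of o1 w w "nul o1 w" "Idt C w" "nul w (T o1)"] w
      dist_identity[OF w T_zero_object[OF o1]] by simp
qed

lemma dist_weak_cokernel:
  assumes d: "dist C x y z f g h" and w: "w \<in> Obj C" and u: "u \<in> mor y w" and 0: "Cmp C x y w u f = nul x w"
  shows "\<exists>v \<in> mor z w. Cmp C y z w v g = u"
proof -
  note D = distD[OF d]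
  obtain o1 where o1: "zero_object C o1" using zero_object_exists by blast
  have O: "o1 \<in> Obj C" using o1 unfolding zero_object_def by blast
  note t = dist_zero_first[OF w o1]
  obtain v where "v \<in> mor z w" "Cmp C y z w v g = Cmp C y w w (Idt C w) u"
    using dist_morphism[OF d t, of "nul x o1" u] D O w u 0 by auto
  then show ?thesis using u w D by auto
qed

lemma dist_weak_kernel:
  assumes d: "dist C x y z f g h" and w: "w \<in> Obj C" and u: "u \<in> mor w y" and 0: "Cmp C w y z g u = nul w z"
  shows "\<exists>v \<in> mor w x. Cmp C w x y f v = u"
proof -
  note D = distD[OF d]
  obtain o1 where o1: "zero_object C o1" using zero_object_exists by blast
  have O: "o1 \<in> Obj C" using o1 unfolding zero_object_def by blast
  have t: "dist C w o1 (T w) (nul w o1) (nul o1 (T w)) (\<ominus>\<^bsub>Hom C (T w) (T w)\<^esub> Idt C (T w))"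
    using dist_rot[OF dist_identity[OF w o1]] w by simp
  obtain c where c: "c \<in> mor (T w) (T x)"
    and e: "Cmp C (T w) (T w) (T y) (Tm w y u) (\<ominus>\<^bsub>Hom C (T w) (T w)\<^esub> Idt C (T w))
        = Cmp C (T w) (T x) (T y) (\<ominus>\<^bsub>Hom C (T x) (T y)\<^esub> Tm x y f) c"
    using dist_morphism[OF t dist_rot[OF d], of u "nul o1 z"] D O w u 0 by auto
  have "\<ominus>\<^bsub>Hom C (T w) (T y)\<^esub> Tm w y u = \<ominus>\<^bsub>Hom C (T w) (T y)\<^esub> Cmp C (T w) (T x) (T y) (Tm x y f) c"
    using e c w D u by (simp add: Cmp_neg_left Cmp_neg_right)
  then have "\<ominus>\<^bsub>Hom C (T w) (T y)\<^esub> (\<ominus>\<^bsub>Hom C (T w) (T y)\<^esub> Tm w y u)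
    = \<ominus>\<^bsub>Hom C (T w) (T y)\<^esub> (\<ominus>\<^bsub>Hom C (T w) (T y)\<^esub> Cmp C (T w) (T x) (T y) (Tm x y f) c)" by (rule arg_cong)
  then have e': "Tm w y u = Cmp C (T w) (T x) (T y) (Tm x y f) c" using c w D u by simp
  obtain v where v: "v \<in> mor w x" "Tm w x v = c" using Tm_surj[of w x c] c w D by auto
  have "Tm w y (Cmp C w x y f v) = Tm w y u" using e' v w D by (simp add: Tm_Cmp)
  then show ?thesis using v w D u Tm_inj[of w y "Cmp C w x y f v" u] by auto
qed

lemma dist_comp_zero:
  assumes d: "dist C x y z f g h"
  shows "Cmp C x y z g f = nul x z"
proof -
  note D = distD[OF d]
  obtain o1 where o1: "zero_object C o1" using zero_object_exists by blast
  have O: "o1 \<in> Obj C" using o1 unfolding zero_object_def by blast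
  obtain c where "c \<in> mor o1 z" "Cmp C x o1 z c (nul x o1) = Cmp C x y z g f"
    using dist_morphism[OF dist_identity[OF D(1) o1] d, of "Idt C x" f] D by auto
  then show ?thesis using D O by auto
qed

lemma dist_comp_zero':
  assumes d: "dist C x y z f g h"
  shows "Cmp C y z (T x) h g = nul y (T x)" "Cmp C z (T x) (T y) (Tm x y f) h = nul z (T y)"
proof -
  note D = distD[OF d]
  show "Cmp C y z (T x) h g = nul y (T x)" by (rule dist_comp_zero[OF dist_rot[OF d]])
  show "Cmp C z (T x) (T y) (Tm x y f) h = nul z (T y)"
    using dist_comp_zero[OF dist_rot[OF dist_rot[OF d]]] D by (simp add: Cmp_neg_left)
qed

lemma dist_lift:
  assumes d: "dist C x y z f g h" and w: "w \<in> Obj C" and u: "u \<in> mor w z" and 0: "Cmp C w z (T x) h u = nul w (T x)"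
  shows "\<exists>v \<in> mor w y. Cmp C w y z g v = u"
  using dist_weak_kernel[OF dist_rot[OF d] w u 0] .

lemma dist_factor_connecting:
  assumes d: "dist C x y z f g h" and w: "w \<in> Obj C" and u: "u \<in> mor z w" and 0: "Cmp C y z w u g = nul y w"
  shows "\<exists>v \<in> mor (T x) w. Cmp C z (T x) w v h = u"
  using dist_weak_cokernel[OF dist_rot[OF d] w u 0] .

lemma dist_mono:
  assumes d: "dist C x y z f g h" and w: "w \<in> Obj C" and u: "u \<in> mor w x" and 0: "Cmp C w x y f u = nul w y"
    and van: "mor (T w) z = {nul (T w) z}"
  shows "u = nul w x"
proof -
  note D = distD[OF d]
  have "Cmp C (T w) (T x) (T y) (Tm x y f) (Tm w x u) = nul (T w) (T y)"
    using 0 D w u Tm_Cmp[of w x y f u] by simp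
  then obtain v where v: "v \<in> mor (T w) z" "Cmp C (T w) z (T x) h v = Tm w x u"
    using dist_weak_kernel[OF dist_rot[OF dist_rot[OF d]], of "T w" "Tm w x u"] D w u
    by (auto simp: Cmp_neg_left)
  then have "Tm w x u = nul (T w) (T x)" using van D w by auto
  then show ?thesis using Tm_eq_nul D w u by blast
qed

lemma dist_extend:
  assumes d: "dist C x y z f g h" and w: "w \<in> Obj C" and u: "u \<in> mor x w"
    and 0: "Cmp C z (T x) (T w) (Tm x w u) h = nul z (T w)"
  shows "\<exists>v \<in> mor y w. Cmp C x y w v f = u"
proof -
  note D = distD[OF d]
  obtain t where t: "t \<in> mor (T y) (T w)"
    and e: "Cmp C (T x) (T y) (T w) t (\<ominus>\<^bsub>Hom C (T x) (T y)\<^esub> Tm x y f) = Tm x w u"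
    using dist_weak_cokernel[OF dist_rot[OF dist_rot[OF d]], of "T w" "Tm x w u"] D w u 0 by auto
  obtain v where v: "v \<in> mor y w" "Tm y w v = t" using Tm_surj[of y w t] t w D by auto
  let ?v = "\<ominus>\<^bsub>Hom C y w\<^esub> v"
  have "Tm x w (Cmp C x y w ?v f) = Tm x w u"
    using e t v D w by (simp add: Tm_Cmp Tm_neg Cmp_neg_left Cmp_neg_right)
  then show ?thesis using v D w u Tm_inj[of x w "Cmp C x y w ?v f" u] by (auto intro!: bexI[of _ ?v])
qed

lemma dist_epi:
  assumes d: "dist C x y z f g h" and w: "w \<in> Obj C" and u: "u \<in> mor z w" and 0: "Cmp C y z w u g = nul y w"
    and van: "mor (T x) w = {nul (T x) w}"
  shows "u = nul z w"
  using dist_factor_connecting[OF d w u 0] van distD[OF d] w by auto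

lemma dist_third_zero:
  assumes d: "dist C x y z f g h" and z: "zero_object C z"
  shows "isomorphic C x y"
proof -
  note D = distD[OF d]
  have "g = nul y z" using zero_objectD[OF z D(2)] D by blast
  then obtain v where v: "v \<in> mor y x" "Cmp C y x y f v = Idt C y"
    using dist_weak_kernel[OF d D(2), of "Idt C y"] D by auto
  have "Cmp C x y x v f \<ominus>\<^bsub>Hom C x x\<^esub> Idt C x = nul x x"
  proof (rule dist_mono[OF d D(1)])
    show "mor (T x) z = {nul (T x) z}" using z D T_obj unfolding zero_object_def by blast
    show "Cmp C x x y f (Cmp C x y x v f \<ominus>\<^bsub>Hom C x x\<^esub> Idt C x) = nul x y"
      using D v Cmp_reassoc[OF v(2), of x f] by (simp add: Cmp_diff_right)
  qed (use D v in simp)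
  then have "Cmp C x y x v f = Idt C x" using D v by simp
  then show ?thesis unfolding isomorphic_def is_iso_def using D v by blast
qed

lemma vanishing_from_middle:
  assumes "short_triangle C x y z" "w \<in> Obj C" "mor x w = {nul x w}" "mor z w = {nul z w}"
  shows "mor y w = {nul y w}"
proof -
  obtain f g h where d: "dist C x y z f g h" using assms unfolding short_triangle_def by blast
  note D = distD[OF d]
  have "u = nul y w" if u: "u \<in> mor y w" for u
  proof -
    have "Cmp C x y w u f \<in> mor x w" using D u assms(2) by simp
    then have "Cmp C x y w u f = nul x w" using assms(3) by blast
    then obtain v where "v \<in> mor z w" "Cmp C y z w v g = u"
      using dist_weak_cokernel[OF d assms(2) u] by blast
    then show ?thesis using assms D by auto
  qed
  then show ?thesis using D assms(2) nul_closed by blast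
qed

lemma vanishing_to_middle:
  assumes "short_triangle C x y z" "w \<in> Obj C" "mor w x = {nul w x}" "mor w z = {nul w z}"
  shows "mor w y = {nul w y}"
proof -
  obtain f g h where d: "dist C x y z f g h" using assms unfolding short_triangle_def by blast
  note D = distD[OF d]
  have "u = nul w y" if u: "u \<in> mor w y" for u
  proof -
    have "Cmp C w y z g u \<in> mor w z" using D u assms(2) by simp
    then have "Cmp C w y z g u = nul w z" using assms(4) by blast
    then obtain v where "v \<in> mor w x" "Cmp C w x y f v = u"
      using dist_weak_kernel[OF d assms(2) u] by blast
    then show ?thesis using assms D by auto
  qed
  then show ?thesis using D assms(2) nul_closed by blast
qed

lemma dist_iso_third:
  assumes d: "dist C x y z f g h" and z': "z' \<in> Obj C" and c: "is_iso C z z' c"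
  shows "\<exists>h'. dist C x y z' f (Cmp C y z z' c g) h'"
proof -
  note D = distD[OF d]
  obtain e where e: "e \<in> mor z' z" "c \<in> mor z z'" "Cmp C z z' z e c = Idt C z"
    by (rule is_iso_inverse[OF c])
  have "dist C x y z' f (Cmp C y z z' c g) (Cmp C z' z (T x) h e)"
    by (rule dist_iso_closed[OF d, of x y z' _ _ _ "Idt C x" "Idt C y" c])
      (use D z' c e in \<open>simp_all add: Cmp_assoc\<close>)
  then show ?thesis by blast
qed

lemma dist_iso_first:
  assumes d: "dist C x y z f g h" and x': "x' \<in> Obj C" and a: "is_iso C x x' a"
  shows "\<exists>f' h'. dist C x' y z f' g h'"
proof -
  note D = distD[OF d]
  obtain e where e: "e \<in> mor x' x" "a \<in> mor x x'" "Cmp C x x' x e a = Idt C x"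
    by (rule is_iso_inverse[OF a])
  have "dist C x' y z (Cmp C x' x y f e) g (Cmp C z (T x) (T x') (Tm x x' a) h)"
    by (rule dist_iso_closed[OF d, of x' y z _ _ _ a "Idt C y" "Idt C z"])
      (use D x' a e in \<open>simp_all add: Cmp_assoc\<close>)
  then show ?thesis by blast
qed

lemma dist_iso_second:
  assumes d: "dist C x y z f g h" and y': "y' \<in> Obj C" and b: "is_iso C y y' b"
  shows "\<exists>g'. dist C x y' z (Cmp C x y y' b f) g' h"
proof -
  note D = distD[OF d]
  obtain e where e: "e \<in> mor y' y" "b \<in> mor y y'" "Cmp C y y' y e b = Idt C y"
    by (rule is_iso_inverse[OF b])
  have "dist C x y' z (Cmp C x y y' b f) (Cmp C y' y z g e) h"
    by (rule dist_iso_closed[OF d, of x y' z _ _ _ "Idt C x" b "Idt C z"])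
      (use D y' b e in \<open>simp_all add: Cmp_assoc\<close>)
  then show ?thesis by blast
qed

text \<open>A cone need not be a suspension on the nose, but it is isomorphic to one.\<close>

lemma fibre_exists:
  assumes "x \<in> Obj C" "y \<in> Obj C" "v \<in> mor x y"
  shows "\<exists>m i h. dist C m x y i v h"
proof -
  obtain c g h where d: "dist C x y c v g h" using dist_complete assms by blast
  note D = distD[OF d]
  obtain m where m: "m \<in> Obj C" "isomorphic C (T m) c" using desusp[OF D(3)] by blast
  then obtain a where a: "is_iso C c (T m) a" using isomorphic_sym[OF m(2)] unfolding isomorphic_def by blast
  obtain g' h' where "dist C x y (T m) v g' h'" using dist_iso_third[OF d _ a] m by auto
  then show ?thesis using dist_unrot m(1) by blast
qed

lemma short_triangleD:
  "short_triangle C x y z \<Longrightarrow> x \<in> Obj C \<and> y \<in> Obj C \<and> z \<in> Obj C"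
  unfolding short_triangle_def using distD by blast

lemma short_triangle_rot: "short_triangle C x y z \<Longrightarrow> short_triangle C y z (T x)"
  unfolding short_triangle_def using dist_rot by blast

lemma short_triangle_unrot: "short_triangle C y z (T x) \<Longrightarrow> x \<in> Obj C \<Longrightarrow> short_triangle C x y z"
  unfolding short_triangle_def using dist_unrot by blast

lemma short_triangle_susp: "short_triangle C x y z \<Longrightarrow> short_triangle C (T x) (T y) (T z)"
  by (blast intro: short_triangle_rot)

lemma short_triangle_iso:
  assumes "short_triangle C x y z" "x' \<in> Obj C" "y' \<in> Obj C" "z' \<in> Obj C"
    "isomorphic C x x'" "isomorphic C y y'" "isomorphic C z z'"
  shows "short_triangle C x' y' z'"
proof -
  obtain f g h where "dist C x y z f g h" using assms(1) unfolding short_triangle_def by blast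
  then obtain f g h where "dist C x' y z f g h"
    using dist_iso_first assms unfolding isomorphic_def by blast
  then obtain f g h where "dist C x' y' z f g h"
    using dist_iso_second assms unfolding isomorphic_def by blast
  then obtain f g h where "dist C x' y' z' f g h"
    using dist_iso_third assms unfolding isomorphic_def by blast
  then show ?thesis unfolding short_triangle_def by blast
qed

text \<open>Two forms of the octahedral axiom: the fibres of \<open>f\<close>, \<open>g \<circ> f\<close> and \<open>g\<close> form a triangle, and
  for a cone of \<open>f\<close> instead of a fibre the triangle is rotated.\<close>

lemma fibres_of_composite:
  assumes f: "dist C k1 x y i1 f h1" and g: "dist C k2 y z i2 g h2"
    and gf: "dist C k x z i (Cmp C x y z g f) h"
  shows "short_triangle C k1 k k2"
proof -
  have "\<exists>r s t. dist C (T k1) (T k) (T k2) r s t"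
    using octahedral[OF dist_rot[OF f] dist_rot[OF g] dist_rot[OF gf]] by blast
  then obtain r s t where 1: "dist C (T k1) (T k) (T k2) r s t" by blast
  have O: "k1 \<in> Obj C" "k \<in> Obj C" "k2 \<in> Obj C" using distD[OF f] distD[OF g] distD[OF gf] by auto
  obtain r' where "dist C k2 (T k1) (T k) r' r s" using dist_unrot[OF 1] O by blast
  then obtain r'' where "dist C k k2 (T k1) r'' r' r" using dist_unrot O by blast
  then show ?thesis unfolding short_triangle_def using dist_unrot O by blast
qed

lemma fibres_of_restriction:
  assumes f: "dist C x' x t a b h1" and g: "dist C m x s i v h2"
    and gf: "dist C k x' s j (Cmp C x' x s v a) h"
  shows "short_triangle C k m t"
proof -
  have "\<exists>r s t'. dist C t (T k) (T m) r s t'"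
    using octahedral[OF f dist_rot[OF g] dist_rot[OF gf]] by blast
  then obtain r s t' where 1: "dist C t (T k) (T m) r s t'" by blast
  have O: "k \<in> Obj C" "m \<in> Obj C" using distD[OF g] distD[OF gf] by auto
  obtain r' where "dist C m t (T k) r' r s" using dist_unrot[OF 1] O by blast
  then show ?thesis unfolding short_triangle_def using dist_unrot O by blast
qed

end


section \<open>The extension closure of orthogonal simple objects\<close>

locale simple_collection = triangulated_category K C
  for K :: "('k, 'r) ring_scheme" and C :: "('k, 'o, 'm, 's) tri_cat_scheme" +
  fixes S :: "'o set"
  assumes S_finite: "finite S"
    and S_obj: "s \<in> S \<Longrightarrow> s \<in> Obj C"
    and S_skew: "s \<in> S \<Longrightarrow> skew_field (End_ring C s)"
    and S_orth: "\<lbrakk>s \<in> S; t \<in> S; s \<noteq> t\<rbrakk> \<Longrightarrow> mor s t = {nul s t}"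
    and S_susp: "\<lbrakk>s \<in> S; t \<in> S\<rbrakk> \<Longrightarrow> mor (T s) t = {nul (T s) t}"
begin

abbreviation E :: "'o set" where "E \<equiv> ext_closure C S"

lemma ext_pow_obj: "x \<in> ext_pow C S n \<Longrightarrow> x \<in> Obj C"
  by (cases n) (auto simp: ext_prod_def zero_object_def)

lemma E_obj [simp]: "x \<in> E \<Longrightarrow> x \<in> Obj C"
  unfolding ext_closure_def using ext_pow_obj by blast

lemma ext_pow_iso:
  assumes "x \<in> ext_pow C S n" "y \<in> Obj C" "isomorphic C x y"
  shows "y \<in> ext_pow C S n"
proof (cases n)
  case 0
  then show ?thesis using assms zero_object_iso by auto
next
  case (Suc m)
  then obtain x' s where *: "x' \<in> ext_pow C S m" "s \<in> S \<union> {z. zero_object C z}" "short_triangle C x' x s"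
    using assms(1) by (auto simp: ext_prod_def)
  then have "short_triangle C x' y s"
    using short_triangle_iso[OF *(3)] short_triangleD[OF *(3)] assms isomorphic_refl by blast
  then show ?thesis using Suc * assms(2) by (auto simp: ext_prod_def)
qed

lemma E_zero: "zero_object C z \<Longrightarrow> z \<in> E"
  unfolding ext_closure_def by (auto intro!: exI[of _ 0])

lemma E_ext_simple: "\<lbrakk>x \<in> E; s \<in> S; short_triangle C x e s\<rbrakk> \<Longrightarrow> e \<in> E"
proof -
  assume *: "x \<in> E" "s \<in> S" "short_triangle C x e s"
  then obtain n where "x \<in> ext_pow C S n" unfolding ext_closure_def by blast
  then have "e \<in> ext_pow C S (Suc n)" using * short_triangleD[of x e s] by (auto simp: ext_prod_def)
  then show "e \<in> E" unfolding ext_closure_def by blast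
qed

lemma S_E: "s \<in> S \<Longrightarrow> s \<in> E"
proof -
  assume s: "s \<in> S"
  obtain o1 where o1: "zero_object C o1" using zero_object_exists by blast
  show ?thesis using E_ext_simple[OF E_zero[OF o1] s] dist_zero_first[OF S_obj[OF s] o1]
    unfolding short_triangle_def by blast
qed

lemma ext_pow_cases:
  "x \<in> ext_pow C S n \<Longrightarrow> zero_object C x \<or>
    (\<exists>m<n. \<exists>x' \<in> ext_pow C S m. \<exists>s \<in> S. \<exists>a b h. dist C x' x s a b h)"
proof (induction n arbitrary: x)
  case 0
  then show ?case by simp
next
  case (Suc n)
  then obtain x' s where *: "x \<in> Obj C" "x' \<in> ext_pow C S n" "s \<in> S \<or> zero_object C s" "short_triangle C x' x s"
    by (auto simp: ext_prod_def)
  show ?case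
  proof (cases "s \<in> S")
    case True
    then show ?thesis using * unfolding short_triangle_def by blast
  next
    case False
    then have i: "isomorphic C x' x" using * dist_third_zero unfolding short_triangle_def by blast
    have x': "x' \<in> Obj C" using *(2) ext_pow_obj by blast
    from Suc.IH[OF *(2)] show ?thesis
    proof
      assume "zero_object C x'"
      then show ?thesis using zero_object_iso i * by blast
    next
      assume "\<exists>m<n. \<exists>x'' \<in> ext_pow C S m. \<exists>s \<in> S. \<exists>a b h. dist C x'' x' s a b h"
      then obtain m x'' s a b h where m: "m < n" "x'' \<in> ext_pow C S m" "s \<in> S" "dist C x'' x' s a b h"
        by blast
      then have "short_triangle C x'' x s"
        using short_triangle_iso[of x'' x' s x'' x s] i * x' distD[OF m(4)] isomorphic_refl
        unfolding short_triangle_def by blast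
      then show ?thesis using m unfolding short_triangle_def by (meson less_SucI)
    qed
  qed
qed

text \<open>The working form of the finite length of the objects of \<open>E\<close>: induction along the filtration
  with subquotients in \<open>S\<close>, in which trivial extensions by zero objects are suppressed.\<close>

lemma E_induct [consumes 1, case_names zero extension]:
  assumes "x \<in> E"
    and zero: "\<And>x. zero_object C x \<Longrightarrow> Q x"
    and ext: "\<And>x' x s a b h. \<lbrakk>x' \<in> E; x \<in> E; Q x'; s \<in> S; dist C x' x s a b h\<rbrakk> \<Longrightarrow> Q x"
  shows "Q x"
proof -
  obtain n where "x \<in> ext_pow C S n" using assms(1) unfolding ext_closure_def by blast
  then show ?thesis
  proof (induction n arbitrary: x rule: less_induct)
    case (less n)
    show ?case
    proof (cases "zero_object C x")
      case False
      then obtain m x' s a b h where m: "m < n" "x' \<in> ext_pow C S m" "s \<in> S" "dist C x' x s a b h"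
        using ext_pow_cases[OF less.prems] by blast
      have "x' \<in> E" "x \<in> E" using m less.prems unfolding ext_closure_def by blast+
      then show ?thesis using ext less.IH m by blast
    qed (rule zero)
  qed
qed

text \<open>By induction on the length of \<open>y\<close>: for \<open>y' \<rightarrow> y \<rightarrow> s\<close> the fibre \<open>m\<close> of the composite from \<open>e\<close>
  to \<open>s\<close> is an extension of \<open>y'\<close> by \<open>x\<close>.\<close>

lemma E_ext:
  assumes "x \<in> E" "y \<in> E" "short_triangle C x e y"
  shows "e \<in> E"
proof -
  have "\<forall>e. short_triangle C x e y \<longrightarrow> e \<in> E"
    using assms(2)
  proof (induction rule: E_induct)
    case (zero y)
    show ?case
    proof (intro allI impI)
      fix e assume e: "short_triangle C x e y"
      then have "isomorphic C x e" using zero dist_third_zero unfolding short_triangle_def by blast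
      then show "e \<in> E" using ext_pow_iso short_triangleD[OF e] assms(1) unfolding ext_closure_def by blast
    qed
  next
    case (extension y' y s a b h)
    show ?case
    proof (intro allI impI)
      fix e assume "short_triangle C x e y"
      then obtain f g k where d: "dist C x e y f g k" unfolding short_triangle_def by blast
      have bg: "Cmp C e y s b g \<in> mor e s" using distD[OF d] distD[OF extension.hyps(4)] by simp
      obtain m i k' where m: "dist C m e s i (Cmp C e y s b g) k'"
        using fibre_exists[OF _ _ bg] distD[OF d] distD[OF extension.hyps(4)] by blast
      have "short_triangle C x m y'" by (rule fibres_of_composite[OF d extension.hyps(4) m])
      then have "m \<in> E" using extension by blast
      then show "e \<in> E" using E_ext_simple[OF _ extension.hyps(3)] m unfolding short_triangle_def by blast
    qed
  qed
  then show ?thesis using assms(3) by blast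
qed

lemma funpow_T_zero: "zero_object C x \<Longrightarrow> zero_object C ((T ^^ n) x)"
  by (induction n) (auto intro: T_zero_object)

lemma funpow_short_triangle: "short_triangle C x y z \<Longrightarrow> short_triangle C ((T ^^ n) x) ((T ^^ n) y) ((T ^^ n) z)"
  by (induction n) (auto intro: short_triangle_susp)

lemma vanishing_from_E:
  assumes "x \<in> E" "z \<in> Obj C" "\<And>s. s \<in> S \<Longrightarrow> mor ((T ^^ n) s) z = {nul ((T ^^ n) s) z}"
  shows "mor ((T ^^ n) x) z = {nul ((T ^^ n) x) z}"
  using assms(1)
proof (induction rule: E_induct)
  case (zero x)
  then show ?case using funpow_T_zero[OF zero, of n] assms(2) unfolding zero_object_def by blast
next
  case (extension x' x s a b h)
  then have "short_triangle C x' x s" unfolding short_triangle_def by blast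
  then show ?case using vanishing_from_middle[OF funpow_short_triangle] assms(2,3) extension by blast
qed

lemma vanishing_to_E:
  assumes "x \<in> E" "z \<in> Obj C" "\<And>s. s \<in> S \<Longrightarrow> mor z ((T ^^ n) s) = {nul z ((T ^^ n) s)}"
  shows "mor z ((T ^^ n) x) = {nul z ((T ^^ n) x)}"
  using assms(1)
proof (induction rule: E_induct)
  case (zero x)
  then show ?case using funpow_T_zero[OF zero, of n] assms(2) unfolding zero_object_def by blast
next
  case (extension x' x s a b h)
  then have "short_triangle C x' x s" unfolding short_triangle_def by blast
  then show ?case using vanishing_to_middle[OF funpow_short_triangle] assms(2,3) extension by blast
qed

lemma E_susp_orth:
  assumes "x \<in> E" "y \<in> E"
  shows "mor (T x) y = {nul (T x) y}"
proof -
  have "mor (T x) t = {nul (T x) t}" if "t \<in> S" for t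
    using vanishing_from_E[OF assms(1), of t 1] S_susp S_obj that by simp
  then show ?thesis using vanishing_to_E[OF assms(2), of "T x" 0] assms(1) by simp
qed

lemma S_Idt_nonzero: "s \<in> S \<Longrightarrow> Idt C s \<noteq> nul s s"
proof
  assume s: "s \<in> S" and 0: "Idt C s = nul s s"
  have r: "ring (End_ring C s)" and u: "Units (End_ring C s) = carrier (End_ring C s) - {\<zero>\<^bsub>End_ring C s\<^esub>}"
    using S_skew[OF s] unfolding skew_field_def by auto
  have "\<one>\<^bsub>End_ring C s\<^esub> \<in> Units (End_ring C s)"
    using r unfolding ring_def by (simp add: monoid.Units_one_closed)
  then show False using u 0 unfolding End_ring_def by simp
qed

lemma S_endo_iso:
  assumes s: "s \<in> S" and v: "v \<in> mor s s" "v \<noteq> nul s s"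
  shows "is_iso C s s v"
proof -
  have "v \<in> Units (End_ring C s)"
    using S_skew[OF s] v unfolding skew_field_def End_ring_def by simp
  then show ?thesis unfolding Units_def is_iso_def End_ring_def by auto
qed

text \<open>Every nonzero morphism from an object of \<open>E\<close> to a simple object behaves like an epimorphism
  of an abelian category: its fibre lies in \<open>E\<close>. Restrict it to the penultimate step of the filtration;
  if the restriction vanishes, the morphism is the last projection up to an automorphism.\<close>

lemma simple_quotient:
  assumes "x \<in> E" "s \<in> S" "v \<in> mor x s" "v \<noteq> nul x s"
  shows "\<exists>k \<in> E. \<exists>i h. dist C k x s i v h"
proof -
  have "\<forall>v \<in> mor x s. v \<noteq> nul x s \<longrightarrow> (\<exists>k \<in> E. \<exists>i h. dist C k x s i v h)"
    using assms(1)
  proof (induction rule: E_induct)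
    case (zero x)
    then show ?case using zero_objectD(2)[OF zero S_obj[OF assms(2)]] by blast
  next
    case (extension x' x t a b h)
    note D = distD[OF extension.hyps(4)]
    have s: "s \<in> Obj C" using S_obj assms(2) .
    show ?case
    proof (intro ballI impI)
      fix v assume v: "v \<in> mor x s" "v \<noteq> nul x s"
      show "\<exists>k \<in> E. \<exists>i h. dist C k x s i v h"
      proof (cases "Cmp C x' x s v a = nul x' s")
        case False
        moreover have "Cmp C x' x s v a \<in> mor x' s" using D v s by simp
        ultimately obtain k i h' where k: "k \<in> E" "dist C k x' s i (Cmp C x' x s v a) h'"
          using extension.IH by blast
        obtain m j h2 where m: "dist C m x s j v h2" using fibre_exists[OF D(2) s v(1)] by blast
        have "m \<in> E"
          using E_ext_simple[OF k(1) extension.hyps(3) fibres_of_restriction[OF extension.hyps(4) m k(2)]] .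
        then show ?thesis using m by blast
      next
        case True
        then obtain g where g: "g \<in> mor t s" "Cmp C x t s g b = v"
          using dist_weak_cokernel[OF extension.hyps(4) s v(1)] by blast
        have g0: "g \<noteq> nul t s" using g v D s by auto
        have [simp]: "t = s" using g0 g(1) S_orth[OF extension.hyps(3) assms(2)] by blast
        have "is_iso C t s g" using S_endo_iso assms(2) g(1) g0 by simp
        then have "\<exists>h'. dist C x' x s a v h'"
          using dist_iso_third[OF extension.hyps(4) s] g(2) by blast
        then show ?thesis using extension.hyps(1) by blast
      qed
    qed
  qed
  then show ?thesis using assms by blast
qed

text \<open>Otherwise the filtration of \<open>x\<close> shows that every map from \<open>x\<close> to \<open>x\<close> is zero.\<close>

lemma nonzero_has_simple_quotient:
  assumes "x \<in> E" "\<not> zero_object C x"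
  shows "\<exists>s \<in> S. \<exists>v \<in> mor x s. v \<noteq> nul x s"
proof (rule ccontr)
  assume "\<not> ?thesis"
  then have "mor x s = {nul x s}" if "s \<in> S" for s
    using that nul_closed S_obj assms(1) E_obj by blast
  then have "mor x x = {nul x x}" using vanishing_to_E[OF assms(1), of x 0] assms(1) by simp
  then have "Idt C x = nul x x" using Idt_closed[of x] assms(1) by auto
  then show False using assms zero_objectI by simp
qed

end


section \<open>A projective generator\<close>

context triangulated_category
begin

lemma vanishing_iso:
  assumes "x \<in> Obj C" "x' \<in> Obj C" "y \<in> Obj C" "y' \<in> Obj C"
    and "isomorphic C x x'" "isomorphic C y y'" "mor x y = {nul x y}"
  shows "mor x' y' = {nul x' y'}"
proof -
  obtain a where "is_iso C x x' a" using assms unfolding isomorphic_def by blast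
  then obtain e where a: "e \<in> mor x' x" "a \<in> mor x x'" "Cmp C x' x x' a e = Idt C x'"
    by (rule is_iso_inverse)
  obtain b where "is_iso C y y' b" using assms unfolding isomorphic_def by blast
  then obtain d where b: "d \<in> mor y' y" "b \<in> mor y y'" "Cmp C y' y y' b d = Idt C y'"
    by (rule is_iso_inverse)
  have "f = nul x' y'" if f: "f \<in> mor x' y'" for f
  proof -
    let ?f = "Cmp C x y' y d (Cmp C x x' y' f a)"
    have "?f \<in> mor x y" using f a b assms(1-4) by simp
    then have "?f = nul x y" using assms(7) by blast
    then have "Cmp C x y y' b ?f = nul x y'" using assms b by simp
    then have "Cmp C x x' y' f a = nul x y'"
      using Cmp_reassoc[OF b(3), of x "Cmp C x x' y' f a"] f a b assms by simp
    then have "Cmp C x' x y' (Cmp C x x' y' f a) e = nul x' y'" using assms a by simp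
    then show ?thesis using f a assms by (simp add: Cmp_assoc)
  qed
  then show ?thesis using nul_closed assms by blast
qed

lemma funpow_susp_obj [simp]: "x \<in> Obj C \<Longrightarrow> (T ^^ n) x \<in> Obj C"
  by (induction n) auto

lemma funpow_desusp_obj [simp]: "x \<in> Obj C \<Longrightarrow> (desusp C ^^ n) x \<in> Obj C"
  by (induction n) (auto simp: desusp)

lemma susp_isomorphic: "\<lbrakk>x \<in> Obj C; y \<in> Obj C; isomorphic C x y\<rbrakk> \<Longrightarrow> isomorphic C (T x) (T y)"
  unfolding isomorphic_def using Tm_iso by blast

lemma funpow_susp_isomorphic:
  "\<lbrakk>x \<in> Obj C; y \<in> Obj C; isomorphic C x y\<rbrakk> \<Longrightarrow> isomorphic C ((T ^^ n) x) ((T ^^ n) y)"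
  by (induction n) (auto intro: susp_isomorphic)

lemma funpow_susp_desusp:
  "y \<in> Obj C \<Longrightarrow> isomorphic C ((T ^^ n) ((desusp C ^^ n) y)) y"
proof (induction n)
  case 0
  then show ?case by (simp add: isomorphic_refl)
next
  case (Suc n)
  let ?d = "(desusp C ^^ n) y"
  have d: "?d \<in> Obj C" "desusp C ?d \<in> Obj C" "isomorphic C (T (desusp C ?d)) ?d"
    using Suc.prems desusp[of ?d] by auto
  have "isomorphic C ((T ^^ n) (T (desusp C ?d))) ((T ^^ n) ?d)"
    using funpow_susp_isomorphic d by simp
  then have "isomorphic C ((T ^^ n) (T (desusp C ?d))) y"
    using isomorphic_trans[of _ "(T ^^ n) ?d" y] Suc d by simp
  then show ?case by (simp add: funpow_swap1)
qed

lemma vanishing_susp: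
  assumes "x \<in> Obj C" "y \<in> Obj C"
  shows "mor (T x) (T y) = {nul (T x) (T y)} \<longleftrightarrow> mor x y = {nul x y}"
proof
  assume "mor x y = {nul x y}"
  then show "mor (T x) (T y) = {nul (T x) (T y)}"
    using bij_betw_imp_surj_on[OF Tm_bij[OF assms]] assms by simp
qed (rule Tm_reflects_zero_mor[OF assms])

lemma vanishing_desusp:
  "\<lbrakk>x \<in> Obj C; y \<in> Obj C\<rbrakk> \<Longrightarrow>
    mor x ((desusp C ^^ n) y) = {nul x ((desusp C ^^ n) y)} \<longleftrightarrow> mor ((T ^^ n) x) y = {nul ((T ^^ n) x) y}"
proof (induction n arbitrary: x)
  case (Suc n)
  let ?d = "(desusp C ^^ n) y"
  have d: "?d \<in> Obj C" "desusp C ?d \<in> Obj C" "isomorphic C (T (desusp C ?d)) ?d"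
    using Suc.prems desusp[of ?d] by auto
  have "mor x (desusp C ?d) = {nul x (desusp C ?d)} \<longleftrightarrow> mor (T x) (T (desusp C ?d)) = {nul (T x) (T (desusp C ?d))}"
    using vanishing_susp Suc.prems d by blast
  also have "\<dots> \<longleftrightarrow> mor (T x) ?d = {nul (T x) ?d}"
  proof
    have x: "T x \<in> Obj C" "isomorphic C (T x) (T x)" using Suc.prems isomorphic_refl by simp_all
    show "mor (T x) (T (desusp C ?d)) = {nul (T x) (T (desusp C ?d))} \<Longrightarrow> mor (T x) ?d = {nul (T x) ?d}"
      by (rule vanishing_iso[OF x(1) x(1) T_obj[OF d(2)] d(1) x(2) d(3)])
    show "mor (T x) ?d = {nul (T x) ?d} \<Longrightarrow> mor (T x) (T (desusp C ?d)) = {nul (T x) (T (desusp C ?d))}"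
      by (rule vanishing_iso[OF x(1) x(1) d(1) T_obj[OF d(2)] x(2) isomorphic_sym[OF d(3)]])
  qed
  also have "\<dots> \<longleftrightarrow> mor ((T ^^ n) (T x)) y = {nul ((T ^^ n) (T x)) y}"
    using Suc.IH[of "T x"] Suc.prems by simp
  finally show ?case by (simp add: funpow_swap1)
qed simp

lemma shift_neg: "shift C (- int n) x = (desusp C ^^ n) x"
  by (auto simp: shift_def)

lemma vanishing_from_neg_shift_prod:
  assumes "d \<in> neg_shift_prod C U n" "U \<subseteq> Obj C" "y \<in> Obj C"
    and "\<And>j u. \<lbrakk>j \<le> n; u \<in> U\<rbrakk> \<Longrightarrow> mor ((desusp C ^^ j) u) y = {nul ((desusp C ^^ j) u) y}"
  shows "mor d y = {nul d y}"
  using assms(1,4)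
proof (induction n arbitrary: d)
  case 0
  then show ?case by (metis funpow_0 le_refl neg_shift_prod.simps(1))
next
  case (Suc n)
  obtain x u where *: "x \<in> neg_shift_prod C U n" "u \<in> U" "short_triangle C x d (shift C (- int (Suc n)) u)"
    using Suc.prems(1) by (auto simp: ext_prod_def)
  have "mor x y = {nul x y}" by (rule Suc.IH[OF *(1)]) (use Suc.prems(2) in simp)
  moreover have "mor ((desusp C ^^ Suc n) u) y = {nul ((desusp C ^^ Suc n) u) y}"
    by (rule Suc.prems(2)) (use * in simp_all)
  ultimately show ?case
    using vanishing_from_middle[OF *(3) assms(3)] unfolding shift_neg by blast
qed

lemma triangle_with_connecting:
  assumes "y \<in> Obj C" "x \<in> Obj C" "h \<in> mor y (T x)"
  shows "\<exists>z a b. dist C x z y a b h"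
proof -
  obtain c g k where d: "dist C y (T x) c h g k"
    using dist_complete[of y "T x" h] assms by auto
  note D = distD[OF d]
  obtain z where z: "z \<in> Obj C" "isomorphic C (T z) c" using desusp[OF D(3)] by blast
  then obtain e where e: "is_iso C c (T z) e" using isomorphic_sym[OF z(2)] unfolding isomorphic_def by blast
  obtain g' k' where "dist C y (T x) (T z) h g' k'"
    using dist_iso_third[OF d _ e] z by auto
  then obtain q where "dist C z y (T x) q h g'" using dist_unrot z by blast
  then show ?thesis using dist_unrot assms by blast
qed

text \<open>A map between triangles may also be completed at the middle objects. If the third objects agree
  and the connecting map is pushed out along \<open>u\<close>, the third component can be taken to be the identity.\<close>

lemma dist_morphism_middle:
  assumes d: "dist C x y z f g h" and d': "dist C x' y' z f' g' (Cmp C z (T x) (T x') (Tm x x' u) h)"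
    and u: "u \<in> mor x x'"
  shows "\<exists>v \<in> mor y y'. Cmp C x y y' v f = Cmp C x x' y' f' u \<and> Cmp C y y' z g' v = g"
proof -
  note D = distD[OF d] and D' = distD[OF d']
  obtain t where t: "t \<in> mor (T y) (T y')"
    and 1: "Cmp C (T x) (T x') (T y') (\<ominus>\<^bsub>Hom C (T x') (T y')\<^esub> Tm x' y' f') (Tm x x' u)
      = Cmp C (T x) (T y) (T y') t (\<ominus>\<^bsub>Hom C (T x) (T y)\<^esub> Tm x y f)"
    and 2: "Cmp C (T y) (T z) (T z) (Tm z z (Idt C z)) (\<ominus>\<^bsub>Hom C (T y) (T z)\<^esub> Tm y z g)
      = Cmp C (T y) (T y') (T z) (\<ominus>\<^bsub>Hom C (T y') (T z)\<^esub> Tm y' z g') t"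
    using dist_morphism[OF dist_rot[OF dist_rot[OF d]] dist_rot[OF dist_rot[OF d']], of "Idt C z" "Tm x x' u"]
      D D' u by auto
  obtain v where v: "v \<in> mor y y'" "Tm y y' v = t" using Tm_surj[of y y' t] t D D' by auto
  have "\<ominus>\<^bsub>Hom C (T x) (T y')\<^esub> Tm x y' (Cmp C x y y' v f)
      = \<ominus>\<^bsub>Hom C (T x) (T y')\<^esub> Tm x y' (Cmp C x x' y' f' u)"
    using 1 v t D D' u by (simp add: Tm_Cmp Cmp_neg_left Cmp_neg_right)
  then have "Tm x y' (\<ominus>\<^bsub>Hom C x y'\<^esub> Cmp C x y y' v f) = Tm x y' (\<ominus>\<^bsub>Hom C x y'\<^esub> Cmp C x x' y' f' u)"
    using v u D D' by (simp add: Tm_neg)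
  then have "\<ominus>\<^bsub>Hom C x y'\<^esub> Cmp C x y y' v f = \<ominus>\<^bsub>Hom C x y'\<^esub> Cmp C x x' y' f' u"
    using Tm_inj v u D D' by simp
  then have "\<ominus>\<^bsub>Hom C x y'\<^esub> (\<ominus>\<^bsub>Hom C x y'\<^esub> Cmp C x y y' v f)
    = \<ominus>\<^bsub>Hom C x y'\<^esub> (\<ominus>\<^bsub>Hom C x y'\<^esub> Cmp C x x' y' f' u)" by (rule arg_cong)
  then have A: "Cmp C x y y' v f = Cmp C x x' y' f' u" using v u D D' by simp
  have "Tm y z (\<ominus>\<^bsub>Hom C y z\<^esub> g) = Tm y z (\<ominus>\<^bsub>Hom C y z\<^esub> Cmp C y y' z g' v)"
    using 2 v t D D' by (simp add: Tm_Cmp Tm_neg Cmp_neg_left Cmp_neg_right)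
  then have "\<ominus>\<^bsub>Hom C y z\<^esub> g = \<ominus>\<^bsub>Hom C y z\<^esub> Cmp C y y' z g' v" using Tm_inj v D D' by simp
  then have "\<ominus>\<^bsub>Hom C y z\<^esub> (\<ominus>\<^bsub>Hom C y z\<^esub> g) = \<ominus>\<^bsub>Hom C y z\<^esub> (\<ominus>\<^bsub>Hom C y z\<^esub> Cmp C y y' z g' v)"
    by (rule arg_cong)
  then have "Cmp C y y' z g' v = g" using v D D' by simp
  then show ?thesis using A v by blast
qed

end

locale simple_minded = simple_collection K C S
  for K :: "('k, 'r) ring_scheme" and C :: "('k, 'o, 'm, 's) tri_cat_scheme" and S :: "'o set" +
  fixes w :: nat
  assumes w_ge_2: "w \<ge> 2"
    and S_susp_orth: "\<lbrakk>s \<in> S; t \<in> S; 1 \<le> l; l < w\<rbrakk> \<Longrightarrow> mor ((T ^^ l) s) t = {nul ((T ^^ l) s) t}"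
    and generation: "Obj C = neg_shift_prod C (ext_closure C S) (w - 1)"

lemma simple_minded_systemD:
  assumes "triangulated_category K C" "w \<ge> 2" "simple_minded_system C w S"
  shows "simple_minded K C S w"
proof -
  interpret triangulated_category K C by (fact assms)
  have o: "orthogonal_collection C w S" and g: "Obj C = neg_shift_prod C (ext_closure C S) (w - 1)"
    using assms(3) unfolding simple_minded_system_def by auto
  have obj: "s \<in> S \<Longrightarrow> s \<in> Obj C" for s using o unfolding orthogonal_collection_def by blast
  have orth: "mor ((T ^^ l) s) t = {nul ((T ^^ l) s) t}" if "s \<in> S" "t \<in> S" "1 \<le> l" "l < w" for s t l
  proof -
    have "- int l \<in> {- int w + 1 .. -1}" using that by auto
    then have "mor s (shift C (- int l) t) = {nul s (shift C (- int l) t)}"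
      using o that unfolding orthogonal_collection_def by blast
    then show ?thesis using vanishing_desusp[OF obj obj, of s t l] that unfolding shift_neg by simp
  qed
  show ?thesis
  proof unfold_locales
    show "finite S" using o unfolding orthogonal_collection_def by blast
    show "s \<in> S \<Longrightarrow> s \<in> Obj C" for s by (rule obj)
    show "s \<in> S \<Longrightarrow> skew_field (End_ring C s)" for s using o unfolding orthogonal_collection_def by blast
    show "\<lbrakk>s \<in> S; t \<in> S; s \<noteq> t\<rbrakk> \<Longrightarrow> mor s t = {nul s t}" for s t
      using o unfolding orthogonal_collection_def by blast
    show "\<lbrakk>s \<in> S; t \<in> S\<rbrakk> \<Longrightarrow> mor (T s) t = {nul (T s) t}" for s t
      using orth[of s t 1] assms(2) by simp
  qed (use assms(2) orth g in auto)
qed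

context simple_minded
begin

lemma E_funpow_orth:
  assumes "x \<in> E" "y \<in> E" "1 \<le> l" "l < w"
  shows "mor ((T ^^ l) x) y = {nul ((T ^^ l) x) y}"
proof -
  have "mor ((T ^^ l) x) t = {nul ((T ^^ l) x) t}" if "t \<in> S" for t
    using vanishing_from_E[OF assms(1), of t l] S_susp_orth S_obj that assms by simp
  then show ?thesis using vanishing_to_E[OF assms(2), of "(T ^^ l) x" 0] assms(1) by simp
qed

text \<open>Apply \<open>\<Sigma>\<^sup>w\<close> to the last of the triangles that build \<open>\<Sigma>\<^sup>-\<^sup>w s\<close> from negative shifts
  of \<open>E\<close>. This gives a triangle \<open>d \<rightarrow> s \<rightarrow> \<Sigma>e\<close> with \<open>e\<close> in \<open>E\<close> such that there are no nonzero
  morphisms from \<open>d\<close> to \<open>\<Sigma>E\<close>. Now \<open>e \<rightarrow> d \<rightarrow> s\<close> shows that \<open>d\<close> itself is in \<open>E\<close>.\<close>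

lemma projective_presentation:
  assumes s: "s \<in> S"
  shows "\<exists>e \<in> E. \<exists>d \<in> E. short_triangle C e d s \<and> (\<forall>y \<in> E. mor d (T y) = {nul d (T y)})"
proof -
  obtain n where n: "w = Suc (Suc n)" using w_ge_2 by (metis Suc_le_D numeral_2_eq_2 Suc_le_mono)
  let ?c = "(desusp C ^^ w) s"
  have sO: "s \<in> Obj C" using S_obj s .
  have "?c \<in> neg_shift_prod C E (Suc n)" using generation n sO funpow_desusp_obj[of s w] by simp
  then obtain d' e where *: "d' \<in> neg_shift_prod C E n" "e \<in> E"
    "short_triangle C d' ?c (shift C (- int (Suc n)) e)"
    by (auto simp: ext_prod_def)
  have d': "d' \<in> Obj C" using short_triangleD[OF *(3)] by blast
  let ?d = "(T ^^ w) d'"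
  have eO: "e \<in> Obj C" using * by simp
  have "short_triangle C ?d ((T ^^ w) ?c) ((T ^^ w) ((desusp C ^^ Suc n) e))"
    using funpow_short_triangle[OF *(3), of w] unfolding shift_neg .
  moreover have "isomorphic C ((T ^^ w) ?c) s" by (rule funpow_susp_desusp[OF sO])
  moreover have "isomorphic C ((T ^^ w) ((desusp C ^^ Suc n) e)) (T e)"
  proof -
    have "isomorphic C (T ((T ^^ Suc n) ((desusp C ^^ Suc n) e))) (T e)"
      by (rule susp_isomorphic[OF _ _ funpow_susp_desusp[OF eO]])
        (use eO funpow_susp_obj[OF funpow_desusp_obj[OF eO]] in blast)+
    then show ?thesis by (simp add: n)
  qed
  ultimately have "short_triangle C ?d s (T e)"
    using short_triangle_iso[of ?d "(T ^^ w) ?c" "(T ^^ w) ((desusp C ^^ Suc n) e)" ?d s "T e"]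
      d' sO eO isomorphic_refl[of ?d] funpow_susp_obj[OF d', of w] by simp
  then have t: "short_triangle C e ?d s" using short_triangle_unrot eO by blast
  have "mor ?d (T y) = {nul ?d (T y)}" if y: "y \<in> E" for y
  proof -
    have "mor d' ((desusp C ^^ Suc n) y) = {nul d' ((desusp C ^^ Suc n) y)}"
    proof (rule vanishing_from_neg_shift_prod[OF *(1)])
      fix j u assume j: "j \<le> n" and u: "u \<in> E"
      let ?u = "(desusp C ^^ j) u"
      have uO: "u \<in> Obj C" "?u \<in> Obj C" using u by simp_all
      have "mor ((T ^^ (Suc n - j)) u) y = {nul ((T ^^ (Suc n - j)) u) y}"
        using E_funpow_orth[OF u y, of "Suc n - j"] j n by simp
      moreover have "isomorphic C ((T ^^ (Suc n - j)) u) ((T ^^ (Suc n - j)) ((T ^^ j) ?u))"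
        using funpow_susp_isomorphic[OF _ _ isomorphic_sym[OF funpow_susp_desusp[OF uO(1)]]] uO by simp
      moreover have "(T ^^ (Suc n - j)) ((T ^^ j) ?u) = (T ^^ Suc n) ?u"
        using funpow_add[of "Suc n - j" j T] j by simp
      ultimately have "mor ((T ^^ Suc n) ?u) y = {nul ((T ^^ Suc n) ?u) y}"
        using vanishing_iso[of "(T ^^ (Suc n - j)) u" "(T ^^ Suc n) ?u" y y]
          isomorphic_refl[of y] y uO funpow_susp_obj[OF uO(2), of "Suc n"] funpow_susp_obj[OF uO(1), of "Suc n - j"]
        by simp
      then show "mor ?u ((desusp C ^^ Suc n) y) = {nul ?u ((desusp C ^^ Suc n) y)}"
        using vanishing_desusp[OF uO(2), of y "Suc n"] y by simp
    qed (use y funpow_desusp_obj[of y "Suc n"] in auto)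
    then have v: "mor ((T ^^ Suc n) d') y = {nul ((T ^^ Suc n) d') y}"
      using vanishing_desusp[OF d', of y "Suc n"] y by simp
    have "?d = T ((T ^^ Suc n) d')" by (simp add: n)
    then show ?thesis using vanishing_susp[of "(T ^^ Suc n) d'" y] v y funpow_susp_obj[OF d', of "Suc n"] by simp
  qed
  then show ?thesis using t *(2) E_ext_simple[OF *(2) s t] by blast
qed

text \<open>The projective objects that belong to the elements of \<open>S\<close> are added one by one by means of
  triangles with zero connecting map.\<close>

lemma projective_generator_exists:
  "\<exists>P \<in> E. (\<forall>y \<in> E. mor P (T y) = {nul P (T y)}) \<and> (\<forall>s \<in> S. \<exists>v \<in> mor P s. v \<noteq> nul P s)"
proof -
  have "\<exists>P \<in> E. (\<forall>y \<in> E. mor P (T y) = {nul P (T y)}) \<and> (\<forall>s \<in> S0. \<exists>v \<in> mor P s. v \<noteq> nul P s)"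
    if "finite S0" "S0 \<subseteq> S" for S0
    using that
  proof (induction S0 rule: finite_induct)
    case empty
    obtain o1 where o1: "zero_object C o1" using zero_object_exists by blast
    have "mor o1 (T y) = {nul o1 (T y)}" if "y \<in> E" for y
      using o1 that T_obj[of y] unfolding zero_object_def by simp
    then show ?case using E_zero[OF o1] by blast
  next
    case (insert s S0)
    obtain P where P: "P \<in> E" "\<And>y. y \<in> E \<Longrightarrow> mor P (T y) = {nul P (T y)}"
      "\<And>t. t \<in> S0 \<Longrightarrow> \<exists>v \<in> mor P t. v \<noteq> nul P t"
      using insert by blast
    have s: "s \<in> S" using insert by simp
    obtain e d where ed: "e \<in> E" "d \<in> E" "short_triangle C e d s"
      "\<And>y. y \<in> E \<Longrightarrow> mor d (T y) = {nul d (T y)}"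
      using projective_presentation[OF s] by blast
    obtain f g h where d: "dist C e d s f g h" using ed(3) unfolding short_triangle_def by blast
    note D = distD[OF d]
    have g0: "g \<noteq> nul d s"
    proof
      assume "g = nul d s"
      then have "Idt C s = nul s s"
        using dist_epi[OF d D(3), of "Idt C s"] E_susp_orth[OF ed(1) S_E[OF s]] D by simp
      then show False using S_Idt_nonzero[OF s] by blast
    qed
    obtain Q a b where q: "dist C P Q d a b (nul d (T P))"
      using triangle_with_connecting[of d P "nul d (T P)"] P(1) ed(2) by auto
    note DQ = distD[OF q]
    obtain \<sigma> where \<sigma>: "\<sigma> \<in> mor d Q" "Cmp C d Q d b \<sigma> = Idt C d"
      using dist_lift[OF q DQ(3), of "Idt C d"] DQ by auto
    have "Q \<in> E" using E_ext[OF P(1) ed(2)] q unfolding short_triangle_def by blast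
    moreover have "mor Q (T y) = {nul Q (T y)}" if "y \<in> E" for y
      using vanishing_from_middle[of P Q d "T y"] q P(2) ed(4) that unfolding short_triangle_def by auto
    moreover have "\<exists>v \<in> mor Q t. v \<noteq> nul Q t" if t: "t \<in> insert s S0" for t
    proof (cases "t = s")
      case True
      have "Cmp C Q d s g b \<noteq> nul Q s"
      proof
        assume "Cmp C Q d s g b = nul Q s"
        then have "Cmp C d Q s (Cmp C Q d s g b) \<sigma> = nul d s" using DQ D \<sigma> by simp
        then show False using g0 DQ D \<sigma> by (simp add: Cmp_assoc)
      qed
      then show ?thesis using True DQ D by (auto intro!: bexI[of _ "Cmp C Q d s g b"])
    next
      case False
      then obtain v where v: "v \<in> mor P t" "v \<noteq> nul P t" using t P(3) by blast
      have tO: "t \<in> Obj C" using t insert.prems S_obj by blast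
      obtain u where "u \<in> mor Q t" "Cmp C P Q t u a = v"
        using dist_extend[OF q tO v(1)] DQ v tO by auto
      then show ?thesis using v DQ tO by (auto intro!: bexI[of _ u])
    qed
    ultimately show ?case by blast
  qed
  then show ?thesis using S_finite by blast
qed

end


section \<open>The functor represented by a projective generator\<close>

locale projective_generator = simple_collection K C S
  for K :: "('k, 'r) ring_scheme" and C :: "('k, 'o, 'm, 's) tri_cat_scheme" and S :: "'o set" +
  fixes P :: "'o"
  assumes P_E: "P \<in> ext_closure C S"
    and P_projective: "y \<in> ext_closure C S \<Longrightarrow> mor P (T y) = {nul P (T y)}"
    and P_generates: "s \<in> S \<Longrightarrow> \<exists>v \<in> mor P s. v \<noteq> nul P s"
begin

lemma P_obj [simp]: "P \<in> Obj C"
  using P_E by simp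

lemma projective_lift:
  assumes d: "dist C x y z f g h" and x: "x \<in> E" and u: "u \<in> mor P z"
  shows "\<exists>v \<in> mor P y. Cmp C P y z g v = u"
proof -
  note D = distD[OF d]
  have "Cmp C P z (T x) h u \<in> mor P (T x)" using D u by simp
  then have "Cmp C P z (T x) h u = nul P (T x)" using P_projective[OF x] by blast
  then show ?thesis using dist_lift[OF d P_obj u] by blast
qed

text \<open>In \<open>E\<close> the maps of a triangle are monomorphisms and epimorphisms because \<open>Hom(\<Sigma>E, E) = 0\<close>.\<close>

lemma E_dist_mono:
  assumes d: "dist C x y z f g h" and z: "z \<in> E" and v: "v \<in> E" and u: "u \<in> mor v x"
    and 0: "Cmp C v x y f u = nul v y"
  shows "u = nul v x"
  using dist_mono[OF d _ u 0] E_susp_orth[OF v z] v by simp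

lemma E_dist_epi:
  assumes d: "dist C x y z f g h" and x: "x \<in> E" and w: "w \<in> E" and u: "u \<in> mor z w"
    and 0: "Cmp C y z w u g = nul y w"
  shows "u = nul z w"
  using dist_epi[OF d _ u 0] E_susp_orth[OF x w] w by simp

lemma simple_lift:
  assumes x: "x \<in> E" and s: "s \<in> S" and v: "v \<in> mor x s" "v \<noteq> nul x s" and u: "u \<in> mor P s"
  shows "\<exists>e \<in> mor P x. Cmp C P x s v e = u"
proof -
  obtain k i h where "k \<in> E" "dist C k x s i v h" using simple_quotient[OF x s v] by blast
  then show ?thesis using projective_lift u by blast
qed

text \<open>By induction on the length of \<open>x\<close>: for \<open>x' \<rightarrow> x \<rightarrow> s\<close> the map \<open>f\<close> vanishes on \<open>x'\<close>, so it factors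
  through \<open>s\<close>, and it vanishes there because every nonzero map from \<open>P\<close> to \<open>s\<close> is an epimorphism that
  lifts to \<open>x\<close>.\<close>

lemma represented_faithful:
  assumes "x \<in> E" "y \<in> E" "f \<in> mor x y" "\<And>u. u \<in> mor P x \<Longrightarrow> Cmp C P x y f u = nul P y"
  shows "f = nul x y"
proof -
  have "\<forall>f \<in> mor x y. (\<forall>u \<in> mor P x. Cmp C P x y f u = nul P y) \<longrightarrow> f = nul x y"
    using assms(1)
  proof (induction rule: E_induct)
    case (zero x)
    then show ?case using zero_objectD(2)[OF zero] assms(2) by simp
  next
    case (extension x' x s a b h)
    note d = extension.hyps(4)
    note D = distD[OF d]
    have y: "y \<in> Obj C" using assms(2) by simp
    show ?case
    proof (intro ballI impI)
      fix f assume f: "f \<in> mor x y" and 0: "\<forall>u \<in> mor P x. Cmp C P x y f u = nul P y"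
      have "Cmp C P x' y (Cmp C x' x y f a) u = nul P y" if "u \<in> mor P x'" for u
        using 0 that D y f by (simp add: Cmp_assoc)
      then have "Cmp C x' x y f a = nul x' y" using extension.IH D y f by simp
      then obtain g where g: "g \<in> mor s y" "Cmp C x s y g b = f"
        using dist_weak_cokernel[OF d y f] by blast
      obtain v where v: "v \<in> mor P s" "v \<noteq> nul P s" using P_generates[OF extension.hyps(3)] by blast
      obtain p where p: "p \<in> mor P x" "Cmp C P x s b p = v"
        using projective_lift[OF d extension.hyps(1) v(1)] by blast
      have "Cmp C P s y g v = nul P y"
        using 0 p g D y Cmp_assoc[of P x s y g b p] by simp
      moreover obtain k i h' where k: "k \<in> E" "dist C k P s i v h'"
        using simple_quotient[OF P_E extension.hyps(3) v] by blast
      ultimately have "g = nul s y" using E_dist_epi[OF k(2,1) assms(2) g(1)] by blast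
      then show "f = nul x y" using g D y by auto
    qed
  qed
  then show ?thesis using assms by blast
qed

lemma represented_eqI:
  assumes "x \<in> E" "y \<in> E" "f \<in> mor x y" "g \<in> mor x y"
    and "\<And>u. u \<in> mor P x \<Longrightarrow> Cmp C P x y f u = Cmp C P x y g u"
  shows "f = g"
proof -
  have "f \<ominus>\<^bsub>Hom C x y\<^esub> g = nul x y"
    by (rule represented_faithful) (use assms in \<open>simp_all add: Cmp_diff_left\<close>)
  then show ?thesis using assms by simp
qed

text \<open>The homomorphisms and submodules of the right \<open>End(P)\<close>-modules \<open>Hom(P, x)\<close> are expressed by predicates
  on morphisms, so that this part does not depend on how the modules are encoded.\<close>

definition end_linear :: "'o \<Rightarrow> 'o \<Rightarrow> ('m \<Rightarrow> 'm) \<Rightarrow> bool" where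
  "end_linear x y \<theta> \<longleftrightarrow> (\<forall>u \<in> mor P x. \<theta> u \<in> mor P y) \<and>
     (\<forall>u \<in> mor P x. \<forall>v \<in> mor P x. \<theta> (u \<oplus>\<^bsub>Hom C P x\<^esub> v) = \<theta> u \<oplus>\<^bsub>Hom C P y\<^esub> \<theta> v) \<and>
     (\<forall>u \<in> mor P x. \<forall>e \<in> mor P P. \<theta> (Cmp C P P x u e) = Cmp C P P y (\<theta> u) e)"

lemma end_linear_nul:
  assumes "end_linear x y \<theta>" "x \<in> Obj C" "y \<in> Obj C"
  shows "\<theta> (nul P x) = nul P y"
proof -
  have "nul P x \<in> mor P x" "nul P P \<in> mor P P" using assms by simp_all
  then have "\<theta> (Cmp C P P x (nul P x) (nul P P)) = Cmp C P P y (\<theta> (nul P x)) (nul P P)"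
    and "\<theta> (nul P x) \<in> mor P y"
    using assms(1) unfolding end_linear_def by blast+
  then show ?thesis using assms by simp
qed

text \<open>Fullness, by induction on the length of \<open>x\<close>. For \<open>x' \<rightarrow> x \<rightarrow> s\<close> the restriction of \<open>\<theta>\<close> to
  \<open>x'\<close> comes from some \<open>f'\<close>. A lift \<open>p\<close> of an epimorphism \<open>\<pi>\<close> from \<open>P\<close> to \<open>s\<close> compares the given
  triangle with \<open>k \<rightarrow> P \<rightarrow> s\<close>, and \<open>\<theta>(p)\<close> then shows that the obstruction to extending \<open>f'\<close> to \<open>x\<close>
  vanishes. What is left of \<open>\<theta>\<close> factors through \<open>s\<close> and is determined by its value at \<open>p\<close>.\<close>

lemma represented_full:
  assumes "x \<in> E" "y \<in> E" "end_linear x y \<theta>"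
  shows "\<exists>f \<in> mor x y. \<forall>u \<in> mor P x. \<theta> u = Cmp C P x y f u"
proof -
  have y: "y \<in> Obj C" using assms(2) by simp
  have "\<forall>\<theta>. end_linear x y \<theta> \<longrightarrow> (\<exists>f \<in> mor x y. \<forall>u \<in> mor P x. \<theta> u = Cmp C P x y f u)"
    using assms(1)
  proof (induction rule: E_induct)
    case (zero x)
    have x: "x \<in> Obj C" using zero unfolding zero_object_def by blast
    show ?case
    proof (intro allI impI)
      fix \<theta> assume \<theta>: "end_linear x y \<theta>"
      have only: "mor P x = {nul P x}" using zero unfolding zero_object_def by simp
      have "\<theta> (nul P x) = nul P y" using end_linear_nul[OF \<theta> x y] .
      then have "\<forall>u \<in> mor P x. \<theta> u = Cmp C P x y (nul x y) u" using only x y by simp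
      then show "\<exists>f \<in> mor x y. \<forall>u \<in> mor P x. \<theta> u = Cmp C P x y f u"
        using nul_closed[OF x y] by blast
    qed
  next
    case (extension x' x s a b h)
    note d = extension.hyps(4)
    note D = distD[OF d]
    have s: "s \<in> S" "s \<in> E" using extension.hyps(3) S_E by auto
    show ?case
    proof (intro allI impI)
      fix \<theta> assume \<theta>: "end_linear x y \<theta>"
      have \<theta>c: "\<And>u. u \<in> mor P x \<Longrightarrow> \<theta> u \<in> mor P y"
        and \<theta>a: "\<And>u v. \<lbrakk>u \<in> mor P x; v \<in> mor P x\<rbrakk> \<Longrightarrow> \<theta> (u \<oplus>\<^bsub>Hom C P x\<^esub> v) = \<theta> u \<oplus>\<^bsub>Hom C P y\<^esub> \<theta> v"
        and \<theta>m: "\<And>u e. \<lbrakk>u \<in> mor P x; e \<in> mor P P\<rbrakk> \<Longrightarrow> \<theta> (Cmp C P P x u e) = Cmp C P P y (\<theta> u) e"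
        using \<theta> unfolding end_linear_def by blast+
      have "end_linear x' y (\<lambda>u. \<theta> (Cmp C P x' x a u))"
        unfolding end_linear_def using D y by (simp add: \<theta>c \<theta>a Cmp_add_right flip: \<theta>m Cmp_assoc)
      then obtain f' where f': "f' \<in> mor x' y"
        and f'\<theta>: "\<And>u. u \<in> mor P x' \<Longrightarrow> \<theta> (Cmp C P x' x a u) = Cmp C P x' y f' u"
        using extension.IH by blast
      obtain \<pi> where \<pi>: "\<pi> \<in> mor P s" "\<pi> \<noteq> nul P s" using P_generates[OF s(1)] by blast
      obtain p where p: "p \<in> mor P x" "Cmp C P x s b p = \<pi>"
        using projective_lift[OF d extension.hyps(1) \<pi>(1)] by blast
      obtain k i \<delta> where k: "k \<in> E" and t: "dist C k P s i \<pi> \<delta>"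
        using simple_quotient[OF P_E s(1) \<pi>] by blast
      note Dt = distD[OF t]
      have pi: "Cmp C k P x p i \<in> mor k x" using Dt D p by simp
      have "Cmp C k x s b (Cmp C k P x p i) = nul k s"
        using dist_comp_zero[OF t] p D Dt by (simp flip: Cmp_assoc)
      then obtain c where c: "c \<in> mor k x'" "Cmp C k x' x a c = Cmp C k P x p i"
        using dist_weak_kernel[OF d Dt(1) pi] by blast
      have \<theta>p: "\<theta> p \<in> mor P y" using \<theta>c p by simp
      \<comment> \<open>applied to \<open>u\<close> from \<open>P\<close> to \<open>k\<close>, both sides are \<open>\<theta>\<close> of \<open>p i u = a c u\<close>\<close>
      have claim1: "Cmp C k P y (\<theta> p) i = Cmp C k x' y f' c"
      proof (rule represented_eqI[OF k assms(2)])
        fix u assume u: "u \<in> mor P k"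
        have "Cmp C P k y (Cmp C k P y (\<theta> p) i) u = \<theta> (Cmp C P P x p (Cmp C P k P i u))"
          using u p Dt D y \<theta>p by (simp add: \<theta>m Cmp_assoc)
        also have "Cmp C P P x p (Cmp C P k P i u) = Cmp C P x' x a (Cmp C P k x' c u)"
          using u p Dt D y c Cmp_assoc[of P k P x p i u] Cmp_assoc[of P k x' x a c u] by simp
        also have "\<theta> \<dots> = Cmp C P x' y f' (Cmp C P k x' c u)"
          using f'\<theta>[of "Cmp C P k x' c u"] u c D Dt by simp
        finally show "Cmp C P k y (Cmp C k P y (\<theta> p) i) u = Cmp C P k y (Cmp C k x' y f' c) u"
          using u c D Dt f' y by (simp add: Cmp_assoc)
      qed (use Dt D y \<theta>p f' c in simp_all)
      \<comment> \<open>\<open>(c, p, \<psi>)\<close> is a map of triangles, and \<open>\<psi> = 1\<close> because \<open>b p = \<pi>\<close>; so \<open>h\<close> is \<open>\<Sigma>c\<close> after \<open>\<delta>\<close>\<close>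
      obtain \<psi> where \<psi>: "\<psi> \<in> mor s s" "Cmp C P s s \<psi> \<pi> = Cmp C P x s b p"
        "Cmp C s (T k) (T x') (Tm k x' c) \<delta> = Cmp C s s (T x') h \<psi>"
        using dist_morphism[OF t d c(1) p(1) c(2)[symmetric]] by blast
      have "\<psi> \<ominus>\<^bsub>Hom C s s\<^esub> Idt C s = nul s s"
        by (rule E_dist_epi[OF t k s(2)]) (use \<psi> p Dt in \<open>simp_all add: Cmp_diff_left\<close>)
      then have "\<psi> = Idt C s" using \<psi> Dt by simp
      then have h: "h = Cmp C s (T k) (T x') (Tm k x' c) \<delta>" using \<psi>(3) D by simp
      have "Cmp C s (T x') (T y) (Tm x' y f') h
          = Cmp C s (T k) (T y) (Cmp C (T k) (T x') (T y) (Tm x' y f') (Tm k x' c)) \<delta>"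
        unfolding h using f' c D Dt y by (simp add: Cmp_assoc)
      also have "\<dots> = Cmp C s (T k) (T y) (Tm k y (Cmp C k P y (\<theta> p) i)) \<delta>"
        unfolding claim1 using f' c D Dt y by (simp add: Tm_Cmp)
      also have "\<dots> = nul s (T y)"
        using \<theta>p D Dt y dist_comp_zero'(2)[OF t] by (simp add: Tm_Cmp Cmp_assoc)
      finally obtain f0 where f0: "f0 \<in> mor x y" "Cmp C x' x y f0 a = f'"
        using dist_extend[OF d y f'] by blast
      \<comment> \<open>\<open>f0\<close> agrees with \<open>\<theta>\<close> on \<open>x'\<close>, and \<open>g\<close> corrects it at \<open>p\<close>\<close>
      define w where "w = \<theta> p \<ominus>\<^bsub>Hom C P y\<^esub> Cmp C P x y f0 p"
      have w: "w \<in> mor P y" unfolding w_def using \<theta>p f0 p D y by simp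
      have "Cmp C k P y w i = nul k y"
        unfolding w_def using \<theta>p f0 p D Dt y claim1 c Cmp_reassoc[OF f0(2), of k c] f'
        by (simp add: Cmp_diff_left Cmp_assoc)
      then obtain g where g: "g \<in> mor s y" "Cmp C P s y g \<pi> = w"
        using dist_weak_cokernel[OF t y w] by blast
      let ?f = "f0 \<oplus>\<^bsub>Hom C x y\<^esub> Cmp C x s y g b"
      have f: "?f \<in> mor x y" using f0 g D y by simp
      have "\<theta> u = Cmp C P x y ?f u" if u: "u \<in> mor P x" for u
      proof -
        have "Cmp C P x s b u \<in> mor P s" using u D by simp
        then obtain e where e: "e \<in> mor P P" "Cmp C P P s \<pi> e = Cmp C P x s b u"
          using simple_lift[OF P_E s(1) \<pi>] by blast
        let ?pe = "Cmp C P P x p e"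
        have "Cmp C P x s b (u \<ominus>\<^bsub>Hom C P x\<^esub> ?pe) = nul P s"
          using u e p D Cmp_reassoc[OF p(2), of P e] by (simp add: Cmp_diff_right)
        then obtain v where v: "v \<in> mor P x'" "Cmp C P x' x a v = u \<ominus>\<^bsub>Hom C P x\<^esub> ?pe"
          using dist_weak_kernel[OF d P_obj, of "u \<ominus>\<^bsub>Hom C P x\<^esub> ?pe"] u e p D by auto
        have u': "u = Cmp C P x' x a v \<oplus>\<^bsub>Hom C P x\<^esub> ?pe"
          unfolding v(2) using mor_diff_add(1)[of P x u ?pe] u e p D by simp
        have av: "Cmp C P x' x a v \<in> mor P x" "?pe \<in> mor P x" using v(1) D p e(1) by simp_all
        have "\<theta> u = Cmp C P x' y f' v \<oplus>\<^bsub>Hom C P y\<^esub> Cmp C P P y (\<theta> p) e"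
          unfolding u' using \<theta>a[OF av] f'\<theta>[OF v(1)] \<theta>m[OF p(1) e(1)] by simp
        also have "\<theta> p = Cmp C P x y f0 p \<oplus>\<^bsub>Hom C P y\<^esub> w"
          unfolding w_def using mor_diff_add(2)[of P y "\<theta> p" "Cmp C P x y f0 p"] \<theta>p f0 p D y by simp
        also have "Cmp C P P y (Cmp C P x y f0 p \<oplus>\<^bsub>Hom C P y\<^esub> w) e
            = Cmp C P x y f0 ?pe \<oplus>\<^bsub>Hom C P y\<^esub> Cmp C P P y w e"
          using f0 p e w D y by (simp add: Cmp_add_left Cmp_assoc)
        finally have 1: "\<theta> u = Cmp C P x' y f' v \<oplus>\<^bsub>Hom C P y\<^esub> (Cmp C P x y f0 ?pe \<oplus>\<^bsub>Hom C P y\<^esub> Cmp C P P y w e)" .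
        have "Cmp C P x y f0 u = Cmp C P x y f0 (Cmp C P x' x a v) \<oplus>\<^bsub>Hom C P y\<^esub> Cmp C P x y f0 ?pe"
          by (subst u') (use f0 av D y in \<open>simp add: Cmp_add_right\<close>)
        also have "Cmp C P x y f0 (Cmp C P x' x a v) = Cmp C P x' y f' v"
          using Cmp_reassoc[OF f0(2), of P v] f0 v D y by simp
        finally have 2: "Cmp C P x y f0 u = Cmp C P x' y f' v \<oplus>\<^bsub>Hom C P y\<^esub> Cmp C P x y f0 ?pe" .
        have 3: "Cmp C P x y (Cmp C x s y g b) u = Cmp C P P y w e"
          using g u e D y \<pi> Cmp_reassoc[OF g(2), of P e] by (simp add: Cmp_assoc)
        interpret ab: abelian_group "Hom C P y" by (rule mor_abelian[OF P_obj y])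
        have "Cmp C P x y ?f u = Cmp C P x y f0 u \<oplus>\<^bsub>Hom C P y\<^esub> Cmp C P x y (Cmp C x s y g b) u"
          using f0 g u D y by (simp add: Cmp_add_left)
        then show ?thesis unfolding 1 2 3 using f' v f0 av w e D y by (simp add: ab.a_assoc)
      qed
      then show "\<exists>f \<in> mor x y. \<forall>u \<in> mor P x. \<theta> u = Cmp C P x y f u" using f by blast
    qed
  qed
  then show ?thesis using assms by blast
qed

text \<open>Choose \<open>\<rho>\<close> with \<open>a \<rho> = 1 - \<sigma> b\<close>; the other identities follow by cancelling the monomorphism \<open>a\<close>.\<close>

lemma split_retraction:
  assumes d: "dist C x z y a b h" and E: "x \<in> E" "z \<in> E" "y \<in> E"
    and \<sigma>: "\<sigma> \<in> mor y z" "Cmp C y z y b \<sigma> = Idt C y"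
  shows "\<exists>\<rho> \<in> mor z x. Cmp C x z x \<rho> a = Idt C x \<and> Cmp C y z x \<rho> \<sigma> = nul y x \<and>
    Cmp C z x z a \<rho> \<oplus>\<^bsub>Hom C z z\<^esub> Cmp C z y z \<sigma> b = Idt C z"
proof -
  note D = distD[OF d]
  let ?e = "Idt C z \<ominus>\<^bsub>Hom C z z\<^esub> Cmp C z y z \<sigma> b"
  have e: "?e \<in> mor z z" using D \<sigma> by simp
  have "Cmp C z z y b ?e = nul z y"
    using D \<sigma> Cmp_reassoc[OF \<sigma>(2), of z b] by (simp add: Cmp_diff_right)
  then obtain \<rho> where \<rho>: "\<rho> \<in> mor z x" "Cmp C z x z a \<rho> = ?e"
    using dist_weak_kernel[OF d D(2) e] by blast
  have "Cmp C x z x \<rho> a \<ominus>\<^bsub>Hom C x x\<^esub> Idt C x = nul x x"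
    by (rule E_dist_mono[OF d E(3,1)])
      (use D \<sigma> \<rho> dist_comp_zero[OF d] Cmp_reassoc[OF \<rho>(2), of x a] in
        \<open>simp_all add: Cmp_diff_right Cmp_diff_left Cmp_assoc\<close>)
  moreover have "Cmp C y z x \<rho> \<sigma> = nul y x"
    by (rule E_dist_mono[OF d E(3,3)])
      (use D \<sigma> \<rho> Cmp_reassoc[OF \<rho>(2), of y \<sigma>] in \<open>simp_all add: Cmp_diff_left Cmp_assoc\<close>)
  moreover have "Cmp C z x z a \<rho> \<oplus>\<^bsub>Hom C z z\<^esub> Cmp C z y z \<sigma> b = Idt C z"
    unfolding \<rho>(2) using mor_diff_add(1) D \<sigma> by simp
  ultimately show ?thesis using \<rho> D by auto
qed

lemma E_biproduct:
  assumes "x \<in> E" "y \<in> E"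
  shows "\<exists>z \<in> E. \<exists>a \<in> mor x z. \<exists>b \<in> mor z y. \<exists>\<sigma> \<in> mor y z. \<exists>\<rho> \<in> mor z x.
    Cmp C y z y b \<sigma> = Idt C y \<and> Cmp C x z x \<rho> a = Idt C x \<and> Cmp C y z x \<rho> \<sigma> = nul y x \<and>
    Cmp C x z y b a = nul x y"
proof -
  obtain z a b where d: "dist C x z y a b (nul y (T x))"
    using triangle_with_connecting[of y x "nul y (T x)"] assms by auto
  note D = distD[OF d]
  have z: "z \<in> E" using E_ext[OF assms] d unfolding short_triangle_def by blast
  obtain \<sigma> where \<sigma>: "\<sigma> \<in> mor y z" "Cmp C y z y b \<sigma> = Idt C y"
    using dist_lift[OF d D(3), of "Idt C y"] D by auto
  obtain \<rho> where "\<rho> \<in> mor z x" "Cmp C x z x \<rho> a = Idt C x" "Cmp C y z x \<rho> \<sigma> = nul y x"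
    using split_retraction[OF d assms(1) z assms(2) \<sigma>] by blast
  then show ?thesis using D z \<sigma> dist_comp_zero[OF d] by blast
qed

definition end_submodule :: "'o \<Rightarrow> 'm set \<Rightarrow> bool" where
  "end_submodule x N \<longleftrightarrow> N \<subseteq> mor P x \<and> nul P x \<in> N \<and>
     (\<forall>u \<in> N. \<forall>v \<in> N. u \<oplus>\<^bsub>Hom C P x\<^esub> v \<in> N) \<and> (\<forall>u \<in> N. \<forall>e \<in> mor P P. Cmp C P P x u e \<in> N)"

lemma end_submodule_diff:
  assumes "end_submodule x N" "x \<in> Obj C" "u \<in> N" "v \<in> N"
  shows "u \<ominus>\<^bsub>Hom C P x\<^esub> v \<in> N"
proof -
  have v: "v \<in> mor P x" using assms unfolding end_submodule_def by blast
  have "Cmp C P P x v (\<ominus>\<^bsub>Hom C P P\<^esub> Idt C P) \<in> N"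
    using assms unfolding end_submodule_def by simp
  then have "\<ominus>\<^bsub>Hom C P x\<^esub> v \<in> N" using v assms by (simp add: Cmp_neg_right)
  then show ?thesis using assms unfolding end_submodule_def a_minus_def by blast
qed

text \<open>Quotients of \<open>Hom(P, x)\<close> are represented, by induction on the length of \<open>x\<close>. For \<open>x' \<rightarrow> x \<rightarrow> s\<close> the intersection of \<open>N\<close> with \<open>Hom(P, x')\<close>
  is divided out by pushing out along a map from \<open>x'\<close>. The image of \<open>N\<close> in the result \<open>x1\<close> meets
  the subobject \<open>y'\<close> trivially, so it is zero or isomorphic to \<open>Hom(P, s)\<close>; in the second case it
  splits \<open>x1\<close> and \<open>y'\<close> is the quotient.\<close>

lemma represented_quotient:
  assumes "x \<in> E" "end_submodule x N"
  shows "\<exists>y \<in> E. \<exists>g \<in> mor x y. (\<forall>w \<in> mor P y. \<exists>u \<in> mor P x. Cmp C P x y g u = w) \<and>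
    (\<forall>u \<in> mor P x. Cmp C P x y g u = nul P y \<longleftrightarrow> u \<in> N)"
proof -
  have "\<forall>N. end_submodule x N \<longrightarrow> (\<exists>y \<in> E. \<exists>g \<in> mor x y. (\<forall>w \<in> mor P y. \<exists>u \<in> mor P x. Cmp C P x y g u = w) \<and>
    (\<forall>u \<in> mor P x. Cmp C P x y g u = nul P y \<longleftrightarrow> u \<in> N))"
    using assms(1)
  proof (induction rule: E_induct)
    case (zero x)
    have x: "x \<in> Obj C" using zero unfolding zero_object_def by blast
    have "mor P x = {nul P x}" using zero unfolding zero_object_def by simp
    then have "(\<forall>w \<in> mor P x. \<exists>u \<in> mor P x. Cmp C P x x (Idt C x) u = w) \<and>
      (\<forall>u \<in> mor P x. Cmp C P x x (Idt C x) u = nul P x \<longleftrightarrow> u \<in> N)" if "end_submodule x N" for N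
      using x that unfolding end_submodule_def by simp
    then show ?case using E_zero[OF zero] Idt_closed[OF x] by blast
  next
    case (extension x' x s a b h)
    note d = extension.hyps(4)
    note D = distD[OF d]
    have s: "s \<in> S" "s \<in> E" using extension.hyps(3) S_E by auto
    show ?case
    proof (intro allI impI)
      fix N assume N: "end_submodule x N"
      have Nc: "\<And>u. u \<in> N \<Longrightarrow> u \<in> mor P x" and N0: "nul P x \<in> N"
        and Na: "\<And>u v. \<lbrakk>u \<in> N; v \<in> N\<rbrakk> \<Longrightarrow> u \<oplus>\<^bsub>Hom C P x\<^esub> v \<in> N"
        and Nm: "\<And>u e. \<lbrakk>u \<in> N; e \<in> mor P P\<rbrakk> \<Longrightarrow> Cmp C P P x u e \<in> N"
        using N unfolding end_submodule_def by blast+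
      let ?N' = "{v \<in> mor P x'. Cmp C P x' x a v \<in> N}"
      have "end_submodule x' ?N'"
        unfolding end_submodule_def using D N0 Na Nm by (auto simp: Cmp_add_right simp flip: Cmp_assoc)
      from extension.IH[rule_format, OF this] obtain y' g' where y': "y' \<in> E" and g': "g' \<in> mor x' y'"
        and g'_surj: "\<And>w. w \<in> mor P y' \<Longrightarrow> \<exists>u \<in> mor P x'. Cmp C P x' y' g' u = w"
        and ker: "\<forall>u \<in> mor P x'. Cmp C P x' y' g' u = nul P y' \<longleftrightarrow> u \<in> ?N'"
        by blast
      have g'_ker: "\<And>u. u \<in> mor P x' \<Longrightarrow> Cmp C P x' y' g' u = nul P y' \<longleftrightarrow> Cmp C P x' x a u \<in> N"
        using ker by simp
      have y'O: "y' \<in> Obj C" using y' by simp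
      \<comment> \<open>the pushout of \<open>x' \<rightarrow> x \<rightarrow> s\<close> along \<open>g'\<close>\<close>
      let ?h1 = "Cmp C s (T x') (T y') (Tm x' y' g') h"
      have h1: "?h1 \<in> mor s (T y')" using g' D y'O by simp
      obtain x1 a1 b1 where d1: "dist C y' x1 s a1 b1 ?h1"
        using triangle_with_connecting[OF D(3) y'O h1] by blast
      note D1 = distD[OF d1]
      have x1: "x1 \<in> E" using E_ext_simple[OF y' s(1)] d1 unfolding short_triangle_def by blast
      obtain \<phi> where \<phi>: "\<phi> \<in> mor x x1" "Cmp C x' x x1 \<phi> a = Cmp C x' y' x1 a1 g'"
        "Cmp C x x1 s b1 \<phi> = b"
        using dist_morphism_middle[OF d d1 g'] by blast
      have \<phi>_surj: "\<exists>u \<in> mor P x. Cmp C P x x1 \<phi> u = w" if w: "w \<in> mor P x1" for w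
      proof -
        have "Cmp C P x1 s b1 w \<in> mor P s" using w D1 by simp
        then obtain u where u: "u \<in> mor P x" "Cmp C P x s b u = Cmp C P x1 s b1 w"
          using projective_lift[OF d extension.hyps(1)] by blast
        have 0: "Cmp C P x1 s b1 (w \<ominus>\<^bsub>Hom C P x1\<^esub> Cmp C P x x1 \<phi> u) = nul P s"
          using u w \<phi> D D1 Cmp_reassoc[OF \<phi>(3), of P u] by (simp add: Cmp_diff_right)
        have wu: "w \<ominus>\<^bsub>Hom C P x1\<^esub> Cmp C P x x1 \<phi> u \<in> mor P x1" using u w \<phi> D D1 by simp
        obtain v where v: "v \<in> mor P y'" "Cmp C P y' x1 a1 v = w \<ominus>\<^bsub>Hom C P x1\<^esub> Cmp C P x x1 \<phi> u"
          using dist_weak_kernel[OF d1 P_obj wu 0] by blast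
        obtain v' where v': "v' \<in> mor P x'" "Cmp C P x' y' g' v' = v" using g'_surj v by blast
        have "Cmp C P x x1 \<phi> (Cmp C P x' x a v') = w \<ominus>\<^bsub>Hom C P x1\<^esub> Cmp C P x x1 \<phi> u"
          using Cmp_reassoc[OF \<phi>(2), of P v'] v v' \<phi> g' D D1 by (simp add: Cmp_assoc)
        then have "Cmp C P x x1 \<phi> (Cmp C P x' x a v' \<oplus>\<^bsub>Hom C P x\<^esub> u) = w"
          using v' u w \<phi> D D1 mor_diff_add(1)[of P x1 w "Cmp C P x x1 \<phi> u"] by (simp add: Cmp_add_right)
        then show ?thesis using v' u D by (auto intro!: bexI[of _ "Cmp C P x' x a v' \<oplus>\<^bsub>Hom C P x\<^esub> u"])
      qed
      have \<phi>_ker: "u \<in> N" if u: "u \<in> mor P x" "Cmp C P x x1 \<phi> u = nul P x1" for u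
      proof -
        have "Cmp C P x s b u = nul P s"
          using Cmp_reassoc[OF \<phi>(3), of P u] u \<phi> D D1 by simp
        then obtain v where v: "v \<in> mor P x'" "Cmp C P x' x a v = u"
          using dist_weak_kernel[OF d P_obj u(1)] by blast
        have "Cmp C P y' x1 a1 (Cmp C P x' y' g' v) = nul P x1"
          using Cmp_reassoc[OF \<phi>(2), of P v] v u g' \<phi> D D1 by (simp add: Cmp_assoc)
        then have "Cmp C P x' y' g' v = nul P y'"
          using E_dist_mono[OF d1 s(2) P_E] g' v D D1 by simp
        then show ?thesis using g'_ker v by auto
      qed
      have \<phi>_meets: "n \<in> mor P x \<and> Cmp C P x x1 \<phi> n = nul P x1" if n: "n \<in> N" "Cmp C P x s b n = nul P s" for n
      proof -
        obtain v where v: "v \<in> mor P x'" "Cmp C P x' x a v = n"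
          using dist_weak_kernel[OF d P_obj Nc[OF n(1)] n(2)] by blast
        then have "Cmp C P x' y' g' v = nul P y'" using g'_ker n by blast
        then have "Cmp C P x x1 \<phi> n = nul P x1"
          using Cmp_reassoc[OF \<phi>(2), of P v] v g' \<phi> D D1 by (simp add: Cmp_assoc)
        then show ?thesis using Nc n by blast
      qed
      show "\<exists>y \<in> E. \<exists>g \<in> mor x y. (\<forall>w \<in> mor P y. \<exists>u \<in> mor P x. Cmp C P x y g u = w) \<and>
        (\<forall>u \<in> mor P x. Cmp C P x y g u = nul P y \<longleftrightarrow> u \<in> N)"
      proof (cases "\<forall>n \<in> N. Cmp C P x s b n = nul P s")
        case True
        then have "\<forall>u \<in> mor P x. Cmp C P x x1 \<phi> u = nul P x1 \<longleftrightarrow> u \<in> N"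
          using \<phi>_ker \<phi>_meets by blast
        then show ?thesis using x1 \<phi>(1) \<phi>_surj by blast
      next
        case False
        then obtain n where n: "n \<in> N" "Cmp C P x s b n \<noteq> nul P s" by blast
        have nm: "n \<in> mor P x" using Nc n by blast
        let ?v = "Cmp C P x s b n" and ?n1 = "Cmp C P x x1 \<phi> n"
        have v: "?v \<in> mor P s" and n1: "?n1 \<in> mor P x1" using nm D D1 \<phi> by simp_all
        obtain k i \<delta> where k: "k \<in> E" and t: "dist C k P s i ?v \<delta>"
          using simple_quotient[OF P_E s(1) v n(2)] by blast
        note Dt = distD[OF t]
        have "Cmp C k P x1 ?n1 i = nul k x1"
        proof (rule represented_faithful[OF k x1])
          fix u assume u: "u \<in> mor P k"
          let ?e = "Cmp C P k P i u"
          have e: "?e \<in> mor P P" using u Dt by simp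
          have "Cmp C P x s b (Cmp C P P x n ?e) = nul P s"
            using dist_comp_zero[OF t] u e nm D Dt Cmp_assoc[of P P x s b n ?e]
              Cmp_assoc[of P k P s ?v i u] by simp
          then have "Cmp C P x x1 \<phi> (Cmp C P P x n ?e) = nul P x1"
            using \<phi>_meets Nm n e by blast
          then show "Cmp C P k x1 (Cmp C k P x1 ?n1 i) u = nul P x1"
            using Cmp_assoc[OF P_obj Dt(1) P_obj D1(2) n1 Dt(4) u]
              Cmp_assoc[OF P_obj P_obj D(2) D1(2) \<phi>(1) nm e] by simp
        qed (use n1 Dt D1 in simp)
        then obtain \<sigma> where \<sigma>: "\<sigma> \<in> mor s x1" "Cmp C P s x1 \<sigma> ?v = ?n1"
          using dist_weak_cokernel[OF t D1(2) n1] by blast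
        have "Cmp C s x1 s b1 \<sigma> \<ominus>\<^bsub>Hom C s s\<^esub> Idt C s = nul s s"
        proof (rule E_dist_epi[OF t k s(2)])
          have "Cmp C P x1 s b1 ?n1 = ?v" using Cmp_reassoc[OF \<phi>(3), of P n] nm \<phi> D D1 by simp
          then show "Cmp C P s s (Cmp C s x1 s b1 \<sigma> \<ominus>\<^bsub>Hom C s s\<^esub> Idt C s) ?v = nul P s"
            using \<sigma> v D D1 by (simp add: Cmp_diff_left Cmp_assoc)
        qed (use \<sigma> D D1 in simp)
        then have b1\<sigma>: "Cmp C s x1 s b1 \<sigma> = Idt C s" using \<sigma> D1 by simp
        obtain \<rho> where \<rho>: "\<rho> \<in> mor x1 y'" "Cmp C y' x1 y' \<rho> a1 = Idt C y'" "Cmp C s x1 y' \<rho> \<sigma> = nul s y'"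
          "Cmp C x1 y' x1 a1 \<rho> \<oplus>\<^bsub>Hom C x1 x1\<^esub> Cmp C x1 s x1 \<sigma> b1 = Idt C x1"
          using split_retraction[OF d1 y' x1 s(2) \<sigma>(1) b1\<sigma>] by blast
        let ?g = "Cmp C x x1 y' \<rho> \<phi>"
        have surj: "\<exists>u \<in> mor P x. Cmp C P x y' ?g u = w" if w: "w \<in> mor P y'" for w
        proof -
          have "Cmp C P y' x1 a1 w \<in> mor P x1" using w D1 by simp
          then obtain u where u: "u \<in> mor P x" "Cmp C P x x1 \<phi> u = Cmp C P y' x1 a1 w"
            using \<phi>_surj by blast
          then have "Cmp C P x y' ?g u = w"
            using \<rho> \<phi> w D D1 Cmp_reassoc[OF \<rho>(2), of P w] by (simp add: Cmp_assoc)
          then show ?thesis using u by blast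
        qed
        have gn: "Cmp C P x y' ?g (Cmp C P P x n e) = nul P y'" if e: "e \<in> mor P P" for e
        proof -
          have "Cmp C P x1 y' \<rho> ?n1 = nul P y'"
            unfolding \<sigma>(2)[symmetric] using Cmp_reassoc[OF \<rho>(3), of P ?v] \<rho> \<sigma> v D D1 by simp
          then have "Cmp C P P y' (Cmp C P x1 y' \<rho> ?n1) e = nul P y'" using e D1 by simp
          then show ?thesis using \<rho> \<phi> nm e D D1 by (simp add: Cmp_assoc)
        qed
        have reduce: "\<exists>e \<in> mor P P. Cmp C P x s b (u \<ominus>\<^bsub>Hom C P x\<^esub> Cmp C P P x n e) = nul P s"
          if u: "u \<in> mor P x" for u
        proof -
          have "Cmp C P x s b u \<in> mor P s" using u D by simp
          then obtain e where e: "e \<in> mor P P" "Cmp C P P s ?v e = Cmp C P x s b u"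
            using simple_lift[OF P_E s(1) v n(2)] by blast
          then have "Cmp C P x s b (u \<ominus>\<^bsub>Hom C P x\<^esub> Cmp C P P x n e) = nul P s"
            using u nm D by (simp add: Cmp_diff_right Cmp_assoc)
          then show ?thesis using e by blast
        qed
        have "Cmp C P x y' ?g u = nul P y' \<longleftrightarrow> u \<in> N" if u: "u \<in> mor P x" for u
        proof -
          obtain e where e: "e \<in> mor P P" "Cmp C P x s b (u \<ominus>\<^bsub>Hom C P x\<^esub> Cmp C P P x n e) = nul P s"
            using reduce[OF u] by blast
          let ?r = "u \<ominus>\<^bsub>Hom C P x\<^esub> Cmp C P P x n e"
          have ne: "Cmp C P P x n e \<in> N" "Cmp C P P x n e \<in> mor P x" using Nm n e Nc by blast+
          have r: "?r \<in> mor P x" using u ne D by simp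
          have gr: "Cmp C P x y' ?g ?r = Cmp C P x y' ?g u"
            using u ne gn[OF e(1)] \<rho> \<phi> D D1 by (simp add: Cmp_diff_right)
          have u_iff: "u \<in> N \<longleftrightarrow> ?r \<in> N"
          proof
            assume "?r \<in> N"
            then have "?r \<oplus>\<^bsub>Hom C P x\<^esub> Cmp C P P x n e \<in> N" using Na ne by blast
            then show "u \<in> N" using mor_diff_add(1)[of P x u "Cmp C P P x n e"] u ne D by simp
          qed (use end_submodule_diff[OF N D(2)] ne in blast)
          have "Cmp C P x y' ?g ?r = nul P y' \<longleftrightarrow> ?r \<in> N"
          proof
            assume 0: "Cmp C P x y' ?g ?r = nul P y'"
            have "Cmp C P x1 s b1 (Cmp C P x x1 \<phi> ?r) = nul P s"
              using Cmp_reassoc[OF \<phi>(3), of P ?r] e(2) r \<phi> D D1 by simp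
            then obtain q where q: "q \<in> mor P y'" "Cmp C P y' x1 a1 q = Cmp C P x x1 \<phi> ?r"
              using dist_weak_kernel[OF d1 P_obj, of "Cmp C P x x1 \<phi> ?r"] r \<phi> D D1 by auto
            have "q = Cmp C P x1 y' \<rho> (Cmp C P x x1 \<phi> ?r)"
              using Cmp_reassoc[OF \<rho>(2), of P q] q \<rho> D1 by simp
            also have "\<dots> = nul P y'" using 0 \<rho> \<phi> r D D1 by (simp add: Cmp_assoc)
            finally have "Cmp C P x x1 \<phi> ?r = nul P x1" using q D1 by simp
            then show "?r \<in> N" using \<phi>_ker r by blast
          next
            assume "?r \<in> N"
            then have "Cmp C P x x1 \<phi> ?r = nul P x1" using \<phi>_meets e(2) by blast
            then show "Cmp C P x y' ?g ?r = nul P y'" using \<rho> \<phi> r D D1 by (simp add: Cmp_assoc)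
          qed
          then show ?thesis using gr u_iff by simp
        qed
        moreover have "?g \<in> mor x y'" using \<rho> \<phi> D D1 by simp
        ultimately show ?thesis using y' surj by blast
      qed
    qed
  qed
  then show ?thesis using assms(2) by blast
qed

end


section \<open>Linear algebra\<close>

lemma vectorspace_surjective_image:
  assumes V: "vectorspace K V" and im: "q ` carrier V = carrier W"
    and add: "\<And>u v. \<lbrakk>u \<in> carrier V; v \<in> carrier V\<rbrakk> \<Longrightarrow> q (u \<oplus>\<^bsub>V\<^esub> v) = q u \<oplus>\<^bsub>W\<^esub> q v"
    and smult: "\<And>c u. \<lbrakk>c \<in> carrier K; u \<in> carrier V\<rbrakk> \<Longrightarrow> q (c \<odot>\<^bsub>V\<^esub> u) = c \<odot>\<^bsub>W\<^esub> q u"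
    and zero: "q \<zero>\<^bsub>V\<^esub> = \<zero>\<^bsub>W\<^esub>"
  shows "vectorspace K W" and "vectorspace.fin_dim K V \<Longrightarrow> vectorspace.fin_dim K W"
proof -
  interpret V: vectorspace K V by (fact V)
  show W: "vectorspace K W"
  proof (rule vs_criteria)
    show "field K" by (fact V.field_axioms)
    show "\<zero>\<^bsub>W\<^esub> \<in> carrier W" using imageI[of "\<zero>\<^bsub>V\<^esub>" "carrier V" q] im zero by simp
    show "\<forall>v w. v \<in> carrier W \<and> w \<in> carrier W \<longrightarrow> v \<oplus>\<^bsub>W\<^esub> w \<in> carrier W"
      unfolding im[symmetric] by (auto simp flip: add)
    show "\<forall>v \<in> carrier W. \<exists>n \<in> carrier W. v \<oplus>\<^bsub>W\<^esub> n = \<zero>\<^bsub>W\<^esub>"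
    proof
      fix v assume "v \<in> carrier W"
      then obtain u where u: "u \<in> carrier V" "v = q u" using im by blast
      have "v \<oplus>\<^bsub>W\<^esub> q (\<ominus>\<^bsub>V\<^esub> u) = \<zero>\<^bsub>W\<^esub>"
        using add[OF u(1), of "\<ominus>\<^bsub>V\<^esub> u"] u zero by (simp add: V.r_neg)
      then show "\<exists>n \<in> carrier W. v \<oplus>\<^bsub>W\<^esub> n = \<zero>\<^bsub>W\<^esub>" using u im by blast
    qed
    show "\<forall>c v. c \<in> carrier K \<and> v \<in> carrier W \<longrightarrow> c \<odot>\<^bsub>W\<^esub> v \<in> carrier W"
      unfolding im[symmetric] by (auto simp flip: smult)
    show "\<forall>v w. v \<in> carrier W \<and> w \<in> carrier W \<longrightarrow> v \<oplus>\<^bsub>W\<^esub> w = w \<oplus>\<^bsub>W\<^esub> v"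
      unfolding im[symmetric] by (auto simp: V.M.a_comm simp flip: add)
    show "\<forall>v w x. v \<in> carrier W \<and> w \<in> carrier W \<and> x \<in> carrier W \<longrightarrow>
      v \<oplus>\<^bsub>W\<^esub> w \<oplus>\<^bsub>W\<^esub> x = v \<oplus>\<^bsub>W\<^esub> (w \<oplus>\<^bsub>W\<^esub> x)"
      unfolding im[symmetric] by (auto simp: V.M.a_assoc simp flip: add)
    show "\<forall>v \<in> carrier W. v \<oplus>\<^bsub>W\<^esub> \<zero>\<^bsub>W\<^esub> = v"
      unfolding im[symmetric] zero[symmetric] by (auto simp flip: add)
    show "\<forall>a b v. a \<in> carrier K \<and> b \<in> carrier K \<and> v \<in> carrier W \<longrightarrow>
      a \<otimes>\<^bsub>K\<^esub> b \<odot>\<^bsub>W\<^esub> v = a \<odot>\<^bsub>W\<^esub> (b \<odot>\<^bsub>W\<^esub> v)"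
      unfolding im[symmetric] by (auto simp: V.smult_assoc1 simp flip: smult)
    show "\<forall>v \<in> carrier W. \<one>\<^bsub>K\<^esub> \<odot>\<^bsub>W\<^esub> v = v"
      unfolding im[symmetric] by (auto simp flip: smult)
    show "\<forall>a b v. a \<in> carrier K \<and> b \<in> carrier K \<and> v \<in> carrier W \<longrightarrow>
      (a \<oplus>\<^bsub>K\<^esub> b) \<odot>\<^bsub>W\<^esub> v = a \<odot>\<^bsub>W\<^esub> v \<oplus>\<^bsub>W\<^esub> b \<odot>\<^bsub>W\<^esub> v"
      unfolding im[symmetric] by (auto simp: V.smult_l_distr simp flip: smult add)
    show "\<forall>a v w. a \<in> carrier K \<and> v \<in> carrier W \<and> w \<in> carrier W \<longrightarrow>
      a \<odot>\<^bsub>W\<^esub> (v \<oplus>\<^bsub>W\<^esub> w) = a \<odot>\<^bsub>W\<^esub> v \<oplus>\<^bsub>W\<^esub> a \<odot>\<^bsub>W\<^esub> w"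
      unfolding im[symmetric] by (auto simp: V.smult_r_distr simp flip: smult add)
  qed
  have hom: "q \<in> LinearCombinations.module_hom K V W"
    unfolding LinearCombinations.module_hom_def using im add smult by auto
  interpret linear_map K V W q
    using V W hom unfolding linear_map_def mod_hom_def mod_hom_axioms_def vectorspace_def by blast
  show "vectorspace.fin_dim K V \<Longrightarrow> vectorspace.fin_dim K W" using surj_fin_dim im by blast
qed

text \<open>Coordinates with respect to a finite spanning set that is numbered; on the remaining indices the
  value does not matter, since only injectivity is asked for.\<close>

lemma vectorspace_coords_injection:
  assumes V: "vectorspace (K :: ('k, 'r) ring_scheme) V" and fd: "vectorspace.fin_dim K V"
  shows "\<exists>\<psi> :: 'v \<Rightarrow> 'k coords. inj_on \<psi> (carrier V)"
proof -
  interpret V: vectorspace K V by (fact V)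
  obtain B where B: "finite B" "B \<subseteq> carrier V" "V.span B = carrier V" using fd unfolding V.fin_dim_def by blast
  obtain f :: "'v \<Rightarrow> nat" where f: "inj_on f B" using finite_imp_inj_to_nat_seg[OF B(1)] by blast
  define a where "a v = (SOME a. a \<in> B \<rightarrow> carrier K \<and> V.lincomb a B = v)" for v
  have a: "a v \<in> B \<rightarrow> carrier K \<and> V.lincomb (a v) B = v" if "v \<in> carrier V" for v
  proof -
    have "\<exists>a. a \<in> B \<rightarrow> carrier K \<and> V.lincomb a B = v"
      using V.finite_in_span[OF B(1,2), of v] B(3) that by simp
    from someI_ex[OF this] show ?thesis unfolding a_def .
  qed
  have "inj_on (\<lambda>v i. a v (the_inv_into B f i)) (carrier V)"
  proof (rule inj_onI)
    fix v w assume v: "v \<in> carrier V" and w: "w \<in> carrier V"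
      and eq: "(\<lambda>i. a v (the_inv_into B f i)) = (\<lambda>i. a w (the_inv_into B f i))"
    have "a v b = a w b" if "b \<in> B" for b
      using fun_cong[OF eq, of "f b"] the_inv_into_f_f[OF f that] by simp
    then have "V.lincomb (a v) B = V.lincomb (a w) B"
      by (intro V.lincomb_cong) (use B a[OF w] in auto)
    then show "v = w" using a[OF v] a[OF w] by simp
  qed
  then show ?thesis by blast
qed

context vectorspace
begin

lemma smult_right_cancel:
  assumes v: "v \<in> carrier V" "v \<noteq> \<zero>\<^bsub>V\<^esub>" and a: "a \<in> carrier K" and b: "b \<in> carrier K"
    and eq: "a \<odot>\<^bsub>V\<^esub> v = b \<odot>\<^bsub>V\<^esub> v"
  shows "a = b"
proof (rule ccontr)
  assume "a \<noteq> b"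
  define d where "d = a \<ominus>\<^bsub>K\<^esub> b"
  have d: "d \<in> carrier K" "d \<noteq> \<zero>\<^bsub>K\<^esub>" using \<open>a \<noteq> b\<close> a b unfolding d_def by simp_all
  have "a = d \<oplus>\<^bsub>K\<^esub> b" unfolding d_def using a b by (simp add: a_minus_def R.a_assoc R.l_neg)
  then have "d \<odot>\<^bsub>V\<^esub> v \<oplus>\<^bsub>V\<^esub> b \<odot>\<^bsub>V\<^esub> v = \<zero>\<^bsub>V\<^esub> \<oplus>\<^bsub>V\<^esub> b \<odot>\<^bsub>V\<^esub> v"
    using eq smult_l_distr[OF d(1) b v(1)] b v by simp
  moreover have "d \<odot>\<^bsub>V\<^esub> v \<in> carrier V" "b \<odot>\<^bsub>V\<^esub> v \<in> carrier V" using d b v by simp_all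
  ultimately have 0: "d \<odot>\<^bsub>V\<^esub> v = \<zero>\<^bsub>V\<^esub>" using M.add.right_cancel by simp
  have di: "inv\<^bsub>K\<^esub> d \<in> carrier K" "inv\<^bsub>K\<^esub> d \<otimes>\<^bsub>K\<^esub> d = \<one>\<^bsub>K\<^esub>"
    using d field_Units Units_inv_closed Units_l_inv by auto
  have "v = (inv\<^bsub>K\<^esub> d \<otimes>\<^bsub>K\<^esub> d) \<odot>\<^bsub>V\<^esub> v" using di(2) v(1) by simp
  also have "\<dots> = inv\<^bsub>K\<^esub> d \<odot>\<^bsub>V\<^esub> (d \<odot>\<^bsub>V\<^esub> v)" by (rule smult_assoc1[OF di(1) d(1) v(1)])
  also have "\<dots> = \<zero>\<^bsub>V\<^esub>" unfolding 0 using di(1) by simp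
  finally show False using v(2) by simp
qed

lemma submodule_carrier: "submodule K (carrier V) V"
  using module_axioms by unfold_locales auto

text \<open>By induction on the number of functionals: pass to the kernel of one of them, and add one vector on
  which it is nonzero.\<close>

lemma subspace_spanned_of_separating:
  assumes "submodule K L V"
    and "\<And>i u v. \<lbrakk>i < (m :: nat); u \<in> carrier V; v \<in> carrier V\<rbrakk> \<Longrightarrow> l i (u \<oplus>\<^bsub>V\<^esub> v) = l i u \<oplus>\<^bsub>K\<^esub> l i v"
    and "\<And>i c v. \<lbrakk>i < m; c \<in> carrier K; v \<in> carrier V\<rbrakk> \<Longrightarrow> l i (c \<odot>\<^bsub>V\<^esub> v) = c \<otimes>\<^bsub>K\<^esub> l i v"
    and "\<And>i v. \<lbrakk>i < m; v \<in> carrier V\<rbrakk> \<Longrightarrow> l i v \<in> carrier K"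
    and "\<And>v. \<lbrakk>v \<in> L; \<forall>i<m. l i v = \<zero>\<^bsub>K\<^esub>\<rbrakk> \<Longrightarrow> v = \<zero>\<^bsub>V\<^esub>"
  shows "\<exists>U \<subseteq> L. finite U \<and> card U \<le> m \<and> L \<subseteq> span U"
  using assms
proof (induction m arbitrary: L)
  case 0
  then have "L \<subseteq> {\<zero>\<^bsub>V\<^esub>}" by auto
  then show ?case using span_empty by (intro exI[of _ "{}"]) auto
next
  case (Suc m)
  interpret L: submodule K L V by (fact Suc.prems(1))
  let ?X = "{v \<in> L. l m v = \<zero>\<^bsub>K\<^esub>}"
  have XV: "v \<in> carrier V" if "v \<in> L" for v using L.subset that by blast
  note add = Suc.prems(2) and sm = Suc.prems(3) and cl = Suc.prems(4)
  have l0: "l m \<zero>\<^bsub>V\<^esub> = \<zero>\<^bsub>K\<^esub>"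
    using sm[of m "\<zero>\<^bsub>K\<^esub>" "\<zero>\<^bsub>V\<^esub>"] cl[of m "\<zero>\<^bsub>V\<^esub>"] by simp
  have X': "submodule K ?X V"
    by (intro submodule.intro module_axioms) (use XV l0 add[of m] sm[of m] in auto)
  have "\<exists>U \<subseteq> ?X. finite U \<and> card U \<le> m \<and> ?X \<subseteq> span U"
  proof (rule Suc.IH[OF X'])
    fix v assume "v \<in> ?X" "\<forall>i<m. l i v = \<zero>\<^bsub>K\<^esub>"
    then show "v = \<zero>\<^bsub>V\<^esub>" using Suc.prems(5)[of v] by (auto simp: less_Suc_eq)
  qed (use add sm cl in simp_all)
  then obtain U where U: "U \<subseteq> ?X" "finite U" "card U \<le> m" "?X \<subseteq> span U" by blast
  show ?case
  proof (cases "?X = L")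
    case True
    then show ?thesis using U by (intro exI[of _ U]) auto
  next
    case False
    then obtain v0 where v0: "v0 \<in> L" "l m v0 \<noteq> \<zero>\<^bsub>K\<^esub>" by blast
    let ?c = "l m v0"
    have c: "?c \<in> carrier K" "inv\<^bsub>K\<^esub> ?c \<in> carrier K" "inv\<^bsub>K\<^esub> ?c \<otimes>\<^bsub>K\<^esub> ?c = \<one>\<^bsub>K\<^esub>"
      using cl[of m v0] v0 XV field_Units by (auto simp: Units_l_inv)
    let ?U = "insert v0 U"
    have UV: "?U \<subseteq> carrier V" using U v0 XV by blast
    interpret sp: submodule K "span ?U" V using span_is_submodule[OF UV] .
    have "L \<subseteq> span ?U"
    proof
      fix v assume v: "v \<in> L"
      let ?d = "l m v \<otimes>\<^bsub>K\<^esub> inv\<^bsub>K\<^esub> ?c"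
      have d: "?d \<in> carrier K" using cl[of m v] v XV c by simp
      let ?w = "v \<oplus>\<^bsub>V\<^esub> (\<ominus>\<^bsub>K\<^esub> ?d) \<odot>\<^bsub>V\<^esub> v0"
      have w: "?w \<in> L" using v v0 d by simp
      have dc: "?d \<otimes>\<^bsub>K\<^esub> ?c = l m v" using cl[of m v] v XV c by (simp add: m_assoc)
      have "l m ?w = l m v \<oplus>\<^bsub>K\<^esub> (\<ominus>\<^bsub>K\<^esub> ?d) \<otimes>\<^bsub>K\<^esub> ?c"
        using add[of m v] sm[of m _ v0] v v0 d XV by simp
      also have "\<dots> = \<zero>\<^bsub>K\<^esub>" using dc d c cl[of m v] v XV by (simp add: l_minus R.r_neg)
      finally have "?w \<in> span U" using U w by blast
      then have w': "?w \<in> span ?U" using span_is_monotone[of U ?U] by blast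
      have v0': "?d \<odot>\<^bsub>V\<^esub> v0 \<in> span ?U" using in_own_span[OF UV] d by auto
      have "v = ?w \<oplus>\<^bsub>V\<^esub> ?d \<odot>\<^bsub>V\<^esub> v0"
      proof -
        have "(\<ominus>\<^bsub>K\<^esub> ?d) \<odot>\<^bsub>V\<^esub> v0 \<oplus>\<^bsub>V\<^esub> ?d \<odot>\<^bsub>V\<^esub> v0 = \<zero>\<^bsub>V\<^esub>"
          using d v0 XV by (simp add: R.l_neg flip: smult_l_distr)
        then show ?thesis using v v0 d XV by (simp add: M.a_assoc)
      qed
      then show "v \<in> span ?U" using w' v0' sp.m_closed by metis
    qed
    moreover have "card ?U \<le> Suc m" using U card_insert_le_m1[of "Suc m" U v0] by simp
    ultimately show ?thesis using U v0 by (intro exI[of _ ?U]) auto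
  qed
qed

text \<open>A strictly monotone rank function on subspaces: the size of a largest linearly independent
  subset.\<close>

lemma subspace_rank_exists:
  assumes fd: "fin_dim"
  shows "\<exists>rk :: 'c set \<Rightarrow> nat. (\<forall>L Y. submodule K L V \<longrightarrow> submodule K Y V \<longrightarrow> L \<subset> Y \<longrightarrow> rk L < rk Y) \<and>
    (\<forall>L. submodule K L V \<longrightarrow> rk L \<le> dim)"
proof -
  define rk where "rk L = Max {card B | B. B \<subseteq> L \<and> lin_indpt B}" for L
  have fin: "finite {card B | B. B \<subseteq> L \<and> lin_indpt B}" "\<forall>n \<in> {card B | B. B \<subseteq> L \<and> lin_indpt B}. n \<le> dim"
    "{card B | B. B \<subseteq> L \<and> lin_indpt B} \<noteq> {}"
    if "submodule K L V" for L
  proof -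
    have L: "L \<subseteq> carrier V" using that unfolding submodule_def by blast
    show le: "\<forall>n \<in> {card B | B. B \<subseteq> L \<and> lin_indpt B}. n \<le> dim"
      using li_le_dim(2)[OF fd] L by blast
    then show "finite {card B | B. B \<subseteq> L \<and> lin_indpt B}" by (meson finite_nat_set_iff_bounded_le)
    have "lin_indpt {}" unfolding lin_dep_def by blast
    then show "{card B | B. B \<subseteq> L \<and> lin_indpt B} \<noteq> {}" by blast
  qed
  have "rk L < rk Y" if L: "submodule K L V" and Y: "submodule K Y V" and XY: "L \<subset> Y" for L Y
  proof -
    have "rk L \<in> {card B | B. B \<subseteq> L \<and> lin_indpt B}" unfolding rk_def using fin[OF L] by (intro Max_in)
    then obtain B where B: "B \<subseteq> L" "lin_indpt B" "card B = rk L" by auto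
    obtain y where y: "y \<in> Y" "y \<notin> L" using XY by blast
    have V: "B \<subseteq> carrier V" "y \<in> carrier V" using B L Y y unfolding submodule_def by auto
    have "span B \<subseteq> L" by (rule span_is_subset[OF B(1) L])
    then have "lin_indpt (B \<union> {y})" using lin_dep_iff_in_span[OF V(1) B(2) V(2)] y B by blast
    then have "card (B \<union> {y}) \<le> rk Y" unfolding rk_def using fin[OF Y] B y XY by (intro Max_ge) auto
    moreover have "card (B \<union> {y}) = Suc (card B)"
      using card_insert_disjoint[OF li_le_dim(1)[OF fd V(1) B(2)], of y] y B by auto
    ultimately show ?thesis using B by simp
  qed
  moreover have "rk L \<le> dim" if "submodule K L V" for L
    unfolding rk_def using fin[OF that] by simp
  ultimately show ?thesis by blast
qed

end

text \<open>A basis of \<open>V\<close> provides finitely many functionals on \<open>W\<close>, which separate points by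
  nondegeneracy.\<close>

lemma pairing_dim_le:
  assumes V: "vectorspace K V" and W: "vectorspace K W" and fd: "vectorspace.fin_dim K V"
    and cl: "\<And>v w. \<lbrakk>v \<in> carrier V; w \<in> carrier W\<rbrakk> \<Longrightarrow> \<beta> v w \<in> carrier K"
    and addl: "\<And>v v' w. \<lbrakk>v \<in> carrier V; v' \<in> carrier V; w \<in> carrier W\<rbrakk> \<Longrightarrow> \<beta> (v \<oplus>\<^bsub>V\<^esub> v') w = \<beta> v w \<oplus>\<^bsub>K\<^esub> \<beta> v' w"
    and sml: "\<And>c v w. \<lbrakk>c \<in> carrier K; v \<in> carrier V; w \<in> carrier W\<rbrakk> \<Longrightarrow> \<beta> (c \<odot>\<^bsub>V\<^esub> v) w = c \<otimes>\<^bsub>K\<^esub> \<beta> v w"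
    and addr: "\<And>v w w'. \<lbrakk>v \<in> carrier V; w \<in> carrier W; w' \<in> carrier W\<rbrakk> \<Longrightarrow> \<beta> v (w \<oplus>\<^bsub>W\<^esub> w') = \<beta> v w \<oplus>\<^bsub>K\<^esub> \<beta> v w'"
    and smr: "\<And>c v w. \<lbrakk>c \<in> carrier K; v \<in> carrier V; w \<in> carrier W\<rbrakk> \<Longrightarrow> \<beta> v (c \<odot>\<^bsub>W\<^esub> w) = c \<otimes>\<^bsub>K\<^esub> \<beta> v w"
    and nd: "\<And>w. \<lbrakk>w \<in> carrier W; \<forall>v \<in> carrier V. \<beta> v w = \<zero>\<^bsub>K\<^esub>\<rbrakk> \<Longrightarrow> w = \<zero>\<^bsub>W\<^esub>"
  shows "vectorspace.fin_dim K W \<and> vectorspace.dim K W \<le> vectorspace.dim K V"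
proof -
  interpret V: vectorspace K V by (fact V)
  interpret W: vectorspace K W by (fact W)
  obtain B where B: "finite B" "V.basis B" using V.finite_basis_exists[OF fd] by blast
  have BV: "B \<subseteq> carrier V" "V.span B = carrier V" "V.dim = card B"
    using B V.dim_basis[OF B] unfolding V.basis_def by auto
  obtain e where e: "bij_betw e {..<card B} B" using ex_bij_betw_nat_finite[OF B(1)] by (auto simp: atLeast0LessThan)
  have eB: "e i \<in> carrier V" if "i < card B" for i using e that BV unfolding bij_betw_def by blast
  have "\<exists>U \<subseteq> carrier W. finite U \<and> card U \<le> card B \<and> carrier W \<subseteq> W.span U"
  proof (rule W.subspace_spanned_of_separating[OF W.submodule_carrier, where l = "\<lambda>i. \<beta> (e i)"])
    fix w assume w: "w \<in> carrier W" and 0: "\<forall>i<card B. \<beta> (e i) w = \<zero>\<^bsub>K\<^esub>"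
    let ?X = "{v \<in> carrier V. \<beta> v w = \<zero>\<^bsub>K\<^esub>}"
    have z: "\<beta> \<zero>\<^bsub>V\<^esub> w = \<zero>\<^bsub>K\<^esub>" using sml[of "\<zero>\<^bsub>K\<^esub>" "\<zero>\<^bsub>V\<^esub>" w] cl[of "\<zero>\<^bsub>V\<^esub>" w] w by simp
    have X: "submodule K ?X V"
      by (intro submodule.intro V.module_axioms) (use z addl sml w in auto)
    have BX: "B \<subseteq> ?X"
    proof
      fix b assume b: "b \<in> B"
      then obtain i where "i < card B" "b = e i" using e unfolding bij_betw_def by blast
      then show "b \<in> ?X" using 0 b BV by auto
    qed
    then have "carrier V \<subseteq> ?X" using V.span_is_subset[OF BX X] BV(2) by simp
    then show "w = \<zero>\<^bsub>W\<^esub>" using nd[OF w] by blast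
  qed (use addr smr cl eB in simp_all)
  then obtain U where U: "U \<subseteq> carrier W" "finite U" "card U \<le> card B" "carrier W \<subseteq> W.span U" by blast
  then have g: "W.span U = carrier W" using W.span_is_subset2[OF U(1)] by blast
  then show ?thesis using U BV W.gen_ge_dim[OF U(2,1) g] unfolding W.fin_dim_def by auto
qed

lemma perfect_pairing_dim:
  assumes V: "vectorspace K V" and W: "vectorspace K W" and fd: "vectorspace.fin_dim K V"
    and cl: "\<And>v w. \<lbrakk>v \<in> carrier V; w \<in> carrier W\<rbrakk> \<Longrightarrow> \<beta> v w \<in> carrier K"
    and addl: "\<And>v v' w. \<lbrakk>v \<in> carrier V; v' \<in> carrier V; w \<in> carrier W\<rbrakk> \<Longrightarrow> \<beta> (v \<oplus>\<^bsub>V\<^esub> v') w = \<beta> v w \<oplus>\<^bsub>K\<^esub> \<beta> v' w"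
    and sml: "\<And>c v w. \<lbrakk>c \<in> carrier K; v \<in> carrier V; w \<in> carrier W\<rbrakk> \<Longrightarrow> \<beta> (c \<odot>\<^bsub>V\<^esub> v) w = c \<otimes>\<^bsub>K\<^esub> \<beta> v w"
    and addr: "\<And>v w w'. \<lbrakk>v \<in> carrier V; w \<in> carrier W; w' \<in> carrier W\<rbrakk> \<Longrightarrow> \<beta> v (w \<oplus>\<^bsub>W\<^esub> w') = \<beta> v w \<oplus>\<^bsub>K\<^esub> \<beta> v w'"
    and smr: "\<And>c v w. \<lbrakk>c \<in> carrier K; v \<in> carrier V; w \<in> carrier W\<rbrakk> \<Longrightarrow> \<beta> v (c \<odot>\<^bsub>W\<^esub> w) = c \<otimes>\<^bsub>K\<^esub> \<beta> v w"
    and ndr: "\<And>w. \<lbrakk>w \<in> carrier W; \<forall>v \<in> carrier V. \<beta> v w = \<zero>\<^bsub>K\<^esub>\<rbrakk> \<Longrightarrow> w = \<zero>\<^bsub>W\<^esub>"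
    and ndl: "\<And>v. \<lbrakk>v \<in> carrier V; \<forall>w \<in> carrier W. \<beta> v w = \<zero>\<^bsub>K\<^esub>\<rbrakk> \<Longrightarrow> v = \<zero>\<^bsub>V\<^esub>"
  shows "vectorspace.dim K W = vectorspace.dim K V"
proof -
  have 1: "vectorspace.fin_dim K W \<and> vectorspace.dim K W \<le> vectorspace.dim K V"
    by (rule pairing_dim_le[of K V W \<beta>]) (fact assms)+
  have "vectorspace.dim K V \<le> vectorspace.dim K W"
    using pairing_dim_le[of K W V "\<lambda>w v. \<beta> v w"] 1 assms by blast
  then show ?thesis using 1 by simp
qed


section \<open>Fully faithful and essentially surjective functors\<close>

lemma linear_functorI:
  assumes "\<And>x. x \<in> Obj C \<Longrightarrow> on_obj F x \<in> Obj D"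
    and "\<And>x y f. \<lbrakk>x \<in> Obj C; y \<in> Obj C; f \<in> carrier (Hom C x y)\<rbrakk> \<Longrightarrow>
      on_hom F x y f \<in> carrier (Hom D (on_obj F x) (on_obj F y))"
    and "\<And>x y f g. \<lbrakk>x \<in> Obj C; y \<in> Obj C; f \<in> carrier (Hom C x y); g \<in> carrier (Hom C x y)\<rbrakk> \<Longrightarrow>
      on_hom F x y (f \<oplus>\<^bsub>Hom C x y\<^esub> g)
        = on_hom F x y f \<oplus>\<^bsub>Hom D (on_obj F x) (on_obj F y)\<^esub> on_hom F x y g"
    and "\<And>x y c f. \<lbrakk>x \<in> Obj C; y \<in> Obj C; c \<in> carrier K; f \<in> carrier (Hom C x y)\<rbrakk> \<Longrightarrow>
      on_hom F x y (c \<odot>\<^bsub>Hom C x y\<^esub> f) = c \<odot>\<^bsub>Hom D (on_obj F x) (on_obj F y)\<^esub> on_hom F x y f"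
    and "\<And>x. x \<in> Obj C \<Longrightarrow> on_hom F x x (Idt C x) = Idt D (on_obj F x)"
    and "\<And>x y z g f. \<lbrakk>x \<in> Obj C; y \<in> Obj C; z \<in> Obj C; g \<in> carrier (Hom C y z); f \<in> carrier (Hom C x y)\<rbrakk> \<Longrightarrow>
      on_hom F x z (Cmp C x y z g f)
        = Cmp D (on_obj F x) (on_obj F y) (on_obj F z) (on_hom F y z g) (on_hom F x y f)"
  shows "linear_functor K C D F"
  using assms unfolding linear_functor_def LinearCombinations.module_hom_def by (simp add: Pi_iff)

text \<open>The quasi-inverse sends \<open>m\<close> to a chosen object \<open>G m\<close> with an isomorphism from \<open>F(G m)\<close> to \<open>m\<close>, and
  a morphism to the preimage under \<open>F\<close> of its conjugate by these isomorphisms.\<close>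

lemma linear_equivalenceI:
  assumes C: "linear_category K C" and D: "linear_category K D" and F: "linear_functor K C D F"
    and ff: "\<And>x y. \<lbrakk>x \<in> Obj C; y \<in> Obj C\<rbrakk> \<Longrightarrow>
      bij_betw (on_hom F x y) (carrier (Hom C x y)) (carrier (Hom D (on_obj F x) (on_obj F y)))"
    and es: "\<And>m. m \<in> Obj D \<Longrightarrow> \<exists>x \<in> Obj C. isomorphic D (on_obj F x) m"
  shows "linear_equivalence K C D F"
proof -
  interpret C: linear_category K C by (fact C)
  interpret D: linear_category K D by (fact D)
  let ?F = "on_obj F"
  have Fo [simp]: "x \<in> Obj C \<Longrightarrow> ?F x \<in> Obj D" for x by (rule linear_functor_obj[OF F])
  have Fm [simp]: "\<lbrakk>x \<in> Obj C; y \<in> Obj C; f \<in> C.mor x y\<rbrakk> \<Longrightarrow> on_hom F x y f \<in> D.mor (?F x) (?F y)" for x y f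
    by (rule linear_functor_mor[OF F])
  have inj: "\<lbrakk>x \<in> Obj C; y \<in> Obj C; f \<in> C.mor x y; g \<in> C.mor x y; on_hom F x y f = on_hom F x y g\<rbrakk> \<Longrightarrow> f = g"
    for x y f g using ff[of x y] unfolding bij_betw_def inj_on_def by blast
  have surj: "\<exists>f \<in> C.mor x y. on_hom F x y f = h"
    if "x \<in> Obj C" "y \<in> Obj C" "h \<in> D.mor (?F x) (?F y)" for x y h
  proof -
    have "h \<in> on_hom F x y ` C.mor x y" using bij_betw_imp_surj_on[OF ff[OF that(1,2)]] that(3) by simp
    then show ?thesis by blast
  qed
  define G where "G m = (SOME x. x \<in> Obj C \<and> isomorphic D (?F x) m)" for m
  have G: "G m \<in> Obj C \<and> isomorphic D (?F (G m)) m" if "m \<in> Obj D" for m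
    unfolding G_def by (rule someI_ex) (use es[OF that] in blast)
  then have Go [simp]: "m \<in> Obj D \<Longrightarrow> G m \<in> Obj C" for m by blast
  have "\<forall>m. \<exists>e e'. m \<in> Obj D \<longrightarrow> e \<in> D.mor (?F (G m)) m \<and> e' \<in> D.mor m (?F (G m)) \<and>
    Cmp D (?F (G m)) m (?F (G m)) e' e = Idt D (?F (G m)) \<and> Cmp D m (?F (G m)) m e e' = Idt D m"
    using G unfolding isomorphic_def is_iso_def by meson
  then obtain e e' where ee: "\<And>m. m \<in> Obj D \<Longrightarrow> e m \<in> D.mor (?F (G m)) m \<and> e' m \<in> D.mor m (?F (G m)) \<and>
    Cmp D (?F (G m)) m (?F (G m)) (e' m) (e m) = Idt D (?F (G m)) \<and> Cmp D m (?F (G m)) m (e m) (e' m) = Idt D m"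
    by metis
  then have e [simp]: "m \<in> Obj D \<Longrightarrow> e m \<in> D.mor (?F (G m)) m"
    and e' [simp]: "m \<in> Obj D \<Longrightarrow> e' m \<in> D.mor m (?F (G m))"
    and e'e [simp]: "m \<in> Obj D \<Longrightarrow> Cmp D (?F (G m)) m (?F (G m)) (e' m) (e m) = Idt D (?F (G m))"
    and ee' [simp]: "m \<in> Obj D \<Longrightarrow> Cmp D m (?F (G m)) m (e m) (e' m) = Idt D m" for m
    by blast+
  define conj where "conj m n h = Cmp D (?F (G m)) n (?F (G n)) (e' n) (Cmp D (?F (G m)) m n h (e m))" for m n h
  have conj [simp]: "\<lbrakk>m \<in> Obj D; n \<in> Obj D; h \<in> D.mor m n\<rbrakk> \<Longrightarrow> conj m n h \<in> D.mor (?F (G m)) (?F (G n))" for m n h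
    unfolding conj_def by simp
  define Gm where "Gm m n h = (SOME f. f \<in> C.mor (G m) (G n) \<and> on_hom F (G m) (G n) f = conj m n h)" for m n h
  have Gm: "Gm m n h \<in> C.mor (G m) (G n) \<and> on_hom F (G m) (G n) (Gm m n h) = conj m n h"
    if "m \<in> Obj D" "n \<in> Obj D" "h \<in> D.mor m n" for m n h
    unfolding Gm_def by (rule someI_ex) (use surj[of "G m" "G n" "conj m n h"] that in auto)
  then have Gm_mor [simp]: "\<lbrakk>m \<in> Obj D; n \<in> Obj D; h \<in> D.mor m n\<rbrakk> \<Longrightarrow> Gm m n h \<in> C.mor (G m) (G n)"
    and FGm: "\<lbrakk>m \<in> Obj D; n \<in> Obj D; h \<in> D.mor m n\<rbrakk> \<Longrightarrow> on_hom F (G m) (G n) (Gm m n h) = conj m n h" for m n h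
    by blast+
  have GmI: "Gm m n h = f" if "m \<in> Obj D" "n \<in> Obj D" "h \<in> D.mor m n" "f \<in> C.mor (G m) (G n)"
    "on_hom F (G m) (G n) f = conj m n h" for m n h f
    using inj[of "G m" "G n" "Gm m n h" f] FGm[of m n h] that by simp
  let ?G = "\<lparr>on_obj = G, on_hom = Gm\<rparr>"
  have Gfun: "linear_functor K D C ?G"
  proof (rule linear_functorI, simp_all)
    fix m n assume mn: "m \<in> Obj D" "n \<in> Obj D"
    show "Gm m n (h \<oplus>\<^bsub>Hom D m n\<^esub> h') = Gm m n h \<oplus>\<^bsub>Hom C (G m) (G n)\<^esub> Gm m n h'"
      if "h \<in> D.mor m n" "h' \<in> D.mor m n" for h h'
      by (rule GmI) (use that mn in \<open>simp_all add: linear_functor_add[OF F] FGm conj_def D.Cmp_add_left D.Cmp_add_right\<close>)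
    show "Gm m n (c \<odot>\<^bsub>Hom D m n\<^esub> h) = c \<odot>\<^bsub>Hom C (G m) (G n)\<^esub> Gm m n h"
      if "c \<in> carrier K" "h \<in> D.mor m n" for c h
      by (rule GmI) (use that mn in \<open>simp_all add: linear_functor_smult[OF F] FGm conj_def D.Cmp_smult_left D.Cmp_smult_right\<close>)
  next
    fix m assume m: "m \<in> Obj D"
    show "Gm m m (Idt D m) = Idt C (G m)"
      by (rule GmI) (use m in \<open>simp_all add: linear_functor_Idt[OF F] conj_def\<close>)
  next
    fix l m n h h' assume lmn: "l \<in> Obj D" "m \<in> Obj D" "n \<in> Obj D" and h: "h \<in> D.mor m n" "h' \<in> D.mor l m"
    have "Cmp D (?F (G l)) (?F (G m)) m (e m) (Cmp D (?F (G l)) m (?F (G m)) (e' m) (Cmp D (?F (G l)) l m h' (e l)))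
      = Cmp D (?F (G l)) m m (Idt D m) (Cmp D (?F (G l)) l m h' (e l))"
      by (rule D.Cmp_reassoc[OF ee']) (use lmn h in simp_all)
    then show "Gm l n (Cmp D l m n h h') = Cmp C (G l) (G m) (G n) (Gm m n h) (Gm l m h')"
      by (intro GmI) (use lmn h in \<open>simp_all add: linear_functor_Cmp[OF F] FGm conj_def D.Cmp_assoc\<close>)
  qed
  have FG: "naturally_isomorphic D D (fun_comp F ?G) fun_id"
    unfolding naturally_isomorphic_def fun_comp_def fun_id_def
  proof (simp, intro exI[of _ e] conjI ballI)
    fix m assume m: "m \<in> Obj D"
    show "is_iso D (?F (G m)) m (e m)" unfolding is_iso_def using m by (auto intro!: bexI[of _ "e' m"])
  next
    fix m n h assume mn: "m \<in> Obj D" "n \<in> Obj D" and h: "h \<in> D.mor m n"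
    show "Cmp D (?F (G m)) (?F (G n)) n (e n) (on_hom F (G m) (G n) (Gm m n h)) = Cmp D (?F (G m)) m n h (e m)"
      unfolding FGm[OF mn h] conj_def
      using D.Cmp_reassoc[OF ee'[OF mn(2)], of "?F (G m)" "Cmp D (?F (G m)) m n h (e m)"] mn h by simp
  qed
  have "\<forall>x. \<exists>u u'. x \<in> Obj C \<longrightarrow> u \<in> C.mor (G (?F x)) x \<and> u' \<in> C.mor x (G (?F x)) \<and>
    on_hom F (G (?F x)) x u = e (?F x) \<and> on_hom F x (G (?F x)) u' = e' (?F x)"
    using surj[OF Go[OF Fo] _ e[OF Fo]] surj[OF _ Go[OF Fo] e'[OF Fo]] by meson
  then obtain u u' where uu: "\<And>x. x \<in> Obj C \<Longrightarrow> u x \<in> C.mor (G (?F x)) x \<and> u' x \<in> C.mor x (G (?F x)) \<and>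
    on_hom F (G (?F x)) x (u x) = e (?F x) \<and> on_hom F x (G (?F x)) (u' x) = e' (?F x)"
    by metis
  have GF: "naturally_isomorphic C C (fun_comp ?G F) fun_id"
    unfolding naturally_isomorphic_def fun_comp_def fun_id_def
  proof (simp, intro exI[of _ u] conjI ballI)
    fix x assume x: "x \<in> Obj C"
    have "Cmp C (G (?F x)) x (G (?F x)) (u' x) (u x) = Idt C (G (?F x))"
      by (rule inj[of "G (?F x)" "G (?F x)"])
        (use uu[OF x] x in \<open>simp_all add: linear_functor_Cmp[OF F] linear_functor_Idt[OF F]\<close>)
    moreover have "Cmp C x (G (?F x)) x (u x) (u' x) = Idt C x"
      by (rule inj[of x x])
        (use uu[OF x] x in \<open>simp_all add: linear_functor_Cmp[OF F] linear_functor_Idt[OF F]\<close>)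
    ultimately show "is_iso C (G (?F x)) x (u x)" unfolding is_iso_def using uu[OF x] by blast
  next
    fix x y f assume xy: "x \<in> Obj C" "y \<in> Obj C" and f: "f \<in> C.mor x y"
    have "Cmp D (?F (G (?F x))) (?F (G (?F y))) (?F y) (e (?F y)) (conj (?F x) (?F y) (on_hom F x y f))
      = Cmp D (?F (G (?F x))) (?F x) (?F y) (on_hom F x y f) (e (?F x))"
      unfolding conj_def
      using D.Cmp_reassoc[OF ee'[OF Fo[OF xy(2)]], of "?F (G (?F x))" "Cmp D (?F (G (?F x))) (?F x) (?F y) (on_hom F x y f) (e (?F x))"] xy f
      by simp
    then show "Cmp C (G (?F x)) (G (?F y)) y (u y) (Gm (?F x) (?F y) (on_hom F x y f)) = Cmp C (G (?F x)) x y f (u x)"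
      by (intro inj[of "G (?F x)" y])
        (use uu[OF xy(1)] uu[OF xy(2)] xy f in \<open>simp_all add: linear_functor_Cmp[OF F] FGm\<close>)
  qed
  show ?thesis unfolding linear_equivalence_def using F Gfun FG GF by blast
qed

lemma full_subcat_linear_category:
  assumes "linear_category K C" "U \<subseteq> Obj C"
  shows "linear_category K (full_subcat C U)"
proof -
  interpret linear_category K C by (fact assms)
  have U: "\<And>x. x \<in> U \<Longrightarrow> x \<in> Obj C" using assms(2) by blast
  show ?thesis
  proof (rule linear_category.intro)
    show "field K" by (fact field_K)
  qed (use U in \<open>simp_all add: full_subcat_def Hom_vectorspace Cmp_assoc Cmp_add_left Cmp_add_right
      Cmp_smult_left Cmp_smult_right\<close>)
qed


section \<open>Modules over a finite dimensional algebra\<close>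

lemma right_moduleD:
  assumes "right_module A M"
  shows right_module_ring: "ring A"
    and right_module_group: "abelian_group M"
    and right_smult_closed: "\<lbrakk>a \<in> carrier A; v \<in> carrier M\<rbrakk> \<Longrightarrow> a \<odot>\<^bsub>M\<^esub> v \<in> carrier M"
    and right_smult_add_left: "\<lbrakk>a \<in> carrier A; b \<in> carrier A; v \<in> carrier M\<rbrakk> \<Longrightarrow>
      (a \<oplus>\<^bsub>A\<^esub> b) \<odot>\<^bsub>M\<^esub> v = a \<odot>\<^bsub>M\<^esub> v \<oplus>\<^bsub>M\<^esub> b \<odot>\<^bsub>M\<^esub> v"
    and right_smult_add_right: "\<lbrakk>a \<in> carrier A; v \<in> carrier M; u \<in> carrier M\<rbrakk> \<Longrightarrow>
      a \<odot>\<^bsub>M\<^esub> (v \<oplus>\<^bsub>M\<^esub> u) = a \<odot>\<^bsub>M\<^esub> v \<oplus>\<^bsub>M\<^esub> a \<odot>\<^bsub>M\<^esub> u"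
    and right_smult_assoc: "\<lbrakk>a \<in> carrier A; b \<in> carrier A; v \<in> carrier M\<rbrakk> \<Longrightarrow>
      (a \<otimes>\<^bsub>A\<^esub> b) \<odot>\<^bsub>M\<^esub> v = b \<odot>\<^bsub>M\<^esub> (a \<odot>\<^bsub>M\<^esub> v)"
    and right_smult_one: "v \<in> carrier M \<Longrightarrow> \<one>\<^bsub>A\<^esub> \<odot>\<^bsub>M\<^esub> v = v"
  using assms unfolding right_module_def by auto

lemma right_smult_zero:
  assumes M: "right_module A M" and a: "a \<in> carrier A"
  shows "a \<odot>\<^bsub>M\<^esub> \<zero>\<^bsub>M\<^esub> = \<zero>\<^bsub>M\<^esub>"
proof -
  interpret M: abelian_group M by (rule right_module_group[OF M])
  have "a \<odot>\<^bsub>M\<^esub> \<zero>\<^bsub>M\<^esub> = a \<odot>\<^bsub>M\<^esub> \<zero>\<^bsub>M\<^esub> \<oplus>\<^bsub>M\<^esub> a \<odot>\<^bsub>M\<^esub> \<zero>\<^bsub>M\<^esub>"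
    using right_smult_add_right[OF M a, of "\<zero>\<^bsub>M\<^esub>" "\<zero>\<^bsub>M\<^esub>"] by simp
  then show ?thesis using right_smult_closed[OF M a, of "\<zero>\<^bsub>M\<^esub>"] by (metis M.zero_closed M.add.r_cancel_one')
qed

lemma right_homD:
  assumes "f \<in> right_hom A M N"
  shows right_hom_closed: "v \<in> carrier M \<Longrightarrow> f v \<in> carrier N"
    and right_hom_add: "\<lbrakk>v \<in> carrier M; u \<in> carrier M\<rbrakk> \<Longrightarrow> f (v \<oplus>\<^bsub>M\<^esub> u) = f v \<oplus>\<^bsub>N\<^esub> f u"
    and right_hom_smult: "\<lbrakk>a \<in> carrier A; v \<in> carrier M\<rbrakk> \<Longrightarrow> f (a \<odot>\<^bsub>M\<^esub> v) = a \<odot>\<^bsub>N\<^esub> f v"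
    and right_hom_restrict: "(\<lambda>v \<in> carrier M. f v) = f"
  using assms unfolding right_hom_def by (auto simp: PiE_mem PiE_restrict)

lemma right_hom_eqI:
  assumes "f \<in> right_hom A M N" "g \<in> right_hom A M N'" "\<And>v. v \<in> carrier M \<Longrightarrow> f v = g v"
  shows "f = g"
proof -
  have "(\<lambda>v \<in> carrier M. f v) = (\<lambda>v \<in> carrier M. g v)" using assms(3) by (rule restrict_ext)
  then show ?thesis unfolding right_hom_restrict[OF assms(1)] right_hom_restrict[OF assms(2)] .
qed

lemma right_homI:
  assumes "\<And>v. v \<in> carrier M \<Longrightarrow> f v \<in> carrier N"
    and "\<And>v u. \<lbrakk>v \<in> carrier M; u \<in> carrier M\<rbrakk> \<Longrightarrow> f (v \<oplus>\<^bsub>M\<^esub> u) = f v \<oplus>\<^bsub>N\<^esub> f u"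
    and "\<And>a v. \<lbrakk>a \<in> carrier A; v \<in> carrier M\<rbrakk> \<Longrightarrow> f (a \<odot>\<^bsub>M\<^esub> v) = a \<odot>\<^bsub>N\<^esub> f v"
    and M: "right_module A M"
  shows "(\<lambda>v \<in> carrier M. f v) \<in> right_hom A M N"
  using assms(1-3) right_smult_closed[OF M] abelian_monoid.a_closed[OF abelian_group.axioms(1)[OF right_module_group[OF M]]]
  unfolding right_hom_def by simp

lemma mod_cat_simps [simp]:
  "Obj (mod_cat A) = {M. right_module A M \<and> finitely_generated A M}"
  "carrier (Hom (mod_cat A) M N) = right_hom A M N"
  "zero (Hom (mod_cat A) M N) = (\<lambda>v\<in>carrier M. \<zero>\<^bsub>N\<^esub>)"
  "add (Hom (mod_cat A) M N) f g = (\<lambda>v\<in>carrier M. f v \<oplus>\<^bsub>N\<^esub> g v)"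
  "Module.smult (Hom (mod_cat A) M N) c f = (\<lambda>v\<in>carrier M. (c \<odot>\<^bsub>A\<^esub> \<one>\<^bsub>A\<^esub>) \<odot>\<^bsub>N\<^esub> f v)"
  "Idt (mod_cat A) M = (\<lambda>v\<in>carrier M. v)"
  "Cmp (mod_cat A) L M N g f = compose (carrier L) g f"
  by (simp_all add: mod_cat_def)

locale fin_dim_algebra =
  fixes K :: "('k, 'r) ring_scheme" and A :: "('k, 'a) module"
  assumes fd: "fd_algebra K A"
begin

sublocale A: ring A
  using fd unfolding fd_algebra_def by blast

sublocale AV: vectorspace K A
  using fd unfolding fd_algebra_def by blast

lemma smult_mult: "\<lbrakk>c \<in> carrier K; a \<in> carrier A; b \<in> carrier A\<rbrakk> \<Longrightarrow> (c \<odot>\<^bsub>A\<^esub> a) \<otimes>\<^bsub>A\<^esub> b = c \<odot>\<^bsub>A\<^esub> (a \<otimes>\<^bsub>A\<^esub> b)"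
  and mult_smult: "\<lbrakk>c \<in> carrier K; a \<in> carrier A; b \<in> carrier A\<rbrakk> \<Longrightarrow> a \<otimes>\<^bsub>A\<^esub> (c \<odot>\<^bsub>A\<^esub> b) = c \<odot>\<^bsub>A\<^esub> (a \<otimes>\<^bsub>A\<^esub> b)"
  using fd unfolding fd_algebra_def by auto

text \<open>Multiplication by a scalar of the ground field is a homomorphism of modules; this is what makes the
  homomorphisms a vector space.\<close>

lemma scalar_central:
  assumes "right_module A M" "c \<in> carrier K" "a \<in> carrier A" "v \<in> carrier M"
  shows "(c \<odot>\<^bsub>A\<^esub> \<one>\<^bsub>A\<^esub>) \<odot>\<^bsub>M\<^esub> (a \<odot>\<^bsub>M\<^esub> v) = a \<odot>\<^bsub>M\<^esub> ((c \<odot>\<^bsub>A\<^esub> \<one>\<^bsub>A\<^esub>) \<odot>\<^bsub>M\<^esub> v)"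
  using assms(2-4) right_smult_assoc[OF assms(1), of a "c \<odot>\<^bsub>A\<^esub> \<one>\<^bsub>A\<^esub>" v]
    right_smult_assoc[OF assms(1), of "c \<odot>\<^bsub>A\<^esub> \<one>\<^bsub>A\<^esub>" a v]
  by (simp add: smult_mult mult_smult)

lemma right_hom_vectorspace:
  assumes M: "right_module A M" and N: "right_module A N"
  shows "vectorspace K (Hom (mod_cat A) M N)"
proof -
  interpret N: abelian_group N by (rule right_module_group[OF N])
  note [simp] = right_hom_closed right_hom_add right_hom_smult right_smult_closed[OF N] right_smult_zero[OF N]
    right_smult_add_left[OF N] right_smult_add_right[OF N] right_smult_one[OF N]
    right_smult_closed[OF M] abelian_monoid.a_closed[OF abelian_group.axioms(1)[OF right_module_group[OF M]]]
  have zero: "(\<lambda>v \<in> carrier M. \<zero>\<^bsub>N\<^esub>) \<in> right_hom A M N"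
    by (rule right_homI[OF _ _ _ M]) simp_all
  have add: "(\<lambda>v \<in> carrier M. f v \<oplus>\<^bsub>N\<^esub> g v) \<in> right_hom A M N" if "f \<in> right_hom A M N" "g \<in> right_hom A M N" for f g
  proof (rule right_homI[OF _ _ _ M])
    fix v u assume vu: "v \<in> carrier M" "u \<in> carrier M"
    then have "f v \<in> carrier N" "f u \<in> carrier N" "g v \<in> carrier N" "g u \<in> carrier N" using that by simp_all
    moreover have "f (v \<oplus>\<^bsub>M\<^esub> u) = f v \<oplus>\<^bsub>N\<^esub> f u" "g (v \<oplus>\<^bsub>M\<^esub> u) = g v \<oplus>\<^bsub>N\<^esub> g u"
      using right_hom_add[OF that(1) vu] right_hom_add[OF that(2) vu] .
    ultimately show "f (v \<oplus>\<^bsub>M\<^esub> u) \<oplus>\<^bsub>N\<^esub> g (v \<oplus>\<^bsub>M\<^esub> u) = f v \<oplus>\<^bsub>N\<^esub> g v \<oplus>\<^bsub>N\<^esub> (f u \<oplus>\<^bsub>N\<^esub> g u)"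
      by (simp add: N.a_ac)
  qed (use that in \<open>simp_all add: right_hom_smult[OF that(1)] right_hom_smult[OF that(2)]\<close>)
  have smult: "(\<lambda>v \<in> carrier M. (c \<odot>\<^bsub>A\<^esub> \<one>\<^bsub>A\<^esub>) \<odot>\<^bsub>N\<^esub> f v) \<in> right_hom A M N"
    if "c \<in> carrier K" "f \<in> right_hom A M N" for c f
  proof (rule right_homI[OF _ _ _ M])
    fix a v assume "a \<in> carrier A" "v \<in> carrier M"
    then show "(c \<odot>\<^bsub>A\<^esub> \<one>\<^bsub>A\<^esub>) \<odot>\<^bsub>N\<^esub> f (a \<odot>\<^bsub>M\<^esub> v) = a \<odot>\<^bsub>N\<^esub> ((c \<odot>\<^bsub>A\<^esub> \<one>\<^bsub>A\<^esub>) \<odot>\<^bsub>N\<^esub> f v)"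
      using scalar_central[OF N that(1), of a "f v"] right_hom_smult[OF that(2), of a v] right_hom_closed[OF that(2), of v]
      by simp
  next
    fix v u assume "v \<in> carrier M" "u \<in> carrier M"
    then show "(c \<odot>\<^bsub>A\<^esub> \<one>\<^bsub>A\<^esub>) \<odot>\<^bsub>N\<^esub> f (v \<oplus>\<^bsub>M\<^esub> u) = (c \<odot>\<^bsub>A\<^esub> \<one>\<^bsub>A\<^esub>) \<odot>\<^bsub>N\<^esub> f v \<oplus>\<^bsub>N\<^esub> (c \<odot>\<^bsub>A\<^esub> \<one>\<^bsub>A\<^esub>) \<odot>\<^bsub>N\<^esub> f u"
      using right_hom_add[OF that(2), of v u] right_hom_closed[OF that(2)] that(1) by simp
  qed (use that in simp)
  show ?thesis
  proof (rule vs_criteria, simp_all only: mod_cat_simps)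
    show "field K" by (fact AV.field_axioms)
    show "(\<lambda>v \<in> carrier M. \<zero>\<^bsub>N\<^esub>) \<in> right_hom A M N" by (fact zero)
    show "\<forall>f g. f \<in> right_hom A M N \<and> g \<in> right_hom A M N \<longrightarrow> (\<lambda>v \<in> carrier M. f v \<oplus>\<^bsub>N\<^esub> g v) \<in> right_hom A M N"
      using add by blast
    show "\<forall>c f. c \<in> carrier K \<and> f \<in> right_hom A M N \<longrightarrow> (\<lambda>v \<in> carrier M. (c \<odot>\<^bsub>A\<^esub> \<one>\<^bsub>A\<^esub>) \<odot>\<^bsub>N\<^esub> f v) \<in> right_hom A M N"
      using smult by blast
    show "\<forall>f \<in> right_hom A M N. \<exists>g \<in> right_hom A M N. (\<lambda>v \<in> carrier M. f v \<oplus>\<^bsub>N\<^esub> g v) = (\<lambda>v \<in> carrier M. \<zero>\<^bsub>N\<^esub>)"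
    proof
      fix f assume f: "f \<in> right_hom A M N"
      let ?g = "\<lambda>v \<in> carrier M. ((\<ominus>\<^bsub>K\<^esub> \<one>\<^bsub>K\<^esub>) \<odot>\<^bsub>A\<^esub> \<one>\<^bsub>A\<^esub>) \<odot>\<^bsub>N\<^esub> f v"
      have "(\<lambda>v \<in> carrier M. f v \<oplus>\<^bsub>N\<^esub> ?g v) = (\<lambda>v \<in> carrier M. \<zero>\<^bsub>N\<^esub>)"
      proof (rule restrict_ext)
        fix v assume v: "v \<in> carrier M"
        then have fv: "f v \<in> carrier N" using f by simp
        have "f v \<oplus>\<^bsub>N\<^esub> ((\<ominus>\<^bsub>K\<^esub> \<one>\<^bsub>K\<^esub>) \<odot>\<^bsub>A\<^esub> \<one>\<^bsub>A\<^esub>) \<odot>\<^bsub>N\<^esub> f v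
          = (\<one>\<^bsub>A\<^esub> \<oplus>\<^bsub>A\<^esub> (\<ominus>\<^bsub>K\<^esub> \<one>\<^bsub>K\<^esub>) \<odot>\<^bsub>A\<^esub> \<one>\<^bsub>A\<^esub>) \<odot>\<^bsub>N\<^esub> f v"
          using fv by simp
        also have "\<one>\<^bsub>A\<^esub> \<oplus>\<^bsub>A\<^esub> (\<ominus>\<^bsub>K\<^esub> \<one>\<^bsub>K\<^esub>) \<odot>\<^bsub>A\<^esub> \<one>\<^bsub>A\<^esub> = \<zero>\<^bsub>A\<^esub>"
          by (simp add: AV.smult_minus_1 A.r_neg)
        also have "\<zero>\<^bsub>A\<^esub> \<odot>\<^bsub>N\<^esub> f v = \<zero>\<^bsub>N\<^esub>"
        proof -
          have "\<zero>\<^bsub>A\<^esub> \<odot>\<^bsub>N\<^esub> f v = \<zero>\<^bsub>A\<^esub> \<odot>\<^bsub>N\<^esub> f v \<oplus>\<^bsub>N\<^esub> \<zero>\<^bsub>A\<^esub> \<odot>\<^bsub>N\<^esub> f v"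
            using right_smult_add_left[OF N, of "\<zero>\<^bsub>A\<^esub>" "\<zero>\<^bsub>A\<^esub>" "f v"] fv by simp
          moreover have "\<zero>\<^bsub>A\<^esub> \<odot>\<^bsub>N\<^esub> f v \<in> carrier N" using fv by simp
          ultimately show ?thesis by (metis N.add.r_cancel_one')
        qed
        finally show "f v \<oplus>\<^bsub>N\<^esub> ?g v = \<zero>\<^bsub>N\<^esub>" using v by simp
      qed
      then show "\<exists>g \<in> right_hom A M N. (\<lambda>v \<in> carrier M. f v \<oplus>\<^bsub>N\<^esub> g v) = (\<lambda>v \<in> carrier M. \<zero>\<^bsub>N\<^esub>)"
        using smult[OF _ f, of "\<ominus>\<^bsub>K\<^esub> \<one>\<^bsub>K\<^esub>"] by blast
    qed
    show "\<forall>f g. f \<in> right_hom A M N \<and> g \<in> right_hom A M N \<longrightarrow>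
      (\<lambda>v \<in> carrier M. f v \<oplus>\<^bsub>N\<^esub> g v) = (\<lambda>v \<in> carrier M. g v \<oplus>\<^bsub>N\<^esub> f v)"
      by (auto intro!: restrict_ext N.a_comm)
    show "\<forall>f g h. f \<in> right_hom A M N \<and> g \<in> right_hom A M N \<and> h \<in> right_hom A M N \<longrightarrow>
      (\<lambda>v \<in> carrier M. (\<lambda>v \<in> carrier M. f v \<oplus>\<^bsub>N\<^esub> g v) v \<oplus>\<^bsub>N\<^esub> h v)
      = (\<lambda>v \<in> carrier M. f v \<oplus>\<^bsub>N\<^esub> (\<lambda>v \<in> carrier M. g v \<oplus>\<^bsub>N\<^esub> h v) v)"
      by (auto intro!: restrict_ext N.a_assoc)
    show "\<forall>f \<in> right_hom A M N. (\<lambda>v \<in> carrier M. f v \<oplus>\<^bsub>N\<^esub> (\<lambda>v \<in> carrier M. \<zero>\<^bsub>N\<^esub>) v) = f"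
    proof
      fix f assume f: "f \<in> right_hom A M N"
      have "(\<lambda>v \<in> carrier M. f v \<oplus>\<^bsub>N\<^esub> (\<lambda>v \<in> carrier M. \<zero>\<^bsub>N\<^esub>) v) = (\<lambda>v \<in> carrier M. f v)"
        by (rule restrict_ext) (use f in simp)
      then show "(\<lambda>v \<in> carrier M. f v \<oplus>\<^bsub>N\<^esub> (\<lambda>v \<in> carrier M. \<zero>\<^bsub>N\<^esub>) v) = f"
        using right_hom_restrict[OF f] by simp
    qed
    show "\<forall>a b f. a \<in> carrier K \<and> b \<in> carrier K \<and> f \<in> right_hom A M N \<longrightarrow>
      (\<lambda>v \<in> carrier M. ((a \<otimes>\<^bsub>K\<^esub> b) \<odot>\<^bsub>A\<^esub> \<one>\<^bsub>A\<^esub>) \<odot>\<^bsub>N\<^esub> f v)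
      = (\<lambda>v \<in> carrier M. (a \<odot>\<^bsub>A\<^esub> \<one>\<^bsub>A\<^esub>) \<odot>\<^bsub>N\<^esub> (\<lambda>v \<in> carrier M. (b \<odot>\<^bsub>A\<^esub> \<one>\<^bsub>A\<^esub>) \<odot>\<^bsub>N\<^esub> f v) v)"
    proof (intro allI impI restrict_ext, elim conjE)
      fix a b f v assume ab: "a \<in> carrier K" "b \<in> carrier K" and f: "f \<in> right_hom A M N" and v: "v \<in> carrier M"
      have "(a \<otimes>\<^bsub>K\<^esub> b) \<odot>\<^bsub>A\<^esub> \<one>\<^bsub>A\<^esub> = (b \<odot>\<^bsub>A\<^esub> \<one>\<^bsub>A\<^esub>) \<otimes>\<^bsub>A\<^esub> (a \<odot>\<^bsub>A\<^esub> \<one>\<^bsub>A\<^esub>)"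
        using ab by (simp add: smult_mult mult_smult AV.m_comm flip: AV.smult_assoc1)
      then show "((a \<otimes>\<^bsub>K\<^esub> b) \<odot>\<^bsub>A\<^esub> \<one>\<^bsub>A\<^esub>) \<odot>\<^bsub>N\<^esub> f v
        = (a \<odot>\<^bsub>A\<^esub> \<one>\<^bsub>A\<^esub>) \<odot>\<^bsub>N\<^esub> (\<lambda>v \<in> carrier M. (b \<odot>\<^bsub>A\<^esub> \<one>\<^bsub>A\<^esub>) \<odot>\<^bsub>N\<^esub> f v) v"
        using ab f v by (simp add: right_smult_assoc[OF N])
    qed
    show "\<forall>f \<in> right_hom A M N. (\<lambda>v \<in> carrier M. (\<one>\<^bsub>K\<^esub> \<odot>\<^bsub>A\<^esub> \<one>\<^bsub>A\<^esub>) \<odot>\<^bsub>N\<^esub> f v) = f"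
    proof
      fix f assume f: "f \<in> right_hom A M N"
      have "(\<lambda>v \<in> carrier M. (\<one>\<^bsub>K\<^esub> \<odot>\<^bsub>A\<^esub> \<one>\<^bsub>A\<^esub>) \<odot>\<^bsub>N\<^esub> f v) = (\<lambda>v \<in> carrier M. f v)"
        by (rule restrict_ext) (use f in simp)
      then show "(\<lambda>v \<in> carrier M. (\<one>\<^bsub>K\<^esub> \<odot>\<^bsub>A\<^esub> \<one>\<^bsub>A\<^esub>) \<odot>\<^bsub>N\<^esub> f v) = f"
        using right_hom_restrict[OF f] by simp
    qed
    show "\<forall>a b f. a \<in> carrier K \<and> b \<in> carrier K \<and> f \<in> right_hom A M N \<longrightarrow>
      (\<lambda>v \<in> carrier M. ((a \<oplus>\<^bsub>K\<^esub> b) \<odot>\<^bsub>A\<^esub> \<one>\<^bsub>A\<^esub>) \<odot>\<^bsub>N\<^esub> f v)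
      = (\<lambda>v \<in> carrier M. (\<lambda>v \<in> carrier M. (a \<odot>\<^bsub>A\<^esub> \<one>\<^bsub>A\<^esub>) \<odot>\<^bsub>N\<^esub> f v) v \<oplus>\<^bsub>N\<^esub>
          (\<lambda>v \<in> carrier M. (b \<odot>\<^bsub>A\<^esub> \<one>\<^bsub>A\<^esub>) \<odot>\<^bsub>N\<^esub> f v) v)"
      by (auto intro!: restrict_ext simp: AV.smult_l_distr)
    show "\<forall>a f g. a \<in> carrier K \<and> f \<in> right_hom A M N \<and> g \<in> right_hom A M N \<longrightarrow>
      (\<lambda>v \<in> carrier M. (a \<odot>\<^bsub>A\<^esub> \<one>\<^bsub>A\<^esub>) \<odot>\<^bsub>N\<^esub> (\<lambda>v \<in> carrier M. f v \<oplus>\<^bsub>N\<^esub> g v) v)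
      = (\<lambda>v \<in> carrier M. (\<lambda>v \<in> carrier M. (a \<odot>\<^bsub>A\<^esub> \<one>\<^bsub>A\<^esub>) \<odot>\<^bsub>N\<^esub> f v) v \<oplus>\<^bsub>N\<^esub>
          (\<lambda>v \<in> carrier M. (a \<odot>\<^bsub>A\<^esub> \<one>\<^bsub>A\<^esub>) \<odot>\<^bsub>N\<^esub> g v) v)"
      by (auto intro!: restrict_ext)
  qed
qed

lemma right_hom_compose:
  assumes L: "right_module A L" and f: "f \<in> right_hom A L M" and g: "g \<in> right_hom A M N"
  shows "compose (carrier L) g f \<in> right_hom A L N"
  unfolding compose_def by (rule right_homI[OF _ _ _ L])
    (use right_hom_closed[OF f] right_hom_closed[OF g] in
      \<open>simp_all add: right_hom_add[OF f] right_hom_add[OF g] right_hom_smult[OF f] right_hom_smult[OF g]\<close>)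

lemma right_hom_id: "right_module A M \<Longrightarrow> (\<lambda>v \<in> carrier M. v) \<in> right_hom A M M"
  by (rule right_homI) auto

lemma mod_cat_linear_category: "linear_category K (mod_cat A :: ('k, ('a, 'v) module, 'v \<Rightarrow> 'v) lin_cat)"
proof (rule linear_category.intro)
  show "field K" by (fact AV.field_axioms)
  fix L M N :: "('a, 'v) module"
  assume L: "L \<in> Obj (mod_cat A)" and M: "M \<in> Obj (mod_cat A)"
  then have Lm: "right_module A L" and Mm: "right_module A M" by auto
  show "vectorspace K (Hom (mod_cat A) L M)" by (rule right_hom_vectorspace[OF Lm Mm])
  show "Idt (mod_cat A) L \<in> carrier (Hom (mod_cat A) L L)" using right_hom_id[OF Lm] by simp
  fix f assume f: "f \<in> carrier (Hom (mod_cat A) L M)"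
  then have f': "f \<in> right_hom A L M" by simp
  show "Cmp (mod_cat A) L M M (Idt (mod_cat A) M) f = f"
    using f' right_hom_closed[OF f'] right_hom_compose[OF Lm f' right_hom_id[OF Mm]]
    by (intro right_hom_eqI[of _ A L M f M]) (auto simp: compose_def)
  show "Cmp (mod_cat A) L L M f (Idt (mod_cat A) L) = f"
    using f' right_hom_compose[OF Lm right_hom_id[OF Lm] f']
    by (intro right_hom_eqI[of _ A L M f M]) (auto simp: compose_def)
  assume N: "N \<in> Obj (mod_cat A)"
  then have Nm: "right_module A N" by simp
  fix g assume g: "g \<in> carrier (Hom (mod_cat A) M N)"
  then have g': "g \<in> right_hom A M N" by simp
  note [simp] = right_hom_closed[OF f'] right_hom_closed[OF g']
  show "Cmp (mod_cat A) L M N g f \<in> carrier (Hom (mod_cat A) L N)"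
    using right_hom_compose[OF Lm f' g'] by simp
  show "Cmp (mod_cat A) L M N (g \<oplus>\<^bsub>Hom (mod_cat A) M N\<^esub> g2) f
    = Cmp (mod_cat A) L M N g f \<oplus>\<^bsub>Hom (mod_cat A) L N\<^esub> Cmp (mod_cat A) L M N g2 f"
    if "g2 \<in> carrier (Hom (mod_cat A) M N)" for g2
    by (simp add: compose_def) (rule restrict_ext, simp)
  show "Cmp (mod_cat A) L M N g (f \<oplus>\<^bsub>Hom (mod_cat A) L M\<^esub> f2)
    = Cmp (mod_cat A) L M N g f \<oplus>\<^bsub>Hom (mod_cat A) L N\<^esub> Cmp (mod_cat A) L M N g f2"
    if f2: "f2 \<in> carrier (Hom (mod_cat A) L M)" for f2
  proof -
    have "f2 v \<in> carrier M" if "v \<in> carrier L" for v using right_hom_closed f2 that by simp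
    then show ?thesis by (simp add: compose_def) (rule restrict_ext, simp add: right_hom_add[OF g'])
  qed
  fix c assume c: "c \<in> carrier K"
  show "Cmp (mod_cat A) L M N (c \<odot>\<^bsub>Hom (mod_cat A) M N\<^esub> g) f
    = c \<odot>\<^bsub>Hom (mod_cat A) L N\<^esub> Cmp (mod_cat A) L M N g f"
    by (simp add: compose_def) (rule restrict_ext, simp)
  show "Cmp (mod_cat A) L M N g (c \<odot>\<^bsub>Hom (mod_cat A) L M\<^esub> f)
    = c \<odot>\<^bsub>Hom (mod_cat A) L N\<^esub> Cmp (mod_cat A) L M N g f"
    by (simp add: compose_def) (rule restrict_ext, simp add: right_hom_smult[OF g'] c)
next
  fix L M N Q :: "('a, 'v) module" and f g h
  assume "h \<in> carrier (Hom (mod_cat A) N Q)" "g \<in> carrier (Hom (mod_cat A) M N)" "f \<in> carrier (Hom (mod_cat A) L M)"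
  then have "\<And>v. v \<in> carrier L \<Longrightarrow> f v \<in> carrier M" using right_hom_closed by simp
  then show "Cmp (mod_cat A) L M Q (Cmp (mod_cat A) M N Q h g) f
    = Cmp (mod_cat A) L N Q h (Cmp (mod_cat A) L M N g f)"
    by (simp add: compose_def) (rule restrict_ext, simp)
qed

lemma right_iso_inverse:
  assumes M: "right_module A M" and N: "right_module A N"
    and f: "f \<in> right_hom A M N" and b: "bij_betw f (carrier M) (carrier N)"
  obtains g where "g \<in> right_hom A N M" "bij_betw g (carrier N) (carrier M)"
    "\<And>v. v \<in> carrier M \<Longrightarrow> g (f v) = v" "\<And>v. v \<in> carrier N \<Longrightarrow> f (g v) = v"
proof -
  interpret M: abelian_group M by (rule right_module_group[OF M])
  let ?i = "the_inv_into (carrier M) f"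
  let ?g = "\<lambda>v \<in> carrier N. ?i v"
  have inj: "inj_on f (carrier M)" and im: "f ` carrier M = carrier N" using b unfolding bij_betw_def by auto
  have i1 [simp]: "?i (f v) = v" if "v \<in> carrier M" for v using the_inv_into_f_f[OF inj that] .
  have cl: "f v \<in> carrier N" if "v \<in> carrier M" for v using right_hom_closed[OF f that] .
  have g: "?g \<in> right_hom A N M"
  proof (rule right_homI[OF _ _ _ N])
    fix v u assume "v \<in> carrier N" "u \<in> carrier N"
    then obtain v' u' where *: "v' \<in> carrier M" "v = f v'" "u' \<in> carrier M" "u = f u'" using im by blast
    then have "v \<oplus>\<^bsub>N\<^esub> u = f (v' \<oplus>\<^bsub>M\<^esub> u')" using right_hom_add[OF f] by simp
    then show "?i (v \<oplus>\<^bsub>N\<^esub> u) = ?i v \<oplus>\<^bsub>M\<^esub> ?i u" using * by simp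
  next
    fix a v assume a: "a \<in> carrier A" and "v \<in> carrier N"
    then obtain v' where *: "v' \<in> carrier M" "v = f v'" using im by blast
    then have "a \<odot>\<^bsub>N\<^esub> v = f (a \<odot>\<^bsub>M\<^esub> v')" using right_hom_smult[OF f a] by simp
    then show "?i (a \<odot>\<^bsub>N\<^esub> v) = a \<odot>\<^bsub>M\<^esub> ?i v" using * right_smult_closed[OF M a] by simp
  qed (use the_inv_into_into[OF inj _ subset_refl] im in auto)
  have 1: "?g (f v) = v" if "v \<in> carrier M" for v using that cl by simp
  have 2: "f (?g v) = v" if "v \<in> carrier N" for v using that im f_the_inv_into_f[OF inj] by auto
  have "bij_betw ?g (carrier N) (carrier M)"
    by (rule bij_betw_byWitness[where f' = f]) (use 1 2 cl right_hom_closed[OF g] in auto)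
  then show thesis by (rule that[OF g _ 1 2])
qed

lemma right_iso_sym:
  assumes "right_module A M" "right_module A N" "right_iso A M N"
  shows "right_iso A N M"
proof -
  obtain f where "f \<in> right_hom A M N" "bij_betw f (carrier M) (carrier N)"
    using assms(3) unfolding right_iso_def by blast
  then obtain g where "g \<in> right_hom A N M" "bij_betw g (carrier N) (carrier M)"
    using right_iso_inverse[OF assms(1,2)] by metis
  then show ?thesis unfolding right_iso_def by blast
qed

lemma right_iso_refl: "right_module A M \<Longrightarrow> right_iso A M M"
  unfolding right_iso_def using right_hom_id[of M]
  by (auto intro!: bexI[of _ "\<lambda>v \<in> carrier M. v"] simp: bij_betw_def inj_on_def)

lemma right_iso_trans:
  assumes L: "right_module A L" and "right_iso A L M" "right_iso A M N"
  shows "right_iso A L N"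
proof -
  obtain f where f: "f \<in> right_hom A L M" "bij_betw f (carrier L) (carrier M)"
    using assms(2) unfolding right_iso_def by blast
  obtain g where g: "g \<in> right_hom A M N" "bij_betw g (carrier M) (carrier N)"
    using assms(3) unfolding right_iso_def by blast
  have "bij_betw (compose (carrier L) g f) (carrier L) (carrier N)" by (rule bij_betw_compose[OF f(2) g(2)])
  then show ?thesis unfolding right_iso_def using right_hom_compose[OF L f(1) g(1)] by blast
qed

lemma right_iso_isomorphic:
  assumes M: "right_module A M" and N: "right_module A N" and i: "right_iso A M N"
  shows "isomorphic (mod_cat A) M N"
proof -
  obtain f where f: "f \<in> right_hom A M N" "bij_betw f (carrier M) (carrier N)"
    using i unfolding right_iso_def by blast
  obtain g where g: "g \<in> right_hom A N M"
    "\<And>v. v \<in> carrier M \<Longrightarrow> g (f v) = v" "\<And>v. v \<in> carrier N \<Longrightarrow> f (g v) = v"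
    using right_iso_inverse[OF M N f] by metis
  have "compose (carrier M) g f = (\<lambda>v \<in> carrier M. v)" "compose (carrier N) f g = (\<lambda>v \<in> carrier N. v)"
    unfolding compose_def using g(2,3) by (auto intro!: restrict_ext)
  then show ?thesis unfolding isomorphic_def is_iso_def using f g by auto
qed

end


section \<open>The equivalence with modules over the endomorphism algebra\<close>

lemma right_zero_smult:
  assumes M: "right_module A M" and v: "v \<in> carrier M"
  shows "\<zero>\<^bsub>A\<^esub> \<odot>\<^bsub>M\<^esub> v = \<zero>\<^bsub>M\<^esub>"
proof -
  interpret A: ring A by (rule right_module_ring[OF M])
  interpret M: abelian_group M by (rule right_module_group[OF M])
  have "\<zero>\<^bsub>A\<^esub> \<odot>\<^bsub>M\<^esub> v = \<zero>\<^bsub>A\<^esub> \<odot>\<^bsub>M\<^esub> v \<oplus>\<^bsub>M\<^esub> \<zero>\<^bsub>A\<^esub> \<odot>\<^bsub>M\<^esub> v"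
    using right_smult_add_left[OF M, of "\<zero>\<^bsub>A\<^esub>" "\<zero>\<^bsub>A\<^esub>" v] v by simp
  then show ?thesis using right_smult_closed[OF M, of "\<zero>\<^bsub>A\<^esub>" v] v by (metis A.zero_closed M.add.r_cancel_one')
qed

locale represented_modules = projective_generator K C S P
  for K :: "('k, 'r) ring_scheme" and C :: "('k, 'o, 'm, 's) tri_cat_scheme" and S :: "'o set" and P :: "'o" +
  assumes hom_finite: "hom_finite K C"
begin

lemma mor_fin_dim: "x \<in> Obj C \<Longrightarrow> y \<in> Obj C \<Longrightarrow> vectorspace.fin_dim K (Hom C x y)"
  using hom_finite unfolding hom_finite_def by blast

text \<open>The algebra and the modules have to live on the type of coordinate vectors, so the structure of
  \<open>Hom(P, x)\<close> is transported along an arbitrary injection into that type.\<close>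

definition enc :: "'o \<Rightarrow> 'm \<Rightarrow> 'k coords" where
  "enc x = (SOME \<psi>. inj_on \<psi> (mor P x))"

definition dec :: "'o \<Rightarrow> 'k coords \<Rightarrow> 'm" where
  "dec x = the_inv_into (mor P x) (enc x)"

lemma enc_inj: "x \<in> Obj C \<Longrightarrow> inj_on (enc x) (mor P x)"
  unfolding enc_def
  by (rule someI_ex[of "\<lambda>\<psi>. inj_on \<psi> (mor P x)"])
    (rule vectorspace_coords_injection[OF Hom_vectorspace mor_fin_dim], simp_all)

lemma dec_enc [simp]: "x \<in> Obj C \<Longrightarrow> u \<in> mor P x \<Longrightarrow> dec x (enc x u) = u"
  unfolding dec_def by (rule the_inv_into_f_f[OF enc_inj])

lemma enc_eq_iff: "\<lbrakk>x \<in> Obj C; u \<in> mor P x; v \<in> mor P x\<rbrakk> \<Longrightarrow> enc x u = enc x v \<longleftrightarrow> u = v"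
  using enc_inj[of x] by (auto simp: inj_on_eq_iff)

definition alg :: "('k, 'k coords) module" where
  "alg = \<lparr>
     carrier = enc P ` mor P P,
     monoid.mult = (\<lambda>a b. enc P (Cmp C P P P (dec P a) (dec P b))),
     one = enc P (Idt C P),
     zero = enc P (nul P P),
     add = (\<lambda>a b. enc P (dec P a \<oplus>\<^bsub>Hom C P P\<^esub> dec P b)),
     smult = (\<lambda>c a. enc P (c \<odot>\<^bsub>Hom C P P\<^esub> dec P a))\<rparr>"

definition rep :: "'o \<Rightarrow> ('k coords, 'k coords) module" where
  "rep x = \<lparr>
     carrier = enc x ` mor P x,
     monoid.mult = (\<lambda>a b. undefined),
     one = undefined,
     zero = enc x (nul P x),
     add = (\<lambda>a b. enc x (dec x a \<oplus>\<^bsub>Hom C P x\<^esub> dec x b)),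
     smult = (\<lambda>a v. enc x (Cmp C P P x (dec x v) (dec P a)))\<rparr>"

lemma alg_simps [simp]:
  "carrier alg = enc P ` mor P P"
  "one alg = enc P (Idt C P)"
  "zero alg = enc P (nul P P)"
  "\<lbrakk>a \<in> mor P P; b \<in> mor P P\<rbrakk> \<Longrightarrow> enc P a \<otimes>\<^bsub>alg\<^esub> enc P b = enc P (Cmp C P P P a b)"
  "\<lbrakk>a \<in> mor P P; b \<in> mor P P\<rbrakk> \<Longrightarrow> enc P a \<oplus>\<^bsub>alg\<^esub> enc P b = enc P (a \<oplus>\<^bsub>Hom C P P\<^esub> b)"
  "\<lbrakk>c \<in> carrier K; a \<in> mor P P\<rbrakk> \<Longrightarrow> c \<odot>\<^bsub>alg\<^esub> enc P a = enc P (c \<odot>\<^bsub>Hom C P P\<^esub> a)"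
  by (simp_all add: alg_def)

lemma rep_simps [simp]:
  "carrier (rep x) = enc x ` mor P x"
  "zero (rep x) = enc x (nul P x)"
  "\<lbrakk>x \<in> Obj C; u \<in> mor P x; v \<in> mor P x\<rbrakk> \<Longrightarrow> enc x u \<oplus>\<^bsub>rep x\<^esub> enc x v = enc x (u \<oplus>\<^bsub>Hom C P x\<^esub> v)"
  "\<lbrakk>x \<in> Obj C; u \<in> mor P x; a \<in> mor P P\<rbrakk> \<Longrightarrow> enc P a \<odot>\<^bsub>rep x\<^esub> enc x u = enc x (Cmp C P P x u a)"
  by (simp_all add: rep_def)

lemma alg_vectorspace: "vectorspace K alg" "vectorspace.fin_dim K alg"
proof -
  have *: "vectorspace K alg \<and> (vectorspace.fin_dim K (Hom C P P) \<longrightarrow> vectorspace.fin_dim K alg)"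
    using vectorspace_surjective_image[of K "Hom C P P" "enc P" alg] Hom_vectorspace[of P P] by simp
  show "vectorspace K alg" "vectorspace.fin_dim K alg" using * mor_fin_dim by auto
qed

lemma mor_abelian_facts:
  assumes "x \<in> Obj C" "y \<in> Obj C"
  shows "\<lbrakk>u \<in> mor x y; v \<in> mor x y; w \<in> mor x y\<rbrakk> \<Longrightarrow>
      u \<oplus>\<^bsub>Hom C x y\<^esub> v \<oplus>\<^bsub>Hom C x y\<^esub> w = u \<oplus>\<^bsub>Hom C x y\<^esub> (v \<oplus>\<^bsub>Hom C x y\<^esub> w)"
    and "\<lbrakk>u \<in> mor x y; v \<in> mor x y\<rbrakk> \<Longrightarrow> u \<oplus>\<^bsub>Hom C x y\<^esub> v = v \<oplus>\<^bsub>Hom C x y\<^esub> u"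
    and "u \<in> mor x y \<Longrightarrow> \<ominus>\<^bsub>Hom C x y\<^esub> u \<oplus>\<^bsub>Hom C x y\<^esub> u = nul x y"
proof -
  interpret abelian_group "Hom C x y" by (rule mor_abelian[OF assms])
  show "\<lbrakk>u \<in> mor x y; v \<in> mor x y; w \<in> mor x y\<rbrakk> \<Longrightarrow>
      u \<oplus>\<^bsub>Hom C x y\<^esub> v \<oplus>\<^bsub>Hom C x y\<^esub> w = u \<oplus>\<^bsub>Hom C x y\<^esub> (v \<oplus>\<^bsub>Hom C x y\<^esub> w)" by (rule a_assoc)
  show "\<lbrakk>u \<in> mor x y; v \<in> mor x y\<rbrakk> \<Longrightarrow> u \<oplus>\<^bsub>Hom C x y\<^esub> v = v \<oplus>\<^bsub>Hom C x y\<^esub> u" by (rule a_comm)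
  show "u \<in> mor x y \<Longrightarrow> \<ominus>\<^bsub>Hom C x y\<^esub> u \<oplus>\<^bsub>Hom C x y\<^esub> u = nul x y" by (rule l_neg)
qed

lemma alg_ring: "ring alg"
proof (rule ringI)
  show "abelian_group alg"
    using alg_vectorspace(1) unfolding vectorspace_def Module.module_def by blast
  show "monoid alg" by (rule monoidI) (auto simp: Cmp_assoc)
qed (auto simp: Cmp_add_left Cmp_add_right)

lemma alg_fd: "fd_algebra K alg"
  unfolding fd_algebra_def using alg_vectorspace alg_ring by (auto simp: Cmp_smult_left Cmp_smult_right)

sublocale alg: fin_dim_algebra K alg
  by unfold_locales (rule alg_fd)

lemma rep_abelian:
  assumes x: "x \<in> Obj C"
  shows "abelian_group (rep x)"
proof (rule abelian_groupI)
  fix u v assume "u \<in> carrier (rep x)" "v \<in> carrier (rep x)"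
  then show "u \<oplus>\<^bsub>rep x\<^esub> v = v \<oplus>\<^bsub>rep x\<^esub> u"
    using x mor_abelian_facts(2)[OF P_obj x] by auto
next
  fix u assume "u \<in> carrier (rep x)"
  then obtain u' where u: "u' \<in> mor P x" "u = enc x u'" by auto
  then have "enc x (\<ominus>\<^bsub>Hom C P x\<^esub> u') \<oplus>\<^bsub>rep x\<^esub> u = \<zero>\<^bsub>rep x\<^esub>"
    using x mor_abelian_facts(3)[OF P_obj x] by simp
  then show "\<exists>v \<in> carrier (rep x). v \<oplus>\<^bsub>rep x\<^esub> u = \<zero>\<^bsub>rep x\<^esub>" using u x by auto
qed (use x in \<open>auto simp: mor_abelian_facts(1)\<close>)

lemma rep_right_module: "x \<in> Obj C \<Longrightarrow> right_module alg (rep x)"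
  unfolding right_module_def using alg_ring rep_abelian[of x]
  by (simp add: Cmp_add_left Cmp_add_right Cmp_assoc)

lemma rep_finitely_generated:
  assumes x: "x \<in> Obj C"
  shows "finitely_generated alg (rep x)"
proof -
  interpret V: vectorspace K "Hom C P x" using Hom_vectorspace x by simp
  interpret M: abelian_group "rep x" by (rule rep_abelian[OF x])
  obtain B where B: "finite B" "B \<subseteq> mor P x" "V.span B = mor P x"
    using mor_fin_dim[OF P_obj x] unfolding V.fin_dim_def by blast
  have inj: "inj_on (enc x) B" using enc_inj[OF x] B(2) inj_on_subset by blast
  have "\<exists>c \<in> enc x ` B \<rightarrow> carrier alg. v = (\<Oplus>\<^bsub>rep x\<^esub>y\<in>enc x ` B. c y \<odot>\<^bsub>rep x\<^esub> y)"
    if v: "v \<in> carrier (rep x)" for v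
  proof -
    obtain u where u: "u \<in> mor P x" "v = enc x u" using v by auto
    obtain a where a: "a \<in> B \<rightarrow> carrier K" "V.lincomb a B = u"
      using V.finite_in_span[OF B(1,2), of u] B(3) u by auto
    define c where "c y = enc P (a (dec x y) \<odot>\<^bsub>Hom C P P\<^esub> Idt C P)" for y
    have c: "c \<in> enc x ` B \<rightarrow> carrier alg"
      unfolding c_def using a(1) B(2) x by (auto simp: subset_iff Pi_iff)
    have trm: "c (enc x b) \<odot>\<^bsub>rep x\<^esub> enc x b = enc x (a b \<odot>\<^bsub>Hom C P x\<^esub> b)" if "b \<in> B" for b
    proof -
      have b: "b \<in> mor P x" "a b \<in> carrier K" using that B a by auto
      then show ?thesis unfolding c_def using x by (simp add: Cmp_smult_right)
    qed
    have "(\<Oplus>\<^bsub>rep x\<^esub>y\<in>enc x ` B. c y \<odot>\<^bsub>rep x\<^esub> y) = (\<Oplus>\<^bsub>rep x\<^esub>b\<in>B. c (enc x b) \<odot>\<^bsub>rep x\<^esub> enc x b)"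
    proof (rule M.finsum_reindex[OF _ inj])
      show "(\<lambda>y. c y \<odot>\<^bsub>rep x\<^esub> y) \<in> enc x ` B \<rightarrow> carrier (rep x)"
        using c B x right_smult_closed[OF rep_right_module[OF x]] by (auto simp: Pi_iff)
    qed
    also have "\<dots> = (\<Oplus>\<^bsub>rep x\<^esub>b\<in>B. enc x (a b \<odot>\<^bsub>Hom C P x\<^esub> b))"
    proof (rule M.finsum_cong'[OF refl])
      show "(\<lambda>b. enc x (a b \<odot>\<^bsub>Hom C P x\<^esub> b)) \<in> B \<rightarrow> carrier (rep x)"
        using a(1) B(2) x by (auto simp: Pi_iff subset_iff)
    qed (rule trm)
    also have "\<dots> = enc x (\<Oplus>\<^bsub>Hom C P x\<^esub>b\<in>B. a b \<odot>\<^bsub>Hom C P x\<^esub> b)"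
      using B(1,2) a(1)
    proof (induction B rule: finite_induct)
      case empty
      then show ?case by simp
    next
      case (insert b B)
      have m: "(\<lambda>b. a b \<odot>\<^bsub>Hom C P x\<^esub> b) \<in> B \<rightarrow> mor P x" "a b \<odot>\<^bsub>Hom C P x\<^esub> b \<in> mor P x"
        "(\<lambda>b. enc x (a b \<odot>\<^bsub>Hom C P x\<^esub> b)) \<in> B \<rightarrow> carrier (rep x)" "enc x (a b \<odot>\<^bsub>Hom C P x\<^esub> b) \<in> carrier (rep x)"
        using insert.prems x by (auto simp: Pi_iff)
      have s: "(\<Oplus>\<^bsub>Hom C P x\<^esub>b\<in>B. a b \<odot>\<^bsub>Hom C P x\<^esub> b) \<in> mor P x" by (rule V.M.finsum_closed[OF m(1)])
      have IH: "(\<Oplus>\<^bsub>rep x\<^esub>b\<in>B. enc x (a b \<odot>\<^bsub>Hom C P x\<^esub> b)) = enc x (\<Oplus>\<^bsub>Hom C P x\<^esub>b\<in>B. a b \<odot>\<^bsub>Hom C P x\<^esub> b)"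
        by (rule insert.IH) (use insert.prems in auto)
      show ?case
        unfolding M.finsum_insert[OF insert.hyps m(3,4)] V.M.finsum_insert[OF insert.hyps m(1,2)] IH
        using s m(2) x by simp
    qed
    also have "\<dots> = v" using a(2) u(2) unfolding V.lincomb_def by simp
    finally show ?thesis using c by auto
  qed
  moreover have "enc x ` B \<subseteq> carrier (rep x)" using B by auto
  ultimately show ?thesis unfolding finitely_generated_def using B(1) by blast
qed

definition rep_functor :: "('o, 'm, ('k coords, 'k coords) module, 'k coords \<Rightarrow> 'k coords) fun_data" where
  "rep_functor = \<lparr>on_obj = rep, on_hom = (\<lambda>x y f. \<lambda>v \<in> carrier (rep x). enc y (Cmp C P x y f (dec x v)))\<rparr>"

lemma rep_on_hom:
  assumes "x \<in> Obj C" "y \<in> Obj C" "f \<in> mor x y"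
  shows "on_hom rep_functor x y f \<in> right_hom alg (rep x) (rep y)"
  unfolding rep_functor_def fun_data.simps
  by (rule right_homI[OF _ _ _ rep_right_module]) (use assms in \<open>auto simp: Cmp_add_right Cmp_assoc\<close>)

lemma rep_on_hom_apply:
  "\<lbrakk>x \<in> Obj C; u \<in> mor P x\<rbrakk> \<Longrightarrow> on_hom rep_functor x y f (enc x u) = enc y (Cmp C P x y f u)"
  by (simp add: rep_functor_def)

lemma full_subcat_simps [simp]:
  "Obj (full_subcat C U) = U" "Hom (full_subcat C U) = Hom C" "Idt (full_subcat C U) = Idt C"
  "Cmp (full_subcat C U) = Cmp C"
  by (simp_all add: full_subcat_def)

lemma on_obj_rep [simp]: "on_obj rep_functor = rep"
  by (simp add: rep_functor_def)

lemma rep_eqI: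
  assumes "f \<in> right_hom alg (rep x) M" "g \<in> right_hom alg (rep x) N" "\<And>u. u \<in> mor P x \<Longrightarrow> f (enc x u) = g (enc x u)"
  shows "f = g"
  by (rule right_hom_eqI[OF assms(1,2)]) (use assms(3) in auto)

lemma rep_functor_linear: "linear_functor K (full_subcat C E) (mod_cat alg) rep_functor"
proof (rule linear_functorI, simp_all only: full_subcat_simps on_obj_rep)
  show "rep x \<in> Obj (mod_cat alg)" if "x \<in> E" for x
    using that rep_right_module rep_finitely_generated by simp
  fix x y f assume x: "x \<in> E" and y: "y \<in> E" and f: "f \<in> mor x y"
  then have o: "x \<in> Obj C" "y \<in> Obj C" by simp_all
  note F = rep_on_hom[OF o]
  note lc = linear_category.Cmp_closed[OF alg.mod_cat_linear_category]
  have ro: "rep x \<in> Obj (mod_cat alg)" "rep y \<in> Obj (mod_cat alg)"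
    using o rep_right_module rep_finitely_generated by simp_all
  have vs: "vectorspace K (Hom (mod_cat alg) (rep x) (rep y))"
    by (rule alg.right_hom_vectorspace) (use o rep_right_module in simp_all)
  then interpret V: vectorspace K "Hom (mod_cat alg) (rep x) (rep y)" .
  show "on_hom rep_functor x y f \<in> carrier (Hom (mod_cat alg) (rep x) (rep y))" using F f by simp
  show "on_hom rep_functor x y (f \<oplus>\<^bsub>Hom C x y\<^esub> g)
    = on_hom rep_functor x y f \<oplus>\<^bsub>Hom (mod_cat alg) (rep x) (rep y)\<^esub> on_hom rep_functor x y g" if g: "g \<in> mor x y" for g
  proof (rule rep_eqI[where x = x and M = "rep y" and N = "rep y"])
    show "on_hom rep_functor x y (f \<oplus>\<^bsub>Hom C x y\<^esub> g) \<in> right_hom alg (rep x) (rep y)" using F f g o by simp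
    show "on_hom rep_functor x y f \<oplus>\<^bsub>Hom (mod_cat alg) (rep x) (rep y)\<^esub> on_hom rep_functor x y g \<in> right_hom alg (rep x) (rep y)"
      using V.M.a_closed[of "on_hom rep_functor x y f" "on_hom rep_functor x y g"] F[OF f] F[OF g] by simp
  qed (use f g o in \<open>simp add: rep_on_hom_apply Cmp_add_left\<close>)
  show "on_hom rep_functor x y (c \<odot>\<^bsub>Hom C x y\<^esub> f)
    = c \<odot>\<^bsub>Hom (mod_cat alg) (rep x) (rep y)\<^esub> on_hom rep_functor x y f" if c: "c \<in> carrier K" for c
  proof (rule rep_eqI[where x = x and M = "rep y" and N = "rep y"])
    show "on_hom rep_functor x y (c \<odot>\<^bsub>Hom C x y\<^esub> f) \<in> right_hom alg (rep x) (rep y)" using F f c o by simp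
    show "c \<odot>\<^bsub>Hom (mod_cat alg) (rep x) (rep y)\<^esub> on_hom rep_functor x y f \<in> right_hom alg (rep x) (rep y)"
      using V.smult_closed[OF c, of "on_hom rep_functor x y f"] F[OF f] by simp
  qed (use f c o in \<open>simp add: rep_on_hom_apply Cmp_smult_left Cmp_smult_right\<close>)
next
  fix x assume x: "x \<in> E"
  show "on_hom rep_functor x x (Idt C x) = Idt (mod_cat alg) (rep x)"
  proof (rule rep_eqI[where x = x and M = "rep x" and N = "rep x"])
    show "on_hom rep_functor x x (Idt C x) \<in> right_hom alg (rep x) (rep x)" using rep_on_hom x by simp
    show "Idt (mod_cat alg) (rep x) \<in> right_hom alg (rep x) (rep x)"
      using alg.right_hom_id[OF rep_right_module] x by simp
  qed (use x in \<open>simp add: rep_on_hom_apply\<close>)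
next
  fix x y z g f assume o: "x \<in> E" "y \<in> E" "z \<in> E" and g: "g \<in> mor y z" and f: "f \<in> mor x y"
  show "on_hom rep_functor x z (Cmp C x y z g f)
    = Cmp (mod_cat alg) (rep x) (rep y) (rep z) (on_hom rep_functor y z g) (on_hom rep_functor x y f)"
  proof (rule rep_eqI[where x = x and M = "rep z" and N = "rep z"])
    show "on_hom rep_functor x z (Cmp C x y z g f) \<in> right_hom alg (rep x) (rep z)" using rep_on_hom o f g by simp
    show "Cmp (mod_cat alg) (rep x) (rep y) (rep z) (on_hom rep_functor y z g) (on_hom rep_functor x y f)
      \<in> right_hom alg (rep x) (rep z)"
      using alg.right_hom_compose[OF rep_right_module rep_on_hom rep_on_hom] o f g by simp
  qed (use o f g in \<open>simp add: rep_on_hom_apply compose_eq Cmp_assoc\<close>)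
qed

lemma rep_fully_faithful:
  assumes x: "x \<in> E" and y: "y \<in> E"
  shows "bij_betw (on_hom rep_functor x y) (mor x y) (right_hom alg (rep x) (rep y))"
  unfolding bij_betw_def
proof (intro conjI inj_onI equalityI subsetI)
  fix f g assume f: "f \<in> mor x y" and g: "g \<in> mor x y" and eq: "on_hom rep_functor x y f = on_hom rep_functor x y g"
  show "f = g"
  proof (rule represented_eqI[OF x y f g])
    fix u assume u: "u \<in> mor P x"
    then have "enc y (Cmp C P x y f u) = enc y (Cmp C P x y g u)"
      using arg_cong[OF eq, of "\<lambda>h. h (enc x u)"] x by (simp add: rep_on_hom_apply)
    then show "Cmp C P x y f u = Cmp C P x y g u" using u f g x y by (simp add: enc_eq_iff)
  qed
next
  fix h assume "h \<in> on_hom rep_functor x y ` mor x y"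
  then show "h \<in> right_hom alg (rep x) (rep y)" using rep_on_hom x y by auto
next
  fix h assume h: "h \<in> right_hom alg (rep x) (rep y)"
  have o: "x \<in> Obj C" "y \<in> Obj C" using x y by simp_all
  have hc: "\<exists>w \<in> mor P y. h (enc x u) = enc y w" if "u \<in> mor P x" for u
    using right_hom_closed[OF h, of "enc x u"] that by auto
  have "end_linear x y (\<lambda>u. dec y (h (enc x u)))"
    unfolding end_linear_def
  proof (intro conjI ballI)
    fix u assume u: "u \<in> mor P x"
    obtain w where w: "w \<in> mor P y" "h (enc x u) = enc y w" using hc[OF u] by blast
    show "dec y (h (enc x u)) \<in> mor P y" using w o by simp
    fix e assume e: "e \<in> mor P P"
    have "h (enc x (Cmp C P P x u e)) = enc P e \<odot>\<^bsub>rep y\<^esub> h (enc x u)"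
      using right_hom_smult[OF h, of "enc P e" "enc x u"] u e o by simp
    then show "dec y (h (enc x (Cmp C P P x u e))) = Cmp C P P y (dec y (h (enc x u))) e"
      using w e o by simp
  next
    fix u v assume u: "u \<in> mor P x" and v: "v \<in> mor P x"
    obtain w where w: "w \<in> mor P y" "h (enc x u) = enc y w" using hc[OF u] by blast
    obtain z where z: "z \<in> mor P y" "h (enc x v) = enc y z" using hc[OF v] by blast
    show "dec y (h (enc x (u \<oplus>\<^bsub>Hom C P x\<^esub> v))) = dec y (h (enc x u)) \<oplus>\<^bsub>Hom C P y\<^esub> dec y (h (enc x v))"
      using right_hom_add[OF h, of "enc x u" "enc x v"] u v w z o by simp
  qed
  then obtain f where f: "f \<in> mor x y" "\<And>u. u \<in> mor P x \<Longrightarrow> dec y (h (enc x u)) = Cmp C P x y f u"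
    using represented_full[OF x y] by blast
  have "h = on_hom rep_functor x y f"
  proof (rule rep_eqI[OF h rep_on_hom[OF o f(1)]])
    fix u assume u: "u \<in> mor P x"
    obtain w where w: "w \<in> mor P y" "h (enc x u) = enc y w" using hc[OF u] by blast
    then show "h (enc x u) = on_hom rep_functor x y f (enc x u)" using f(2)[OF u] u o by (simp add: rep_on_hom_apply)
  qed
  then show "h \<in> on_hom rep_functor x y ` mor x y" using f by blast
qed

text \<open>Homomorphisms from \<open>rep x\<close> to \<open>M\<close>, as maps on \<open>Hom(P, x)\<close> itself.\<close>

definition module_map :: "'o \<Rightarrow> ('k coords, 'v) module \<Rightarrow> ('m \<Rightarrow> 'v) \<Rightarrow> bool" where
  "module_map x M \<theta> \<longleftrightarrow> (\<forall>u \<in> mor P x. \<theta> u \<in> carrier M) \<and>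
     (\<forall>u \<in> mor P x. \<forall>v \<in> mor P x. \<theta> (u \<oplus>\<^bsub>Hom C P x\<^esub> v) = \<theta> u \<oplus>\<^bsub>M\<^esub> \<theta> v) \<and>
     (\<forall>u \<in> mor P x. \<forall>e \<in> mor P P. \<theta> (Cmp C P P x u e) = enc P e \<odot>\<^bsub>M\<^esub> \<theta> u)"

lemma module_mapD:
  assumes "module_map x M \<theta>"
  shows "u \<in> mor P x \<Longrightarrow> \<theta> u \<in> carrier M"
    and "\<lbrakk>u \<in> mor P x; v \<in> mor P x\<rbrakk> \<Longrightarrow> \<theta> (u \<oplus>\<^bsub>Hom C P x\<^esub> v) = \<theta> u \<oplus>\<^bsub>M\<^esub> \<theta> v"
    and "\<lbrakk>u \<in> mor P x; e \<in> mor P P\<rbrakk> \<Longrightarrow> \<theta> (Cmp C P P x u e) = enc P e \<odot>\<^bsub>M\<^esub> \<theta> u"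
  using assms unfolding module_map_def by auto

lemma module_map_nul:
  assumes M: "right_module alg M" and x: "x \<in> Obj C" and \<theta>: "module_map x M \<theta>"
  shows "\<theta> (nul P x) = \<zero>\<^bsub>M\<^esub>"
proof -
  have "\<theta> (Cmp C P P x (nul P x) (nul P P)) = \<zero>\<^bsub>alg\<^esub> \<odot>\<^bsub>M\<^esub> \<theta> (nul P x)"
    using module_mapD(3)[OF \<theta>, of "nul P x" "nul P P"] x by simp
  then show ?thesis using right_zero_smult[OF M] module_mapD(1)[OF \<theta>, of "nul P x"] x by simp
qed

text \<open>Take for \<open>Q\<close> a direct sum of copies of \<open>P\<close>, one for each element of \<open>U\<close>.\<close>

lemma module_map_covering:
  assumes M: "right_module alg M" and U: "finite U" "U \<subseteq> carrier M"
  shows "\<exists>Q \<in> E. \<exists>\<theta>. module_map Q M \<theta> \<and> U \<subseteq> \<theta> ` mor P Q"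
  using U
proof (induction U rule: finite_induct)
  case empty
  interpret M: abelian_group M by (rule right_module_group[OF M])
  obtain Q where Q: "zero_object C Q" using zero_object_exists by blast
  have "module_map Q M (\<lambda>u. \<zero>\<^bsub>M\<^esub>)"
    unfolding module_map_def using right_smult_zero[OF M] by simp
  then show ?case using E_zero[OF Q] by blast
next
  case (insert m U)
  interpret M: abelian_group M by (rule right_module_group[OF M])
  obtain Q \<theta> where Q: "Q \<in> E" and \<theta>: "module_map Q M \<theta>" and im: "U \<subseteq> \<theta> ` mor P Q"
    using insert by blast
  note \<theta>c = module_mapD(1)[OF \<theta>] and \<theta>a = module_mapD(2)[OF \<theta>] and \<theta>m = module_mapD(3)[OF \<theta>]
  have m: "m \<in> carrier M" using insert by simp
  obtain Z a b \<sigma> \<rho> where Z: "Z \<in> E" and mo: "a \<in> mor Q Z" "b \<in> mor Z P" "\<sigma> \<in> mor P Z" "\<rho> \<in> mor Z Q"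
    and eq: "Cmp C P Z P b \<sigma> = Idt C P" "Cmp C Q Z Q \<rho> a = Idt C Q" "Cmp C P Z Q \<rho> \<sigma> = nul P Q" "Cmp C Q Z P b a = nul Q P"
    using E_biproduct[OF Q P_E] by blast
  have o [simp]: "Q \<in> Obj C" "Z \<in> Obj C" using Q Z by simp_all
  have mc [simp]: "\<And>e. e \<in> mor P P \<Longrightarrow> enc P e \<odot>\<^bsub>M\<^esub> m \<in> carrier M"
    using right_smult_closed[OF M] m by simp
  define \<theta>' where "\<theta>' u = \<theta> (Cmp C P Z Q \<rho> u) \<oplus>\<^bsub>M\<^esub> enc P (Cmp C P Z P b u) \<odot>\<^bsub>M\<^esub> m" for u
  have "module_map Z M \<theta>'"
    unfolding module_map_def
  proof (intro conjI ballI)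
    fix u assume u: "u \<in> mor P Z"
    have c: "Cmp C P Z Q \<rho> u \<in> mor P Q" "Cmp C P Z P b u \<in> mor P P" using u mo by simp_all
    show "\<theta>' u \<in> carrier M" unfolding \<theta>'_def using c \<theta>c by simp
    show "\<theta>' (Cmp C P P Z u e) = enc P e \<odot>\<^bsub>M\<^esub> \<theta>' u" if e: "e \<in> mor P P" for e
    proof -
      have "enc P (Cmp C P P P (Cmp C P Z P b u) e) \<odot>\<^bsub>M\<^esub> m = enc P e \<odot>\<^bsub>M\<^esub> (enc P (Cmp C P Z P b u) \<odot>\<^bsub>M\<^esub> m)"
        using right_smult_assoc[OF M, of "enc P (Cmp C P Z P b u)" "enc P e" m] c e m by simp
      moreover have "\<theta> (Cmp C P P Q (Cmp C P Z Q \<rho> u) e) = enc P e \<odot>\<^bsub>M\<^esub> \<theta> (Cmp C P Z Q \<rho> u)" using \<theta>m c e by simp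
      moreover have "enc P e \<odot>\<^bsub>M\<^esub> \<theta>' u = enc P e \<odot>\<^bsub>M\<^esub> \<theta> (Cmp C P Z Q \<rho> u) \<oplus>\<^bsub>M\<^esub> enc P e \<odot>\<^bsub>M\<^esub> (enc P (Cmp C P Z P b u) \<odot>\<^bsub>M\<^esub> m)"
        unfolding \<theta>'_def using right_smult_add_right[OF M, of "enc P e"] c e \<theta>c by simp
      ultimately show ?thesis unfolding \<theta>'_def using u e mo by (simp add: Cmp_assoc)
    qed
    show "\<theta>' (u \<oplus>\<^bsub>Hom C P Z\<^esub> v) = \<theta>' u \<oplus>\<^bsub>M\<^esub> \<theta>' v" if v: "v \<in> mor P Z" for v
    proof -
      have d: "Cmp C P Z Q \<rho> v \<in> mor P Q" "Cmp C P Z P b v \<in> mor P P" using v mo by simp_all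
      have "enc P (Cmp C P Z P b u \<oplus>\<^bsub>Hom C P P\<^esub> Cmp C P Z P b v) \<odot>\<^bsub>M\<^esub> m
        = enc P (Cmp C P Z P b u) \<odot>\<^bsub>M\<^esub> m \<oplus>\<^bsub>M\<^esub> enc P (Cmp C P Z P b v) \<odot>\<^bsub>M\<^esub> m"
        using right_smult_add_left[OF M, of "enc P (Cmp C P Z P b u)" "enc P (Cmp C P Z P b v)" m] c d m by simp
      moreover have "\<theta> (Cmp C P Z Q \<rho> u \<oplus>\<^bsub>Hom C P Q\<^esub> Cmp C P Z Q \<rho> v) = \<theta> (Cmp C P Z Q \<rho> u) \<oplus>\<^bsub>M\<^esub> \<theta> (Cmp C P Z Q \<rho> v)"
        using \<theta>a c d by simp
      ultimately show ?thesis unfolding \<theta>'_def using u v mo c d \<theta>c[OF c(1)] \<theta>c[OF d(1)]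
        by (simp add: Cmp_add_right M.a_ac)
    qed
  qed
  moreover have "insert m U \<subseteq> \<theta>' ` mor P Z"
  proof
    fix y assume "y \<in> insert m U"
    then consider "y = m" | "y \<in> U" by blast
    then show "y \<in> \<theta>' ` mor P Z"
    proof cases
      case 1
      have "\<theta>' \<sigma> = m"
        unfolding \<theta>'_def eq using module_map_nul[OF M o(1) \<theta>] right_smult_one[OF M, of m] m by simp
      then show ?thesis using 1 mo by blast
    next
      case 2
      then obtain u where u: "u \<in> mor P Q" "y = \<theta> u" using im by blast
      have "Cmp C P Z Q \<rho> (Cmp C P Q Z a u) = u" "Cmp C P Z P b (Cmp C P Q Z a u) = nul P P"
        using Cmp_reassoc[OF eq(2), of P u] Cmp_reassoc[OF eq(4), of P u] u mo by simp_all
      then have "\<theta>' (Cmp C P Q Z a u) = y"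
        unfolding \<theta>'_def using right_zero_smult[OF M, of m] m u \<theta>c by simp
      then show ?thesis using u mo by (auto intro!: image_eqI[of _ _ "Cmp C P Q Z a u"])
    qed
  qed
  ultimately show ?case using Z by blast
qed

text \<open>Cover \<open>M\<close> by some \<open>Hom(P, Q)\<close> and realize the quotient by the kernel inside \<open>E\<close>.\<close>

lemma rep_essentially_surjective:
  assumes M: "right_module alg M" and fg: "finitely_generated alg M"
  shows "\<exists>y \<in> E. right_iso alg (rep y) M"
proof -
  interpret M: abelian_group M by (rule right_module_group[OF M])
  obtain U where U: "finite U" "U \<subseteq> carrier M"
    "\<And>v. v \<in> carrier M \<Longrightarrow> \<exists>c \<in> U \<rightarrow> carrier alg. v = (\<Oplus>\<^bsub>M\<^esub>x\<in>U. c x \<odot>\<^bsub>M\<^esub> x)"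
    using fg unfolding finitely_generated_def by blast
  obtain Q \<theta> where Q: "Q \<in> E" and \<theta>: "module_map Q M \<theta>" and im: "U \<subseteq> \<theta> ` mor P Q"
    using module_map_covering[OF M U(1,2)] by blast
  note \<theta>c = module_mapD(1)[OF \<theta>] and \<theta>a = module_mapD(2)[OF \<theta>] and \<theta>m = module_mapD(3)[OF \<theta>]
  have o [simp]: "Q \<in> Obj C" using Q by simp
  have \<theta>0: "\<theta> (nul P Q) = \<zero>\<^bsub>M\<^esub>" by (rule module_map_nul[OF M o \<theta>])
  have "(\<Oplus>\<^bsub>M\<^esub>x\<in>U'. c x \<odot>\<^bsub>M\<^esub> x) \<in> \<theta> ` mor P Q" if c: "c \<in> U \<rightarrow> carrier alg" and U': "finite U'" "U' \<subseteq> U" for c U'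
    using U'
  proof (induction U' rule: finite_induct)
    case empty
    then show ?case using \<theta>0 by (auto intro!: image_eqI[of _ _ "nul P Q"])
  next
    case (insert x U')
    have cm: "c y \<odot>\<^bsub>M\<^esub> y \<in> carrier M" if "y \<in> U" for y
      using right_smult_closed[OF M] c U(2) that by blast
    obtain s where s: "s \<in> mor P Q" "(\<Oplus>\<^bsub>M\<^esub>x\<in>U'. c x \<odot>\<^bsub>M\<^esub> x) = \<theta> s" using insert by blast
    obtain u where u: "u \<in> mor P Q" "x = \<theta> u" using im insert.prems by blast
    obtain e where e: "e \<in> mor P P" "c x = enc P e" using c insert.prems by auto
    have "(\<Oplus>\<^bsub>M\<^esub>x\<in>insert x U'. c x \<odot>\<^bsub>M\<^esub> x) = c x \<odot>\<^bsub>M\<^esub> x \<oplus>\<^bsub>M\<^esub> (\<Oplus>\<^bsub>M\<^esub>x\<in>U'. c x \<odot>\<^bsub>M\<^esub> x)"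
      by (rule M.finsum_insert[OF insert.hyps]) (use cm insert.prems in auto)
    also have "\<dots> = \<theta> (Cmp C P P Q u e \<oplus>\<^bsub>Hom C P Q\<^esub> s)"
      using s u e \<theta>a[of "Cmp C P P Q u e" s] \<theta>m[of u e] by simp
    finally show ?case using s u e by (auto intro!: image_eqI[of _ \<theta> "Cmp C P P Q u e \<oplus>\<^bsub>Hom C P Q\<^esub> s"])
  qed
  then have surj: "\<exists>u \<in> mor P Q. \<theta> u = v" if "v \<in> carrier M" for v
    using U(1) U(3)[OF that] by (metis (no_types, lifting) imageE order_refl)
  let ?N = "{u \<in> mor P Q. \<theta> u = \<zero>\<^bsub>M\<^esub>}"
  have "end_submodule Q ?N"
    unfolding end_submodule_def using \<theta>0 \<theta>a \<theta>m right_smult_zero[OF M] by auto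
  from represented_quotient[OF Q this] obtain y g where y: "y \<in> E" and g: "g \<in> mor Q y"
    and g_surj: "\<And>w. w \<in> mor P y \<Longrightarrow> \<exists>u \<in> mor P Q. Cmp C P Q y g u = w"
    and ker: "\<forall>u \<in> mor P Q. Cmp C P Q y g u = nul P y \<longleftrightarrow> u \<in> ?N"
    by blast
  have yo [simp]: "y \<in> Obj C" using y by simp
  have same: "Cmp C P Q y g u = Cmp C P Q y g v \<longleftrightarrow> \<theta> u = \<theta> v" if u: "u \<in> mor P Q" and v: "v \<in> mor P Q" for u v
  proof -
    let ?d = "u \<ominus>\<^bsub>Hom C P Q\<^esub> v"
    have d: "?d \<in> mor P Q" using u v by simp
    have "\<theta> u = \<theta> ?d \<oplus>\<^bsub>M\<^esub> \<theta> v" using \<theta>a[OF d v] mor_diff_add(1)[of P Q u v] u v by simp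
    then have "\<theta> ?d = \<zero>\<^bsub>M\<^esub> \<longleftrightarrow> \<theta> u = \<theta> v" using \<theta>c[OF d] \<theta>c[OF v] by (metis M.add.r_cancel_one)
    moreover have "Cmp C P Q y g ?d = nul P y \<longleftrightarrow> Cmp C P Q y g u = Cmp C P Q y g v"
      using u v g by (simp add: Cmp_diff_right)
    ultimately show ?thesis using ker d by simp
  qed
  define lft where "lft w = (SOME u. u \<in> mor P Q \<and> Cmp C P Q y g u = w)" for w
  have lft: "lft w \<in> mor P Q \<and> Cmp C P Q y g (lft w) = w" if "w \<in> mor P y" for w
    unfolding lft_def by (rule someI_ex) (use g_surj[OF that] in blast)
  have \<theta>l: "\<theta> (lft w) = \<theta> u" if "u \<in> mor P Q" "Cmp C P Q y g u = w" for u w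
  proof -
    have "w \<in> mor P y" using that g by auto
    then show ?thesis using same[of "lft w" u] lft[of w] that by simp
  qed
  let ?f = "\<lambda>v \<in> carrier (rep y). \<theta> (lft (dec y v))"
  have f: "?f \<in> right_hom alg (rep y) M"
  proof (rule right_homI[OF _ _ _ rep_right_module[OF yo]])
    fix v assume "v \<in> carrier (rep y)"
    then obtain w where w: "w \<in> mor P y" "v = enc y w" by auto
    show "\<theta> (lft (dec y v)) \<in> carrier M" using w lft \<theta>c by simp
    show "\<theta> (lft (dec y (a \<odot>\<^bsub>rep y\<^esub> v))) = a \<odot>\<^bsub>M\<^esub> \<theta> (lft (dec y v))" if a: "a \<in> carrier alg" for a
    proof -
      obtain e where e: "e \<in> mor P P" "a = enc P e" using a by auto
      have "\<theta> (lft (Cmp C P P y w e)) = \<theta> (Cmp C P P Q (lft w) e)"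
        by (rule \<theta>l) (use w e lft g in \<open>simp_all flip: Cmp_assoc\<close>)
      then show ?thesis using w e lft \<theta>m by simp
    qed
    show "\<theta> (lft (dec y (v \<oplus>\<^bsub>rep y\<^esub> v'))) = \<theta> (lft (dec y v)) \<oplus>\<^bsub>M\<^esub> \<theta> (lft (dec y v'))" if v': "v' \<in> carrier (rep y)" for v'
    proof -
      obtain w' where w': "w' \<in> mor P y" "v' = enc y w'" using v' by auto
      have "\<theta> (lft (w \<oplus>\<^bsub>Hom C P y\<^esub> w')) = \<theta> (lft w \<oplus>\<^bsub>Hom C P Q\<^esub> lft w')"
        by (rule \<theta>l) (use w w' lft g in \<open>simp_all add: Cmp_add_right\<close>)
      then show ?thesis using w w' lft \<theta>a by simp
    qed
  qed
  moreover have "bij_betw ?f (carrier (rep y)) (carrier M)"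
    unfolding bij_betw_def
  proof
    show "inj_on ?f (carrier (rep y))"
    proof (rule inj_onI)
      fix v v' assume "v \<in> carrier (rep y)" "v' \<in> carrier (rep y)" and e: "?f v = ?f v'"
      then obtain w w' where w: "w \<in> mor P y" "v = enc y w" "w' \<in> mor P y" "v' = enc y w'" by auto
      then have "\<theta> (lft w) = \<theta> (lft w')" using e by simp
      then have "w = w'" using same[of "lft w" "lft w'"] lft w by simp
      then show "v = v'" using w by simp
    qed
    show "?f ` carrier (rep y) = carrier M"
    proof (intro equalityI subsetI)
      fix v assume "v \<in> carrier M"
      then obtain u where u: "u \<in> mor P Q" "\<theta> u = v" using surj by blast
      have "?f (enc y (Cmp C P Q y g u)) = v" using \<theta>l[OF u(1) refl] u g by simp
      then show "v \<in> ?f ` carrier (rep y)" using u g by (auto intro!: image_eqI[of _ _ "enc y (Cmp C P Q y g u)"])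
    qed (use right_hom_closed[OF f] in blast)
  qed
  ultimately show ?thesis unfolding right_iso_def using y by blast
qed

theorem rep_equivalence: "linear_equivalence K (full_subcat C E) (mod_cat alg) rep_functor"
proof (rule linear_equivalenceI)
  show "linear_category K (full_subcat C E)"
    by (rule full_subcat_linear_category[OF linear_category_axioms]) auto
  show "linear_category K (mod_cat alg)" by (rule alg.mod_cat_linear_category)
  show "linear_functor K (full_subcat C E) (mod_cat alg) rep_functor" by (rule rep_functor_linear)
  show "bij_betw (on_hom rep_functor x y) (carrier (Hom (full_subcat C E) x y))
    (carrier (Hom (mod_cat alg) (on_obj rep_functor x) (on_obj rep_functor y)))"
    if "x \<in> Obj (full_subcat C E)" "y \<in> Obj (full_subcat C E)" for x y
    using rep_fully_faithful that by simp
  show "\<exists>x \<in> Obj (full_subcat C E). isomorphic (mod_cat alg) (on_obj rep_functor x) M"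
    if M: "M \<in> Obj (mod_cat alg)" for M
  proof -
    have m: "right_module alg M" "finitely_generated alg M" using M by simp_all
    obtain x where x: "x \<in> E" "right_iso alg (rep x) M" using rep_essentially_surjective[OF m] by blast
    have "isomorphic (mod_cat alg) (rep x) M"
      by (rule alg.right_iso_isomorphic[OF rep_right_module m(1) x(2)]) (use x in simp)
    then show ?thesis using x by auto
  qed
qed

end


section \<open>Endomorphisms of simple objects over an algebraically closed field\<close>

context linear_category
begin

text \<open>\<open>horner x d q\<close> is the value at \<open>d\<close> of the polynomial whose coefficients are listed in \<open>q\<close>
  in ascending order.\<close>

primrec horner :: "'o \<Rightarrow> 'm \<Rightarrow> 'k list \<Rightarrow> 'm" where
  "horner x d [] = nul x x"
| "horner x d (a # q) = a \<odot>\<^bsub>Hom C x x\<^esub> Idt C x \<oplus>\<^bsub>Hom C x x\<^esub> Cmp C x x x d (horner x d q)"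

context
  fixes x d
  assumes x: "x \<in> Obj C" and d: "d \<in> mor x x"
begin

interpretation Kf: field K by (rule field_K)

interpretation V: vectorspace K "Hom C x x" by (rule Hom_vectorspace[OF x x])

lemma horner_closed: "set q \<subseteq> carrier K \<Longrightarrow> horner x d q \<in> mor x x"
  using x d by (induction q) auto

lemma set_map2_add:
  assumes "set p \<subseteq> carrier K" "set q \<subseteq> carrier K"
  shows "set (map2 (\<oplus>\<^bsub>K\<^esub>) p q) \<subseteq> carrier K"
proof -
  have "a \<in> carrier K \<and> b \<in> carrier K" if "(a, b) \<in> set (zip p q)" for a b
    using set_zip_leftD[OF that] set_zip_rightD[OF that] assms by blast
  then show ?thesis by auto
qed

lemma horner_add:
  "\<lbrakk>length p = length q; set p \<subseteq> carrier K; set q \<subseteq> carrier K\<rbrakk> \<Longrightarrow>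
    horner x d (map2 (\<oplus>\<^bsub>K\<^esub>) p q) = horner x d p \<oplus>\<^bsub>Hom C x x\<^esub> horner x d q"
proof (induction p q rule: list_induct2)
  case Nil
  then show ?case using x by simp
next
  case (Cons a p b q)
  then have "horner x d p \<in> mor x x" "horner x d q \<in> mor x x" using horner_closed by auto
  then show ?case using Cons x d by (simp add: V.smult_l_distr Cmp_add_right V.M.a_ac)
qed

lemma horner_smult:
  "\<lbrakk>set q \<subseteq> carrier K; c \<in> carrier K\<rbrakk> \<Longrightarrow> horner x d (map (\<lambda>a. c \<otimes>\<^bsub>K\<^esub> a) q) = c \<odot>\<^bsub>Hom C x x\<^esub> horner x d q"
proof (induction q)
  case Nil
  then show ?case by simp
next
  case (Cons a q)
  then have "horner x d q \<in> mor x x" using horner_closed by auto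
  then show ?case using Cons x d by (simp add: V.smult_r_distr V.smult_assoc1 Cmp_smult_right)
qed

lemma horner_append_zero: "set q \<subseteq> carrier K \<Longrightarrow> horner x d (q @ [\<zero>\<^bsub>K\<^esub>]) = horner x d q"
  using x d by (induction q) simp_all

text \<open>Division by the linear polynomial \<open>X - c\<close>, with the remainder given by evaluation at \<open>c\<close>.\<close>

lemma horner_division:
  assumes "set q \<subseteq> carrier K" "c \<in> carrier K"
  shows "\<exists>q1. set q1 \<subseteq> carrier K \<and> length q1 = length q - 1 \<and> (length q > 1 \<longrightarrow> last q1 = last q) \<and>
    horner x d q = Cmp C x x x (d \<ominus>\<^bsub>Hom C x x\<^esub> c \<odot>\<^bsub>Hom C x x\<^esub> Idt C x) (horner x d q1)
      \<oplus>\<^bsub>Hom C x x\<^esub> ring.eval K (rev q) c \<odot>\<^bsub>Hom C x x\<^esub> Idt C x"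
  using assms(1)
proof (induction q)
  case Nil
  then show ?case using x d assms by simp
next
  case (Cons a q)
  let ?dc = "d \<ominus>\<^bsub>Hom C x x\<^esub> c \<odot>\<^bsub>Hom C x x\<^esub> Idt C x" and ?e = "Kf.eval (rev q) c" and ?I = "Idt C x"
  have a: "a \<in> carrier K" and q: "set q \<subseteq> carrier K" using Cons.prems by auto
  have e: "?e \<in> carrier K" using q assms by (intro Kf.eval_in_carrier) auto
  have ev: "Kf.eval (rev (a # q)) c = ?e \<otimes>\<^bsub>K\<^esub> c \<oplus>\<^bsub>K\<^esub> a"
    using Kf.eval_append_aux[of "rev q" a c] q a assms by simp
  show ?case
  proof (cases "q = []")
    case True
    then show ?thesis using x d a assms by (intro exI[of _ "[]"]) simp
  next
    case False
    obtain q1 where q1: "set q1 \<subseteq> carrier K" "length q1 = length q - 1" "length q > 1 \<longrightarrow> last q1 = last q"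
      "horner x d q = Cmp C x x x ?dc (horner x d q1) \<oplus>\<^bsub>Hom C x x\<^esub> ?e \<odot>\<^bsub>Hom C x x\<^esub> ?I"
      using Cons.IH[OF q] by blast
    let ?h = "horner x d q1"
    have h: "?h \<in> mor x x" by (rule horner_closed[OF q1(1)])
    have dc: "?dc \<in> mor x x" using x d assms by simp
    have comm: "Cmp C x x x d (Cmp C x x x ?dc ?h) = Cmp C x x x ?dc (Cmp C x x x d ?h)"
      using x d h assms by (simp add: Cmp_diff_left Cmp_diff_right Cmp_smult_left Cmp_smult_right Cmp_assoc)
    have dce: "d = ?dc \<oplus>\<^bsub>Hom C x x\<^esub> c \<odot>\<^bsub>Hom C x x\<^esub> ?I"
      using mor_diff_add(1)[of x x d "c \<odot>\<^bsub>Hom C x x\<^esub> ?I"] x d assms by simp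
    have "Cmp C x x x d (horner x d q) = Cmp C x x x ?dc (Cmp C x x x d ?h) \<oplus>\<^bsub>Hom C x x\<^esub> ?e \<odot>\<^bsub>Hom C x x\<^esub> d"
      unfolding q1(4) using x d h dc e comm by (simp add: Cmp_add_right Cmp_smult_right)
    also have "?e \<odot>\<^bsub>Hom C x x\<^esub> d = Cmp C x x x ?dc (?e \<odot>\<^bsub>Hom C x x\<^esub> ?I) \<oplus>\<^bsub>Hom C x x\<^esub> (?e \<otimes>\<^bsub>K\<^esub> c) \<odot>\<^bsub>Hom C x x\<^esub> ?I"
      by (subst dce) (use x dc e assms in \<open>simp add: V.smult_r_distr V.smult_assoc1 Cmp_smult_right\<close>)
    finally have "horner x d (a # q) = Cmp C x x x ?dc (horner x d (?e # q1))
        \<oplus>\<^bsub>Hom C x x\<^esub> Kf.eval (rev (a # q)) c \<odot>\<^bsub>Hom C x x\<^esub> ?I"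
      unfolding ev using x d h dc e a assms by (simp add: Cmp_add_right V.smult_l_distr V.M.a_ac)
    moreover have "last (?e # q1) = last (a # q)"
    proof (cases "length q = 1")
      case True
      then obtain b where "q = [b]" by (auto simp: length_Suc_conv)
      then show ?thesis using q1(2) q assms by simp
    next
      case F: False
      then have "length q > 1" using False by (cases q) auto
      then show ?thesis using q1 by auto
    qed
    ultimately show ?thesis using q1 e False by (intro exI[of _ "?e # q1"]) simp
  qed
qed

text \<open>The spaces of values at \<open>d\<close> of the polynomials with \<open>n\<close> coefficients increase with \<open>n\<close>, so by
  finite dimension \<open>d\<^sup>n\<close> is at some point a combination of lower powers.\<close>

lemma monic_annihilator_exists:
  assumes fd: "vectorspace.fin_dim K (Hom C x x)"
  shows "\<exists>n q. length q = Suc n \<and> set q \<subseteq> carrier K \<and> last q = \<one>\<^bsub>K\<^esub> \<and> horner x d q = nul x x"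
proof -
  define W where "W n = {horner x d q | q. length q = n \<and> set q \<subseteq> carrier K}" for n
  obtain rk where rk: "\<And>U Y. submodule K U (Hom C x x) \<Longrightarrow> submodule K Y (Hom C x x) \<Longrightarrow> U \<subset> Y \<Longrightarrow> rk U < (rk Y :: nat)"
    and bound: "\<And>U. submodule K U (Hom C x x) \<Longrightarrow> rk U \<le> V.dim"
    using V.subspace_rank_exists[OF fd] by blast
  have sub: "submodule K (W n) (Hom C x x)" for n
  proof (intro submodule.intro V.module_axioms)
    show "W n \<subseteq> mor x x" unfolding W_def using horner_closed by blast
    have z: "horner x d (replicate m \<zero>\<^bsub>K\<^esub>) = nul x x" for m using x d by (induction m) simp_all
    show "nul x x \<in> W n" unfolding W_def using z[of n] by (auto intro!: exI[of _ "replicate n \<zero>\<^bsub>K\<^esub>"])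
    fix u v assume "u \<in> W n" "v \<in> W n"
    then obtain p q where pq: "length p = n" "set p \<subseteq> carrier K" "u = horner x d p"
      "length q = n" "set q \<subseteq> carrier K" "v = horner x d q" unfolding W_def by blast
    have "set (map2 (\<oplus>\<^bsub>K\<^esub>) p q) \<subseteq> carrier K"
      using pq set_map2_add by blast
    then show "u \<oplus>\<^bsub>Hom C x x\<^esub> v \<in> W n" unfolding W_def using horner_add[of p q] pq
      by (auto intro!: exI[of _ "map2 (\<oplus>\<^bsub>K\<^esub>) p q"])
  next
    fix c v assume c: "c \<in> carrier K" and "v \<in> W n"
    then obtain q where "length q = n" "set q \<subseteq> carrier K" "v = horner x d q" unfolding W_def by blast
    then show "c \<odot>\<^bsub>Hom C x x\<^esub> v \<in> W n" unfolding W_def using horner_smult[of q c] c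
      by (auto intro!: exI[of _ "map (\<lambda>a. c \<otimes>\<^bsub>K\<^esub> a) q"] simp: subset_iff)
  qed
  have mono: "W n \<subseteq> W (Suc n)" for n
  proof
    fix u assume "u \<in> W n"
    then obtain q where "length q = n" "set q \<subseteq> carrier K" "u = horner x d q" unfolding W_def by blast
    then show "u \<in> W (Suc n)" unfolding W_def using horner_append_zero[of q]
      by (auto intro!: exI[of _ "q @ [\<zero>\<^bsub>K\<^esub>]"])
  qed
  have "\<exists>n. W n = W (Suc n)"
  proof (rule ccontr)
    assume "\<nexists>n. W n = W (Suc n)"
    then have "rk (W n) < rk (W (Suc n))" for n using rk[OF sub sub] mono by blast
    then have "n \<le> rk (W n)" for n by (induction n) (auto simp: Suc_le_eq intro: le_less_trans)
    then show False using bound[OF sub, of "Suc V.dim"] by (meson not_less_eq_eq order_trans)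
  qed
  then obtain n where n: "W n = W (Suc n)" by blast
  let ?p = "replicate n \<zero>\<^bsub>K\<^esub> @ [\<one>\<^bsub>K\<^esub>]"
  have p: "length ?p = Suc n" "set ?p \<subseteq> carrier K" by auto
  then have "horner x d ?p \<in> W (Suc n)" unfolding W_def by blast
  then obtain q where q: "length q = n" "set q \<subseteq> carrier K" "horner x d ?p = horner x d q"
    using n unfolding W_def by blast
  let ?m = "\<ominus>\<^bsub>K\<^esub> \<one>\<^bsub>K\<^esub>"
  let ?q = "map (\<lambda>a. ?m \<otimes>\<^bsub>K\<^esub> a) q @ [\<zero>\<^bsub>K\<^esub>]"
  have q': "length ?q = Suc n" "set ?q \<subseteq> carrier K" "horner x d ?q = \<ominus>\<^bsub>Hom C x x\<^esub> horner x d q"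
    using q horner_append_zero[of "map (\<lambda>a. ?m \<otimes>\<^bsub>K\<^esub> a) q"] horner_smult[of q ?m] horner_closed[OF q(2)]
    by (auto simp: V.smult_minus_1 subset_iff)
  let ?r = "map2 (\<oplus>\<^bsub>K\<^esub>) ?p ?q"
  have "horner x d ?r = nul x x"
    using horner_add[of ?p ?q] p q' q(3) horner_closed[OF q(2)] by (simp add: V.M.r_neg)
  moreover have "length ?r = Suc n" using p q' by simp
  moreover have "set ?r \<subseteq> carrier K" by (rule set_map2_add[OF p(2) q'(2)])
  moreover have "last ?r = \<one>\<^bsub>K\<^esub>" using q by simp
  ultimately show ?thesis by blast
qed

end

end

context simple_collection
begin

text \<open>A monic polynomial that annihilates \<open>d\<close> splits into linear factors. As nonzero endomorphisms of \<open>s\<close>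
  are invertible, one of the factors \<open>d - c\<close> is zero.\<close>

lemma simple_endo_scalar:
  assumes ac: "algebraically_closed K" and s: "s \<in> S" and fd: "vectorspace.fin_dim K (Hom C s s)"
    and d: "d \<in> mor s s"
  shows "\<exists>c \<in> carrier K. d = c \<odot>\<^bsub>Hom C s s\<^esub> Idt C s"
proof -
  interpret Kc: algebraically_closed K by (fact ac)
  have so: "s \<in> Obj C" by (rule S_obj[OF s])
  interpret V: vectorspace K "Hom C s s" by (rule Hom_vectorspace[OF so so])
  have "\<lbrakk>length q = Suc n; set q \<subseteq> carrier K; last q = \<one>\<^bsub>K\<^esub>; horner s d q = nul s s\<rbrakk> \<Longrightarrow>
    \<exists>c \<in> carrier K. d = c \<odot>\<^bsub>Hom C s s\<^esub> Idt C s" for n q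
  proof (induction n arbitrary: q)
    case 0
    then have "q = [\<one>\<^bsub>K\<^esub>]" by (auto simp: length_Suc_conv)
    then have "Idt C s = nul s s" using 0 so d by simp
    then show ?case using S_Idt_nonzero[OF s] by blast
  next
    case (Suc n)
    have q0: "q \<noteq> []" using Suc.prems by auto
    then have "lead_coeff (rev q) = \<one>\<^bsub>K\<^esub>" using Suc.prems(3) by (simp add: hd_rev)
    then have p: "rev q \<in> carrier (poly_ring K)"
      using Suc.prems(2) by (simp add: univ_poly_def polynomial_def)
    have "size (Kc.roots (rev q)) = Suc n" using Kc.roots_over_carrier[OF p] Suc.prems(1) unfolding Kc.splitted_def by simp
    then obtain c where "c \<in># Kc.roots (rev q)" by (metis Zero_not_Suc multiset_nonemptyE size_empty)
    then have c: "c \<in> carrier K" "Kc.eval (rev q) c = \<zero>\<^bsub>K\<^esub>"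
      using Kc.roots_mem_iff_is_root[OF p] unfolding Kc.is_root_def by auto
    obtain q1 where q1: "set q1 \<subseteq> carrier K" "length q1 = length q - 1" "length q > 1 \<longrightarrow> last q1 = last q"
      "horner s d q = Cmp C s s s (d \<ominus>\<^bsub>Hom C s s\<^esub> c \<odot>\<^bsub>Hom C s s\<^esub> Idt C s) (horner s d q1)
      \<oplus>\<^bsub>Hom C s s\<^esub> Kc.eval (rev q) c \<odot>\<^bsub>Hom C s s\<^esub> Idt C s"
      using horner_division[OF so d Suc.prems(2) c(1)] by blast
    let ?dc = "d \<ominus>\<^bsub>Hom C s s\<^esub> c \<odot>\<^bsub>Hom C s s\<^esub> Idt C s"
    have dc: "?dc \<in> mor s s" and h: "horner s d q1 \<in> mor s s"
      using so d c horner_closed[OF so d q1(1)] by simp_all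
    have 0: "Cmp C s s s ?dc (horner s d q1) = nul s s"
      using q1(4) Suc.prems(4) c dc h so by simp
    show ?case
    proof (cases "?dc = nul s s")
      case True
      then show ?thesis using so d c by auto
    next
      case False
      then obtain g where g: "g \<in> mor s s" "Cmp C s s s g ?dc = Idt C s"
        using S_endo_iso[OF s dc] is_iso_inverse by metis
      have "horner s d q1 = nul s s"
        using Cmp_reassoc[OF g(2), of s "horner s d q1"] 0 g dc h so by simp
      then show ?thesis using Suc.IH[of q1] q1 Suc.prems by simp
    qed
  qed
  then show ?thesis using monic_annihilator_exists[OF so d fd] by blast
qed

end


section \<open>The radical and the simple modules\<close>

lemma right_smult_neg_one:
  assumes M: "right_module A M" and v: "v \<in> carrier M"
  shows "(\<ominus>\<^bsub>A\<^esub> \<one>\<^bsub>A\<^esub>) \<odot>\<^bsub>M\<^esub> v = \<ominus>\<^bsub>M\<^esub> v"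
proof -
  interpret A: ring A by (rule right_module_ring[OF M])
  interpret M: abelian_group M by (rule right_module_group[OF M])
  have "(\<ominus>\<^bsub>A\<^esub> \<one>\<^bsub>A\<^esub>) \<odot>\<^bsub>M\<^esub> v \<oplus>\<^bsub>M\<^esub> \<one>\<^bsub>A\<^esub> \<odot>\<^bsub>M\<^esub> v = (\<ominus>\<^bsub>A\<^esub> \<one>\<^bsub>A\<^esub> \<oplus>\<^bsub>A\<^esub> \<one>\<^bsub>A\<^esub>) \<odot>\<^bsub>M\<^esub> v"
    using right_smult_add_left[OF M, of "\<ominus>\<^bsub>A\<^esub> \<one>\<^bsub>A\<^esub>" "\<one>\<^bsub>A\<^esub>" v] v by simp
  also have "\<dots> = \<zero>\<^bsub>M\<^esub>" using right_zero_smult[OF M v] by (simp add: A.l_neg)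
  finally have "(\<ominus>\<^bsub>A\<^esub> \<one>\<^bsub>A\<^esub>) \<odot>\<^bsub>M\<^esub> v \<oplus>\<^bsub>M\<^esub> v = \<zero>\<^bsub>M\<^esub>" using right_smult_one[OF M v] by simp
  then show ?thesis using M.minus_equality right_smult_closed[OF M _ v] v by simp
qed

lemma right_submodule_iff:
  assumes M: "right_module A M"
  shows "right_submodule A M N \<longleftrightarrow> N \<subseteq> carrier M \<and> \<zero>\<^bsub>M\<^esub> \<in> N \<and> (\<forall>u \<in> N. \<forall>v \<in> N. u \<oplus>\<^bsub>M\<^esub> v \<in> N) \<and>
    (\<forall>a \<in> carrier A. \<forall>v \<in> N. a \<odot>\<^bsub>M\<^esub> v \<in> N)" (is "?l \<longleftrightarrow> ?r")
proof
  interpret A: ring A by (rule right_module_ring[OF M])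
  interpret M: abelian_group M by (rule right_module_group[OF M])
  show "?l \<Longrightarrow> ?r"
    unfolding right_submodule_def
    using additive_subgroup.a_subset additive_subgroup.a_closed additive_subgroup.zero_closed by metis
  assume r: ?r
  have "subgroup N (add_monoid M)"
  proof
    fix v assume v: "v \<in> N"
    then have "(\<ominus>\<^bsub>A\<^esub> \<one>\<^bsub>A\<^esub>) \<odot>\<^bsub>M\<^esub> v \<in> N" using r by simp
    moreover have "v \<in> carrier M" using v r by blast
    ultimately have "\<ominus>\<^bsub>M\<^esub> v \<in> N" using right_smult_neg_one[OF M, of v] by simp
    then show "inv\<^bsub>add_monoid M\<^esub> v \<in> N" unfolding a_inv_def .
  qed (use r in auto)
  then show ?l unfolding right_submodule_def using r additive_subgroupI by blast
qed

lemma idem_module_simps [simp]: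
  "carrier (idem_module A e) = (\<lambda>a. e \<otimes>\<^bsub>A\<^esub> a) ` carrier A"
  "zero (idem_module A e) = \<zero>\<^bsub>A\<^esub>"
  "add (idem_module A e) = add A"
  "a \<odot>\<^bsub>idem_module A e\<^esub> v = v \<otimes>\<^bsub>A\<^esub> a"
  by (simp_all add: idem_module_def)

lemma idem_module_right_module:
  assumes "ring A" "e \<in> carrier A"
  shows "right_module A (idem_module A e)"
proof -
  interpret ring A by (fact assms)
  have ab: "abelian_group (idem_module A e)"
  proof (rule abelian_groupI)
    fix u v assume "u \<in> carrier (idem_module A e)" "v \<in> carrier (idem_module A e)"
    then show "u \<oplus>\<^bsub>idem_module A e\<^esub> v \<in> carrier (idem_module A e)"
      using assms by (auto simp flip: r_distr)
  next
    show "\<zero>\<^bsub>idem_module A e\<^esub> \<in> carrier (idem_module A e)" using assms by (auto intro!: image_eqI[of _ _ "\<zero>\<^bsub>A\<^esub>"])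
  next
    fix u assume "u \<in> carrier (idem_module A e)"
    then obtain a where a: "a \<in> carrier A" "u = e \<otimes>\<^bsub>A\<^esub> a" by auto
    then have "e \<otimes>\<^bsub>A\<^esub> (\<ominus>\<^bsub>A\<^esub> a) \<oplus>\<^bsub>A\<^esub> u = \<zero>\<^bsub>A\<^esub>" using assms by (simp add: r_minus l_neg)
    then show "\<exists>v \<in> carrier (idem_module A e). v \<oplus>\<^bsub>idem_module A e\<^esub> u = \<zero>\<^bsub>idem_module A e\<^esub>"
      using a by auto
  qed (use assms in \<open>auto simp: a_ac\<close>)
  show ?thesis
    unfolding right_module_def using assms ab by (auto simp: m_assoc l_distr r_distr)
qed

text \<open>The union in the definition of the quotient runs over all representatives of a coset, and their
  multiples lie in one coset.\<close>

lemma coset_smult: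
  assumes M: "abelian_group M" and N: "additive_subgroup N M" and x: "x \<in> carrier M"
    and cl: "\<And>v. v \<in> carrier M \<Longrightarrow> a \<odot>\<^bsub>M\<^esub> v \<in> carrier M"
    and add: "\<And>u v. \<lbrakk>u \<in> carrier M; v \<in> carrier M\<rbrakk> \<Longrightarrow> a \<odot>\<^bsub>M\<^esub> (u \<oplus>\<^bsub>M\<^esub> v) = a \<odot>\<^bsub>M\<^esub> u \<oplus>\<^bsub>M\<^esub> a \<odot>\<^bsub>M\<^esub> v"
    and stable: "\<And>n. n \<in> N \<Longrightarrow> a \<odot>\<^bsub>M\<^esub> n \<in> N"
  shows "a \<odot>\<^bsub>quot_module M N\<^esub> (N +>\<^bsub>M\<^esub> x) = N +>\<^bsub>M\<^esub> (a \<odot>\<^bsub>M\<^esub> x)"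
proof -
  interpret N: abelian_subgroup N M by (rule abelian_subgroupI3[OF N M])
  have eq: "N +>\<^bsub>M\<^esub> (a \<odot>\<^bsub>M\<^esub> v) = N +>\<^bsub>M\<^esub> (a \<odot>\<^bsub>M\<^esub> x)" if v: "v \<in> N +>\<^bsub>M\<^esub> x" for v
  proof -
    obtain n where n: "n \<in> N" "v = n \<oplus>\<^bsub>M\<^esub> x" using v unfolding a_r_coset_def' by blast
    then have "a \<odot>\<^bsub>M\<^esub> v = a \<odot>\<^bsub>M\<^esub> n \<oplus>\<^bsub>M\<^esub> a \<odot>\<^bsub>M\<^esub> x" using add x by simp
    then have "a \<odot>\<^bsub>M\<^esub> v \<in> N +>\<^bsub>M\<^esub> (a \<odot>\<^bsub>M\<^esub> x)" unfolding a_r_coset_def' using stable n by blast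
    then show ?thesis using N.a_repr_independence'[OF _ cl[OF x]] by simp
  qed
  have "x \<in> N +>\<^bsub>M\<^esub> x" by (rule N.a_rcos_self[OF x])
  moreover have "a \<odot>\<^bsub>quot_module M N\<^esub> (N +>\<^bsub>M\<^esub> x) = (\<Union>v \<in> N +>\<^bsub>M\<^esub> x. N +>\<^bsub>M\<^esub> (a \<odot>\<^bsub>M\<^esub> v))"
    by (simp add: quot_module_def)
  moreover have "\<dots> = (\<Union>v \<in> N +>\<^bsub>M\<^esub> x. N +>\<^bsub>M\<^esub> (a \<odot>\<^bsub>M\<^esub> x))"
    by (rule SUP_cong[OF refl eq])
  ultimately show ?thesis by auto
qed

context represented_modules
begin

lemma right_ideal_iff:
  "right_submodule alg (idem_module alg \<one>\<^bsub>alg\<^esub>) I \<longleftrightarrow> (\<exists>N. end_submodule P N \<and> I = enc P ` N)"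
proof -
  have rm: "right_module alg (idem_module alg \<one>\<^bsub>alg\<^esub>)"
    using idem_module_right_module[OF alg_ring, of "\<one>\<^bsub>alg\<^esub>"] by simp
  have c: "carrier (idem_module alg \<one>\<^bsub>alg\<^esub>) = enc P ` mor P P" by (auto simp: image_iff)
  show ?thesis
    unfolding right_submodule_iff[OF rm] c
  proof
    assume I: "I \<subseteq> enc P ` mor P P \<and> \<zero>\<^bsub>idem_module alg \<one>\<^bsub>alg\<^esub>\<^esub> \<in> I \<and>
      (\<forall>u \<in> I. \<forall>v \<in> I. u \<oplus>\<^bsub>idem_module alg \<one>\<^bsub>alg\<^esub>\<^esub> v \<in> I) \<and>
      (\<forall>a \<in> carrier alg. \<forall>v \<in> I. a \<odot>\<^bsub>idem_module alg \<one>\<^bsub>alg\<^esub>\<^esub> v \<in> I)"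
    let ?N = "{u \<in> mor P P. enc P u \<in> I}"
    have cl: "enc P u \<otimes>\<^bsub>alg\<^esub> enc P e \<in> I" if "enc P u \<in> I" "e \<in> mor P P" for u e
      using I that by simp
    have ad: "enc P u \<oplus>\<^bsub>alg\<^esub> enc P v \<in> I" if "enc P u \<in> I" "enc P v \<in> I" for u v
      using I that by simp
    have "end_submodule P ?N"
      unfolding end_submodule_def
    proof (intro conjI ballI)
      show "nul P P \<in> ?N" using I by simp
      fix u assume u: "u \<in> ?N"
      show "u \<oplus>\<^bsub>Hom C P P\<^esub> v \<in> ?N" if "v \<in> ?N" for v using ad[of u v] u that by simp
      show "Cmp C P P P u e \<in> ?N" if "e \<in> mor P P" for e using cl[of u e] u that by simp
    qed auto
    moreover have "I = enc P ` ?N" using I by blast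
    ultimately show "\<exists>N. end_submodule P N \<and> I = enc P ` N" by blast
  next
    assume "\<exists>N. end_submodule P N \<and> I = enc P ` N"
    then obtain N where N: "end_submodule P N" and I: "I = enc P ` N" by blast
    have m: "u \<in> mor P P" if "u \<in> N" for u using N that unfolding end_submodule_def by blast
    show "I \<subseteq> enc P ` mor P P \<and> \<zero>\<^bsub>idem_module alg \<one>\<^bsub>alg\<^esub>\<^esub> \<in> I \<and>
      (\<forall>u \<in> I. \<forall>v \<in> I. u \<oplus>\<^bsub>idem_module alg \<one>\<^bsub>alg\<^esub>\<^esub> v \<in> I) \<and>
      (\<forall>a \<in> carrier alg. \<forall>v \<in> I. a \<odot>\<^bsub>idem_module alg \<one>\<^bsub>alg\<^esub>\<^esub> v \<in> I)"
      unfolding I using N m unfolding end_submodule_def by auto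
  qed
qed

definition annihilator :: "'o \<Rightarrow> 'm \<Rightarrow> 'm set" where
  "annihilator s v = {a \<in> mor P P. Cmp C P P s v a = nul P s}"

text \<open>The radical before encoding: the common annihilator of the modules \<open>Hom(P, s)\<close>.\<close>

definition jac :: "'m set" where
  "jac = {a \<in> mor P P. \<forall>s \<in> S. \<forall>v \<in> mor P s. Cmp C P P s v a = nul P s}"

lemma annihilator_submodule:
  assumes s: "s \<in> Obj C" and v: "v \<in> mor P s"
  shows "end_submodule P (annihilator s v)"
  unfolding end_submodule_def annihilator_def
  using assms by (auto simp: Cmp_add_right simp flip: Cmp_assoc)

text \<open>\<open>Hom(P, s)\<close> is generated by each of its nonzero elements, by projectivity of \<open>P\<close>.\<close>

lemma annihilator_maximal:
  assumes s: "s \<in> S" and v: "v \<in> mor P s" "v \<noteq> nul P s"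
    and N: "end_submodule P N" "annihilator s v \<subseteq> N" "annihilator s v \<noteq> N"
  shows "N = mor P P"
proof -
  have so: "s \<in> Obj C" by (rule S_obj[OF s])
  obtain c where c: "c \<in> N" "c \<notin> annihilator s v" using N by blast
  have cm: "c \<in> mor P P" using c N unfolding end_submodule_def by blast
  have vc: "Cmp C P P s v c \<in> mor P s" "Cmp C P P s v c \<noteq> nul P s"
    using cm v c so unfolding annihilator_def by auto
  obtain b where b: "b \<in> mor P P" "Cmp C P P s (Cmp C P P s v c) b = v"
    using simple_lift[OF P_E s vc v(1)] by blast
  have cb: "Cmp C P P P c b \<in> N" using N c b unfolding end_submodule_def by blast
  have "Idt C P \<ominus>\<^bsub>Hom C P P\<^esub> Cmp C P P P c b \<in> annihilator s v"
    unfolding annihilator_def using v so cm b by (simp add: Cmp_diff_right Cmp_assoc)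
  then have "(Idt C P \<ominus>\<^bsub>Hom C P P\<^esub> Cmp C P P P c b) \<oplus>\<^bsub>Hom C P P\<^esub> Cmp C P P P c b \<in> N"
    using N cb unfolding end_submodule_def by blast
  then have 1: "Idt C P \<in> N" using mor_diff_add(1)[of P P "Idt C P" "Cmp C P P P c b"] cm b by simp
  have "u \<in> N" if u: "u \<in> mor P P" for u
  proof -
    have "Cmp C P P P (Idt C P) u \<in> N" using N 1 u unfolding end_submodule_def by blast
    then show ?thesis using u by simp
  qed
  then show ?thesis using N unfolding end_submodule_def by blast
qed

text \<open>\<open>N\<close> is the kernel of the map to \<open>Hom(P, y)\<close> induced by some \<open>g\<close>, and \<open>y\<close> has a simple quotient
  because it is nonzero.\<close>

lemma proper_submodule_annihilated:
  assumes N: "end_submodule P N" "N \<noteq> mor P P"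
  shows "\<exists>s \<in> S. \<exists>v \<in> mor P s. v \<noteq> nul P s \<and> N \<subseteq> annihilator s v"
proof -
  obtain y g where y: "y \<in> E" and g: "g \<in> mor P y"
    and surj: "\<forall>w \<in> mor P y. \<exists>u \<in> mor P P. Cmp C P P y g u = w"
    and ker: "\<forall>u \<in> mor P P. Cmp C P P y g u = nul P y \<longleftrightarrow> u \<in> N"
    using represented_quotient[OF P_E N(1)] by blast
  have yo: "y \<in> Obj C" using y by simp
  have "\<not> zero_object C y"
  proof
    assume "zero_object C y"
    then have "Cmp C P P y g u = nul P y" if "u \<in> mor P P" for u
      using zero_objectD(3) g that yo by (meson Cmp_closed P_obj)
    then show False using ker N unfolding end_submodule_def by blast
  qed
  then obtain s b where s: "s \<in> S" and b: "b \<in> mor y s" "b \<noteq> nul y s"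
    using nonzero_has_simple_quotient[OF y] by blast
  have so: "s \<in> Obj C" by (rule S_obj[OF s])
  let ?v = "Cmp C P y s b g"
  have "?v \<noteq> nul P s"
  proof
    assume 0: "?v = nul P s"
    have "b = nul y s"
    proof (rule represented_faithful[OF y S_E[OF s] b(1)])
      fix w assume "w \<in> mor P y"
      then obtain u where u: "u \<in> mor P P" "Cmp C P P y g u = w" using surj by blast
      then show "Cmp C P y s b w = nul P s" using Cmp_assoc[of P P y s b g u] 0 b g so yo by simp
    qed
    then show False using b by blast
  qed
  moreover have "N \<subseteq> annihilator s ?v"
  proof
    fix u assume u: "u \<in> N"
    then have um: "u \<in> mor P P" using N unfolding end_submodule_def by blast
    then have "Cmp C P P y g u = nul P y" using ker u by blast
    then show "u \<in> annihilator s ?v" unfolding annihilator_def using um b g so yo by (simp add: Cmp_assoc)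
  qed
  ultimately show ?thesis using s b g so yo by (intro bexI[of _ s] bexI[of _ ?v]) simp_all
qed

text \<open>This identifies the radical of the algebra with \<open>jac\<close>, as each \<open>v\<close> contributes its annihilator to the
  intersection of the maximal right ideals.\<close>

lemma maximal_right_ideal_iff:
  "maximal_right_ideal alg I \<longleftrightarrow> (\<exists>s \<in> S. \<exists>v \<in> mor P s. v \<noteq> nul P s \<and> I = enc P ` annihilator s v)"
proof
  have img2: "enc P ` N \<subseteq> enc P ` N' \<longleftrightarrow> N \<subseteq> N'" if "N \<subseteq> mor P P" "N' \<subseteq> mor P P" for N N'
  proof
    assume sub: "enc P ` N \<subseteq> enc P ` N'"
    show "N \<subseteq> N'"
    proof
      fix u assume u: "u \<in> N"
      then obtain u' where u': "u' \<in> N'" "enc P u = enc P u'" using sub by blast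
      then have "u = u'" using enc_eq_iff[OF P_obj, of u u'] u that by blast
      then show "u \<in> N'" using u' by simp
    qed
  qed blast
  have img: "enc P ` N = enc P ` N' \<longleftrightarrow> N = N'" if "N \<subseteq> mor P P" "N' \<subseteq> mor P P" for N N'
    by (rule inj_on_image_eq_iff[OF enc_inj[OF P_obj] that])
  have sub: "N \<subseteq> mor P P" if "end_submodule P N" for N using that unfolding end_submodule_def by blast
  have ann: "end_submodule P (annihilator s v)" "annihilator s v \<noteq> mor P P"
    if "s \<in> S" "v \<in> mor P s" "v \<noteq> nul P s" for s v
  proof -
    show "end_submodule P (annihilator s v)" by (rule annihilator_submodule[OF S_obj[OF that(1)] that(2)])
    have "Idt C P \<notin> annihilator s v"
      using Idt_right[OF P_obj S_obj[OF that(1)] that(2)] that(3) unfolding annihilator_def by simp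
    then show "annihilator s v \<noteq> mor P P" using Idt_closed[OF P_obj] by blast
  qed
  {
    assume I: "maximal_right_ideal alg I"
    then obtain N where N: "end_submodule P N" "I = enc P ` N"
      unfolding maximal_right_ideal_def right_ideal_iff by blast
    have "N \<noteq> mor P P" using I N unfolding maximal_right_ideal_def by auto
    then obtain s v where sv: "s \<in> S" "v \<in> mor P s" "v \<noteq> nul P s" "N \<subseteq> annihilator s v"
      using proper_submodule_annihilated[OF N(1)] by blast
    have "right_submodule alg (idem_module alg \<one>\<^bsub>alg\<^esub>) (enc P ` annihilator s v)"
      unfolding right_ideal_iff using ann[OF sv(1-3)] by blast
    then have "enc P ` annihilator s v = I \<or> enc P ` annihilator s v = carrier alg"
      using I sv(4) N(2) unfolding maximal_right_ideal_def by blast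
    moreover have "enc P ` annihilator s v \<noteq> carrier alg"
      using img[OF sub[OF ann(1)[OF sv(1-3)]], of "mor P P"] ann(2)[OF sv(1-3)] by simp
    ultimately show "\<exists>s \<in> S. \<exists>v \<in> mor P s. v \<noteq> nul P s \<and> I = enc P ` annihilator s v" using sv by blast
  next
    assume "\<exists>s \<in> S. \<exists>v \<in> mor P s. v \<noteq> nul P s \<and> I = enc P ` annihilator s v"
    then obtain s v where sv: "s \<in> S" "v \<in> mor P s" "v \<noteq> nul P s" and I: "I = enc P ` annihilator s v" by blast
    note a = ann[OF sv]
    show "maximal_right_ideal alg I"
      unfolding maximal_right_ideal_def right_ideal_iff
    proof (intro conjI allI impI)
      show "\<exists>N. end_submodule P N \<and> I = enc P ` N" using a(1) I by blast
      show "I \<noteq> carrier alg" using img[OF sub[OF a(1)], of "mor P P"] a(2) I by simp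
    next
      fix J assume "(\<exists>N. end_submodule P N \<and> J = enc P ` N) \<and> I \<subseteq> J"
      then obtain N where N: "end_submodule P N" "J = enc P ` N" "I \<subseteq> J" by blast
      then have "annihilator s v \<subseteq> N" using img2[OF sub[OF a(1)] sub[OF N(1)]] I by simp
      then have "N = annihilator s v \<or> N = mor P P" using annihilator_maximal[OF sv N(1)] by blast
      then show "J = I \<or> J = carrier alg" using N I by auto
    qed
  }
qed

lemma rad_alg: "rad alg = enc P ` jac"
proof (intro equalityI subsetI)
  fix r assume r: "r \<in> rad alg"
  then obtain a where a: "a \<in> mor P P" "r = enc P a" unfolding rad_def by auto
  have "Cmp C P P s v a = nul P s" if "s \<in> S" "v \<in> mor P s" for s v
  proof (cases "v = nul P s")
    case True
    then show ?thesis using a S_obj that by simp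
  next
    case False
    then have "r \<in> enc P ` annihilator s v"
      using r that maximal_right_ideal_iff unfolding rad_def by blast
    then obtain b where "b \<in> annihilator s v" "enc P a = enc P b" using a by auto
    then show ?thesis using a unfolding annihilator_def by (auto simp: enc_eq_iff)
  qed
  then show "r \<in> enc P ` jac" unfolding jac_def using a by blast
next
  fix r assume "r \<in> enc P ` jac"
  then obtain a where a: "a \<in> jac" "r = enc P a" by blast
  have "r \<in> I" if "maximal_right_ideal alg I" for I
    using that a unfolding maximal_right_ideal_iff annihilator_def jac_def by auto
  then show "r \<in> rad alg" unfolding rad_def using a unfolding jac_def by auto
qed

lemma jac_mor: "a \<in> jac \<Longrightarrow> a \<in> mor P P"
  unfolding jac_def by blast

lemma jac_annihilates: "\<lbrakk>a \<in> jac; s \<in> S; v \<in> mor P s\<rbrakk> \<Longrightarrow> Cmp C P P s v a = nul P s"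
  unfolding jac_def by blast

lemma jac_submodule: "end_submodule P jac"
  unfolding end_submodule_def jac_def using S_obj by (auto simp: Cmp_add_right simp flip: Cmp_assoc)

lemma jac_left: "\<lbrakk>a \<in> jac; b \<in> mor P P\<rbrakk> \<Longrightarrow> Cmp C P P P b a \<in> jac"
  using S_obj unfolding jac_def by (auto simp flip: Cmp_assoc)

lemma jac_right: "\<lbrakk>a \<in> jac; b \<in> mor P P\<rbrakk> \<Longrightarrow> Cmp C P P P a b \<in> jac"
  using jac_submodule unfolding end_submodule_def by blast

lemma jac_add: "\<lbrakk>a \<in> jac; b \<in> jac\<rbrakk> \<Longrightarrow> a \<oplus>\<^bsub>Hom C P P\<^esub> b \<in> jac"
  using jac_submodule unfolding end_submodule_def by blast

lemma rep_simple:
  assumes s: "s \<in> S"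
  shows "simple_right_module alg (rep s)"
proof -
  have so: "s \<in> Obj C" by (rule S_obj[OF s])
  note rm = rep_right_module[OF so]
  have "carrier (rep s) \<noteq> {\<zero>\<^bsub>rep s\<^esub>}"
    using P_generates[OF s] so enc_eq_iff[OF so _ nul_closed[OF P_obj so]] by auto
  moreover have "N = {\<zero>\<^bsub>rep s\<^esub>} \<or> N = carrier (rep s)" if N: "right_submodule alg (rep s) N" for N
  proof (cases "N = {\<zero>\<^bsub>rep s\<^esub>}")
    case False
    have N': "N \<subseteq> carrier (rep s)" "\<zero>\<^bsub>rep s\<^esub> \<in> N" "\<And>a v. \<lbrakk>a \<in> carrier alg; v \<in> N\<rbrakk> \<Longrightarrow> a \<odot>\<^bsub>rep s\<^esub> v \<in> N"
      using N unfolding right_submodule_iff[OF rm] by auto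
    then obtain n where "n \<in> N" "n \<noteq> \<zero>\<^bsub>rep s\<^esub>" using False by blast
    then obtain u where u: "u \<in> mor P s" "enc s u \<in> N" "u \<noteq> nul P s" using N'(1) by auto
    have "carrier (rep s) \<subseteq> N"
    proof
      fix w assume "w \<in> carrier (rep s)"
      then obtain w' where w': "w' \<in> mor P s" "w = enc s w'" by auto
      obtain e where e: "e \<in> mor P P" "Cmp C P P s u e = w'" using simple_lift[OF P_E s u(1,3) w'(1)] by blast
      then have "w = enc P e \<odot>\<^bsub>rep s\<^esub> enc s u" using u w' so by simp
      then show "w \<in> N" using N'(3)[of "enc P e"] u e by simp
    qed
    then show ?thesis using N'(1) by blast
  qed simp
  ultimately show ?thesis unfolding simple_right_module_def using rm by blast
qed

lemma rep_Obj: "x \<in> Obj C \<Longrightarrow> rep x \<in> Obj (mod_cat alg)"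
  using rep_right_module rep_finitely_generated by simp

text \<open>\<open>M\<close> is isomorphic to some \<open>Hom(P, y)\<close>. A simple quotient of \<open>y\<close> gives a nonzero homomorphism to a
  simple module, which is an isomorphism by Schur's lemma.\<close>

lemma simple_module_represented:
  assumes M: "simple_right_module alg M" and fg: "finitely_generated alg M"
  shows "\<exists>s \<in> S. right_iso alg M (rep s)"
proof -
  have rm: "right_module alg M" using M unfolding simple_right_module_def by blast
  interpret M: abelian_group M by (rule right_module_group[OF rm])
  obtain y where y: "y \<in> E" "right_iso alg (rep y) M" using rep_essentially_surjective[OF rm fg] by blast
  have yo: "y \<in> Obj C" using y by simp
  note ry = rep_right_module[OF yo]
  obtain f where f: "f \<in> right_hom alg (rep y) M" "bij_betw f (carrier (rep y)) (carrier M)"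
    using y unfolding right_iso_def by blast
  obtain g where g: "g \<in> right_hom alg M (rep y)" "bij_betw g (carrier M) (carrier (rep y))"
    using alg.right_iso_inverse[OF ry rm f] by metis
  have "\<not> zero_object C y"
  proof
    assume "zero_object C y"
    then have "mor P y = {nul P y}" unfolding zero_object_def by simp
    then have "carrier M = {f (enc y (nul P y))}" using bij_betw_imp_surj_on[OF f(2)] by simp
    then have "carrier M = {\<zero>\<^bsub>M\<^esub>}" using M.zero_closed by auto
    then show False using M unfolding simple_right_module_def by blast
  qed
  then obtain s b where s: "s \<in> S" and b: "b \<in> mor y s" "b \<noteq> nul y s"
    using nonzero_has_simple_quotient[OF y(1)] by blast
  have so: "s \<in> Obj C" by (rule S_obj[OF s])
  note rs = rep_right_module[OF so]
  let ?b = "on_hom rep_functor y s b"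
  note B = rep_on_hom[OF yo so b(1)]
  let ?h = "compose (carrier M) ?b g"
  have h: "?h \<in> right_hom alg M (rep s)" by (rule alg.right_hom_compose[OF rm g(1) B])
  have him: "?h ` carrier M = carrier (rep s)"
  proof (intro equalityI subsetI)
    fix w assume "w \<in> carrier (rep s)"
    then obtain w' where w': "w' \<in> mor P s" "w = enc s w'" by auto
    obtain u where u: "u \<in> mor P y" "Cmp C P y s b u = w'" using simple_lift[OF y(1) s b w'(1)] by blast
    have "enc y u \<in> g ` carrier M" using bij_betw_imp_surj_on[OF g(2)] u by simp
    then obtain m where m: "m \<in> carrier M" "g m = enc y u" by (metis imageE)
    have "?h m = w" using m u w' yo by (simp add: compose_eq rep_on_hom_apply)
    then show "w \<in> ?h ` carrier M" using m by blast
  next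
    fix w assume "w \<in> ?h ` carrier M"
    then obtain m where "m \<in> carrier M" "w = ?h m" by (rule imageE)
    then show "w \<in> carrier (rep s)" using right_hom_closed[OF h, of m] by (simp del: rep_simps)
  qed
  let ?N = "{m \<in> carrier M. ?h m = \<zero>\<^bsub>rep s\<^esub>}"
  interpret Rs: abelian_group "rep s" by (rule rep_abelian[OF so])
  have h0: "?h \<zero>\<^bsub>M\<^esub> = \<zero>\<^bsub>rep s\<^esub>"
  proof -
    have "?h \<zero>\<^bsub>M\<^esub> = ?h \<zero>\<^bsub>M\<^esub> \<oplus>\<^bsub>rep s\<^esub> ?h \<zero>\<^bsub>M\<^esub>"
      using right_hom_add[OF h M.zero_closed M.zero_closed] by (simp del: rep_simps)
    then show ?thesis using right_hom_closed[OF h M.zero_closed] by (metis Rs.add.r_cancel_one')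
  qed
  have "right_submodule alg M ?N"
    unfolding right_submodule_iff[OF rm]
  proof (intro conjI ballI)
    show "\<zero>\<^bsub>M\<^esub> \<in> ?N" using h0 by simp
    fix u assume u: "u \<in> ?N"
    show "u \<oplus>\<^bsub>M\<^esub> v \<in> ?N" if "v \<in> ?N" for v
      using u that right_hom_add[OF h, of u v] Rs.l_zero[OF Rs.zero_closed] by (simp del: rep_simps)
  next
    fix a v assume a: "a \<in> carrier alg" and v: "v \<in> ?N"
    then have vm: "v \<in> carrier M" by simp
    have "?h (a \<odot>\<^bsub>M\<^esub> v) = a \<odot>\<^bsub>rep s\<^esub> ?h v" by (rule right_hom_smult[OF h a vm])
    also have "\<dots> = \<zero>\<^bsub>rep s\<^esub>" using v right_smult_zero[OF rs a] by simp
    finally show "a \<odot>\<^bsub>M\<^esub> v \<in> ?N" using right_smult_closed[OF rm a vm] by simp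
  qed auto
  moreover have "?N \<noteq> carrier M"
  proof
    assume all: "?N = carrier M"
    have "?h m \<in> {\<zero>\<^bsub>rep s\<^esub>}" if m: "m \<in> carrier M" for m
    proof -
      have "m \<in> ?N" by (subst all) (rule m)
      then show ?thesis by blast
    qed
    then have "?h ` carrier M \<subseteq> {\<zero>\<^bsub>rep s\<^esub>}" by blast
    then have "carrier (rep s) = {\<zero>\<^bsub>rep s\<^esub>}" unfolding him using Rs.zero_closed by blast
    then show False using rep_simple[OF s] unfolding simple_right_module_def by blast
  qed
  ultimately have N: "?N = {\<zero>\<^bsub>M\<^esub>}" using M unfolding simple_right_module_def by blast
  have "inj_on ?h (carrier M)"
  proof (rule inj_onI)
    fix u v assume u: "u \<in> carrier M" and v: "v \<in> carrier M" and eq: "?h u = ?h v"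
    let ?d = "u \<ominus>\<^bsub>M\<^esub> v"
    have d: "?d \<in> carrier M" using u v by simp
    have "?d \<oplus>\<^bsub>M\<^esub> v = u" using u v by (simp add: a_minus_def M.a_assoc M.l_neg)
    then have "?h v = ?h ?d \<oplus>\<^bsub>rep s\<^esub> ?h v" using right_hom_add[OF h d v] eq by simp
    then have "?h ?d = \<zero>\<^bsub>rep s\<^esub>"
      using right_hom_closed[OF h d] right_hom_closed[OF h v] by (metis Rs.add.r_cancel_one')
    then have "?d = \<zero>\<^bsub>M\<^esub>" using N d by blast
    then show "u = v" using u v by simp
  qed
  then show ?thesis unfolding right_iso_def bij_betw_def using h him s by blast
qed

lemma rep_simple_iso_imp_eq:
  assumes s: "s \<in> S" and t: "t \<in> S" and iso: "right_iso alg (rep s) (rep t)"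
  shows "s = t"
proof (rule ccontr)
  assume ne: "s \<noteq> t"
  have so: "s \<in> Obj C" "t \<in> Obj C" using S_obj s t by auto
  obtain f where f: "f \<in> right_hom alg (rep s) (rep t)" "bij_betw f (carrier (rep s)) (carrier (rep t))"
    using iso unfolding right_iso_def by blast
  have "f \<in> on_hom rep_functor s t ` mor s t"
    using bij_betw_imp_surj_on[OF rep_fully_faithful[OF S_E[OF s] S_E[OF t]]] f(1) by simp
  then have "f = on_hom rep_functor s t (nul s t)" using S_orth[OF s t ne] by simp
  then have "f (enc s u) = enc t (nul P t)" if "u \<in> mor P s" for u
    using that so by (simp add: rep_on_hom_apply)
  then have "f ` carrier (rep s) \<subseteq> {\<zero>\<^bsub>rep t\<^esub>}" by auto
  then have "carrier (rep t) \<subseteq> {\<zero>\<^bsub>rep t\<^esub>}" using bij_betw_imp_surj_on[OF f(2)] by simp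
  then have "carrier (rep t) = {\<zero>\<^bsub>rep t\<^esub>}" using so by auto
  then show False using rep_simple[OF t] unfolding simple_right_module_def by blast
qed

lemma gabriel_quiver_vertices:
  "bij_betw (\<lambda>s. iso_class alg (rep s)) S
    (iso_class alg ` {M \<in> Obj (mod_cat alg). simple_right_module alg M})"
  unfolding bij_betw_def
proof (intro conjI inj_onI equalityI subsetI)
  fix s t assume s: "s \<in> S" and t: "t \<in> S" and eq: "iso_class alg (rep s) = iso_class alg (rep t)"
  have "rep t \<in> iso_class alg (rep t)"
    unfolding iso_class_def using rep_Obj alg.right_iso_refl rep_right_module S_obj t by blast
  then have "right_iso alg (rep s) (rep t)" using eq unfolding iso_class_def by blast
  then show "s = t" by (rule rep_simple_iso_imp_eq[OF s t])
next
  fix U :: "('k coords, 'k coords) module set" assume "U \<in> (\<lambda>s. iso_class alg (rep s)) ` S"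
  then show "U \<in> iso_class alg ` {M \<in> Obj (mod_cat alg). simple_right_module alg M}"
    using rep_Obj S_obj rep_simple by blast
next
  fix U :: "('k coords, 'k coords) module set" assume "U \<in> iso_class alg ` {M \<in> Obj (mod_cat alg). simple_right_module alg M}"
  then obtain M :: "('k coords, 'k coords) module" where U: "U = iso_class alg M"
    and M: "right_module alg M" "finitely_generated alg M" "simple_right_module alg M"
    by auto
  obtain s where s: "s \<in> S" "right_iso alg M (rep s)" using simple_module_represented[OF M(3,2)] by blast
  have rs: "right_module alg (rep s)" using rep_right_module S_obj s by blast
  have "iso_class alg M = iso_class alg (rep s)"
    unfolding iso_class_def
    using alg.right_iso_trans[OF M(1) s(2)] alg.right_iso_trans[OF rs alg.right_iso_sym[OF M(1) rs s(2)]] by blast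
  then show "U \<in> (\<lambda>s. iso_class alg (rep s)) ` S" using U s by blast
qed

end


section \<open>Idempotents of the simple modules\<close>

context represented_modules
begin

text \<open>\<open>top_idempotent s e v\<close> expresses by means of the quotient map \<open>v\<close> that \<open>eA\<close> has the unique
  maximal submodule \<open>e rad A\<close>, with quotient \<open>Hom(P, s)\<close>.\<close>

definition top_idempotent :: "'o \<Rightarrow> 'm \<Rightarrow> 'm \<Rightarrow> bool" where
  "top_idempotent s e v \<longleftrightarrow> e \<in> mor P P \<and> Cmp C P P P e e = e \<and> v \<in> mor P s \<and> v \<noteq> nul P s \<and>
     Cmp C P P s v e = v \<and> (\<forall>a \<in> mor P P. Cmp C P P s v a = nul P s \<longrightarrow> Cmp C P P P e a \<in> jac)"

definition right_multiples :: "'m \<Rightarrow> 'm set" where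
  "right_multiples a = {Cmp C P P P a b | b. b \<in> mor P P}"

definition left_multiples :: "'m \<Rightarrow> 'm set" where
  "left_multiples a = {Cmp C P P P b a | b. b \<in> mor P P}"

lemma multiples_subspace:
  assumes a: "a \<in> mor P P"
  shows "submodule K (right_multiples a) (Hom C P P)" "submodule K (left_multiples a) (Hom C P P)"
proof -
  interpret V: vectorspace K "Hom C P P" by (rule Hom_vectorspace) simp_all
  show "submodule K (right_multiples a) (Hom C P P)"
  proof (intro submodule.intro V.module_axioms)
    show "nul P P \<in> right_multiples a" unfolding right_multiples_def using a by (auto intro!: exI[of _ "nul P P"])
    fix u v assume "u \<in> right_multiples a" "v \<in> right_multiples a"
    then obtain b d where "u = Cmp C P P P a b" "v = Cmp C P P P a d" "b \<in> mor P P" "d \<in> mor P P"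
      unfolding right_multiples_def by blast
    then show "u \<oplus>\<^bsub>Hom C P P\<^esub> v \<in> right_multiples a"
      unfolding right_multiples_def using a by (auto intro!: exI[of _ "b \<oplus>\<^bsub>Hom C P P\<^esub> d"] simp: Cmp_add_right)
  next
    fix c u assume c: "c \<in> carrier K" and "u \<in> right_multiples a"
    then obtain b where "u = Cmp C P P P a b" "b \<in> mor P P" unfolding right_multiples_def by blast
    then show "c \<odot>\<^bsub>Hom C P P\<^esub> u \<in> right_multiples a"
      unfolding right_multiples_def using a c by (auto intro!: exI[of _ "c \<odot>\<^bsub>Hom C P P\<^esub> b"] simp: Cmp_smult_right)
  qed (use a in \<open>auto simp: right_multiples_def\<close>)
  show "submodule K (left_multiples a) (Hom C P P)"
  proof (intro submodule.intro V.module_axioms)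
    show "nul P P \<in> left_multiples a" unfolding left_multiples_def using a by (auto intro!: exI[of _ "nul P P"])
    fix u v assume "u \<in> left_multiples a" "v \<in> left_multiples a"
    then obtain b d where "u = Cmp C P P P b a" "v = Cmp C P P P d a" "b \<in> mor P P" "d \<in> mor P P"
      unfolding left_multiples_def by blast
    then show "u \<oplus>\<^bsub>Hom C P P\<^esub> v \<in> left_multiples a"
      unfolding left_multiples_def using a by (auto intro!: exI[of _ "b \<oplus>\<^bsub>Hom C P P\<^esub> d"] simp: Cmp_add_left)
  next
    fix c u assume c: "c \<in> carrier K" and "u \<in> left_multiples a"
    then obtain b where "u = Cmp C P P P b a" "b \<in> mor P P" unfolding left_multiples_def by blast
    then show "c \<odot>\<^bsub>Hom C P P\<^esub> u \<in> left_multiples a"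
      unfolding left_multiples_def using a c by (auto intro!: exI[of _ "c \<odot>\<^bsub>Hom C P P\<^esub> b"] simp: Cmp_smult_left)
  qed (use a in \<open>auto simp: left_multiples_def\<close>)
qed

lemma self_multiple: "a \<in> mor P P \<Longrightarrow> a \<in> right_multiples a" "a \<in> mor P P \<Longrightarrow> a \<in> left_multiples a"
  unfolding right_multiples_def left_multiples_def by (auto intro!: exI[of _ "Idt C P"])

lemma multiples_mono:
  assumes "a \<in> mor P P" "b \<in> mor P P"
  shows "right_multiples (Cmp C P P P a b) \<subseteq> right_multiples a" "left_multiples (Cmp C P P P b a) \<subseteq> left_multiples a"
proof -
  show "right_multiples (Cmp C P P P a b) \<subseteq> right_multiples a"
  proof
    fix u assume "u \<in> right_multiples (Cmp C P P P a b)"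
    then obtain d where "d \<in> mor P P" "u = Cmp C P P P (Cmp C P P P a b) d" unfolding right_multiples_def by blast
    then show "u \<in> right_multiples a" unfolding right_multiples_def using assms
      by (auto intro!: exI[of _ "Cmp C P P P b d"] simp: Cmp_assoc)
  qed
  show "left_multiples (Cmp C P P P b a) \<subseteq> left_multiples a"
  proof
    fix u assume "u \<in> left_multiples (Cmp C P P P b a)"
    then obtain d where "d \<in> mor P P" "u = Cmp C P P P d (Cmp C P P P b a)" unfolding left_multiples_def by blast
    then show "u \<in> left_multiples a" unfolding left_multiples_def using assms
      by (auto intro!: exI[of _ "Cmp C P P P d b"] simp: Cmp_assoc)
  qed
qed

text \<open>Among the elements \<open>a\<close> with \<open>va = v\<close> one with minimal \<open>aA\<close> and \<open>Aa\<close> has \<open>a\<^sup>2A = aA\<close> and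
  \<open>Aa\<^sup>2 = Aa\<close>, because \<open>a\<^sup>2\<close> is another such element. If \<open>a = a\<^sup>2b = ca\<^sup>2\<close> then \<open>e = ab = ca\<close> is
  idempotent, and it is just as minimal.\<close>

lemma minimal_stabilizing_idempotent:
  assumes s: "s \<in> Obj C" and v: "v \<in> mor P s"
  shows "\<exists>e \<in> mor P P. Cmp C P P P e e = e \<and> Cmp C P P s v e = v \<and>
    (\<forall>d \<in> mor P P. Cmp C P P P e d = d \<longrightarrow> Cmp C P P P d e = d \<longrightarrow> Cmp C P P s v d = v \<longrightarrow>
      (\<exists>g \<in> mor P P. Cmp C P P P d g = e))"
proof -
  interpret V: vectorspace K "Hom C P P" by (rule Hom_vectorspace) simp_all
  obtain rk where rk: "\<And>U Y. submodule K U (Hom C P P) \<Longrightarrow> submodule K Y (Hom C P P) \<Longrightarrow> U \<subset> Y \<Longrightarrow> rk U < (rk Y :: nat)"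
    using V.subspace_rank_exists mor_fin_dim[of P P] by auto
  let ?m = "\<lambda>a. rk (right_multiples a) + rk (left_multiples a)"
  have "Idt C P \<in> mor P P \<and> Cmp C P P s v (Idt C P) = v" using v s by simp
  then obtain a where a: "a \<in> mor P P" "Cmp C P P s v a = v"
    and least: "\<And>b. \<lbrakk>b \<in> mor P P; Cmp C P P s v b = v\<rbrakk> \<Longrightarrow> ?m a \<le> ?m b"
    using ex_has_least_nat[of "\<lambda>a. a \<in> mor P P \<and> Cmp C P P s v a = v" "Idt C P" ?m] by blast
  have minimal: "right_multiples d = right_multiples a \<and> left_multiples d = left_multiples a"
    if d: "d \<in> mor P P" "Cmp C P P s v d = v" "right_multiples d \<subseteq> right_multiples a" "left_multiples d \<subseteq> left_multiples a" for d
  proof -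
    have "rk (right_multiples d) \<le> rk (right_multiples a)"
      using rk[OF multiples_subspace(1)[OF d(1)] multiples_subspace(1)[OF a(1)]] d(3)
      by (metis less_imp_le order_refl psubsetI)
    moreover have "rk (left_multiples d) \<le> rk (left_multiples a)"
      using rk[OF multiples_subspace(2)[OF d(1)] multiples_subspace(2)[OF a(1)]] d(4)
      by (metis less_imp_le order_refl psubsetI)
    moreover have "\<not> right_multiples d \<subset> right_multiples a \<and> \<not> left_multiples d \<subset> left_multiples a"
      using calculation least[OF d(1,2)] rk[OF multiples_subspace(1)[OF d(1)] multiples_subspace(1)[OF a(1)]]
        rk[OF multiples_subspace(2)[OF d(1)] multiples_subspace(2)[OF a(1)]] by linarith
    ultimately show ?thesis using d(3,4) by blast
  qed
  let ?aa = "Cmp C P P P a a"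
  have "right_multiples ?aa = right_multiples a \<and> left_multiples ?aa = left_multiples a"
    by (rule minimal) (use a v s multiples_mono[OF a(1) a(1)] Cmp_assoc[of P P P s v a a] in simp_all)
  then have "a \<in> right_multiples ?aa" "a \<in> left_multiples ?aa" using self_multiple[OF a(1)] by simp_all
  then obtain b c where b: "b \<in> mor P P" "Cmp C P P P ?aa b = a" and c: "c \<in> mor P P" "Cmp C P P P c ?aa = a"
    unfolding right_multiples_def left_multiples_def by auto
  let ?e = "Cmp C P P P a b"
  have e: "?e \<in> mor P P" using a b by simp
  have aab: "Cmp C P P P a ?e = a" using b a by (simp add: Cmp_assoc)
  have eca: "?e = Cmp C P P P c a"
  proof -
    have "Cmp C P P P (Cmp C P P P c ?aa) b = Cmp C P P P c (Cmp C P P P ?aa b)"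
      by (rule Cmp_assoc) (use a b c in simp_all)
    then show ?thesis using b(2) c(2) by simp
  qed
  have ea: "Cmp C P P P ?e a = a" unfolding eca using c a by (simp add: Cmp_assoc)
  have ee: "Cmp C P P P ?e ?e = ?e"
    using Cmp_assoc[of P P P P ?e a b] ea a b e by simp
  have ve: "Cmp C P P s v ?e = v"
    using Cmp_assoc[of P P P s v a ?e] aab a v e s by simp
  have mult_e: "right_multiples ?e \<subseteq> right_multiples a" "left_multiples ?e \<subseteq> left_multiples a"
    using multiples_mono(1)[OF a(1) b(1)] multiples_mono(2)[OF a(1) c(1)] eca by simp_all
  have "\<exists>g \<in> mor P P. Cmp C P P P d g = ?e"
    if d: "d \<in> mor P P" "Cmp C P P P ?e d = d" "Cmp C P P P d ?e = d" "Cmp C P P s v d = v" for d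
  proof -
    have "right_multiples d \<subseteq> right_multiples ?e" "left_multiples d \<subseteq> left_multiples ?e"
      using multiples_mono[OF e d(1)] d(2,3) by simp_all
    then have "right_multiples d = right_multiples a" using minimal[OF d(1,4)] mult_e by blast
    moreover have "?e \<in> right_multiples a" using mult_e self_multiple[OF e] by blast
    ultimately have "?e \<in> right_multiples d" by simp
    then obtain g where "g \<in> mor P P" "?e = Cmp C P P P d g" unfolding right_multiples_def by blast
    then show ?thesis by metis
  qed
  then show ?thesis using e ee ve by blast
qed

text \<open>The minimality of \<open>e\<close> says that \<open>dA = eA\<close> for all \<open>d\<close> in \<open>eAe\<close> with \<open>vd = v\<close>. Suppose that
  \<open>vc = 0\<close> and \<open>ec\<close> is not in the radical. Then \<open>uecb = u\<close> for a map \<open>u\<close> to a simple object with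
  \<open>uec\<close> nonzero and some \<open>b\<close>, and \<open>d = e - ecbe\<close> satisfies \<open>vd = v\<close> and \<open>ud = 0\<close>; now \<open>e\<close> is
  in \<open>dA\<close>, so \<open>ue = 0\<close>, a contradiction. If \<open>e = x + y\<close> with orthogonal idempotents and \<open>vx\<close> nonzero,
  then \<open>vxb = v\<close> for some \<open>b\<close>, thus \<open>e\<close> is in \<open>xbeA\<close> and \<open>y = ye = 0\<close>.\<close>

lemma top_idempotent_exists:
  assumes s: "s \<in> S"
  shows "\<exists>e v. top_idempotent s e v \<and> primitive_idempotent alg (enc P e)"
proof -
  have so: "s \<in> Obj C" by (rule S_obj[OF s])
  obtain v where v: "v \<in> mor P s" "v \<noteq> nul P s" using P_generates[OF s] by blast
  obtain e where e: "e \<in> mor P P" "Cmp C P P P e e = e" "Cmp C P P s v e = v"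
    and min: "\<And>d. \<lbrakk>d \<in> mor P P; Cmp C P P P e d = d; Cmp C P P P d e = d; Cmp C P P s v d = v\<rbrakk> \<Longrightarrow>
      \<exists>g \<in> mor P P. Cmp C P P P d g = e"
    using minimal_stabilizing_idempotent[OF so v(1)] by blast
  have "Cmp C P P P e c \<in> jac" if c: "c \<in> mor P P" "Cmp C P P s v c = nul P s" for c
  proof (rule ccontr)
    assume "Cmp C P P P e c \<notin> jac"
    then obtain t u where t: "t \<in> S" and u: "u \<in> mor P t" and n: "Cmp C P P t u (Cmp C P P P e c) \<noteq> nul P t"
      unfolding jac_def using e c by auto
    have to: "t \<in> Obj C" by (rule S_obj[OF t])
    have "Cmp C P P t u (Cmp C P P P e c) \<in> mor P t" using u e c to by simp
    then obtain b where b: "b \<in> mor P P" "Cmp C P P t (Cmp C P P t u (Cmp C P P P e c)) b = u"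
      using simple_lift[OF P_E t _ n u] by blast
    let ?x = "Cmp C P P P e (Cmp C P P P c (Cmp C P P P b e))"
    let ?d = "e \<ominus>\<^bsub>Hom C P P\<^esub> ?x"
    have x: "?x \<in> mor P P" using e b c by simp
    have "Cmp C P P P e ?x = ?x" using Cmp_reassoc[OF e(2), of P "Cmp C P P P c (Cmp C P P P b e)"] e b c by simp
    then have ed: "Cmp C P P P e ?d = ?d" using e x by (simp add: Cmp_diff_right)
    have "Cmp C P P P ?x e = ?x" using e b c by (simp add: Cmp_assoc)
    then have de: "Cmp C P P P ?d e = ?d" using e x by (simp add: Cmp_diff_left)
    have "Cmp C P P s v ?x = nul P s"
      using Cmp_reassoc[OF e(3), of P "Cmp C P P P c (Cmp C P P P b e)"]
        Cmp_reassoc[OF c(2), of P "Cmp C P P P b e"] e b c v so by simp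
    then have vd: "Cmp C P P s v ?d = v" using e x v so by (simp add: Cmp_diff_right)
    have dm: "?d \<in> mor P P" using e x by simp
    obtain g where g: "g \<in> mor P P" "Cmp C P P P ?d g = e" using min[OF dm ed de vd] by blast
    have "Cmp C P P t u (Cmp C P P P e (Cmp C P P P c b)) = u"
      using b u e c to by (simp add: Cmp_assoc)
    from Cmp_reassoc[OF this, of P e] have ux: "Cmp C P P t u ?x = Cmp C P P t u e"
      using u e b c to by (simp add: Cmp_assoc)
    then have "Cmp C P P t u ?d = nul P t" using u e x to by (simp add: Cmp_diff_right)
    then have "Cmp C P P t u e = nul P t"
      using Cmp_assoc[of P P P t u ?d g] g u dm to by simp
    then have "Cmp C P P t u (Cmp C P P P e c) = nul P t"
      using Cmp_assoc[of P P P t u e c] u e c to by simp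
    then show False using n by blast
  qed
  then have top: "top_idempotent s e v" unfolding top_idempotent_def using e v by blast
  have half: "y = nul P P" if x: "x \<in> mor P P" and y: "y \<in> mor P P" and sum: "e = x \<oplus>\<^bsub>Hom C P P\<^esub> y"
    and xx: "Cmp C P P P x x = x" and yy: "Cmp C P P P y y = y" and yx: "Cmp C P P P y x = nul P P"
    and vx: "Cmp C P P s v x \<noteq> nul P s" for x y
  proof -
    have "Cmp C P P P e x = x" unfolding sum using x y xx yx by (simp add: Cmp_add_left)
    have "Cmp C P P s v x \<in> mor P s" using x v so by simp
    then obtain b where b: "b \<in> mor P P" "Cmp C P P s (Cmp C P P s v x) b = v"
      using simple_lift[OF P_E s _ vx v(1)] by blast
    let ?d = "Cmp C P P P x (Cmp C P P P b e)"
    have d: "?d \<in> mor P P" using x b e by simp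
    have ed: "Cmp C P P P e ?d = ?d"
      using Cmp_reassoc[OF \<open>Cmp C P P P e x = x\<close>, of P "Cmp C P P P b e"] x b e by simp
    have de: "Cmp C P P P ?d e = ?d" using x b e by (simp add: Cmp_assoc)
    have "Cmp C P P s v (Cmp C P P P x b) = v" using b x v so by (simp add: Cmp_assoc)
    from Cmp_reassoc[OF this, of P e] have vd: "Cmp C P P s v ?d = v"
      using x b e v so by (simp add: Cmp_assoc)
    obtain g where g: "g \<in> mor P P" "Cmp C P P P ?d g = e" using min[OF d ed de vd] by blast
    have "Cmp C P P P y e = Cmp C P P P y (Cmp C P P P ?d g)" using g by simp
    also have "\<dots> = nul P P"
      using Cmp_reassoc[OF yx, of P "Cmp C P P P b (Cmp C P P P e g)"] x y b e g by (simp add: Cmp_assoc)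
    finally have "Cmp C P P P y e = nul P P" .
    moreover have "Cmp C P P P y e = y" unfolding sum using x y yx yy by (simp add: Cmp_add_right)
    ultimately show ?thesis by simp
  qed
  have "primitive_idempotent alg (enc P e)"
    unfolding primitive_idempotent_def
  proof (intro conjI ballI impI)
    show "enc P e \<noteq> \<zero>\<^bsub>alg\<^esub>" using e v so by (auto simp: enc_eq_iff)
    fix f g assume "f \<in> carrier alg" "g \<in> carrier alg" and *: "f \<otimes>\<^bsub>alg\<^esub> f = f \<and> g \<otimes>\<^bsub>alg\<^esub> g = g \<and>
      f \<otimes>\<^bsub>alg\<^esub> g = \<zero>\<^bsub>alg\<^esub> \<and> g \<otimes>\<^bsub>alg\<^esub> f = \<zero>\<^bsub>alg\<^esub> \<and> enc P e = f \<oplus>\<^bsub>alg\<^esub> g"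
    then obtain x y where x: "x \<in> mor P P" "f = enc P x" and y: "y \<in> mor P P" "g = enc P y" by auto
    have eqs: "Cmp C P P P x x = x" "Cmp C P P P y y = y" "Cmp C P P P x y = nul P P" "Cmp C P P P y x = nul P P"
      "e = x \<oplus>\<^bsub>Hom C P P\<^esub> y"
      using * x y e by (simp_all add: enc_eq_iff)
    have "Cmp C P P s v x \<noteq> nul P s \<or> Cmp C P P s v y \<noteq> nul P s"
    proof (rule ccontr)
      assume "\<not> ?thesis"
      then have "Cmp C P P s v e = nul P s" unfolding eqs(5) using x y v so by (simp add: Cmp_add_right)
      then show False using e v by simp
    qed
    then have "y = nul P P \<or> x = nul P P"
    proof
      assume "Cmp C P P s v x \<noteq> nul P s"
      then show ?thesis using half[OF x(1) y(1) eqs(5,1,2,4)] by blast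
    next
      assume n: "Cmp C P P s v y \<noteq> nul P s"
      have "e = y \<oplus>\<^bsub>Hom C P P\<^esub> x" using eqs(5) mor_abelian_facts(2)[OF P_obj P_obj x(1) y(1)] by simp
      then show ?thesis using half[OF y(1) x(1) _ eqs(2,1,3) n] by blast
    qed
    then show "f = \<zero>\<^bsub>alg\<^esub> \<or> g = \<zero>\<^bsub>alg\<^esub>" using x y by auto
  qed (use e in simp_all)
  then show ?thesis using top by blast
qed

lemma idem_rad_submodule:
  assumes e: "e \<in> mor P P"
  shows "right_submodule alg (idem_module alg (enc P e)) ((\<lambda>r. enc P e \<otimes>\<^bsub>alg\<^esub> r) ` rad alg)"
    and "(\<lambda>r. enc P e \<otimes>\<^bsub>alg\<^esub> r) ` rad alg = {enc P (Cmp C P P P e r) | r. r \<in> jac}"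
    and "carrier (idem_module alg (enc P e)) = {enc P (Cmp C P P P e a) | a. a \<in> mor P P}"
proof -
  show 1: "(\<lambda>r. enc P e \<otimes>\<^bsub>alg\<^esub> r) ` rad alg = {enc P (Cmp C P P P e r) | r. r \<in> jac}"
    unfolding rad_alg using e jac_mor by (auto simp: image_iff)
  show 2: "carrier (idem_module alg (enc P e)) = {enc P (Cmp C P P P e a) | a. a \<in> mor P P}"
    using e by (auto simp: image_iff)
  have rm: "right_module alg (idem_module alg (enc P e))"
    by (rule idem_module_right_module[OF alg_ring]) (use e in simp)
  show "right_submodule alg (idem_module alg (enc P e)) ((\<lambda>r. enc P e \<otimes>\<^bsub>alg\<^esub> r) ` rad alg)"
    unfolding right_submodule_iff[OF rm] 1 2
  proof (intro conjI ballI)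
    show "{enc P (Cmp C P P P e r) | r. r \<in> jac} \<subseteq> {enc P (Cmp C P P P e a) | a. a \<in> mor P P}"
      using jac_mor by blast
    have "nul P P \<in> jac" using jac_submodule unfolding end_submodule_def by blast
    then show "\<zero>\<^bsub>idem_module alg (enc P e)\<^esub> \<in> {enc P (Cmp C P P P e r) | r. r \<in> jac}"
      using e by (auto intro!: exI[of _ "nul P P"])
    fix u assume "u \<in> {enc P (Cmp C P P P e r) | r. r \<in> jac}"
    then obtain r where r: "r \<in> jac" "u = enc P (Cmp C P P P e r)" by blast
    show "u \<oplus>\<^bsub>idem_module alg (enc P e)\<^esub> v \<in> {enc P (Cmp C P P P e r) | r. r \<in> jac}"
      if v: "v \<in> {enc P (Cmp C P P P e r) | r. r \<in> jac}" for v
    proof -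
      obtain q where q: "q \<in> jac" "v = enc P (Cmp C P P P e q)" using v by blast
      have "u \<oplus>\<^bsub>idem_module alg (enc P e)\<^esub> v = enc P (Cmp C P P P e (r \<oplus>\<^bsub>Hom C P P\<^esub> q))"
        using r q e jac_mor by (simp add: Cmp_add_right)
      then show ?thesis using jac_add[OF r(1) q(1)] by blast
    qed
  next
    fix a u assume "a \<in> carrier alg" and "u \<in> {enc P (Cmp C P P P e r) | r. r \<in> jac}"
    then obtain b r where r: "r \<in> jac" "u = enc P (Cmp C P P P e r)" and b: "b \<in> mor P P" "a = enc P b" by auto
    have "a \<odot>\<^bsub>idem_module alg (enc P e)\<^esub> u = enc P (Cmp C P P P e (Cmp C P P P r b))"
      using r b e jac_mor by (simp add: Cmp_assoc)
    then show "a \<odot>\<^bsub>idem_module alg (enc P e)\<^esub> u \<in> {enc P (Cmp C P P P e r) | r. r \<in> jac}"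
      using jac_right[OF r(1) b(1)] by blast
  qed
qed

context
  fixes e assumes e: "e \<in> mor P P"
begin

abbreviation (input) eA :: "('k coords, 'k coords) module" where "eA \<equiv> idem_module alg (enc P e)"

abbreviation (input) eJ :: "'k coords set" where "eJ \<equiv> (\<lambda>r. enc P e \<otimes>\<^bsub>alg\<^esub> r) ` rad alg"

lemma eA_module: "right_module alg eA"
  by (rule idem_module_right_module[OF alg_ring]) (use e in simp)

lemma eJ_subgroup: "abelian_subgroup eJ eA"
  using idem_rad_submodule(1)[OF e] right_module_group[OF eA_module] abelian_subgroupI3
  unfolding right_submodule_def by blast

lemma eA_mem: "a \<in> mor P P \<Longrightarrow> enc P (Cmp C P P P e a) \<in> carrier eA"
  unfolding idem_rad_submodule(3)[OF e] by blast

lemma eA_quot_smult: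
  assumes "a \<in> mor P P" "b \<in> mor P P"
  shows "enc P b \<odot>\<^bsub>quot_module eA eJ\<^esub> (eJ +>\<^bsub>eA\<^esub> enc P (Cmp C P P P e a)) = eJ +>\<^bsub>eA\<^esub> enc P (Cmp C P P P e (Cmp C P P P a b))"
proof -
  have b: "enc P b \<in> carrier alg" using assms by simp
  have "enc P b \<odot>\<^bsub>quot_module eA eJ\<^esub> (eJ +>\<^bsub>eA\<^esub> enc P (Cmp C P P P e a))
    = eJ +>\<^bsub>eA\<^esub> (enc P b \<odot>\<^bsub>eA\<^esub> enc P (Cmp C P P P e a))"
    by (rule coset_smult[OF right_module_group[OF eA_module] _ eA_mem[OF assms(1)]
          right_smult_closed[OF eA_module b] right_smult_add_right[OF eA_module b]])
      (use idem_rad_submodule(1)[OF e] b in \<open>simp_all only: right_submodule_def\<close>)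
  then show ?thesis using assms e by (simp add: Cmp_assoc)
qed

lemma eA_quot_carrier: "carrier (quot_module eA eJ) = {eJ +>\<^bsub>eA\<^esub> enc P (Cmp C P P P e a) | a. a \<in> mor P P}"
proof -
  have "carrier (quot_module eA eJ) = {eJ +>\<^bsub>eA\<^esub> x | x. x \<in> carrier eA}"
    unfolding quot_module_def partial_object.simps A_RCOSETS_def' by blast
  then show ?thesis unfolding idem_rad_submodule(3)[OF e] by blast
qed

lemma eA_coset_eq_iff:
  assumes "a \<in> mor P P" "b \<in> mor P P"
  shows "eJ +>\<^bsub>eA\<^esub> enc P (Cmp C P P P e a) = eJ +>\<^bsub>eA\<^esub> enc P (Cmp C P P P e b) \<longleftrightarrow>
    (\<exists>r \<in> jac. Cmp C P P P e (a \<ominus>\<^bsub>Hom C P P\<^esub> b) = Cmp C P P P e r)"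
proof -
  interpret N: abelian_subgroup eJ eA by (rule eJ_subgroup)
  let ?a = "enc P (Cmp C P P P e a)" and ?b = "enc P (Cmp C P P P e b)" and ?d = "enc P (Cmp C P P P e (a \<ominus>\<^bsub>Hom C P P\<^esub> b))"
  have m: "?a \<in> carrier eA" "?b \<in> carrier eA" "?d \<in> carrier eA" using eA_mem assms by simp_all
  have "?d \<oplus>\<^bsub>eA\<^esub> ?b = ?a" using assms e by (simp add: mor_diff_add(1) flip: Cmp_add_right)
  then have d: "?d = ?a \<ominus>\<^bsub>eA\<^esub> ?b"
    using m N.a_assoc[of ?d ?b "\<ominus>\<^bsub>eA\<^esub> ?b"] N.r_neg[of ?b] N.r_zero[of ?d] unfolding a_minus_def
    by (metis N.a_inv_closed)
  have "eJ +>\<^bsub>eA\<^esub> ?a = eJ +>\<^bsub>eA\<^esub> ?b \<longleftrightarrow> ?a \<in> eJ +>\<^bsub>eA\<^esub> ?b"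
    using N.a_repr_independence'[OF _ m(2)] N.a_rcos_self[OF m(1)] by metis
  also have "\<dots> \<longleftrightarrow> ?d \<in> eJ"
    unfolding d using N.a_rcos_module_minus[OF _ m(2,1)] right_module_group[OF eA_module] N.a_rcos_module[OF m(2,1)]
    by (simp add: a_minus_def)
  also have "\<dots> \<longleftrightarrow> (\<exists>r \<in> jac. ?d = enc P (Cmp C P P P e r))"
    unfolding idem_rad_submodule(2)[OF e] by blast
  also have "\<dots> \<longleftrightarrow> (\<exists>r \<in> jac. Cmp C P P P e (a \<ominus>\<^bsub>Hom C P P\<^esub> b) = Cmp C P P P e r)"
    using assms e jac_mor by (auto simp: enc_eq_iff)
  finally show ?thesis .
qed

end

text \<open>For an arbitrary idempotent with top \<open>Hom(P, s)\<close> the map \<open>v\<close> is the image of the coset of \<open>e\<close>.\<close>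

lemma top_idempotent_of_idempotent_of:
  assumes i: "idempotent_of alg M a" and M: "right_module alg M" and s: "s \<in> S" and iso: "right_iso alg (rep s) M"
  shows "\<exists>e v. a = enc P e \<and> top_idempotent s e v"
proof -
  have so: "s \<in> Obj C" by (rule S_obj[OF s])
  note rs = rep_right_module[OF so]
  obtain e where e: "e \<in> mor P P" "a = enc P e"
    using i unfolding idempotent_of_def primitive_idempotent_def by auto
  have ee: "Cmp C P P P e e = e"
    using i e unfolding idempotent_of_def primitive_idempotent_def by (simp add: enc_eq_iff)
  let ?N = "(\<lambda>r. enc P e \<otimes>\<^bsub>alg\<^esub> r) ` rad alg" and ?M = "idem_module alg (enc P e)"
  obtain \<Phi> where \<Phi>: "\<Phi> \<in> right_hom alg (quot_module ?M ?N) M" "bij_betw \<Phi> (carrier (quot_module ?M ?N)) (carrier M)"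
    using i e unfolding idempotent_of_def right_iso_def by auto
  obtain \<chi> where \<chi>: "\<chi> \<in> right_hom alg M (rep s)" "bij_betw \<chi> (carrier M) (carrier (rep s))"
    using alg.right_iso_sym[OF rs M iso] unfolding right_iso_def by blast
  have bij: "bij_betw (\<lambda>U. \<chi> (\<Phi> U)) (carrier (quot_module ?M ?N)) (carrier (rep s))"
    using bij_betw_trans[OF \<Phi>(2) \<chi>(2)] by (simp add: o_def)
  define \<psi> where "\<psi> b = \<chi> (\<Phi> (?N +>\<^bsub>?M\<^esub> enc P (Cmp C P P P e b)))" for b
  have car: "?N +>\<^bsub>?M\<^esub> enc P (Cmp C P P P e b) \<in> carrier (quot_module ?M ?N)" if "b \<in> mor P P" for b
    unfolding eA_quot_carrier[OF e(1)] using that by blast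
  have \<psi>c: "\<psi> b \<in> carrier (rep s)" if "b \<in> mor P P" for b
    unfolding \<psi>_def using bij_betwE[OF bij] car[OF that] by blast
  have \<psi>m: "\<psi> (Cmp C P P P b d) = enc P d \<odot>\<^bsub>rep s\<^esub> \<psi> b" if b: "b \<in> mor P P" and d: "d \<in> mor P P" for b d
  proof -
    have dA: "enc P d \<in> carrier alg" using d by simp
    have "\<Phi> (?N +>\<^bsub>?M\<^esub> enc P (Cmp C P P P e b)) \<in> carrier M" by (rule right_hom_closed[OF \<Phi>(1) car[OF b]])
    then show ?thesis
      unfolding \<psi>_def eA_quot_smult[OF e(1) b d, symmetric] right_hom_smult[OF \<Phi>(1) dA car[OF b]]
      by (rule right_hom_smult[OF \<chi>(1) dA])
  qed
  obtain v where v: "v \<in> mor P s" "\<psi> (Idt C P) = enc s v" using \<psi>c[of "Idt C P"] by auto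
  have \<psi>v: "\<psi> b = enc s (Cmp C P P s v b)" if "b \<in> mor P P" for b
    using \<psi>m[of "Idt C P" b] that v so by simp
  have "\<psi> e = \<psi> (Idt C P)" unfolding \<psi>_def using e ee by simp
  then have ve: "Cmp C P P s v e = v" using \<psi>v[OF e(1)] v e so by (simp add: enc_eq_iff)
  have v0: "v \<noteq> nul P s"
  proof
    assume v0: "v = nul P s"
    have "w = nul P s" if w: "w \<in> mor P s" for w
    proof -
      have "enc s w \<in> (\<lambda>U. \<chi> (\<Phi> U)) ` carrier (quot_module ?M ?N)"
        using bij_betw_imp_surj_on[OF bij] w by simp
      then obtain b where "b \<in> mor P P" "enc s w = \<psi> b"
        unfolding eA_quot_carrier[OF e(1)] \<psi>_def by blast
      then show ?thesis using \<psi>v[of b] v0 w so by (simp add: enc_eq_iff)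
    qed
    then show False using P_generates[OF s] by blast
  qed
  have "Cmp C P P P e b \<in> jac" if b: "b \<in> mor P P" "Cmp C P P s v b = nul P s" for b
  proof -
    have "\<psi> b = \<psi> (nul P P)" using \<psi>v[OF b(1)] \<psi>v[of "nul P P"] b v so by simp
    then have "?N +>\<^bsub>?M\<^esub> enc P (Cmp C P P P e b) = ?N +>\<^bsub>?M\<^esub> enc P (Cmp C P P P e (nul P P))"
      using inj_onD[OF bij_betw_imp_inj_on[OF bij] _ car[OF b(1)] car] unfolding \<psi>_def by simp
    then obtain r where r: "r \<in> jac" "Cmp C P P P e (b \<ominus>\<^bsub>Hom C P P\<^esub> nul P P) = Cmp C P P P e r"
      using eA_coset_eq_iff[OF e(1) b(1), of "nul P P"] by auto
    then have "Cmp C P P P e b = Cmp C P P P e r" using b by simp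
    then show ?thesis using jac_left[OF r(1) e(1)] by simp
  qed
  then have "top_idempotent s e v" unfolding top_idempotent_def using e ee v v0 ve by blast
  then show ?thesis using e by blast
qed

lemma top_idempotent_imp_idempotent_of:
  assumes s: "s \<in> S" and t: "top_idempotent s e v" and p: "primitive_idempotent alg (enc P e)"
  shows "idempotent_of alg (rep s) (enc P e)"
proof -
  have so: "s \<in> Obj C" by (rule S_obj[OF s])
  have e: "e \<in> mor P P" "Cmp C P P P e e = e" and v: "v \<in> mor P s" "v \<noteq> nul P s" "Cmp C P P s v e = v"
    and loc: "\<And>a. \<lbrakk>a \<in> mor P P; Cmp C P P s v a = nul P s\<rbrakk> \<Longrightarrow> Cmp C P P P e a \<in> jac"
    using t unfolding top_idempotent_def by blast+
  let ?N = "(\<lambda>r. enc P e \<otimes>\<^bsub>alg\<^esub> r) ` rad alg" and ?M = "idem_module alg (enc P e)"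
  let ?Q = "quot_module ?M ?N" and ?c = "\<lambda>a. ?N +>\<^bsub>?M\<^esub> enc P (Cmp C P P P e a)"
  interpret N: abelian_subgroup ?N ?M by (rule eJ_subgroup[OF e(1)])
  have vea: "Cmp C P P s v (Cmp C P P P e a) = Cmp C P P s v a" if "a \<in> mor P P" for a
    using Cmp_reassoc[OF v(3), of P a] that v e so by simp
  have c_iff: "?c a = ?c b \<longleftrightarrow> Cmp C P P s v a = Cmp C P P s v b" if a: "a \<in> mor P P" and b: "b \<in> mor P P" for a b
    unfolding eA_coset_eq_iff[OF e(1) a b]
  proof
    let ?d = "a \<ominus>\<^bsub>Hom C P P\<^esub> b"
    have d: "?d \<in> mor P P" using a b by simp
    {
      assume "\<exists>r \<in> jac. Cmp C P P P e ?d = Cmp C P P P e r"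
      then obtain r where r: "r \<in> jac" "Cmp C P P P e ?d = Cmp C P P P e r" by blast
      have "Cmp C P P s v ?d = Cmp C P P s v (Cmp C P P P e r)" using vea[OF d] r(2) by simp
      also have "\<dots> = nul P s" using vea[of r] jac_mor[OF r(1)] jac_annihilates[OF r(1) s v(1)] by simp
      finally show "Cmp C P P s v a = Cmp C P P s v b" using a b v so by (simp add: Cmp_diff_right)
    next
      assume "Cmp C P P s v a = Cmp C P P s v b"
      then have "Cmp C P P s v ?d = nul P s" using a b v so by (simp add: Cmp_diff_right)
      then have "Cmp C P P P e ?d \<in> jac" by (rule loc[OF d])
      moreover have "Cmp C P P P e ?d = Cmp C P P P e (Cmp C P P P e ?d)"
        using Cmp_reassoc[OF e(2), of P ?d] d e by simp
      ultimately show "\<exists>r \<in> jac. Cmp C P P P e ?d = Cmp C P P P e r" by blast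
    }
  qed
  define rp where "rp U = (SOME a. a \<in> mor P P \<and> U = ?c a)" for U
  have rp: "rp (?c a) \<in> mor P P \<and> ?c a = ?c (rp (?c a))" if "a \<in> mor P P" for a
    unfolding rp_def by (rule someI_ex) (use that in blast)
  let ?\<Phi> = "\<lambda>U \<in> carrier ?Q. enc s (Cmp C P P s v (rp U))"
  have car: "?c a \<in> carrier ?Q" if "a \<in> mor P P" for a
    unfolding eA_quot_carrier[OF e(1)] using that by blast
  have \<Phi>: "?\<Phi> (?c a) = enc s (Cmp C P P s v a)" if a: "a \<in> mor P P" for a
    using c_iff[of a "rp (?c a)"] rp[OF a] car[OF a] a by simp
  have "?\<Phi> \<in> right_hom alg ?Q (rep s)"
    unfolding right_hom_def
  proof (intro CollectI conjI ballI)
    show "?\<Phi> \<in> carrier ?Q \<rightarrow>\<^sub>E carrier (rep s)"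
    proof (intro restrict_PiE_iff[THEN iffD2] ballI)
      fix U assume "U \<in> carrier ?Q"
      then obtain a where "a \<in> mor P P" "U = ?c a" unfolding eA_quot_carrier[OF e(1)] by blast
      then show "enc s (Cmp C P P s v (rp U)) \<in> carrier (rep s)" using rp[of a] v so by simp
    qed
    fix U assume "U \<in> carrier ?Q"
    then obtain a where a: "a \<in> mor P P" "U = ?c a" unfolding eA_quot_carrier[OF e(1)] by blast
    show "?\<Phi> (U \<oplus>\<^bsub>?Q\<^esub> Y) = ?\<Phi> U \<oplus>\<^bsub>rep s\<^esub> ?\<Phi> Y" if Y: "Y \<in> carrier ?Q" for Y
    proof -
      obtain b where b: "b \<in> mor P P" "Y = ?c b" using Y unfolding eA_quot_carrier[OF e(1)] by blast
      have ab: "a \<oplus>\<^bsub>Hom C P P\<^esub> b \<in> mor P P" using a b by simp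
      have "U \<oplus>\<^bsub>?Q\<^esub> Y = ?c a <+>\<^bsub>?M\<^esub> ?c b" unfolding a(2) b(2) quot_module_def by simp
      also have "\<dots> = ?N +>\<^bsub>?M\<^esub> (enc P (Cmp C P P P e a) \<oplus>\<^bsub>?M\<^esub> enc P (Cmp C P P P e b))"
        by (rule N.a_rcos_sum) (rule eA_mem[OF e(1) a(1)], rule eA_mem[OF e(1) b(1)])
      also have "\<dots> = ?c (a \<oplus>\<^bsub>Hom C P P\<^esub> b)" using a b e by (simp add: Cmp_add_right)
      finally have 1: "U \<oplus>\<^bsub>?Q\<^esub> Y = ?c (a \<oplus>\<^bsub>Hom C P P\<^esub> b)" .
      show ?thesis unfolding 1 \<Phi>[OF ab] unfolding a(2) b(2) \<Phi>[OF a(1)] \<Phi>[OF b(1)]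
        using a(1) b(1) v so by (simp add: Cmp_add_right)
    qed
  next
    fix x U assume "x \<in> carrier alg" "U \<in> carrier ?Q"
    then obtain b a where b: "b \<in> mor P P" "x = enc P b" and a: "a \<in> mor P P" "U = ?c a"
      unfolding eA_quot_carrier[OF e(1)] by auto
    have ab: "Cmp C P P P a b \<in> mor P P" using a b by simp
    show "?\<Phi> (x \<odot>\<^bsub>?Q\<^esub> U) = x \<odot>\<^bsub>rep s\<^esub> ?\<Phi> U"
      unfolding a(2) b(2) eA_quot_smult[OF e(1) a(1) b(1)] \<Phi>[OF ab] \<Phi>[OF a(1)]
      using a(1) b(1) v so by (simp add: Cmp_assoc)
  qed
  moreover have "bij_betw ?\<Phi> (carrier ?Q) (carrier (rep s))"
    unfolding bij_betw_def
  proof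
    show "inj_on ?\<Phi> (carrier ?Q)"
    proof (rule inj_onI)
      fix U Y assume "U \<in> carrier ?Q" "Y \<in> carrier ?Q" and eq: "?\<Phi> U = ?\<Phi> Y"
      then obtain a b where a: "a \<in> mor P P" "U = ?c a" and b: "b \<in> mor P P" "Y = ?c b"
        unfolding eA_quot_carrier[OF e(1)] by blast
      then have "enc s (Cmp C P P s v a) = enc s (Cmp C P P s v b)"
        using eq unfolding a(2) b(2) \<Phi>[OF a(1)] \<Phi>[OF b(1)] by blast
      then have "Cmp C P P s v a = Cmp C P P s v b" using a b v so by (simp add: enc_eq_iff)
      then show "U = Y" unfolding a(2) b(2) using c_iff[OF a(1) b(1)] by blast
    qed
    show "?\<Phi> ` carrier ?Q = carrier (rep s)"
    proof (intro equalityI subsetI)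
      fix w assume "w \<in> ?\<Phi> ` carrier ?Q"
      then obtain a where a: "a \<in> mor P P" "w = ?\<Phi> (?c a)" unfolding eA_quot_carrier[OF e(1)] by blast
      then have "w = enc s (Cmp C P P s v a)" using \<Phi>[OF a(1)] by metis
      then show "w \<in> carrier (rep s)" using a(1) v so by simp
    next
      fix w assume "w \<in> carrier (rep s)"
      then obtain w' where w': "w' \<in> mor P s" "w = enc s w'" by auto
      obtain a where a: "a \<in> mor P P" "Cmp C P P s v a = w'" using simple_lift[OF P_E s v(1,2) w'(1)] by blast
      then have "w = ?\<Phi> (?c a)" using \<Phi>[OF a(1)] w' by metis
      then show "w \<in> ?\<Phi> ` carrier ?Q" using car[OF a(1)] by blast
    qed
  qed
  ultimately show ?thesis unfolding idempotent_of_def right_iso_def using p by blast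
qed

text \<open>The idempotent of a vertex is an arbitrary choice among those with the right top. One of them exists,
  and all of them have the property that is used below.\<close>

lemma vertex_idempotent_top:
  assumes s: "s \<in> S"
  shows "\<exists>e v. vertex_idempotent alg (iso_class alg (rep s)) = enc P e \<and> top_idempotent s e v"
proof -
  obtain e v where e: "top_idempotent s e v" "primitive_idempotent alg (enc P e)"
    using top_idempotent_exists[OF s] by blast
  have "rep s \<in> iso_class alg (rep s)"
    unfolding iso_class_def using rep_Obj alg.right_iso_refl rep_right_module S_obj s by blast
  then have "\<exists>a. \<exists>M \<in> iso_class alg (rep s). idempotent_of alg M a"
    using top_idempotent_imp_idempotent_of[OF s e] by blast
  then have "\<exists>M \<in> iso_class alg (rep s). idempotent_of alg M (vertex_idempotent alg (iso_class alg (rep s)))"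
    unfolding vertex_idempotent_def by (rule someI_ex)
  then obtain M where "M \<in> iso_class alg (rep s)" "idempotent_of alg M (vertex_idempotent alg (iso_class alg (rep s)))"
    by blast
  then show ?thesis using top_idempotent_of_idempotent_of[OF _ _ s] unfolding iso_class_def by auto
qed

end


section \<open>The square of the radical and the semisimple top\<close>

context represented_modules
begin

lemma rad_ideal: "ideal (rad alg) alg"
proof (rule idealI)
  show "ring alg" by (rule alg_ring)
  show "subgroup (rad alg) (add_monoid alg)"
  proof (rule alg.A.add.subgroupI)
    show "rad alg \<subseteq> carrier alg" unfolding rad_alg using jac_mor by auto
    show "rad alg \<noteq> {}" unfolding rad_alg using jac_submodule unfolding end_submodule_def by blast
    fix a assume "a \<in> rad alg"
    then obtain b where b: "b \<in> jac" "a = enc P b" unfolding rad_alg by blast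
    have bm: "b \<in> mor P P" by (rule jac_mor[OF b(1)])
    let ?n = "\<ominus>\<^bsub>Hom C P P\<^esub> b"
    have "Cmp C P P P b (\<ominus>\<^bsub>Hom C P P\<^esub> Idt C P) \<in> jac" using jac_right[OF b(1)] by simp
    then have n: "?n \<in> jac" using bm by (simp add: Cmp_neg_right)
    have "\<ominus>\<^bsub>alg\<^esub> a = enc P ?n"
      by (rule alg.A.minus_equality) (use b bm mor_abelian_facts(3)[OF P_obj P_obj bm] in simp_all)
    then show "\<ominus>\<^bsub>alg\<^esub> a \<in> rad alg" unfolding rad_alg using n by simp
    fix c assume "c \<in> rad alg"
    then obtain d where "d \<in> jac" "c = enc P d" unfolding rad_alg by blast
    then show "a \<oplus>\<^bsub>alg\<^esub> c \<in> rad alg" unfolding rad_alg using b jac_add[of b d] jac_mor by auto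
  qed
  fix a x assume "a \<in> rad alg" "x \<in> carrier alg"
  then obtain b y where "b \<in> jac" "a = enc P b" "y \<in> mor P P" "x = enc P y" unfolding rad_alg by auto
  then show "x \<otimes>\<^bsub>alg\<^esub> a \<in> rad alg" "a \<otimes>\<^bsub>alg\<^esub> x \<in> rad alg"
    unfolding rad_alg using jac_mor jac_left jac_right by auto
qed

lemma rad2_ideal: "ideal (rad2 alg) alg"
  unfolding rad2_def by (rule alg.A.ideal_prod_is_ideal[OF rad_ideal rad_ideal])

definition jac2 :: "'m set" where
  "jac2 = {a \<in> mor P P. enc P a \<in> rad2 alg}"

lemma rad2_alg: "rad2 alg = enc P ` jac2"
  unfolding jac2_def using alg.A.ideal_prod_in_carrier[OF rad_ideal rad_ideal] unfolding rad2_def[symmetric] by auto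

lemma jac2_mor: "a \<in> jac2 \<Longrightarrow> a \<in> mor P P"
  unfolding jac2_def by blast

lemma jac2_prod: "\<lbrakk>a \<in> jac; b \<in> jac\<rbrakk> \<Longrightarrow> Cmp C P P P a b \<in> jac2"
  unfolding jac2_def rad2_def
  using ideal_prod.prod[of "enc P a" "rad alg" "enc P b" "rad alg" alg] jac_mor rad_alg by simp

lemma jac2_add: "\<lbrakk>a \<in> jac2; b \<in> jac2\<rbrakk> \<Longrightarrow> a \<oplus>\<^bsub>Hom C P P\<^esub> b \<in> jac2"
  unfolding jac2_def rad2_def using ideal_prod.sum[of "enc P a" alg "rad alg" "rad alg" "enc P b"] by simp

lemma jac2_right: "\<lbrakk>a \<in> jac2; b \<in> mor P P\<rbrakk> \<Longrightarrow> Cmp C P P P a b \<in> jac2"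
  unfolding jac2_def using ideal.I_r_closed[OF rad2_ideal, of "enc P a" "enc P b"] by simp

lemma jac2_nul: "nul P P \<in> jac2"
  unfolding jac2_def using additive_subgroup.zero_closed[OF ideal.axioms(1)[OF rad2_ideal]] by simp

lemma jac2_submodule: "end_submodule P jac2"
  unfolding end_submodule_def using jac2_mor jac2_add jac2_right jac2_nul by blast

lemma jac2_jac: "jac2 \<subseteq> jac"
proof
  fix a assume "a \<in> jac2"
  then have "enc P a \<in> enc P ` jac" "a \<in> mor P P"
    using alg.A.ideal_prod_inter[OF rad_ideal rad_ideal] unfolding jac2_def rad2_def rad_alg by auto
  then show "a \<in> jac" using jac_mor by (auto simp: enc_eq_iff)
qed

lemma jac2_induct [consumes 1, case_names prod sum]:
  assumes a: "a \<in> jac2"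
    and prod: "\<And>a b. \<lbrakk>a \<in> jac; b \<in> jac\<rbrakk> \<Longrightarrow> Q (Cmp C P P P a b)"
    and sum: "\<And>a b. \<lbrakk>a \<in> jac2; b \<in> jac2; Q a; Q b\<rbrakk> \<Longrightarrow> Q (a \<oplus>\<^bsub>Hom C P P\<^esub> b)"
  shows "Q a"
proof -
  have "x \<in> ideal_prod alg (rad alg) (rad alg) \<Longrightarrow> \<exists>b \<in> jac2. x = enc P b \<and> Q b" for x
  proof (induction rule: ideal_prod.induct)
    case (prod i j)
    then obtain b c where "b \<in> jac" "i = enc P b" "c \<in> jac" "j = enc P c" unfolding rad_alg by blast
    then show ?case using assms(2)[of b c] jac2_prod[of b c] jac_mor by auto
  next
    case (sum x y)
    then obtain b c where "b \<in> jac2" "x = enc P b" "Q b" "c \<in> jac2" "y = enc P c" "Q c" by blast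
    then show ?case using assms(3)[of b c] jac2_add[of b c] jac2_mor by auto
  qed
  moreover have "enc P a \<in> ideal_prod alg (rad alg) (rad alg)" using a unfolding jac2_def rad2_def by blast
  ultimately obtain b where "b \<in> jac2" "enc P a = enc P b" "Q b" by blast
  then show ?thesis using a jac2_mor by (auto simp: enc_eq_iff)
qed

text \<open>\<open>simple_mod_jac l\<close> says that \<open>l\<close> generates a simple or zero submodule of \<open>A / rad A\<close>.\<close>

definition simple_mod_jac :: "'m \<Rightarrow> bool" where
  "simple_mod_jac l \<longleftrightarrow> l \<in> mor P P \<and> (\<forall>a \<in> mor P P. Cmp C P P P l a \<notin> jac \<longrightarrow>
     (\<exists>b \<in> mor P P. Cmp C P P P (Cmp C P P P l a) b \<ominus>\<^bsub>Hom C P P\<^esub> l \<in> jac))"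

text \<open>The algebra modulo its radical is the sum of such submodules: choose finitely many maps from \<open>P\<close> to
  simple objects, as few as possible, whose common kernel is \<open>rad A\<close>. For each of them, \<open>v\<close>, the
  minimality gives some \<open>l\<close> with \<open>vl = v\<close> which is annihilated by all the others, and the sum of these
  \<open>l\<close> is \<open>1\<close> modulo the radical.\<close>

lemma semisimple_mod_jac:
  assumes add: "\<And>a b. \<lbrakk>a \<in> Y; b \<in> Y\<rbrakk> \<Longrightarrow> a \<oplus>\<^bsub>Hom C P P\<^esub> b \<in> Y" and Y: "Y \<subseteq> mor P P"
    and jac: "jac \<subseteq> Y" and simple: "\<And>l. simple_mod_jac l \<Longrightarrow> l \<in> Y"
  shows "Idt C P \<in> Y"
proof -
  let ?ann = "\<lambda>F a. \<forall>(s, v) \<in> F. Cmp C P P s v a = nul P s"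
  let ?ok = "\<lambda>F. finite F \<and> F \<subseteq> (SIGMA s:S. mor P s) \<and> (\<forall>a \<in> mor P P. ?ann F a \<longrightarrow> a \<in> jac)"
  have "\<exists>F. ?ok F"
  proof -
    have "\<forall>s. \<exists>B. s \<in> S \<longrightarrow> finite B \<and> B \<subseteq> mor P s \<and> LinearCombinations.module.span K (Hom C P s) B = mor P s"
      using mor_fin_dim[OF P_obj S_obj] vectorspace.fin_dim_def[OF Hom_vectorspace[OF P_obj S_obj]] by meson
    then obtain B where B: "\<And>s. s \<in> S \<Longrightarrow> finite (B s) \<and> B s \<subseteq> mor P s \<and>
      LinearCombinations.module.span K (Hom C P s) (B s) = mor P s" by metis
    have "a \<in> jac" if a: "a \<in> mor P P" and an: "?ann (SIGMA s:S. B s) a" for a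
      unfolding jac_def
    proof (intro CollectI conjI a ballI)
      fix s v assume s: "s \<in> S" and v: "v \<in> mor P s"
      have so: "s \<in> Obj C" by (rule S_obj[OF s])
      interpret V: vectorspace K "Hom C P s" by (rule Hom_vectorspace[OF P_obj so])
      have "submodule K {v \<in> mor P s. Cmp C P P s v a = nul P s} (Hom C P s)"
        by (intro submodule.intro V.module_axioms) (use a so in \<open>auto simp: Cmp_add_left Cmp_smult_left\<close>)
      moreover have "B s \<subseteq> {v \<in> mor P s. Cmp C P P s v a = nul P s}" using B[OF s] an s by auto
      ultimately have "V.span (B s) \<subseteq> {v \<in> mor P s. Cmp C P P s v a = nul P s}" by (intro V.span_is_subset)
      then show "Cmp C P P s v a = nul P s" using B[OF s] v by blast
    qed
    moreover have "finite (SIGMA s:S. B s)" using S_finite B by blast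
    moreover have "(SIGMA s:S. B s) \<subseteq> (SIGMA s:S. mor P s)" using B by blast
    ultimately show ?thesis by blast
  qed
  then obtain F0 where "?ok F0" by blast
  then obtain F where F: "?ok F" and least: "\<And>G. ?ok G \<Longrightarrow> card F \<le> card G"
    using ex_has_least_nat[of ?ok F0 card] by blast
  have "\<exists>l \<in> Y. Cmp C P P s v l = v \<and> (\<forall>(t, u) \<in> F - {(s, v)}. Cmp C P P t u l = nul P t)" if sv: "(s, v) \<in> F" for s v
  proof -
    have s: "s \<in> S" and v: "v \<in> mor P s" using F sv by auto
    have so: "s \<in> Obj C" by (rule S_obj[OF s])
    have Ff: "finite F" using F by simp
    have "\<not> ?ok (F - {(s, v)})"
    proof
      assume ok: "?ok (F - {(s, v)})"
      have "card F \<le> card (F - {(s, v)})" using least[OF ok] .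
      moreover have "card (F - {(s, v)}) < card F" by (rule card_Diff1_less[OF Ff sv])
      ultimately show False by simp
    qed
    then obtain a where a: "a \<in> mor P P" "?ann (F - {(s, v)}) a" "a \<notin> jac" using F by blast
    have "Cmp C P P s v a \<noteq> nul P s"
    proof
      assume "Cmp C P P s v a = nul P s"
      then have "?ann F a" using a(2) by auto
      then show False using F a by blast
    qed
    moreover have "Cmp C P P s v a \<in> mor P s" using v a so by simp
    ultimately obtain b where b: "b \<in> mor P P" "Cmp C P P s (Cmp C P P s v a) b = v"
      using simple_lift[OF P_E s _ _ v] by blast
    let ?l = "Cmp C P P P a b"
    have l: "?l \<in> mor P P" using a b by simp
    have vl: "Cmp C P P s v ?l = v" using a b v so by (simp add: Cmp_assoc)
    have others: "Cmp C P P t u ?l = nul P t" if "(t, u) \<in> F - {(s, v)}" for t u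
    proof -
      have u: "u \<in> mor P t" "t \<in> Obj C" using F that S_obj by auto
      have "Cmp C P P t u a = nul P t" using a(2) that by auto
      then show ?thesis using u a(1) b(1) Cmp_assoc[of P P P t u a b] by simp
    qed
    have "simple_mod_jac ?l"
      unfolding simple_mod_jac_def
    proof (intro conjI l ballI impI)
      fix c assume c: "c \<in> mor P P" and nj: "Cmp C P P P ?l c \<notin> jac"
      let ?lc = "Cmp C P P P ?l c"
      have lc: "?lc \<in> mor P P" using l c by simp
      have olc: "Cmp C P P t u ?lc = nul P t" if "(t, u) \<in> F - {(s, v)}" for t u
      proof -
        have u: "u \<in> mor P t" "t \<in> Obj C" using F that S_obj by auto
        then show ?thesis using others[OF that] l c Cmp_assoc[of P P P t u ?l c] by simp
      qed
      have "Cmp C P P s v ?lc \<noteq> nul P s"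
      proof
        assume "Cmp C P P s v ?lc = nul P s"
        then have "?ann F ?lc" using olc by auto
        then show False using F lc nj by blast
      qed
      moreover have "Cmp C P P s v ?lc \<in> mor P s" using v lc so by simp
      ultimately obtain d where d: "d \<in> mor P P" "Cmp C P P s (Cmp C P P s v ?lc) d = v"
        using simple_lift[OF P_E s _ _ v] by blast
      let ?x = "Cmp C P P P ?lc d \<ominus>\<^bsub>Hom C P P\<^esub> ?l"
      have x: "?x \<in> mor P P" using lc d l by simp
      have "Cmp C P P t u ?x = nul P t" if tu: "(t, u) \<in> F" for t u
      proof -
        have u: "u \<in> mor P t" "t \<in> Obj C" using F tu S_obj by auto
        have e: "Cmp C P P t u ?x = Cmp C P P t (Cmp C P P t u ?lc) d \<ominus>\<^bsub>Hom C P t\<^esub> Cmp C P P t u ?l"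
          using u lc d l Cmp_assoc[of P P P t u ?lc d] by (simp add: Cmp_diff_right)
        show ?thesis
        proof (cases "(t, u) = (s, v)")
          case True
          then show ?thesis using e d(2) vl v so by simp
        next
          case False
          then have "(t, u) \<in> F - {(s, v)}" using tu by blast
          then show ?thesis using e olc others u d(1) by simp
        qed
      qed
      then have "?ann F ?x" by blast
      then have "?x \<in> jac" using F x by blast
      then show "\<exists>d \<in> mor P P. Cmp C P P P ?lc d \<ominus>\<^bsub>Hom C P P\<^esub> ?l \<in> jac" using d by blast
    qed
    then show ?thesis using simple vl others by blast
  qed
  note local = this
  have partial: "\<exists>x \<in> Y. (\<forall>(t, u) \<in> G. Cmp C P P t u x = u) \<and> (\<forall>(t, u) \<in> F - G. Cmp C P P t u x = nul P t)"
    if "finite G" "G \<subseteq> F" for G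
    using that
  proof (induction G rule: finite_induct)
    case empty
    have "nul P P \<in> Y" using jac jac_submodule unfolding end_submodule_def by blast
    moreover have "Cmp C P P t u (nul P P) = nul P t" if "(t, u) \<in> F" for t u
      using F that S_obj by auto
    ultimately show ?case by blast
  next
    case (insert p G)
    obtain s v where p: "p = (s, v)" by (cases p)
    have sv: "(s, v) \<in> F" using insert p by blast
    obtain x where x: "x \<in> Y" "\<forall>(t, u) \<in> G. Cmp C P P t u x = u" "\<forall>(t, u) \<in> F - G. Cmp C P P t u x = nul P t"
      using insert by blast
    obtain l where l: "l \<in> Y" "Cmp C P P s v l = v" "\<forall>(t, u) \<in> F - {(s, v)}. Cmp C P P t u l = nul P t"
      using local[OF sv] by blast
    have xl: "x \<in> mor P P" "l \<in> mor P P" using x l Y by auto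
    have tu: "Cmp C P P t u (x \<oplus>\<^bsub>Hom C P P\<^esub> l) = Cmp C P P t u x \<oplus>\<^bsub>Hom C P t\<^esub> Cmp C P P t u l" "t \<in> Obj C" "u \<in> mor P t"
      if "(t, u) \<in> F" for t u
      using F that S_obj xl by (auto simp: Cmp_add_right)
    have "Cmp C P P t u (x \<oplus>\<^bsub>Hom C P P\<^esub> l) = u" if "(t, u) \<in> insert p G" for t u
    proof (cases "(t, u) = (s, v)")
      case True
      have "(s, v) \<in> F - G" using sv insert.hyps p by blast
      then have "Cmp C P P s v x = nul P s" using x(3) by blast
      then show ?thesis using tu[OF sv] True l(2) by simp
    next
      case False
      then have "(t, u) \<in> G" "(t, u) \<in> F - {(s, v)}" using that p insert.prems by auto
      then have "Cmp C P P t u x = u" "Cmp C P P t u l = nul P t" using x(2) l(3) by blast+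
      then show ?thesis using tu[of t u] \<open>(t, u) \<in> F - {(s, v)}\<close> by simp
    qed
    moreover have "Cmp C P P t u (x \<oplus>\<^bsub>Hom C P P\<^esub> l) = nul P t" if "(t, u) \<in> F - insert p G" for t u
    proof -
      have "(t, u) \<in> F - G" "(t, u) \<in> F - {(s, v)}" using that p by auto
      then have "Cmp C P P t u x = nul P t" "Cmp C P P t u l = nul P t" using x(3) l(3) by blast+
      then show ?thesis using tu[of t u] that by simp
    qed
    ultimately show ?case using add[OF x(1) l(1)] by blast
  qed
  have "finite F" using F by blast
  from partial[OF this order_refl] obtain x where x: "x \<in> Y" "\<forall>(t, u) \<in> F. Cmp C P P t u x = u" by blast
  have xm: "x \<in> mor P P" using x Y by blast
  let ?j = "Idt C P \<ominus>\<^bsub>Hom C P P\<^esub> x"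
  have "Cmp C P P t u ?j = nul P t" if "(t, u) \<in> F" for t u
  proof -
    have "t \<in> Obj C" "u \<in> mor P t" using F that S_obj by auto
    moreover have "Cmp C P P t u x = u" using x(2) that by blast
    ultimately show ?thesis using xm by (simp add: Cmp_diff_right)
  qed
  then have "?ann F ?j" by blast
  moreover have "?j \<in> mor P P" using xm by simp
  ultimately have "?j \<in> jac" using F by blast
  then have "?j \<oplus>\<^bsub>Hom C P P\<^esub> x \<in> Y" using add jac x(1) by blast
  then show ?thesis using mor_diff_add(1)[of P P "Idt C P" x] xm by simp
qed

end


section \<open>Pairing extensions with the radical\<close>

context represented_modules
begin

lemma top_idempotentD:
  assumes "top_idempotent s e v"
  shows "e \<in> mor P P" "Cmp C P P P e e = e" "v \<in> mor P s" "v \<noteq> nul P s" "Cmp C P P s v e = v"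
    and "\<lbrakk>a \<in> mor P P; Cmp C P P s v a = nul P s\<rbrakk> \<Longrightarrow> Cmp C P P P e a \<in> jac"
  using assms unfolding top_idempotent_def by blast+

text \<open>\<open>Hom(P, s)e = Kv\<close>: an element \<open>w = we\<close> of \<open>Hom(P, s)\<close> defines the endomorphism
  \<open>va \<mapsto> wa\<close> of \<open>Hom(P, s)\<close>, which comes from an endomorphism of \<open>s\<close>, hence from a scalar.\<close>

lemma top_idempotent_multiple:
  assumes ac: "algebraically_closed K" and s: "s \<in> S" and te: "top_idempotent s e v"
    and w: "w \<in> mor P s" "Cmp C P P s w e = w"
  shows "\<exists>c \<in> carrier K. w = c \<odot>\<^bsub>Hom C P s\<^esub> v"
proof -
  have so: "s \<in> Obj C" by (rule S_obj[OF s])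
  note v = top_idempotentD[OF te]
  define \<theta> where "\<theta> u = Cmp C P P s w (SOME a. a \<in> mor P P \<and> Cmp C P P s v a = u)" for u
  have \<theta>: "\<theta> (Cmp C P P s v a) = Cmp C P P s w a" if a: "a \<in> mor P P" for a
  proof -
    define b where "b = (SOME b. b \<in> mor P P \<and> Cmp C P P s v b = Cmp C P P s v a)"
    have b: "b \<in> mor P P" "Cmp C P P s v b = Cmp C P P s v a"
      unfolding b_def using someI[of "\<lambda>b. b \<in> mor P P \<and> Cmp C P P s v b = Cmp C P P s v a" a] a by blast+
    have "Cmp C P P s v (b \<ominus>\<^bsub>Hom C P P\<^esub> a) = nul P s" using a b v so by (simp add: Cmp_diff_right)
    then have "Cmp C P P P e (b \<ominus>\<^bsub>Hom C P P\<^esub> a) \<in> jac" using v(6) a b by simp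
    then have "Cmp C P P s w (Cmp C P P P e (b \<ominus>\<^bsub>Hom C P P\<^esub> a)) = nul P s"
      using jac_annihilates s w by blast
    then have "Cmp C P P s w (b \<ominus>\<^bsub>Hom C P P\<^esub> a) = nul P s"
      using Cmp_reassoc[OF w(2), of P "b \<ominus>\<^bsub>Hom C P P\<^esub> a"] a b v w so by simp
    then show ?thesis unfolding \<theta>_def b_def[symmetric] using a b w so by (simp add: Cmp_diff_right)
  qed
  have repr: "\<exists>a \<in> mor P P. u = Cmp C P P s v a" if "u \<in> mor P s" for u
    using simple_lift[OF P_E s v(3,4) that] by blast
  have "end_linear s s \<theta>"
    unfolding end_linear_def
  proof (intro conjI ballI)
    fix u assume "u \<in> mor P s"
    then obtain a where a: "a \<in> mor P P" "u = Cmp C P P s v a" using repr by blast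
    then show "\<theta> u \<in> mor P s" using \<theta> w so by simp
    fix d assume d: "d \<in> mor P P"
    have "\<theta> (Cmp C P P s v (Cmp C P P P a d)) = Cmp C P P s w (Cmp C P P P a d)" using \<theta> a d by simp
    then show "\<theta> (Cmp C P P s u d) = Cmp C P P s (\<theta> u) d" unfolding a(2) \<theta>[OF a(1)]
      using a d v w so by (simp add: Cmp_assoc)
  next
    fix u u' assume "u \<in> mor P s" "u' \<in> mor P s"
    then obtain a a' where a: "a \<in> mor P P" "u = Cmp C P P s v a" "a' \<in> mor P P" "u' = Cmp C P P s v a'"
      using repr by blast
    have "\<theta> (Cmp C P P s v (a \<oplus>\<^bsub>Hom C P P\<^esub> a')) = Cmp C P P s w (a \<oplus>\<^bsub>Hom C P P\<^esub> a')" using \<theta> a by simp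
    then show "\<theta> (u \<oplus>\<^bsub>Hom C P s\<^esub> u') = \<theta> u \<oplus>\<^bsub>Hom C P s\<^esub> \<theta> u'"
      unfolding a(2,4) \<theta>[OF a(1)] \<theta>[OF a(3)] using a(1,3) v w so by (simp add: Cmp_add_right)
  qed
  then obtain d where d: "d \<in> mor s s" "\<forall>u \<in> mor P s. \<theta> u = Cmp C P s s d u"
    using represented_full[OF S_E[OF s] S_E[OF s]] by blast
  obtain c where c: "c \<in> carrier K" "d = c \<odot>\<^bsub>Hom C s s\<^esub> Idt C s"
    using simple_endo_scalar[OF ac s mor_fin_dim[OF so so] d(1)] by blast
  have "w = \<theta> v" using \<theta>[of "Idt C P"] v w so by simp
  also have "\<dots> = c \<odot>\<^bsub>Hom C P s\<^esub> v" using d v c so by (simp add: Cmp_smult_left)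
  finally show ?thesis using c by blast
qed

lemma end_submodule_subspace:
  assumes "end_submodule P N"
  shows "submodule K N (Hom C P P)"
proof -
  interpret V: vectorspace K "Hom C P P" by (rule Hom_vectorspace) simp_all
  have N: "N \<subseteq> mor P P" "\<And>u a. \<lbrakk>u \<in> N; a \<in> mor P P\<rbrakk> \<Longrightarrow> Cmp C P P P u a \<in> N"
    using assms unfolding end_submodule_def by blast+
  show ?thesis
  proof (intro submodule.intro V.module_axioms)
    fix c u assume c: "c \<in> carrier K" and u: "u \<in> N"
    have "Cmp C P P P u (c \<odot>\<^bsub>Hom C P P\<^esub> Idt C P) \<in> N" using N u c by simp
    then show "c \<odot>\<^bsub>Hom C P P\<^esub> u \<in> N" using u c N(1) by (simp add: Cmp_smult_right subset_iff)
  qed (use assms in \<open>auto simp: end_submodule_def\<close>)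
qed

definition adjoin :: "'m set \<Rightarrow> 'm \<Rightarrow> 'm set" where
  "adjoin N x = {n \<oplus>\<^bsub>Hom C P P\<^esub> Cmp C P P P x a | n a. n \<in> N \<and> a \<in> mor P P}"

lemma adjoin_iff:
  assumes N: "end_submodule P N" and x: "x \<in> mor P P" and y: "y \<in> mor P P"
  shows "y \<in> adjoin N x \<longleftrightarrow> (\<exists>a \<in> mor P P. y \<ominus>\<^bsub>Hom C P P\<^esub> Cmp C P P P x a \<in> N)"
proof -
  interpret ab: abelian_group "Hom C P P" by (rule mor_abelian) simp_all
  have N': "N \<subseteq> mor P P" using N unfolding end_submodule_def by blast
  show ?thesis
  proof
    assume "y \<in> adjoin N x"
    then obtain n a where na: "n \<in> N" "a \<in> mor P P" "y = n \<oplus>\<^bsub>Hom C P P\<^esub> Cmp C P P P x a"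
      unfolding adjoin_def by blast
    have "y \<ominus>\<^bsub>Hom C P P\<^esub> Cmp C P P P x a = n"
      unfolding na(3) a_minus_def using na x N' by (simp add: subset_iff ab.a_assoc ab.r_neg)
    then show "\<exists>a \<in> mor P P. y \<ominus>\<^bsub>Hom C P P\<^esub> Cmp C P P P x a \<in> N" using na(1,2) by metis
  next
    assume "\<exists>a \<in> mor P P. y \<ominus>\<^bsub>Hom C P P\<^esub> Cmp C P P P x a \<in> N"
    then obtain a where a: "a \<in> mor P P" "y \<ominus>\<^bsub>Hom C P P\<^esub> Cmp C P P P x a \<in> N" by blast
    have "y = (y \<ominus>\<^bsub>Hom C P P\<^esub> Cmp C P P P x a) \<oplus>\<^bsub>Hom C P P\<^esub> Cmp C P P P x a"
      using mor_diff_add(1)[of P P y "Cmp C P P P x a"] a x y by simp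
    then show "y \<in> adjoin N x" unfolding adjoin_def using a by blast
  qed
qed

lemma adjoin_submodule:
  assumes N: "end_submodule P N" and x: "x \<in> mor P P"
  shows "end_submodule P (adjoin N x)" "N \<subseteq> adjoin N x" "x \<in> adjoin N x"
proof -
  interpret ab: abelian_group "Hom C P P" by (rule mor_abelian) simp_all
  have N': "N \<subseteq> mor P P" "nul P P \<in> N" "\<And>u v. \<lbrakk>u \<in> N; v \<in> N\<rbrakk> \<Longrightarrow> u \<oplus>\<^bsub>Hom C P P\<^esub> v \<in> N"
    "\<And>u a. \<lbrakk>u \<in> N; a \<in> mor P P\<rbrakk> \<Longrightarrow> Cmp C P P P u a \<in> N"
    using N unfolding end_submodule_def by blast+
  show 1: "N \<subseteq> adjoin N x"
  proof
    fix n assume n: "n \<in> N"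
    then have "n \<ominus>\<^bsub>Hom C P P\<^esub> Cmp C P P P x (nul P P) \<in> N" using N' x by (simp add: subset_iff)
    moreover have "nul P P \<in> mor P P" by simp
    ultimately show "n \<in> adjoin N x" using adjoin_iff[OF N x] n N' by blast
  qed
  have "x \<ominus>\<^bsub>Hom C P P\<^esub> Cmp C P P P x (Idt C P) = nul P P" using x by simp
  then have "x \<ominus>\<^bsub>Hom C P P\<^esub> Cmp C P P P x (Idt C P) \<in> N" using N' by metis
  moreover have "Idt C P \<in> mor P P" by simp
  ultimately show "x \<in> adjoin N x" using adjoin_iff[OF N x x] by blast
  show "end_submodule P (adjoin N x)"
    unfolding end_submodule_def
  proof (intro conjI ballI)
    show "adjoin N x \<subseteq> mor P P" unfolding adjoin_def using N' x by auto
    show "nul P P \<in> adjoin N x" using 1 N' by blast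
    fix u assume "u \<in> adjoin N x"
    then obtain n a where u: "u = n \<oplus>\<^bsub>Hom C P P\<^esub> Cmp C P P P x a" "n \<in> N" "a \<in> mor P P"
      unfolding adjoin_def by blast
    have nm: "n \<in> mor P P" using u N' by blast
    {
      fix u' assume "u' \<in> adjoin N x"
      then obtain n' a' where u': "u' = n' \<oplus>\<^bsub>Hom C P P\<^esub> Cmp C P P P x a'" "n' \<in> N" "a' \<in> mor P P"
        unfolding adjoin_def by blast
      have nm': "n' \<in> mor P P" using u' N' by blast
      have "u \<oplus>\<^bsub>Hom C P P\<^esub> u' = (n \<oplus>\<^bsub>Hom C P P\<^esub> n') \<oplus>\<^bsub>Hom C P P\<^esub> Cmp C P P P x (a \<oplus>\<^bsub>Hom C P P\<^esub> a')"
        unfolding u(1) u'(1) using u(3) u'(3) nm nm' x by (simp add: Cmp_add_right ab.a_ac)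
      moreover have "n \<oplus>\<^bsub>Hom C P P\<^esub> n' \<in> N" "a \<oplus>\<^bsub>Hom C P P\<^esub> a' \<in> mor P P" using u u' N'(3) by simp_all
      ultimately show "u \<oplus>\<^bsub>Hom C P P\<^esub> u' \<in> adjoin N x" unfolding adjoin_def by blast
    }
    fix d assume d: "d \<in> mor P P"
    have "Cmp C P P P u d = Cmp C P P P n d \<oplus>\<^bsub>Hom C P P\<^esub> Cmp C P P P x (Cmp C P P P a d)"
      unfolding u(1) using u(3) nm x d by (simp add: Cmp_add_left Cmp_assoc)
    moreover have "Cmp C P P P n d \<in> N" "Cmp C P P P a d \<in> mor P P" using u d N'(4) by simp_all
    ultimately show "Cmp C P P P u d \<in> adjoin N x" unfolding adjoin_def by blast
  qed
qed

text \<open>Choose \<open>N\<close> maximal among the submodules of \<open>e rad A\<close> that contain \<open>e rad\<^sup>2 A\<close> but not \<open>r\<close>.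
  Semisimplicity of \<open>A / rad A\<close> reduces \<open>N + rA = e rad A\<close> to elements \<open>yl\<close> that generate a simple or
  zero submodule modulo \<open>rad\<^sup>2 A\<close>. If \<open>yl\<close> is not in \<open>N\<close>, then \<open>r\<close> is in \<open>N + ylA\<close> by maximality, and
  by simplicity \<open>yl\<close> is recovered from \<open>r\<close>.\<close>

lemma complement_of_radical_element:
  assumes e: "e \<in> mor P P" and r: "r \<in> jac" "Cmp C P P P e r = r" "r \<notin> jac2"
  shows "\<exists>N. end_submodule P N \<and> {j \<in> jac2. Cmp C P P P e j = j} \<subseteq> N \<and> r \<notin> N \<and>
    adjoin N r = {j \<in> jac. Cmp C P P P e j = j}"
proof -
  let ?eJ = "{j \<in> jac. Cmp C P P P e j = j}" and ?eJ2 = "{j \<in> jac2. Cmp C P P P e j = j}"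
  let ?ok = "\<lambda>N. end_submodule P N \<and> ?eJ2 \<subseteq> N \<and> N \<subseteq> ?eJ \<and> r \<notin> N"
  interpret V: vectorspace K "Hom C P P" by (rule Hom_vectorspace) simp_all
  interpret ab: abelian_group "Hom C P P" by (rule mor_abelian) simp_all
  have sub: "end_submodule P {j \<in> N. Cmp C P P P e j = j}" if N: "end_submodule P N" for N
  proof -
    have "N \<subseteq> mor P P" "nul P P \<in> N" "\<And>u v. \<lbrakk>u \<in> N; v \<in> N\<rbrakk> \<Longrightarrow> u \<oplus>\<^bsub>Hom C P P\<^esub> v \<in> N"
      "\<And>u a. \<lbrakk>u \<in> N; a \<in> mor P P\<rbrakk> \<Longrightarrow> Cmp C P P P u a \<in> N"
      using N unfolding end_submodule_def by blast+
    then show ?thesis unfolding end_submodule_def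
      using e by (auto simp: Cmp_add_right subset_iff simp flip: Cmp_assoc)
  qed
  have rm: "r \<in> mor P P" by (rule jac_mor[OF r(1)])
  obtain rk where rk: "\<And>U Y. submodule K U (Hom C P P) \<Longrightarrow> submodule K Y (Hom C P P) \<Longrightarrow> U \<subset> Y \<Longrightarrow> rk U < (rk Y :: nat)"
    and bound: "\<And>U. submodule K U (Hom C P P) \<Longrightarrow> rk U \<le> V.dim"
    using V.subspace_rank_exists[OF mor_fin_dim[OF P_obj P_obj]] by blast
  have ok0: "?ok ?eJ2"
  proof (intro conjI)
    show "end_submodule P ?eJ2" by (rule sub[OF jac2_submodule])
    show "?eJ2 \<subseteq> ?eJ" using jac2_jac by blast
  qed (use r in blast)+
  have "\<forall>N. ?ok N \<longrightarrow> rk N < Suc V.dim"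
    using bound end_submodule_subspace by (simp add: less_Suc_eq_le)
  from Lattices_Big.ex_has_greatest_nat[of ?ok, OF ok0 this]
  obtain N where *: "?ok N \<and> (\<forall>N'. ?ok N' \<longrightarrow> rk N' \<le> rk N)" by (rule exE)
  have N: "?ok N" by (rule conjunct1[OF *])
  have greatest: "rk N' \<le> rk N" if "?ok N'" for N' by (rule conjunct2[OF *, rule_format, OF that])
  have NE: "end_submodule P N" using N by blast
  have Nc: "N \<subseteq> mor P P" "\<And>u a. \<lbrakk>u \<in> N; a \<in> mor P P\<rbrakk> \<Longrightarrow> Cmp C P P P u a \<in> N"
    using NE unfolding end_submodule_def by blast+
  have adj_eJ: "adjoin N x \<subseteq> ?eJ" if x: "x \<in> ?eJ" for x
  proof -
    have E: "end_submodule P ?eJ" by (rule sub[OF jac_submodule])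
    then have "\<And>u v. \<lbrakk>u \<in> ?eJ; v \<in> ?eJ\<rbrakk> \<Longrightarrow> u \<oplus>\<^bsub>Hom C P P\<^esub> v \<in> ?eJ"
      "\<And>u a. \<lbrakk>u \<in> ?eJ; a \<in> mor P P\<rbrakk> \<Longrightarrow> Cmp C P P P u a \<in> ?eJ"
      unfolding end_submodule_def by blast+
    then show ?thesis unfolding adjoin_def using N x by blast
  qed
  let ?M = "adjoin N r"
  note M = adjoin_submodule[OF NE rm]
  have Mc: "\<And>u v. \<lbrakk>u \<in> ?M; v \<in> ?M\<rbrakk> \<Longrightarrow> u \<oplus>\<^bsub>Hom C P P\<^esub> v \<in> ?M"
    "\<And>u a. \<lbrakk>u \<in> ?M; a \<in> mor P P\<rbrakk> \<Longrightarrow> Cmp C P P P u a \<in> ?M"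
    using M(1) unfolding end_submodule_def by blast+
  let ?Y = "{a \<in> mor P P. \<forall>y \<in> ?eJ. Cmp C P P P y a \<in> ?M}"
  have "Idt C P \<in> ?Y"
  proof (rule semisimple_mod_jac)
    fix a b assume "a \<in> ?Y" "b \<in> ?Y"
    then show "a \<oplus>\<^bsub>Hom C P P\<^esub> b \<in> ?Y" using Mc(1) jac_mor by (auto simp: Cmp_add_right)
  next
    show "jac \<subseteq> ?Y"
    proof
      fix a assume a: "a \<in> jac"
      have "Cmp C P P P y a \<in> ?M" if y: "y \<in> ?eJ" for y
      proof -
        have "Cmp C P P P y a \<in> ?eJ2"
          using y a jac2_prod jac_mor[of y] jac_mor[OF a] Cmp_reassoc[of P P P e y y P a] e by auto
        then show ?thesis using N M(2) by blast
      qed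
      then show "a \<in> ?Y" using a jac_mor by blast
    qed
  next
    fix l assume l: "simple_mod_jac l"
    have lm: "l \<in> mor P P" using l unfolding simple_mod_jac_def by blast
    have "Cmp C P P P y l \<in> ?M" if y: "y \<in> ?eJ" for y
    proof (rule ccontr)
      assume nM: "Cmp C P P P y l \<notin> ?M"
      let ?x = "Cmp C P P P y l"
      have ym: "y \<in> mor P P" using y jac_mor by blast
      have xm: "?x \<in> mor P P" using ym lm by simp
      have x: "?x \<in> ?eJ" using y lm ym e jac_right Cmp_reassoc[of P P P e y y P l] by auto
      note A = adjoin_submodule[OF NE xm]
      have "N \<subset> adjoin N ?x" using A(2,3) nM M(2) by blast
      then have "rk N < rk (adjoin N ?x)" using rk end_submodule_subspace NE A(1) by blast
      then have "\<not> ?ok (adjoin N ?x)" using greatest leD by blast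
      then have "r \<in> adjoin N ?x" using A(1,2) N adj_eJ[OF x] by blast
      then obtain a where a: "a \<in> mor P P" "r \<ominus>\<^bsub>Hom C P P\<^esub> Cmp C P P P ?x a \<in> N"
        using adjoin_iff[OF NE xm rm] by blast
      let ?la = "Cmp C P P P l a"
      have jN: "Cmp C P P P y j \<in> N" if j: "j \<in> jac" for j
      proof -
        have "Cmp C P P P y j \<in> ?eJ2"
          using y j jac2_prod ym jac_mor[OF j] Cmp_reassoc[of P P P e y y P j] e by auto
        then show ?thesis using N by blast
      qed
      have "?la \<notin> jac"
      proof
        assume "?la \<in> jac"
        then have "Cmp C P P P ?x a \<in> N" using jN ym lm a Cmp_assoc[of P P P P y l a] by simp
        then have "(r \<ominus>\<^bsub>Hom C P P\<^esub> Cmp C P P P ?x a) \<oplus>\<^bsub>Hom C P P\<^esub> Cmp C P P P ?x a \<in> N"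
          using a NE unfolding end_submodule_def by blast
        then show False using N mor_diff_add(1)[of P P r "Cmp C P P P ?x a"] rm xm a by simp
      qed
      then obtain b where b: "b \<in> mor P P" "Cmp C P P P ?la b \<ominus>\<^bsub>Hom C P P\<^esub> l \<in> jac"
        using l a unfolding simple_mod_jac_def by blast
      let ?xab = "Cmp C P P P (Cmp C P P P ?x a) b"
      have m: "?xab \<in> mor P P" "Cmp C P P P r b \<in> mor P P" using xm a b rm by simp_all
      have "Cmp C P P P (r \<ominus>\<^bsub>Hom C P P\<^esub> Cmp C P P P ?x a) b \<in> ?M" using Mc(2) M(2) a b by blast
      moreover have "Cmp C P P P r b \<in> ?M" using Mc(2) M(3) b by blast
      ultimately have "Cmp C P P P r b \<ominus>\<^bsub>Hom C P P\<^esub> Cmp C P P P (r \<ominus>\<^bsub>Hom C P P\<^esub> Cmp C P P P ?x a) b \<in> ?M"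
        using end_submodule_diff[OF M(1)] by simp
      moreover have "Cmp C P P P r b \<ominus>\<^bsub>Hom C P P\<^esub> Cmp C P P P (r \<ominus>\<^bsub>Hom C P P\<^esub> Cmp C P P P ?x a) b = ?xab"
        using m rm xm a(1) b(1) by (simp add: Cmp_diff_left mor_diff_diff)
      ultimately have 1: "?xab \<in> ?M" by simp
      have "Cmp C P P P y (Cmp C P P P ?la b \<ominus>\<^bsub>Hom C P P\<^esub> l) \<in> ?M" using jN[OF b(2)] M(2) by blast
      then have "?xab \<ominus>\<^bsub>Hom C P P\<^esub> ?x \<in> ?M" using ym lm a(1) b(1) by (simp add: Cmp_diff_right Cmp_assoc)
      then have "?xab \<ominus>\<^bsub>Hom C P P\<^esub> (?xab \<ominus>\<^bsub>Hom C P P\<^esub> ?x) \<in> ?M"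
        using end_submodule_diff[OF M(1)] 1 by simp
      moreover have "?xab \<ominus>\<^bsub>Hom C P P\<^esub> (?xab \<ominus>\<^bsub>Hom C P P\<^esub> ?x) = ?x"
        using m xm by (simp add: mor_diff_diff)
      ultimately show False using nM by simp
    qed
    then show "l \<in> ?Y" using lm by blast
  qed blast
  then have "?eJ \<subseteq> ?M" using jac_mor by auto
  then have "?M = ?eJ" using adj_eJ r by blast
  then show ?thesis using N by blast
qed

end

text \<open>For a triangle \<open>k \<rightarrow> P \<rightarrow> t \<rightarrow> \<Sigma>k\<close> over \<open>vt\<close>, every map from \<open>t\<close> to \<open>\<Sigma>s\<close> factors through the
  connecting map and so comes from a map \<open>c\<close> from \<open>k\<close> to \<open>s\<close>. As \<open>Hom(P, k)\<close> is the annihilator of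
  \<open>vt\<close>, the map \<open>c\<close> acts on the radical, and its effect there on \<open>e rad A f\<close> has values in
  \<open>Hom(P, s)f = Kvs\<close>.\<close>

locale arrow_pairing = represented_modules K C S P
  for K :: "('k, 'r) ring_scheme" and C :: "('k, 'o, 'm, 's) tri_cat_scheme" and S :: "'o set" and P :: "'o" +
  fixes s t k :: "'o" and e f vs vt i h :: "'m"
  assumes ac: "algebraically_closed K" and s: "s \<in> S" and t: "t \<in> S" and top_t: "top_idempotent t e vt"
    and top_s: "top_idempotent s f vs" and k: "k \<in> ext_closure C S" and tri: "dist C k P t i vt h"
begin

lemmas e = top_idempotentD[OF top_t]
lemmas f = top_idempotentD[OF top_s]

lemma s_obj [simp]: "s \<in> Obj C" by (rule S_obj[OF s])
lemma t_obj [simp]: "t \<in> Obj C" by (rule S_obj[OF t])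
lemma k_obj [simp]: "k \<in> Obj C" by (rule distD(1)[OF tri])
lemma i_mor [simp]: "i \<in> mor k P" by (rule distD(4)[OF tri])
lemma h_mor [simp]: "h \<in> mor t (T k)" by (rule distD(6)[OF tri])

lemma i_lift: "\<lbrakk>j \<in> mor P P; Cmp C P P t vt j = nul P t\<rbrakk> \<Longrightarrow> \<exists>u \<in> mor P k. j = Cmp C P k P i u"
  using dist_weak_kernel[OF tri P_obj] by blast

lemma jac_lift:
  assumes "j \<in> jac"
  shows "\<exists>u \<in> mor P k. j = Cmp C P k P i u"
  by (rule i_lift[OF jac_mor[OF assms] jac_annihilates[OF assms t e(3)]])

lemma vt_i: "u \<in> mor P k \<Longrightarrow> Cmp C P P t vt (Cmp C P k P i u) = nul P t"
  using Cmp_reassoc[OF dist_comp_zero[OF tri], of P u] e by simp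

lemma e_i_jac: "u \<in> mor P k \<Longrightarrow> Cmp C P P P e (Cmp C P k P i u) \<in> jac"
  using e(6) vt_i by simp

lemma i_mono:
  assumes "u \<in> mor P k" "u' \<in> mor P k" "Cmp C P k P i u = Cmp C P k P i u'"
  shows "u = u'"
proof -
  have "u \<ominus>\<^bsub>Hom C P k\<^esub> u' = nul P k"
    by (rule E_dist_mono[OF tri S_E[OF t] P_E]) (use assms in \<open>simp_all add: Cmp_diff_right\<close>)
  then show ?thesis using assms by simp
qed

text \<open>The effect of \<open>c\<close> on the annihilator of \<open>vt\<close>, whose elements factor uniquely through \<open>i\<close>.\<close>

definition restr :: "'m \<Rightarrow> 'm \<Rightarrow> 'm" where
  "restr c j = Cmp C P k s c (THE u. u \<in> mor P k \<and> Cmp C P k P i u = j)"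

lemma restr_i [simp]:
  assumes "u \<in> mor P k"
  shows "restr c (Cmp C P k P i u) = Cmp C P k s c u"
proof -
  have "(THE u'. u' \<in> mor P k \<and> Cmp C P k P i u' = Cmp C P k P i u) = u"
    by (rule the_equality) (use assms i_mono in auto)
  then show ?thesis unfolding restr_def by simp
qed

lemma restr_rules:
  assumes c: "c \<in> mor k s" and j: "j \<in> jac"
  shows restr_closed: "restr c j \<in> mor P s"
    and restr_add: "j' \<in> jac \<Longrightarrow> restr c (j \<oplus>\<^bsub>Hom C P P\<^esub> j') = restr c j \<oplus>\<^bsub>Hom C P s\<^esub> restr c j'"
    and restr_smult: "b \<in> carrier K \<Longrightarrow> restr c (b \<odot>\<^bsub>Hom C P P\<^esub> j) = b \<odot>\<^bsub>Hom C P s\<^esub> restr c j"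
    and restr_Cmp: "a \<in> mor P P \<Longrightarrow> restr c (Cmp C P P P j a) = Cmp C P P s (restr c j) a"
    and restr_add_left: "c' \<in> mor k s \<Longrightarrow> restr (c \<oplus>\<^bsub>Hom C k s\<^esub> c') j = restr c j \<oplus>\<^bsub>Hom C P s\<^esub> restr c' j"
    and restr_smult_left: "b \<in> carrier K \<Longrightarrow> restr (b \<odot>\<^bsub>Hom C k s\<^esub> c) j = b \<odot>\<^bsub>Hom C P s\<^esub> restr c j"
proof -
  obtain u where u: "u \<in> mor P k" "j = Cmp C P k P i u" using jac_lift[OF j] by blast
  show "restr c j \<in> mor P s" using u c by simp
  show "restr c (j \<oplus>\<^bsub>Hom C P P\<^esub> j') = restr c j \<oplus>\<^bsub>Hom C P s\<^esub> restr c j'" if j': "j' \<in> jac"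
  proof -
    obtain u' where u': "u' \<in> mor P k" "j' = Cmp C P k P i u'" using jac_lift[OF j'] by blast
    show ?thesis using restr_i[of "u \<oplus>\<^bsub>Hom C P k\<^esub> u'" c] u u' c by (simp add: Cmp_add_right)
  qed
  show "restr c (b \<odot>\<^bsub>Hom C P P\<^esub> j) = b \<odot>\<^bsub>Hom C P s\<^esub> restr c j" if "b \<in> carrier K"
    using restr_i[of "b \<odot>\<^bsub>Hom C P k\<^esub> u" c] u c that by (simp add: Cmp_smult_right)
  show "restr c (Cmp C P P P j a) = Cmp C P P s (restr c j) a" if "a \<in> mor P P"
    using restr_i[of "Cmp C P P k u a" c] u c that by (simp add: Cmp_assoc)
  show "restr (c \<oplus>\<^bsub>Hom C k s\<^esub> c') j = restr c j \<oplus>\<^bsub>Hom C P s\<^esub> restr c' j" if "c' \<in> mor k s"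
    using u c that by (simp add: Cmp_add_left)
  show "restr (b \<odot>\<^bsub>Hom C k s\<^esub> c) j = b \<odot>\<^bsub>Hom C P s\<^esub> restr c j" if "b \<in> carrier K"
    using u c that by (simp add: Cmp_smult_left)
qed

lemma connecting_exists:
  assumes d: "\<delta> \<in> mor t (T s)"
  shows "\<exists>c \<in> mor k s. Cmp C t (T k) (T s) (Tm k s c) h = \<delta>"
proof -
  have "Cmp C P t (T s) \<delta> vt \<in> mor P (T s)" using d e by simp
  then have "Cmp C P t (T s) \<delta> vt = nul P (T s)" using P_projective[OF S_E[OF s]] by blast
  then obtain g where "g \<in> mor (T k) (T s)" "Cmp C t (T k) (T s) g h = \<delta>"
    using dist_factor_connecting[OF tri _ d] by auto
  then show ?thesis using Tm_surj[of k s g] by auto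
qed

text \<open>A map \<open>c\<close> with zero connecting map extends to \<open>P\<close>, and maps from \<open>P\<close> to \<open>s\<close> kill the radical.\<close>

lemma restr_connecting:
  assumes c: "c \<in> mor k s" "c' \<in> mor k s" and j: "j \<in> jac"
    and eq: "Cmp C t (T k) (T s) (Tm k s c) h = Cmp C t (T k) (T s) (Tm k s c') h"
  shows "restr c j = restr c' j"
proof -
  interpret ab: abelian_group "Hom C k s" by (rule mor_abelian) simp_all
  let ?d = "c \<ominus>\<^bsub>Hom C k s\<^esub> c'"
  have Td: "Tm k s ?d = Tm k s c \<ominus>\<^bsub>Hom C (T k) (T s)\<^esub> Tm k s c'"
    using c by (simp add: a_minus_def Tm_add Tm_neg)
  have "Cmp C t (T k) (T s) (Tm k s ?d) h = nul t (T s)"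
    unfolding Td using c eq by (simp add: Cmp_diff_left)
  then obtain g where g: "g \<in> mor P s" "Cmp C k P s g i = ?d"
    using dist_extend[OF tri s_obj, of ?d] c by auto
  obtain u where u: "u \<in> mor P k" "j = Cmp C P k P i u" using jac_lift[OF j] by blast
  have "Cmp C P k s ?d u = Cmp C P P s g j"
    using Cmp_reassoc[OF g(2), of P u] g u by simp
  also have "\<dots> = nul P s" using jac_annihilates[OF j s g(1)] .
  finally show ?thesis using u c by (simp add: Cmp_diff_left)
qed

definition pair :: "'m \<Rightarrow> 'm \<Rightarrow> 'm" where
  "pair \<delta> j = restr (SOME c. c \<in> mor k s \<and> Cmp C t (T k) (T s) (Tm k s c) h = \<delta>) j"

lemma pair_eq:
  assumes c: "c \<in> mor k s" "Cmp C t (T k) (T s) (Tm k s c) h = \<delta>" and j: "j \<in> jac"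
  shows "pair \<delta> j = restr c j"
proof -
  let ?Q = "\<lambda>c. c \<in> mor k s \<and> Cmp C t (T k) (T s) (Tm k s c) h = \<delta>"
  have *: "?Q (SOME c. ?Q c)" by (rule someI[of ?Q c]) (use c in simp)
  show ?thesis unfolding pair_def
    by (rule restr_connecting[OF conjunct1[OF *] c(1) j]) (simp only: conjunct2[OF *] c(2))
qed

text \<open>The set \<open>e rad A f\<close> before encoding.\<close>

definition R :: "'m set" where
  "R = {j \<in> jac. Cmp C P P P e j = j \<and> Cmp C P P P j f = j}"

lemma R_jac: "j \<in> R \<Longrightarrow> j \<in> jac"
  unfolding R_def by blast

lemma R_mor: "j \<in> R \<Longrightarrow> j \<in> mor P P"
  using R_jac jac_mor by blast

lemma pair_rules:
  assumes d: "\<delta> \<in> mor t (T s)" and j: "j \<in> jac"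
  shows pair_closed: "pair \<delta> j \<in> mor P s"
    and pair_add: "j' \<in> jac \<Longrightarrow> pair \<delta> (j \<oplus>\<^bsub>Hom C P P\<^esub> j') = pair \<delta> j \<oplus>\<^bsub>Hom C P s\<^esub> pair \<delta> j'"
    and pair_smult: "b \<in> carrier K \<Longrightarrow> pair \<delta> (b \<odot>\<^bsub>Hom C P P\<^esub> j) = b \<odot>\<^bsub>Hom C P s\<^esub> pair \<delta> j"
    and pair_Cmp: "a \<in> mor P P \<Longrightarrow> pair \<delta> (Cmp C P P P j a) = Cmp C P P s (pair \<delta> j) a"
    and pair_add_left: "\<delta>' \<in> mor t (T s) \<Longrightarrow> pair (\<delta> \<oplus>\<^bsub>Hom C t (T s)\<^esub> \<delta>') j = pair \<delta> j \<oplus>\<^bsub>Hom C P s\<^esub> pair \<delta>' j"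
    and pair_smult_left: "b \<in> carrier K \<Longrightarrow> pair (b \<odot>\<^bsub>Hom C t (T s)\<^esub> \<delta>) j = b \<odot>\<^bsub>Hom C P s\<^esub> pair \<delta> j"
proof -
  obtain c where c: "c \<in> mor k s" "Cmp C t (T k) (T s) (Tm k s c) h = \<delta>" using connecting_exists[OF d] by blast
  note eq = pair_eq[OF c]
  show "pair \<delta> j \<in> mor P s" unfolding eq[OF j] by (rule restr_closed[OF c(1) j])
  show "pair \<delta> (j \<oplus>\<^bsub>Hom C P P\<^esub> j') = pair \<delta> j \<oplus>\<^bsub>Hom C P s\<^esub> pair \<delta> j'" if j': "j' \<in> jac"
    unfolding eq[OF j] eq[OF j'] eq[OF jac_add[OF j j']] by (rule restr_add[OF c(1) j j'])
  show "pair \<delta> (b \<odot>\<^bsub>Hom C P P\<^esub> j) = b \<odot>\<^bsub>Hom C P s\<^esub> pair \<delta> j" if a: "b \<in> carrier K"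
  proof -
    have aj: "b \<odot>\<^bsub>Hom C P P\<^esub> j \<in> jac"
      by (rule submodule.smult_closed[OF end_submodule_subspace[OF jac_submodule] a j])
    show ?thesis unfolding eq[OF j] eq[OF aj] by (rule restr_smult[OF c(1) j a])
  qed
  show "pair \<delta> (Cmp C P P P j a) = Cmp C P P s (pair \<delta> j) a" if a: "a \<in> mor P P"
    unfolding eq[OF j] eq[OF jac_right[OF j a]] by (rule restr_Cmp[OF c(1) j a])
  show "pair (\<delta> \<oplus>\<^bsub>Hom C t (T s)\<^esub> \<delta>') j = pair \<delta> j \<oplus>\<^bsub>Hom C P s\<^esub> pair \<delta>' j" if d': "\<delta>' \<in> mor t (T s)"
  proof -
    obtain c' where c': "c' \<in> mor k s" "Cmp C t (T k) (T s) (Tm k s c') h = \<delta>'" using connecting_exists[OF d'] by blast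
    have "pair (\<delta> \<oplus>\<^bsub>Hom C t (T s)\<^esub> \<delta>') j = restr (c \<oplus>\<^bsub>Hom C k s\<^esub> c') j"
      by (rule pair_eq[OF _ _ j]) (use c(1) c'(1) in \<open>simp_all add: Tm_add Cmp_add_left c(2) c'(2)\<close>)
    then show ?thesis unfolding eq[OF j] pair_eq[OF c' j] using restr_add_left[OF c(1) j c'(1)] by simp
  qed
  show "pair (b \<odot>\<^bsub>Hom C t (T s)\<^esub> \<delta>) j = b \<odot>\<^bsub>Hom C P s\<^esub> pair \<delta> j" if a: "b \<in> carrier K"
  proof -
    have "pair (b \<odot>\<^bsub>Hom C t (T s)\<^esub> \<delta>) j = restr (b \<odot>\<^bsub>Hom C k s\<^esub> c) j"
      by (rule pair_eq[OF _ _ j]) (use c(1) a in \<open>simp_all add: Tm_smult Cmp_smult_left c(2)\<close>)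
    then show ?thesis unfolding eq[OF j] using restr_smult_left[OF c(1) j a] by simp
  qed
qed

lemma pair_jac2:
  assumes d: "\<delta> \<in> mor t (T s)" and j: "j \<in> jac2"
  shows "pair \<delta> j = nul P s"
  using j
proof (induction rule: jac2_induct)
  case (prod a b)
  then show ?case using pair_Cmp[OF d, of a b] jac_mor jac_annihilates[OF prod(2) s pair_closed[OF d prod(1)]] by simp
next
  case (sum a b)
  then have "a \<in> jac" "b \<in> jac" using jac2_jac by auto
  then show ?case using pair_add[OF d] sum by simp
qed

lemma pair_multiple:
  assumes d: "\<delta> \<in> mor t (T s)" and j: "j \<in> R"
  shows "\<exists>c \<in> carrier K. pair \<delta> j = c \<odot>\<^bsub>Hom C P s\<^esub> vs"
proof (rule top_idempotent_multiple[OF ac s top_s])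
  show "pair \<delta> j \<in> mor P s" by (rule pair_closed[OF d R_jac[OF j]])
  show "Cmp C P P s (pair \<delta> j) f = pair \<delta> j"
    using pair_Cmp[OF d R_jac[OF j] f(1)] j unfolding R_def by simp
qed

text \<open>The pairing determines \<open>c\<close> on \<open>e rad A\<close>, since a nonzero value there can be moved to \<open>vs\<close> and
  so into \<open>e rad A f\<close>. What remains of \<open>c\<close> is its composite with \<open>(1 - e)\<close>, which extends to \<open>P\<close>.\<close>

lemma pair_left_nondegenerate:
  assumes d: "\<delta> \<in> mor t (T s)" and 0: "\<And>j. j \<in> R \<Longrightarrow> pair \<delta> j = nul P s"
  shows "\<delta> = nul t (T s)"
proof -
  obtain c where c: "c \<in> mor k s" "Cmp C t (T k) (T s) (Tm k s c) h = \<delta>" using connecting_exists[OF d] by blast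
  have eJ: "pair \<delta> j = nul P s" if j: "j \<in> jac" "Cmp C P P P e j = j" for j
  proof (rule ccontr)
    assume "pair \<delta> j \<noteq> nul P s"
    then obtain b where b: "b \<in> mor P P" "Cmp C P P s (pair \<delta> j) b = vs"
      using simple_lift[OF P_E s pair_closed[OF d j(1)] _ f(3)] by blast
    let ?j = "Cmp C P P P j (Cmp C P P P b f)"
    have jm: "j \<in> mor P P" by (rule jac_mor[OF j(1)])
    have "?j \<in> R" unfolding R_def
      using j b f e jm jac_right[OF j(1), of "Cmp C P P P b f"] Cmp_reassoc[OF j(2), of P "Cmp C P P P b f"]
      by (simp add: Cmp_assoc)
    moreover have "pair \<delta> ?j = vs"
      using pair_Cmp[OF d j(1), of "Cmp C P P P b f"] b f Cmp_reassoc[OF b(2), of P f] pair_closed[OF d j(1)] by simp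
    ultimately show False using 0 f(4) by simp
  qed
  have "Cmp C P P t vt (Idt C P \<ominus>\<^bsub>Hom C P P\<^esub> e) = nul P t" using e by (simp add: Cmp_diff_right)
  moreover have "Idt C P \<ominus>\<^bsub>Hom C P P\<^esub> e \<in> mor P P" using e by simp
  ultimately obtain q where q: "q \<in> mor P k" "Idt C P \<ominus>\<^bsub>Hom C P P\<^esub> e = Cmp C P k P i q" using i_lift by blast
  have "c = Cmp C k P s (Cmp C P k s c q) i"
  proof (rule represented_eqI[OF k S_E[OF s]])
    fix u assume u: "u \<in> mor P k"
    let ?iu = "Cmp C P k P i u"
    let ?j = "Cmp C P P P e ?iu"
    have "?j \<in> jac" by (rule e_i_jac[OF u])
    moreover have "Cmp C P P P e ?j = ?j" using Cmp_reassoc[OF e(2), of P ?iu] e u by simp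
    ultimately have j: "?j \<in> jac" "pair \<delta> ?j = nul P s" using eJ by simp_all
    have qu: "Cmp C P P k q ?iu \<in> mor P k" using q u by simp
    have "Cmp C P k P i (u \<ominus>\<^bsub>Hom C P k\<^esub> Cmp C P P k q ?iu) = ?iu \<ominus>\<^bsub>Hom C P P\<^esub> Cmp C P P P (Idt C P \<ominus>\<^bsub>Hom C P P\<^esub> e) ?iu"
      using Cmp_reassoc[OF q(2)[symmetric], of P ?iu] q(1) u qu e by (simp add: Cmp_diff_right)
    also have "\<dots> = ?j" using u e mor_diff_diff[of P P ?iu ?j] by (simp add: Cmp_diff_left)
    finally have ju: "?j = Cmp C P k P i (u \<ominus>\<^bsub>Hom C P k\<^esub> Cmp C P P k q ?iu)" by simp
    have "restr c ?j = Cmp C P k s c (u \<ominus>\<^bsub>Hom C P k\<^esub> Cmp C P P k q ?iu)"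
      unfolding ju by (rule restr_i) (use u qu in simp)
    then have "Cmp C P k s c (u \<ominus>\<^bsub>Hom C P k\<^esub> Cmp C P P k q ?iu) = nul P s"
      using j(2) pair_eq[OF c j(1)] by simp
    then have "Cmp C P k s c u = Cmp C P k s c (Cmp C P P k q ?iu)" using u qu c by (simp add: Cmp_diff_right)
    then show "Cmp C P k s c u = Cmp C P k s (Cmp C k P s (Cmp C P k s c q) i) u"
      using u q c by (simp add: Cmp_assoc)
  qed (use c q in simp_all)
  then have "\<delta> = Cmp C t (T k) (T s) (Tm k s (Cmp C k P s (Cmp C P k s c q) i)) h" using c by simp
  also have "\<dots> = Cmp C t (T P) (T s) (Tm P s (Cmp C P k s c q)) (Cmp C t (T k) (T P) (Tm k P i) h)"
    using c q by (simp add: Tm_Cmp Cmp_assoc)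
  also have "\<dots> = nul t (T s)" using dist_comp_zero'(2)[OF tri] c q by simp
  finally show ?thesis .
qed

text \<open>Conversely, for \<open>r\<close> outside of \<open>rad\<^sup>2 A\<close> the assignment \<open>n + ra \<mapsto> vs a\<close> on a decomposition
  \<open>e rad A = N + rA\<close> is a well-defined map to \<open>Hom(P, s)\<close>; by fullness it comes from \<open>k\<close>.\<close>

lemma pair_right_nondegenerate:
  assumes r: "r \<in> R" "r \<notin> jac2"
  shows "\<exists>\<delta> \<in> mor t (T s). pair \<delta> r = vs"
proof -
  have rj: "r \<in> jac" "Cmp C P P P e r = r" "Cmp C P P P r f = r" using r unfolding R_def by auto
  have rm: "r \<in> mor P P" by (rule jac_mor[OF rj(1)])
  obtain N where N: "end_submodule P N" "{j \<in> jac2. Cmp C P P P e j = j} \<subseteq> N" "r \<notin> N"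
    "adjoin N r = {j \<in> jac. Cmp C P P P e j = j}"
    using complement_of_radical_element[OF e(1) rj(1,2) r(2)] by blast
  have Nc: "N \<subseteq> mor P P" "\<And>u v. \<lbrakk>u \<in> N; v \<in> N\<rbrakk> \<Longrightarrow> u \<oplus>\<^bsub>Hom C P P\<^esub> v \<in> N" "\<And>u a. \<lbrakk>u \<in> N; a \<in> mor P P\<rbrakk> \<Longrightarrow> Cmp C P P P u a \<in> N"
    using N(1) unfolding end_submodule_def by blast+
  have kernel: "Cmp C P P s vs b = nul P s" if b: "b \<in> mor P P" "Cmp C P P P r b \<in> N" for b
  proof (rule ccontr)
    assume "Cmp C P P s vs b \<noteq> nul P s"
    moreover have "Cmp C P P s vs b \<in> mor P s" using b f by simp
    ultimately obtain a where a: "a \<in> mor P P" "Cmp C P P s (Cmp C P P s vs b) a = vs"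
      using simple_lift[OF P_E s _ _ f(3)] by blast
    let ?x = "Cmp C P P P b a \<ominus>\<^bsub>Hom C P P\<^esub> Idt C P"
    have x: "?x \<in> mor P P" using a b by simp
    have "Cmp C P P s vs ?x = nul P s" using a b f by (simp add: Cmp_diff_right Cmp_assoc)
    then have fx: "Cmp C P P P f ?x \<in> jac" using f(6) x by blast
    have rx: "Cmp C P P P r ?x = Cmp C P P P r (Cmp C P P P f ?x)"
      using Cmp_reassoc[OF rj(3), of P ?x] rm f x by simp
    have "Cmp C P P P r ?x \<in> jac2" unfolding rx by (rule jac2_prod[OF rj(1) fx])
    moreover have "Cmp C P P P e (Cmp C P P P r ?x) = Cmp C P P P r ?x"
      using Cmp_reassoc[OF rj(2), of P ?x] rm e x by simp
    ultimately have "Cmp C P P P r ?x \<in> N" using N(2) by blast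
    moreover have "Cmp C P P P r (Cmp C P P P b a) \<in> N" using Nc(3)[OF b(2) a(1)] rm a b by (simp add: Cmp_assoc)
    ultimately have "Cmp C P P P r (Cmp C P P P b a) \<ominus>\<^bsub>Hom C P P\<^esub> Cmp C P P P r ?x \<in> N"
      using end_submodule_diff[OF N(1)] by simp
    moreover have "Cmp C P P P r (Cmp C P P P b a) \<ominus>\<^bsub>Hom C P P\<^esub> Cmp C P P P r ?x = r"
      using rm a b x mor_diff_diff[of P P "Cmp C P P P r (Cmp C P P P b a)" r] by (simp add: Cmp_diff_right)
    ultimately show False using N(3) by simp
  qed
  define \<phi> where "\<phi> j = Cmp C P P s vs (SOME a. a \<in> mor P P \<and> j \<ominus>\<^bsub>Hom C P P\<^esub> Cmp C P P P r a \<in> N)" for j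
  have \<phi>: "\<phi> j = Cmp C P P s vs a" if j: "j \<in> mor P P" and a: "a \<in> mor P P" "j \<ominus>\<^bsub>Hom C P P\<^esub> Cmp C P P P r a \<in> N" for j a
  proof -
    define b where "b = (SOME a. a \<in> mor P P \<and> j \<ominus>\<^bsub>Hom C P P\<^esub> Cmp C P P P r a \<in> N)"
    have b: "b \<in> mor P P" "j \<ominus>\<^bsub>Hom C P P\<^esub> Cmp C P P P r b \<in> N"
      unfolding b_def using someI[of "\<lambda>a. a \<in> mor P P \<and> j \<ominus>\<^bsub>Hom C P P\<^esub> Cmp C P P P r a \<in> N" a] a by blast+
    interpret ab: abelian_group "Hom C P P" by (rule mor_abelian) simp_all
    have "(j \<ominus>\<^bsub>Hom C P P\<^esub> Cmp C P P P r a) \<ominus>\<^bsub>Hom C P P\<^esub> (j \<ominus>\<^bsub>Hom C P P\<^esub> Cmp C P P P r b) \<in> N"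
      using end_submodule_diff[OF N(1)] a b by simp
    moreover have "(j \<ominus>\<^bsub>Hom C P P\<^esub> Cmp C P P P r a) \<ominus>\<^bsub>Hom C P P\<^esub> (j \<ominus>\<^bsub>Hom C P P\<^esub> Cmp C P P P r b)
      = Cmp C P P P r (b \<ominus>\<^bsub>Hom C P P\<^esub> a)"
    proof -
      have *: "y \<oplus>\<^bsub>Hom C P P\<^esub> \<ominus>\<^bsub>Hom C P P\<^esub> z \<oplus>\<^bsub>Hom C P P\<^esub> \<ominus>\<^bsub>Hom C P P\<^esub> (y \<oplus>\<^bsub>Hom C P P\<^esub> \<ominus>\<^bsub>Hom C P P\<^esub> z')
        = z' \<oplus>\<^bsub>Hom C P P\<^esub> \<ominus>\<^bsub>Hom C P P\<^esub> z" if "y \<in> mor P P" "z \<in> mor P P" "z' \<in> mor P P" for y z z'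
        using that by (simp add: ab.minus_add ab.a_ac ab.r_neg1 ab.r_neg2 ab.minus_minus)
      show ?thesis using *[of j "Cmp C P P P r a" "Cmp C P P P r b"] j a b rm
        by (simp add: Cmp_diff_right) (simp add: a_minus_def)
    qed
    ultimately have "Cmp C P P s vs (b \<ominus>\<^bsub>Hom C P P\<^esub> a) = nul P s" using kernel a b by simp
    then show ?thesis unfolding \<phi>_def b_def[symmetric] using a b f by (simp add: Cmp_diff_right)
  qed
  have dec: "\<exists>n \<in> N. \<exists>a \<in> mor P P. j = n \<oplus>\<^bsub>Hom C P P\<^esub> Cmp C P P P r a" if "j \<in> jac" "Cmp C P P P e j = j" for j
    using that N(4) unfolding adjoin_def by blast
  have \<phi>2: "\<phi> (n \<oplus>\<^bsub>Hom C P P\<^esub> Cmp C P P P r a) = Cmp C P P s vs a" if n: "n \<in> N" and a: "a \<in> mor P P" for n a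
  proof (rule \<phi>[OF _ a])
    interpret ab: abelian_group "Hom C P P" by (rule mor_abelian) simp_all
    have nm: "n \<in> mor P P" using n Nc by blast
    show "n \<oplus>\<^bsub>Hom C P P\<^esub> Cmp C P P P r a \<in> mor P P" using nm a rm by simp
    have "n \<oplus>\<^bsub>Hom C P P\<^esub> Cmp C P P P r a \<ominus>\<^bsub>Hom C P P\<^esub> Cmp C P P P r a = n"
      using nm a rm by (simp add: a_minus_def ab.a_assoc ab.r_neg)
    then show "n \<oplus>\<^bsub>Hom C P P\<^esub> Cmp C P P P r a \<ominus>\<^bsub>Hom C P P\<^esub> Cmp C P P P r a \<in> N" using n by simp
  qed
  let ?ei = "\<lambda>u. Cmp C P P P e (Cmp C P k P i u)"
  have dec_ei: "\<exists>n \<in> N. \<exists>a \<in> mor P P. ?ei u = n \<oplus>\<^bsub>Hom C P P\<^esub> Cmp C P P P r a" if u: "u \<in> mor P k" for u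
    by (rule dec[OF e_i_jac[OF u]]) (use u e Cmp_reassoc[OF e(2), of P "Cmp C P k P i u"] in simp)
  have "end_linear k s (\<lambda>u. \<phi> (?ei u))"
    unfolding end_linear_def
  proof (intro conjI ballI)
    interpret ab: abelian_group "Hom C P P" by (rule mor_abelian) simp_all
    fix u assume u: "u \<in> mor P k"
    then obtain n a where na: "n \<in> N" "a \<in> mor P P" "?ei u = n \<oplus>\<^bsub>Hom C P P\<^esub> Cmp C P P P r a" using dec_ei by blast
    have nm: "n \<in> mor P P" using na Nc by blast
    show "\<phi> (?ei u) \<in> mor P s" unfolding na(3) \<phi>2[OF na(1,2)] using na f by simp
    {
      fix d assume d: "d \<in> mor P P"
      have "?ei (Cmp C P P k u d) = Cmp C P P P n d \<oplus>\<^bsub>Hom C P P\<^esub> Cmp C P P P r (Cmp C P P P a d)"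
        using Cmp_reassoc[OF na(3), of P d] u d e rm na(2) nm by (simp add: Cmp_assoc Cmp_add_left)
      then show "\<phi> (?ei (Cmp C P P k u d)) = Cmp C P P s (\<phi> (?ei u)) d"
        unfolding na(3) using \<phi>2[OF na(1,2)] \<phi>2[OF Nc(3)[OF na(1) d], of "Cmp C P P P a d"] na d f
        by (simp add: Cmp_assoc)
    }
    fix u' assume u': "u' \<in> mor P k"
    then obtain n' a' where na': "n' \<in> N" "a' \<in> mor P P" "?ei u' = n' \<oplus>\<^bsub>Hom C P P\<^esub> Cmp C P P P r a'" using dec_ei by blast
    have nm': "n' \<in> mor P P" using na' Nc by blast
    have "?ei (u \<oplus>\<^bsub>Hom C P k\<^esub> u') = (n \<oplus>\<^bsub>Hom C P P\<^esub> n') \<oplus>\<^bsub>Hom C P P\<^esub> Cmp C P P P r (a \<oplus>\<^bsub>Hom C P P\<^esub> a')"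
      using u u' e na(2,3) na'(2,3) nm nm' rm by (simp add: Cmp_add_right ab.a_ac)
    then show "\<phi> (?ei (u \<oplus>\<^bsub>Hom C P k\<^esub> u')) = \<phi> (?ei u) \<oplus>\<^bsub>Hom C P s\<^esub> \<phi> (?ei u')"
      unfolding na(3) na'(3) using \<phi>2[OF na(1,2)] \<phi>2[OF na'(1,2)] \<phi>2[OF Nc(2)[OF na(1) na'(1)], of "a \<oplus>\<^bsub>Hom C P P\<^esub> a'"] na(2) na'(2) f
      by (simp add: Cmp_add_right)
  qed
  then obtain c where c: "c \<in> mor k s" "\<forall>u \<in> mor P k. \<phi> (?ei u) = Cmp C P k s c u"
    using represented_full[OF k S_E[OF s]] by blast
  obtain u where u: "u \<in> mor P k" "r = Cmp C P k P i u" using jac_lift[OF rj(1)] by blast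
  have "restr c r = Cmp C P k s c u" unfolding u(2) by (rule restr_i[OF u(1)])
  also have "\<dots> = \<phi> (?ei u)" using c(2) u(1) by simp
  also have "?ei u = r" using rj(2) u(2) by simp
  also have "\<phi> r = vs"
  proof -
    have "r \<ominus>\<^bsub>Hom C P P\<^esub> Cmp C P P P r (Idt C P) = nul P P" using rm by simp
    moreover have "nul P P \<in> N" using N(1) unfolding end_submodule_def by blast
    ultimately have "r \<ominus>\<^bsub>Hom C P P\<^esub> Cmp C P P P r (Idt C P) \<in> N" by metis
    then show ?thesis using \<phi>[OF rm, of "Idt C P"] f by simp
  qed
  finally have "restr c r = vs" .
  then have "pair (Cmp C t (T k) (T s) (Tm k s c) h) r = vs" using pair_eq[OF c(1) refl rj(1)] by simp
  moreover have "Cmp C t (T k) (T s) (Tm k s c) h \<in> mor t (T s)" using c by simp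
  ultimately show ?thesis by blast
qed

end


section \<open>Arrows of the Gabriel quiver\<close>

context arrow_pairing
begin

lemma rad2_coset_eq_iff:
  assumes "a \<in> mor P P" "b \<in> mor P P"
  shows "rad2 alg +>\<^bsub>alg\<^esub> enc P a = rad2 alg +>\<^bsub>alg\<^esub> enc P b \<longleftrightarrow> a \<ominus>\<^bsub>Hom C P P\<^esub> b \<in> jac2"
proof -
  interpret N: abelian_subgroup "rad2 alg" alg
    by (rule abelian_subgroupI3[OF ideal.axioms(1)[OF rad2_ideal] alg.A.abelian_group_axioms])
  have m: "enc P a \<in> carrier alg" "enc P b \<in> carrier alg" using assms by simp_all
  have "enc P (a \<ominus>\<^bsub>Hom C P P\<^esub> b) \<oplus>\<^bsub>alg\<^esub> enc P b = enc P a" using assms by (simp add: mor_diff_add(1))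
  moreover have dm: "enc P (a \<ominus>\<^bsub>Hom C P P\<^esub> b) \<in> carrier alg" using assms by simp
  ultimately have d: "enc P (a \<ominus>\<^bsub>Hom C P P\<^esub> b) = enc P a \<ominus>\<^bsub>alg\<^esub> enc P b"
    using alg.A.a_assoc[OF dm m(2) alg.A.a_inv_closed[OF m(2)]] alg.A.r_neg[OF m(2)] alg.A.r_zero[OF dm]
    unfolding a_minus_def by metis
  have "rad2 alg +>\<^bsub>alg\<^esub> enc P a = rad2 alg +>\<^bsub>alg\<^esub> enc P b \<longleftrightarrow> enc P a \<in> rad2 alg +>\<^bsub>alg\<^esub> enc P b"
    using N.a_repr_independence'[OF _ m(2)] N.a_rcos_self[OF m(1)] by metis
  also have "\<dots> \<longleftrightarrow> enc P (a \<ominus>\<^bsub>Hom C P P\<^esub> b) \<in> rad2 alg"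
    unfolding d by (rule N.a_rcos_module_minus[OF alg_ring m(2,1)])
  also have "\<dots> \<longleftrightarrow> a \<ominus>\<^bsub>Hom C P P\<^esub> b \<in> jac2" unfolding jac2_def using assms by simp
  finally show ?thesis .
qed

abbreviation "arr \<equiv> arrow_space alg (enc P e) (enc P f)"

definition coset :: "'m \<Rightarrow> 'k coords set" where
  "coset j = rad2 alg +>\<^bsub>alg\<^esub> enc P j"

text \<open>The elements of the arrow space are the cosets of the elements \<open>j = ejf\<close> of the radical; on these
  the pairing has values in the multiples of \<open>vs\<close>.\<close>

lemma arr_carrier: "carrier arr = coset ` R"
proof
  show "carrier arr \<subseteq> coset ` R"
  proof
    fix U assume "U \<in> carrier arr"
    then obtain j where j: "j \<in> jac" "U = rad2 alg +>\<^bsub>alg\<^esub> (enc P e \<otimes>\<^bsub>alg\<^esub> enc P j \<otimes>\<^bsub>alg\<^esub> enc P f)"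
      unfolding arrow_space_def rad_alg by auto
    let ?j = "Cmp C P P P (Cmp C P P P e j) f"
    have jm: "j \<in> mor P P" by (rule jac_mor[OF j(1)])
    have ej: "Cmp C P P P e j \<in> jac" by (rule jac_left[OF j(1) e(1)])
    have "?j \<in> jac" by (rule jac_right[OF ej f(1)])
    moreover have "Cmp C P P P e ?j = ?j"
      using Cmp_reassoc[OF e(2), of P "Cmp C P P P j f"] e f jm by (simp add: Cmp_assoc)
    moreover have "Cmp C P P P ?j f = ?j" using e f jm by (simp add: Cmp_assoc)
    ultimately have "?j \<in> R" unfolding R_def by blast
    moreover have "U = coset ?j" unfolding j(2) coset_def using e f jm by simp
    ultimately show "U \<in> coset ` R" by blast
  qed
  show "coset ` R \<subseteq> carrier arr"
  proof
    fix U assume "U \<in> coset ` R"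
    then obtain j where j: "j \<in> R" "U = coset j" by blast
    have r: "j \<in> jac" "Cmp C P P P e j = j" "Cmp C P P P j f = j" using j unfolding R_def by auto
    have "enc P e \<otimes>\<^bsub>alg\<^esub> enc P j \<otimes>\<^bsub>alg\<^esub> enc P f = enc P j" using r R_mor[OF j(1)] e f by simp
    then have "U = rad2 alg +>\<^bsub>alg\<^esub> (enc P e \<otimes>\<^bsub>alg\<^esub> enc P j \<otimes>\<^bsub>alg\<^esub> enc P f)"
      unfolding j(2) coset_def by simp
    moreover have "enc P j \<in> rad alg" unfolding rad_alg using r by blast
    ultimately show "U \<in> carrier arr" unfolding arrow_space_def by auto
  qed
qed

lemma R_subspace: "submodule K R (Hom C P P)"
proof -
  interpret J: submodule K jac "Hom C P P" by (rule end_submodule_subspace[OF jac_submodule])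
  interpret V: vectorspace K "Hom C P P" by (rule Hom_vectorspace) simp_all
  show ?thesis
  proof (intro submodule.intro V.module_axioms)
    show "R \<subseteq> mor P P" using R_mor by blast
    show "nul P P \<in> R" unfolding R_def using e f jac_submodule by (simp add: end_submodule_def)
    fix u v assume "u \<in> R" "v \<in> R"
    then show "u \<oplus>\<^bsub>Hom C P P\<^esub> v \<in> R"
      unfolding R_def using e f jac_mor jac_add by (auto simp: Cmp_add_left Cmp_add_right)
  next
    fix a u assume "a \<in> carrier K" "u \<in> R"
    then show "a \<odot>\<^bsub>Hom C P P\<^esub> u \<in> R"
      unfolding R_def using e f jac_mor J.smult_closed by (auto simp: Cmp_smult_left Cmp_smult_right)
  qed
qed

lemma arr_ops:
  shows arr_zero: "\<zero>\<^bsub>arr\<^esub> = coset (nul P P)"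
    and arr_add: "\<lbrakk>a \<in> mor P P; b \<in> mor P P\<rbrakk> \<Longrightarrow> coset a \<oplus>\<^bsub>arr\<^esub> coset b = coset (a \<oplus>\<^bsub>Hom C P P\<^esub> b)"
    and arr_smult: "\<lbrakk>c \<in> carrier K; a \<in> mor P P\<rbrakk> \<Longrightarrow> c \<odot>\<^bsub>arr\<^esub> coset a = coset (c \<odot>\<^bsub>Hom C P P\<^esub> a)"
proof -
  interpret N: abelian_subgroup "rad2 alg" alg
    by (rule abelian_subgroupI3[OF ideal.axioms(1)[OF rad2_ideal] alg.A.abelian_group_axioms])
  show "\<zero>\<^bsub>arr\<^esub> = coset (nul P P)"
    using alg.A.a_coset_add_zero[OF N.a_subset] by (simp add: arrow_space_def quot_module_def coset_def)
  show "coset a \<oplus>\<^bsub>arr\<^esub> coset b = coset (a \<oplus>\<^bsub>Hom C P P\<^esub> b)" if "a \<in> mor P P" "b \<in> mor P P"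
    using that N.a_rcos_sum[of "enc P a" "enc P b"] by (simp add: arrow_space_def quot_module_def coset_def)
  show "c \<odot>\<^bsub>arr\<^esub> coset a = coset (c \<odot>\<^bsub>Hom C P P\<^esub> a)" if c: "c \<in> carrier K" and a: "a \<in> mor P P"
  proof -
    interpret J: submodule K jac2 "Hom C P P" by (rule end_submodule_subspace[OF jac2_submodule])
    have "c \<odot>\<^bsub>quot_module alg (rad2 alg)\<^esub> (rad2 alg +>\<^bsub>alg\<^esub> enc P a) = rad2 alg +>\<^bsub>alg\<^esub> (c \<odot>\<^bsub>alg\<^esub> enc P a)"
    proof (rule coset_smult[OF alg.A.abelian_group_axioms ideal.axioms(1)[OF rad2_ideal]])
      show "c \<odot>\<^bsub>alg\<^esub> n \<in> rad2 alg" if "n \<in> rad2 alg" for n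
        using that c jac2_mor J.smult_closed[OF c] unfolding rad2_alg by auto
    qed (use c a alg.AV.smult_closed alg.AV.smult_r_distr in auto)
    then show ?thesis using c a by (simp add: arrow_space_def coset_def)
  qed
qed

lemma arr_vectorspace: "vectorspace K arr"
proof -
  interpret V: vectorspace K "Hom C P P" by (rule Hom_vectorspace) simp_all
  have "vectorspace K ((Hom C P P)\<lparr>carrier := R\<rparr>)"
    by (rule V.subspace_is_vs[OF subspace.intro[OF V.vectorspace_axioms R_subspace]])
  then show ?thesis
    by (rule vectorspace_surjective_image(1)[where q = coset])
      (simp_all add: arr_carrier arr_zero R_mor arr_add arr_smult)
qed

definition coef :: "'m \<Rightarrow> 'k" where
  "coef w = (THE c. c \<in> carrier K \<and> w = c \<odot>\<^bsub>Hom C P s\<^esub> vs)"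

lemma coef:
  assumes "c \<in> carrier K"
  shows "coef (c \<odot>\<^bsub>Hom C P s\<^esub> vs) = c"
proof -
  interpret V: vectorspace K "Hom C P s" by (rule Hom_vectorspace) simp_all
  show ?thesis
    unfolding coef_def
  proof (rule the_equality)
    fix c' assume "c' \<in> carrier K \<and> c \<odot>\<^bsub>Hom C P s\<^esub> vs = c' \<odot>\<^bsub>Hom C P s\<^esub> vs"
    then show "c' = c" using V.smult_right_cancel[OF f(3,4), of c' c] assms by metis
  qed (use assms in blast)
qed

definition form :: "'m \<Rightarrow> 'k coords set \<Rightarrow> 'k" where
  "form \<delta> U = coef (pair \<delta> (SOME j. j \<in> R \<and> U = coset j))"

lemma form_coset:
  assumes d: "\<delta> \<in> mor t (T s)" and j: "j \<in> R"
  shows "form \<delta> (coset j) = coef (pair \<delta> j)"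
proof -
  define j' where "j' = (SOME j'. j' \<in> R \<and> coset j = coset j')"
  have j': "j' \<in> R" "coset j = coset j'"
    unfolding j'_def using someI[of "\<lambda>j'. j' \<in> R \<and> coset j = coset j'" j] j by blast+
  note m = R_mor[OF j] R_mor[OF j'(1)]
  let ?x = "j \<ominus>\<^bsub>Hom C P P\<^esub> j'"
  have x: "?x \<in> jac2" using j'(2) rad2_coset_eq_iff[OF m] unfolding coset_def by simp
  then have "?x \<in> jac" using jac2_jac by blast
  have "pair \<delta> j = pair \<delta> (?x \<oplus>\<^bsub>Hom C P P\<^esub> j')" using m by (simp add: mor_diff_add(1))
  also have "\<dots> = pair \<delta> j'"
    using pair_add[OF d \<open>?x \<in> jac\<close> R_jac[OF j'(1)]] pair_jac2[OF d x] pair_closed[OF d R_jac[OF j'(1)]] by simp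
  finally show ?thesis unfolding form_def j'_def[symmetric] by simp
qed

lemma form_smult_vs:
  assumes d: "\<delta> \<in> mor t (T s)" and j: "j \<in> R"
  shows "form \<delta> (coset j) \<in> carrier K" "pair \<delta> j = form \<delta> (coset j) \<odot>\<^bsub>Hom C P s\<^esub> vs"
  using pair_multiple[OF d j] form_coset[OF d j] coef by auto

text \<open>The coefficient of \<open>vs\<close> turns the pairing into a bilinear form, which is well defined on cosets of
  \<open>rad\<^sup>2 A\<close> and nondegenerate on both sides.\<close>

lemma arrow_space_dim:
  "vectorspace.dim K arr = vectorspace.dim K (Hom C t (T s))"
proof -
  interpret V: vectorspace K "Hom C P s" by (rule Hom_vectorspace) simp_all
  interpret R: submodule K R "Hom C P P" by (rule R_subspace)
  have Ts: "T s \<in> Obj C" by simp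
  interpret D: vectorspace K "Hom C t (T s)" by (rule Hom_vectorspace[OF t_obj Ts])
  have eqI: "form \<delta> (coset j) = c" if "\<delta> \<in> mor t (T s)" "j \<in> R" "c \<in> carrier K" "pair \<delta> j = c \<odot>\<^bsub>Hom C P s\<^esub> vs" for \<delta> j c
    using form_coset[OF that(1,2)] that coef by simp
  show ?thesis
  proof (rule perfect_pairing_dim[where \<beta> = form])
    show "vectorspace K (Hom C t (T s))" by (rule D.vectorspace_axioms)
    show "vectorspace K arr" by (rule arr_vectorspace)
    show "vectorspace.fin_dim K (Hom C t (T s))" by (rule mor_fin_dim[OF t_obj Ts])
  next
    fix \<delta> U assume "\<delta> \<in> mor t (T s)" "U \<in> carrier arr"
    then show "form \<delta> U \<in> carrier K" using form_smult_vs(1) unfolding arr_carrier by blast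
  next
    fix \<delta> \<delta>' U assume d: "\<delta> \<in> mor t (T s)" "\<delta>' \<in> mor t (T s)" and "U \<in> carrier arr"
    then obtain j where j: "j \<in> R" "U = coset j" unfolding arr_carrier by blast
    note F = form_smult_vs[OF d(1) j(1)] form_smult_vs[OF d(2) j(1)]
    have "pair (\<delta> \<oplus>\<^bsub>Hom C t (T s)\<^esub> \<delta>') j = (form \<delta> U \<oplus>\<^bsub>K\<^esub> form \<delta>' U) \<odot>\<^bsub>Hom C P s\<^esub> vs"
      using pair_add_left[OF d(1) R_jac[OF j(1)] d(2)] F f(3) unfolding j(2) by (simp add: V.smult_l_distr)
    then show "form (\<delta> \<oplus>\<^bsub>Hom C t (T s)\<^esub> \<delta>') U = form \<delta> U \<oplus>\<^bsub>K\<^esub> form \<delta>' U"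
      unfolding j(2) using d F j(1) by (intro eqI) simp_all
  next
    fix c \<delta> U assume c: "c \<in> carrier K" and d: "\<delta> \<in> mor t (T s)" and "U \<in> carrier arr"
    then obtain j where j: "j \<in> R" "U = coset j" unfolding arr_carrier by blast
    note F = form_smult_vs[OF d j(1)]
    have "pair (c \<odot>\<^bsub>Hom C t (T s)\<^esub> \<delta>) j = (c \<otimes>\<^bsub>K\<^esub> form \<delta> U) \<odot>\<^bsub>Hom C P s\<^esub> vs"
      using pair_smult_left[OF d R_jac[OF j(1)] c] F c f(3) unfolding j(2) by (simp add: V.smult_assoc1)
    then show "form (c \<odot>\<^bsub>Hom C t (T s)\<^esub> \<delta>) U = c \<otimes>\<^bsub>K\<^esub> form \<delta> U"
      unfolding j(2) using c d F j(1) by (intro eqI) simp_all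
  next
    fix \<delta> U U' assume d: "\<delta> \<in> mor t (T s)" and "U \<in> carrier arr" "U' \<in> carrier arr"
    then obtain j j' where j: "j \<in> R" "U = coset j" "j' \<in> R" "U' = coset j'" unfolding arr_carrier by blast
    note F = form_smult_vs[OF d j(1)] form_smult_vs[OF d j(3)]
    have U: "U \<oplus>\<^bsub>arr\<^esub> U' = coset (j \<oplus>\<^bsub>Hom C P P\<^esub> j')" unfolding j(2,4) by (rule arr_add[OF R_mor[OF j(1)] R_mor[OF j(3)]])
    have "pair \<delta> (j \<oplus>\<^bsub>Hom C P P\<^esub> j') = (form \<delta> U \<oplus>\<^bsub>K\<^esub> form \<delta> U') \<odot>\<^bsub>Hom C P s\<^esub> vs"
      using pair_add[OF d R_jac[OF j(1)] R_jac[OF j(3)]] F f(3) unfolding j(2,4) by (simp add: V.smult_l_distr)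
    then show "form \<delta> (U \<oplus>\<^bsub>arr\<^esub> U') = form \<delta> U \<oplus>\<^bsub>K\<^esub> form \<delta> U'"
      unfolding U unfolding j(2,4) using d F j(1,3) R.m_closed by (intro eqI) simp_all
  next
    fix c \<delta> U assume c: "c \<in> carrier K" and d: "\<delta> \<in> mor t (T s)" and "U \<in> carrier arr"
    then obtain j where j: "j \<in> R" "U = coset j" unfolding arr_carrier by blast
    note F = form_smult_vs[OF d j(1)]
    have U: "c \<odot>\<^bsub>arr\<^esub> U = coset (c \<odot>\<^bsub>Hom C P P\<^esub> j)" unfolding j(2) by (rule arr_smult[OF c R_mor[OF j(1)]])
    have "pair \<delta> (c \<odot>\<^bsub>Hom C P P\<^esub> j) = (c \<otimes>\<^bsub>K\<^esub> form \<delta> U) \<odot>\<^bsub>Hom C P s\<^esub> vs"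
      using pair_smult[OF d R_jac[OF j(1)] c] F c f(3) unfolding j(2) by (simp add: V.smult_assoc1)
    then show "form \<delta> (c \<odot>\<^bsub>arr\<^esub> U) = c \<otimes>\<^bsub>K\<^esub> form \<delta> U"
      unfolding U unfolding j(2) using c d F j(1) R.smult_closed by (intro eqI) simp_all
  next
    fix U assume "U \<in> carrier arr" and 0: "\<forall>\<delta> \<in> mor t (T s). form \<delta> U = \<zero>\<^bsub>K\<^esub>"
    then obtain j where j: "j \<in> R" "U = coset j" unfolding arr_carrier by blast
    have "pair \<delta> j \<noteq> vs" if "\<delta> \<in> mor t (T s)" for \<delta>
      using form_smult_vs(2)[OF that j(1)] 0 that f(3,4) unfolding j(2) by simp
    then have "j \<in> jac2" using pair_right_nondegenerate j(1) by blast
    then have "coset j = coset (nul P P)"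
      unfolding coset_def using rad2_coset_eq_iff[of j "nul P P"] R_mor[OF j(1)] by simp
    then show "U = \<zero>\<^bsub>arr\<^esub>" unfolding j(2) arr_zero .
  next
    fix \<delta> assume d: "\<delta> \<in> mor t (T s)" and 0: "\<forall>U \<in> carrier arr. form \<delta> U = \<zero>\<^bsub>K\<^esub>"
    show "\<delta> = nul t (T s)"
    proof (rule pair_left_nondegenerate[OF d])
      fix j assume j: "j \<in> R"
      then show "pair \<delta> j = nul P s"
        using form_smult_vs(2)[OF d j] 0 f(3) unfolding arr_carrier by simp
    qed
  qed
qed

end

context represented_modules
begin

lemma gabriel_quiver_iso:
  assumes ac: "algebraically_closed K"
  shows "quiver_iso (\<lambda>s. iso_class alg (rep s)) (ext_quiver K C S) (gabriel_quiver K alg)"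
proof -
  have "vectorspace.dim K (arrow_space alg (vertex_idempotent alg (iso_class alg (rep t)))
      (vertex_idempotent alg (iso_class alg (rep s)))) = vectorspace.dim K (Hom C t (T s))"
    if s: "s \<in> S" and t: "t \<in> S" for s t
  proof -
    obtain e vt where e: "vertex_idempotent alg (iso_class alg (rep t)) = enc P e" "top_idempotent t e vt"
      using vertex_idempotent_top[OF t] by blast
    obtain f vs where f: "vertex_idempotent alg (iso_class alg (rep s)) = enc P f" "top_idempotent s f vs"
      using vertex_idempotent_top[OF s] by blast
    obtain k i h where k: "k \<in> E" "dist C k P t i vt h"
      using simple_quotient[OF P_E t top_idempotentD(3,4)[OF e(2)]] by blast
    have "arrow_pairing K C S P s t k e f vs vt i h"
      by (intro arrow_pairing.intro arrow_pairing_axioms.intro represented_modules_axioms)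
        (fact ac s t e(2) f(2) k)+
    then show ?thesis unfolding e(1) f(1) by (rule arrow_pairing.arrow_space_dim)
  qed
  then show ?thesis
    unfolding quiver_iso_def using gabriel_quiver_vertices by (simp add: ext_quiver_def gabriel_quiver_def)
qed

end

theorem theoremB:
  fixes K :: "('k, 'r) ring_scheme"
    and C :: "('k, 'o, 'm, 's) tri_cat_scheme"
    and w :: nat
    and S :: "'o set"
  assumes "triangulated_category K C"
    and "hom_finite K C"
    and "split_idempotents C"
    and "w \<ge> 2"
    and "simple_minded_system C w S"
  shows "\<exists>(A :: ('k, 'k coords) module)
           (F :: ('o, 'm, ('k coords, 'k coords) module, 'k coords \<Rightarrow> 'k coords) fun_data).
           fd_algebra K A \<and>
           linear_equivalence K (full_subcat C (ext_closure C S)) (mod_cat A) F \<and>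
           (algebraically_closed K \<longrightarrow>
             quiver_iso (\<lambda>s. iso_class A (on_obj F s)) (ext_quiver K C S) (gabriel_quiver K A))"
proof -
  interpret simple_minded K C S w by (rule simple_minded_systemD[OF assms(1,4,5)])
  obtain P where P: "P \<in> E" "\<forall>y \<in> E. mor P (T y) = {nul P (T y)}" "\<forall>s \<in> S. \<exists>v \<in> mor P s. v \<noteq> nul P s"
    using projective_generator_exists by blast
  interpret represented_modules K C S P
    by unfold_locales (use P assms(2) in auto)
  have "on_obj rep_functor = rep" by (simp add: rep_functor_def)
  then show ?thesis
    using alg_fd rep_equivalence gabriel_quiver_iso
    by (intro exI[of _ alg] exI[of _ rep_functor]) simp
qed

end
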